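(* There is a computable function $f$ and an algorithm that, given any pair of digraphs $(\vec H,\vec G)$, computes the number of homomorphisms from $\vec H$ to $\vec G$ in time $f(|\vec H|,d)\cdot|\vec G|^{r+O(1)}$, where $d$ is the maximum outdegree of $\vec G$ and $r=\mathsf{fhtw}(\mathcal R(\vec H))$. Consequently, for a class $\vec C$ of digraphs, $\#\textsc{DirHom}_{\mathrm d}(\vec C)$ is fixed-parameter tractable if $\sup_{\vec H\in\vec C}\mathsf{fhtw}(\mathcal R(\vec H))<\infty$.
   Context: Digraphs are finite, have no multiple arcs, may contain loops. A homomorphism $\vec H\to\vec G$ is a map $\varphi:V(\vec H)\to V(\vec G)$ with $(\varphi(u),\varphi(v))\in E(\vec G)$ whenever $(u,v)\in E(\vec H)$. $|\vec G|$ is the length of the adjacency-list encoding. Let $\vec H/\!\sim$ be the DAG obtained by contracting each strongly connected component of $\vec H$ to a vertex and deleting loops; let $S_1,\dots,S_k$ be the components that are sources (indegree $0$) of $\vec H/\!\sim$ and $s_i\in S_i$. The reachability hypergraph $\mathcal R(\vec H)$ has vertex set $V(\vec H)$ and hyperedges $R(s_i)$, the set of vertices reachable from $s_i$ by a directed path (including $s_i$). For a hypergraph $\mathcal H$ and $X\subseteq V(\mathcal H)$, $\rho^*_{\mathcal H}(X)$ is the minimum of $\sum_e\gamma(e)$ over $\gamma:E(\mathcal H)\to[0,\infty)$ with $\sum_{e\ni v}\gamma(e)\ge1$ for all $v\in X$. A tree decomposition of $\mathcal H$ is a tree with bags covering all vertices, each hyperedge inside some bag, and for each vertex the bags containing it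 forming a connected subtree. The fractional hypertreewidth $\mathsf{fhtw}(\mathcal H)$ is the minimum over tree decompositions of the maximum $\rho^*_{\mathcal H}(B)$ over bags $B$. $\#\textsc{DirHom}_{\mathrm d}(\vec C)$: given $(\vec H,\vec G)$ with $\vec H\in\vec C$, output the number of homomorphisms $\vec H\to\vec G$; parameter $|\vec H|+d(\vec G)$. FPT means solvable in time $f(\text{parameter})\cdot(\text{input size})^{O(1)}$ for computable $f$. *)

theory Defs
  imports Complex_Main "HOL-Library.FuncSet" "HOL-Library.Log_Nat"
    "Graph_Theory.Digraph_Component"
begin

section \<open>Random access machines with logarithmic cost\<close>

text \<open>
  Programs for the random access machine of Aho, Hopcroft and Ullman, with structured
  control flow in place of jumps. A configuration consists of the contents of the directly
  addressed registers and of the indirectly addressed memory. A program mentions only finitely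
  many registers, and their indices are constants of the program.
\<close>

datatype arith_op = Add | Sub | Mult | Div

fun arith :: "arith_op \<Rightarrow> nat \<Rightarrow> nat \<Rightarrow> nat" where
  "arith Add x y = x + y"
| "arith Sub x y = x - y"
| "arith Mult x y = x * y"
| "arith Div x y = x div y"

datatype prog =
    Const nat nat
  | Arith arith_op nat nat nat
  | Load nat nat
  | Store nat nat
  | Seq prog prog
  | If nat prog prog
  | While nat prog

type_synonym config = "(nat \<Rightarrow> nat) \<times> (nat \<Rightarrow> nat)"

abbreviation bits :: "nat \<Rightarrow> nat" where
  "bits x \<equiv> floorlog 2 x"

text \<open>
  \<open>exec c s t s'\<close>: program \<open>c\<close> started in \<open>s\<close> halts in \<open>s'\<close> at total cost \<open>t\<close>. An instruction costs
  one plus the binary lengths of the numbers (data and addresses) it operates on; the cost of the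
  constant register indices is absorbed by the one. Branching tests for nonzero.
\<close>

inductive exec :: "prog \<Rightarrow> config \<Rightarrow> nat \<Rightarrow> config \<Rightarrow> bool" where
  Const: "exec (Const i x) (r, m) (1 + bits x) (r(i := x), m)"
| Arith: "exec (Arith f i j k) (r, m) (1 + bits (r j) + bits (r k))
    (r(i := arith f (r j) (r k)), m)"
| Load: "exec (Load i j) (r, m) (1 + bits (r j) + bits (m (r j))) (r(i := m (r j)), m)"
| Store: "exec (Store i j) (r, m) (1 + bits (r i) + bits (r j)) (r, m(r i := r j))"
| Seq: "exec c1 s t1 s' \<Longrightarrow> exec c2 s' t2 s'' \<Longrightarrow> exec (Seq c1 c2) s (t1 + t2) s''"
| IfTrue: "r i \<noteq> 0 \<Longrightarrow> exec c1 (r, m) t s' \<Longrightarrow> exec (If i c1 c2) (r, m) (1 + bits (r i) + t) s'"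
| IfFalse: "r i = 0 \<Longrightarrow> exec c2 (r, m) t s' \<Longrightarrow> exec (If i c1 c2) (r, m) (1 + bits (r i) + t) s'"
| WhileFalse: "r i = 0 \<Longrightarrow> exec (While i c) (r, m) (1 + bits (r i)) (r, m)"
| WhileTrue: "r i \<noteq> 0 \<Longrightarrow> exec c (r, m) t1 s' \<Longrightarrow> exec (While i c) s' t2 s''
    \<Longrightarrow> exec (While i c) (r, m) (1 + bits (r i) + t1 + t2) s''"

text \<open>The input word occupies an initial segment of the memory, its length is in register 0.\<close>

definition initial_config :: "nat list \<Rightarrow> config" where
  "initial_config xs =
     ((\<lambda>_. 0)(0 := length xs), (\<lambda>i. if i < length xs then xs ! i else 0))"

definition computes_in_time :: "prog \<Rightarrow> nat list \<Rightarrow> nat \<Rightarrow> real \<Rightarrow> bool" where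
  "computes_in_time c xs y b \<longleftrightarrow>
     (\<exists>t s. exec c (initial_config xs) t s \<and> fst s 0 = y \<and> real t \<le> b)"

definition computable1 :: "(nat \<Rightarrow> nat) \<Rightarrow> bool" where
  "computable1 f \<longleftrightarrow>
     (\<exists>c. \<forall>x. \<exists>t s. exec c (initial_config [x]) t s \<and> fst s 0 = f x)"

definition computable2 :: "(nat \<Rightarrow> nat \<Rightarrow> nat) \<Rightarrow> bool" where
  "computable2 f \<longleftrightarrow>
     (\<exists>c. \<forall>x y. \<exists>t s. exec c (initial_config [x, y]) t s \<and> fst s 0 = f x y)"


section \<open>Parameterized counting problems\<close>

text \<open>
  Membership in \<open>instances\<close> is a promise: an algorithm need not recognise the instances.
\<close>

record 'i param_problem =
  instances :: "'i set"
  encoding :: "'i \<Rightarrow> nat list"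
  solution :: "'i \<Rightarrow> nat"
  parameter :: "'i \<Rightarrow> nat"

definition bit_size :: "nat list \<Rightarrow> nat" where
  "bit_size xs = (\<Sum>x\<leftarrow>xs. 1 + bits x)"

definition fixed_parameter_tractable :: "('i, 'm) param_problem_scheme \<Rightarrow> bool" where
  "fixed_parameter_tractable P \<longleftrightarrow>
     (\<exists>g c (k :: nat). computable1 g \<and>
        (\<forall>x \<in> instances P.
           computes_in_time c (encoding P x) (solution P x)
             (real (g (parameter P x)) * real (bit_size (encoding P x)) ^ k)))"


section \<open>Digraphs and homomorphisms\<close>

text \<open>
  \<^locale>\<open>pair_fin_digraph\<close> describes finite digraphs without multiple arcs and with loops permitted.
  As inputs of algorithms, digraphs have an initial segment of the natural numbers as vertex set.
\<close>

definition numbered_digraph :: "nat pair_pre_digraph \<Rightarrow> bool" where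
  "numbered_digraph G \<longleftrightarrow> pair_fin_digraph G \<and> (\<exists>n. pverts G = {..<n})"

text \<open>
  The number of vertices, followed by, for each vertex, its outdegree and its out-neighbours
  in increasing order. The encoding is self-delimiting.
\<close>

definition adj_list :: "nat pair_pre_digraph \<Rightarrow> nat list" where
  "adj_list G = card (pverts G) #
     concat (map (\<lambda>v. out_degree G v # sorted_list_of_set {w. (v, w) \<in> parcs G})
       [0..<card (pverts G)])"

definition dg_size :: "nat pair_pre_digraph \<Rightarrow> nat" where
  "dg_size G = length (adj_list G)"

definition max_out_degree :: "'a pair_pre_digraph \<Rightarrow> nat" where
  "max_out_degree G = Max (insert 0 (out_degree G ` pverts G))"

definition homs :: "'a pair_pre_digraph \<Rightarrow> 'b pair_pre_digraph \<Rightarrow> ('a \<Rightarrow> 'b) set" where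
  "homs H G = {\<phi> \<in> pverts H \<rightarrow>\<^sub>E pverts G. \<forall>(u, v) \<in> parcs H. (\<phi> u, \<phi> v) \<in> parcs G}"

definition DirHom_d ::
    "nat pair_pre_digraph set \<Rightarrow> (nat pair_pre_digraph \<times> nat pair_pre_digraph) param_problem" where
  "DirHom_d C =
     \<lparr> instances = {(H, G). H \<in> C \<and> numbered_digraph G},
       encoding = (\<lambda>(H, G). adj_list H @ adj_list G),
       solution = (\<lambda>(H, G). card (homs H G)),
       parameter = (\<lambda>(H, G). dg_size H + max_out_degree G) \<rparr>"


section \<open>Fractional hypertreewidth\<close>

record 'a hypergraph =
  hverts :: "'a set"
  hedges :: "'a set set"

text \<open>
  The infimum below is a minimum whenever every vertex of \<open>X\<close> lies in some hyperedge, as is the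
  case for reachability hypergraphs; otherwise there is no fractional cover.
\<close>

definition frac_cover_number :: "'a hypergraph \<Rightarrow> 'a set \<Rightarrow> real" where
  "frac_cover_number \<H> X =
     Inf {(\<Sum>e \<in> hedges \<H>. \<gamma> e) | \<gamma>.
            (\<forall>e \<in> hedges \<H>. 0 \<le> \<gamma> e) \<and> (\<forall>v \<in> X. 1 \<le> (\<Sum>e \<in> {e \<in> hedges \<H>. v \<in> e}. \<gamma> e))}"

text \<open>
  Undirected trees as symmetric loop-free digraphs. There every edge gives rise to a directed
  cycle of length two, hence the restriction on the length of cycles. The library's \<^const>\<open>tree\<close>
  only excludes directed cycles and is not the right notion here.
\<close>

definition undirected_tree :: "'a pair_pre_digraph \<Rightarrow> bool" where
  "undirected_tree T \<longleftrightarrow>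
     pair_graph T \<and> connected T \<and> \<not> (\<exists>p. pre_digraph.cycle T p \<and> 3 \<le> length p)"

definition tree_decomposition ::
    "'a hypergraph \<Rightarrow> 't pair_pre_digraph \<Rightarrow> ('t \<Rightarrow> 'a set) \<Rightarrow> bool" where
  "tree_decomposition \<H> T B \<longleftrightarrow>
     undirected_tree T \<and>
     (\<Union>t \<in> pverts T. B t) = hverts \<H> \<and>
     (\<forall>e \<in> hedges \<H>. \<exists>t \<in> pverts T. e \<subseteq> B t) \<and>
     (\<forall>v \<in> hverts \<H>. connected (T \<restriction> {t \<in> pverts T. v \<in> B t}))"

text \<open>Every finite tree is isomorphic to one with natural numbers as nodes.\<close>

definition fhtw :: "'a hypergraph \<Rightarrow> real" where
  "fhtw \<H> =
     Inf {Max ((\<lambda>t. frac_cover_number \<H> (B t)) ` pverts T) | (T :: nat pair_pre_digraph) B.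
            tree_decomposition \<H> T B}"


section \<open>The reachability hypergraph\<close>

definition condensation :: "'a pair_pre_digraph \<Rightarrow> 'a set pair_pre_digraph" where
  "condensation H =
     \<lparr> pverts = pre_digraph.sccs_verts H,
       parcs = {(S, S'). S \<in> pre_digraph.sccs_verts H \<and> S' \<in> pre_digraph.sccs_verts H \<and> S \<noteq> S' \<and>
                  (\<exists>u \<in> S. \<exists>v \<in> S'. (u, v) \<in> parcs H)} \<rparr>"

definition source_components :: "'a pair_pre_digraph \<Rightarrow> 'a set set" where
  "source_components H = {S \<in> pverts (condensation H). in_degree (condensation H) S = 0}"

text \<open>
  The vertices of one strongly connected component reach the same vertices, so ranging over all
  representatives of a source component yields one hyperedge per component.
\<close>

definition reachability_hypergraph :: "'a pair_pre_digraph \<Rightarrow> 'a hypergraph" where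
  "reachability_hypergraph H =
     \<lparr> hverts = pverts H,
       hedges = {{v. s \<rightarrow>\<^sup>*\<^bsub>with_proj H\<^esub> v} | s. \<exists>S \<in> source_components H. s \<in> S} \<rparr>"

end

theory Submission
  imports Defs "HOL-Library.Nat_Bijection"
begin

text \<open>
  Call two vertices of \<open>H\<close> adjacent if they lie in a common hyperedge of the reachability hypergraph.
  Homomorphisms are counted by eliminating the vertices of \<open>H\<close>. For a connected set \<open>C\<close> with
  neighbourhood \<open>N\<close>, one tabulates the number of extensions to \<open>C\<close> of every partial assignment on \<open>N\<close>.
  If \<open>v \<in> C\<close>, this table results from the assignments on \<open>N \<union> {v}\<close> and the tables of the components
  of \<open>C - {v}\<close>; a tree decomposition tells how to choose \<open>v\<close> such that \<open>N \<union> {v}\<close> lies inside a bag.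

  Only those assignments matter for which, for every vertex \<open>s\<close> of \<open>H\<close>, the images of the vertices
  reachable from \<open>s\<close> are reachable from one vertex of \<open>G\<close> by walks of bounded length. On one
  hyperedge there are at most \<open>n\<close> times a function of the parameter of them, as outdegrees are bounded
  by \<open>d\<close>, so the inequality of Atserias, Grohe and Marx bounds their number on a bag by \<open>n\<close> to the
  fractional cover number of the bag, times a function of the parameter.

  The tree decomposition is not computed: each round processes all sets \<open>C\<close> with every choice of \<open>v\<close>,
  abandoning enumerations that exceed a bound, and the bound is doubled from round to round until
  the tables of all components of \<open>H\<close> are complete.
\<close>

section \<open>A loop language compiled to the random access machine\<close>

text \<open>The exponent r may enter the time bound only once, although every instruction is charged
  the bit lengths of its operands. Hence the split between \<open>steps\<close>, which counts
  commands, and an overhead \<open>X ^ K\<close> per step, where \<open>X\<close> is a function of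
  the parameter times the size of G and \<open>K\<close> depends on the program alone; the overhead
  goes into f and the O(1). Whatever grows with the number of table rows must be a counted command.
  Evaluating an expression is part of the overhead, even with quantifiers over V(G) or over all
  subsets of V(H).

  Bags are enumerated vertex by vertex, and the cardinality bound is applied to every prefix of a
  bag, so that no intermediate list is longer than the bound for the whole bag.

  Source components are never computed. The algorithm works with the sets reachable from all
  vertices of H; each of them lies inside a hyperedge and each hyperedge is one of them, so
  adjacency is the same.

  Neither infimum in the definition of the width has to be attained: a decomposition within 1 of the
  optimum, and for each bag a cover within 1 of its optimum, cost an additive 2 in the exponent.
  Doubling the bound costs a factor 2 and logarithmically many rounds.\<close>

datatype exp =
    N nat
  | V nat
  | In exp
  | Arr nat exp
  | Op arith_op exp exp
  | Big arith_op nat exp exp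

text \<open>There is no unbounded loop: the bound of \<open>For\<close> is evaluated once on entry,
  so \<open>sem\<close> and \<open>steps\<close> are total and primitive recursive. The doubling
  search fits in, since the number of rounds can be fixed beforehand and a flag can make the
  remaining ones idle.\<close>

datatype cmd =
    Assign nat exp
  | Put nat exp exp
  | Sq cmd cmd
  | When exp cmd
  | For nat exp cmd

type_synonym arrays = "nat \<Rightarrow> nat \<Rightarrow> nat"
type_synonym state = "(nat \<Rightarrow> nat) \<times> arrays"

fun unit_of :: "arith_op \<Rightarrow> nat" where
  "unit_of Mult = 1"
| "unit_of _ = 0"

text \<open>Beyond the input word, the memory holds eight interleaved unbounded arrays.\<close>

definition inp :: "nat list \<Rightarrow> arrays \<Rightarrow> nat \<Rightarrow> nat" where
  "inp xs A v = (if v < length xs then xs ! v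
     else A ((v - length xs) mod 8) ((v - length xs) div 8))"

primrec eval :: "nat list \<Rightarrow> arrays \<Rightarrow> exp \<Rightarrow> (nat \<Rightarrow> nat) \<Rightarrow> nat" where
  "eval xs A (N x) \<sigma> = x"
| "eval xs A (V i) \<sigma> = \<sigma> i"
| "eval xs A (In e) \<sigma> = inp xs A (eval xs A e \<sigma>)"
| "eval xs A (Arr g e) \<sigma> = A g (eval xs A e \<sigma>)"
| "eval xs A (Op f a b) \<sigma> = arith f (eval xs A a \<sigma>) (eval xs A b \<sigma>)"
| "eval xs A (Big f i a b) \<sigma> =
     fold (\<lambda>k acc. arith f acc (eval xs A b (\<sigma>(i := k)))) [0..<eval xs A a \<sigma>] (unit_of f)"

primrec sem :: "nat list \<Rightarrow> cmd \<Rightarrow> state \<Rightarrow> state" where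
  "sem xs (Assign i e) s = ((fst s)(i := eval xs (snd s) e (fst s)), snd s)"
| "sem xs (Put g a e) s =
     (fst s, (snd s)(g := (snd s g)(eval xs (snd s) a (fst s) := eval xs (snd s) e (fst s))))"
| "sem xs (Sq c1 c2) s = sem xs c2 (sem xs c1 s)"
| "sem xs (When e c) s = (if eval xs (snd s) e (fst s) = 0 then s else sem xs c s)"
| "sem xs (For i e c) s =
     fold (\<lambda>k s. sem xs c ((fst s)(i := k), snd s)) [0..<eval xs (snd s) e (fst s)] s"

text \<open>A command that evaluates an expression is one step however many iterations of
  \<open>Big\<close> the expression contains. That cost is charged later, as the factor by which
  \<open>cmd_correct\<close> multiplies every step.\<close>

primrec steps :: "nat list \<Rightarrow> cmd \<Rightarrow> state \<Rightarrow> nat" where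
  "steps xs (Assign i e) s = 1"
| "steps xs (Put g a e) s = 1"
| "steps xs (Sq c1 c2) s = steps xs c1 s + steps xs c2 (sem xs c1 s)"
| "steps xs (When e c) s = 1 + (if eval xs (snd s) e (fst s) = 0 then 0 else steps xs c s)"
| "steps xs (For i e c) s = 1 + (\<Sum>k<eval xs (snd s) e (fst s). 1 +
     (let s' = fold (\<lambda>k s. sem xs c ((fst s)(i := k), snd s)) [0..<k] s
      in steps xs c ((fst s')(i := k), snd s')))"

text \<open>The cost of the compiled code depends on the numbers present all along the run, so a
  bound has to hold in the intermediate states as well, not only at the end.\<close>

primrec safe :: "nat list \<Rightarrow> (state \<Rightarrow> bool) \<Rightarrow> cmd \<Rightarrow> state \<Rightarrow> bool" where
  "safe xs P (Assign i e) s = (P s \<and> P (sem xs (Assign i e) s))"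
| "safe xs P (Put g a e) s = (P s \<and> P (sem xs (Put g a e) s))"
| "safe xs P (Sq c1 c2) s = (safe xs P c1 s \<and> safe xs P c2 (sem xs c1 s))"
| "safe xs P (When e c) s = (P s \<and> (eval xs (snd s) e (fst s) = 0 \<or> safe xs P c s))"
| "safe xs P (For i e c) s = (P s \<and> (\<forall>k<eval xs (snd s) e (fst s).
     (let s' = fold (\<lambda>k s. sem xs c ((fst s)(i := k), snd s)) [0..<k] s
      in P s' \<and> safe xs P c ((fst s')(i := k), snd s'))))"

text \<open>Register \<open>2 * i\<close> holds the variable \<open>i\<close>, register 1 the length of the input, which is where
  the arrays start; the remaining odd registers are a stack of temporaries.\<close>

definition tmp :: "nat \<Rightarrow> nat" where
  "tmp t = Suc (2 * t)"

lemma tmp_eq [simp]: "tmp i = tmp j \<longleftrightarrow> i = j" "tmp i \<noteq> 2 * j" "2 * j \<noteq> tmp i"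
    "tmp i = Suc 0 \<longleftrightarrow> i = 0" "Suc 0 = tmp i \<longleftrightarrow> i = 0" "tmp i \<noteq> 0"
  unfolding tmp_def by presburger+

text \<open>Turns an index into array \<open>g\<close> into the memory address
  \<open>length xs + 8 * i + g\<close>, inverting the interleaving of \<open>inp\<close>. Register 1
  supplies the offset.\<close>

definition address :: "nat \<Rightarrow> nat \<Rightarrow> prog" where
  "address t g = Seq (Const (tmp (t + 1)) 8) (Seq (Arith Mult (tmp t) (tmp t) (tmp (t + 1)))
     (Seq (Const (tmp (t + 1)) g) (Seq (Arith Add (tmp t) (tmp t) (tmp (t + 1)))
       (Arith Add (tmp t) (tmp t) 1))))"

text \<open>The value arrives in \<open>tmp t\<close>, and no register outside the temporaries from
  \<open>t\<close> on changes. The machine has no copy instruction, so a register is copied by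
  adding it to zero. The bound variable of \<open>Big\<close> is redirected to a temporary by
  updating the environment; its home register keeps its value, as the local scope in
  \<open>eval\<close> demands.\<close>

primrec compile_exp :: "exp \<Rightarrow> (nat \<Rightarrow> nat) \<Rightarrow> nat \<Rightarrow> prog" where
  "compile_exp (N x) \<rho> t = Const (tmp t) x"
| "compile_exp (V i) \<rho> t = Seq (Const (tmp t) 0) (Arith Add (tmp t) (\<rho> i) (tmp t))"
| "compile_exp (In e) \<rho> t = Seq (compile_exp e \<rho> t) (Load (tmp t) (tmp t))"
| "compile_exp (Arr g e) \<rho> t =
     Seq (compile_exp e \<rho> t) (Seq (address t g) (Load (tmp t) (tmp t)))"
| "compile_exp (Op f a b) \<rho> t = Seq (compile_exp a \<rho> t) (Seq (compile_exp b \<rho> (t + 1))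
     (Arith f (tmp t) (tmp t) (tmp (t + 1))))"
| "compile_exp (Big f i a b) \<rho> t =
     Seq (compile_exp a \<rho> (t + 2)) (Seq (Const (tmp t) (unit_of f)) (Seq (Const (tmp (t + 1)) 0)
       (While (tmp (t + 2))
         (Seq (compile_exp b (\<rho>(i := tmp (t + 1))) (t + 3))
         (Seq (Arith f (tmp t) (tmp t) (tmp (t + 3)))
         (Seq (Const (tmp (t + 3)) 1)
         (Seq (Arith Add (tmp (t + 1)) (tmp (t + 1)) (tmp (t + 3)))
              (Arith Sub (tmp (t + 2)) (tmp (t + 2)) (tmp (t + 3))))))))))"

text \<open>\<open>For\<close> keeps its counter in a temporary and copies it to variable
  \<open>i\<close> before each iteration, since the body may overwrite \<open>i\<close>. In
  \<open>When\<close>, clearing a temporary takes the place of a missing skip instruction.\<close>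

primrec compile_cmd :: "cmd \<Rightarrow> nat \<Rightarrow> prog" where
  "compile_cmd (Assign i e) t = Seq (compile_exp e ((*) 2) t)
     (Seq (Const (2 * i) 0) (Arith Add (2 * i) (2 * i) (tmp t)))"
| "compile_cmd (Put g a e) t = Seq (compile_exp a ((*) 2) t) (Seq (address t g)
     (Seq (compile_exp e ((*) 2) (t + 1)) (Store (tmp t) (tmp (t + 1)))))"
| "compile_cmd (Sq c1 c2) t = Seq (compile_cmd c1 t) (compile_cmd c2 t)"
| "compile_cmd (When e c) t = Seq (compile_exp e ((*) 2) t)
     (If (tmp t) (compile_cmd c t) (Const (tmp t) 0))"
| "compile_cmd (For i e c) t =
     Seq (compile_exp e ((*) 2) t) (Seq (Const (tmp (t + 1)) 0)
       (While (tmp t)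
         (Seq (Const (2 * i) 0) (Seq (Arith Add (2 * i) (2 * i) (tmp (t + 1)))
         (Seq (compile_cmd c (t + 2))
         (Seq (Const (tmp (t + 2)) 1)
         (Seq (Arith Add (tmp (t + 1)) (tmp (t + 1)) (tmp (t + 2)))
              (Arith Sub (tmp t) (tmp t) (tmp (t + 2))))))))))"

text \<open>Register 0 is also the home of variable 0, so the length of the input is saved in
  register 1 before the program can overwrite it.\<close>

definition compile :: "cmd \<Rightarrow> prog" where
  "compile c = Seq (Const 1 0) (Seq (Arith Add 1 0 1) (compile_cmd c 1))"

text \<open>Loop bounds inside expressions are built from variables whose values are small.\<close>

primrec small :: "nat set \<Rightarrow> exp \<Rightarrow> bool" where
  "small S (N x) = True"
| "small S (V i) = (i \<in> S)"
| "small S (In e) = False"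
| "small S (Arr g e) = False"
| "small S (Op f a b) = (small S a \<and> small S b)"
| "small S (Big f i a b) = False"

text \<open>Inside the body the bound variable is small itself, being below a small bound. This
  admits nested loops such as \<open>powN 55\<close> within \<open>restE\<close>, where a bound
  variable is in turn a loop bound.\<close>

primrec wt_exp :: "nat set \<Rightarrow> exp \<Rightarrow> bool" where
  "wt_exp S (N x) = True"
| "wt_exp S (V i) = True"
| "wt_exp S (In e) = wt_exp S e"
| "wt_exp S (Arr g e) = (g < 8 \<and> wt_exp S e)"
| "wt_exp S (Op f a b) = (wt_exp S a \<and> wt_exp S b)"
| "wt_exp S (Big f i a b) = (small S a \<and> wt_exp S a \<and> wt_exp (insert i S) b)"

primrec wt :: "nat set \<Rightarrow> cmd \<Rightarrow> bool" where
  "wt S (Assign i e) = wt_exp S e"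
| "wt S (Put g a e) = (g < 8 \<and> wt_exp S a \<and> wt_exp S e)"
| "wt S (Sq c1 c2) = (wt S c1 \<and> wt S c2)"
| "wt S (When e c) = (wt_exp S e \<and> wt S c)"
| "wt S (For i e c) = (wt_exp S e \<and> wt S c)"

text \<open>The two bounds differ exponentially. Codes of assignments and table entries only need
  few bits, whereas a loop bound inside an expression must itself be at most \<open>B\<close>,
  because that many iterations are hidden in one step.\<close>

definition bounded_vars :: "nat \<Rightarrow> nat set \<Rightarrow> (nat \<Rightarrow> nat) \<Rightarrow> bool" where
  "bounded_vars B S \<sigma> \<longleftrightarrow> (\<forall>i. bits (\<sigma> i) \<le> B) \<and> (\<forall>i\<in>S. \<sigma> i \<le> B)"

definition bounded_mem :: "nat \<Rightarrow> nat list \<Rightarrow> arrays \<Rightarrow> bool" where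
  "bounded_mem B xs A \<longleftrightarrow> (\<forall>g i. bits (A g i) \<le> B) \<and> (\<forall>x\<in>set xs. bits x \<le> B) \<and> bits (length xs) \<le> B"

section \<open>Upper bounds on costs and bit lengths\<close>

definition exec_le :: "prog \<Rightarrow> config \<Rightarrow> nat \<Rightarrow> config \<Rightarrow> bool" where
  "exec_le c s b s' \<longleftrightarrow> (\<exists>t\<le>b. exec c s t s')"

lemma exec_le_Const: "1 + bits x \<le> b \<Longrightarrow> exec_le (Const i x) (r, m) b (r(i := x), m)"
  unfolding exec_le_def using exec.Const by blast

lemma exec_le_Arith: "1 + bits (r j) + bits (r k) \<le> b \<Longrightarrow>
  exec_le (Arith f i j k) (r, m) b (r(i := arith f (r j) (r k)), m)"
  unfolding exec_le_def using exec.Arith by blast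

lemma exec_le_Load: "1 + bits (r j) + bits (m (r j)) \<le> b \<Longrightarrow>
  exec_le (Load i j) (r, m) b (r(i := m (r j)), m)"
  unfolding exec_le_def using exec.Load by blast

lemma exec_le_Store: "1 + bits (r i) + bits (r j) \<le> b \<Longrightarrow>
  exec_le (Store i j) (r, m) b (r, m(r i := r j))"
  unfolding exec_le_def using exec.Store by blast

lemma exec_le_Seq: "exec_le c1 s b1 s' \<Longrightarrow> exec_le c2 s' b2 s'' \<Longrightarrow>
  exec_le (Seq c1 c2) s (b1 + b2) s''"
  unfolding exec_le_def using exec.Seq add_mono by blast

lemma exec_le_mono: "exec_le c s b s' \<Longrightarrow> b \<le> b' \<Longrightarrow> exec_le c s b' s'"
  unfolding exec_le_def using le_trans by blast

lemma exec_le_If: "r i \<noteq> 0 \<Longrightarrow> exec_le c1 (r, m) b s' \<Longrightarrow>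
    exec_le (If i c1 c2) (r, m) (1 + bits (r i) + b) s'"
  "r i = 0 \<Longrightarrow> exec_le c2 (r, m) b s' \<Longrightarrow> exec_le (If i c1 c2) (r, m) (1 + bits (r i) + b) s'"
  unfolding exec_le_def using exec.IfTrue exec.IfFalse by (meson add_left_mono)+

lemma exec_le_While_False: "r i = 0 \<Longrightarrow> 1 \<le> b \<Longrightarrow> exec_le (While i c) (r, m) b (r, m)"
  unfolding exec_le_def using exec.WhileFalse[of r i c m] by (auto simp: floorlog_def)

lemma exec_le_While_True: "r i \<noteq> 0 \<Longrightarrow> exec_le c (r, m) b1 s' \<Longrightarrow> exec_le (While i c) s' b2 s'' \<Longrightarrow>
    exec_le (While i c) (r, m) (1 + bits (r i) + b1 + b2) s''"
  unfolding exec_le_def by (meson exec.WhileTrue add_mono add_left_mono)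

lemma bits_le: "bits x \<le> x"
  by (simp add: floorlog_leI)

lemma bits_less: "x < 2 ^ bits x"
  by (rule floorlog_leD) auto

lemma bits_leI: "x < 2 ^ b \<Longrightarrow> bits x \<le> b"
  by (rule floorlog_leI) auto

text \<open>One bound for all four operations, so that folds need no case distinction. For addition
  of nonzero numbers it rests on \<open>u + v < a * b\<close> for \<open>u < a\<close>,
  \<open>v < b\<close> and a, b at least 2, applied to powers of two.\<close>

lemma bits_arith: "bits (arith f x y) \<le> bits x + bits y"
proof (cases f)
  case Add
  have *: "u + v < a * b" if "u < a" "v < b" "2 \<le> a" "2 \<le> b" for u v a b :: nat
  proof -
    obtain a' b' where ab: "a = Suc (Suc a')" "b = Suc (Suc b')" "u \<le> Suc a'" "v \<le> Suc b'"
      using \<open>2 \<le> a\<close> \<open>2 \<le> b\<close> \<open>u < a\<close> \<open>v < b\<close>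
      by (metis Suc_le_D Suc_leD Suc_leI less_Suc_eq_le numeral_2_eq_2 Suc_le_mono)
    have "a * b = a' * b' + 2 * a' + 2 * b' + 4" unfolding ab by (simp add: algebra_simps)
    then show ?thesis using ab(3,4) by linarith
  qed
  show ?thesis
  proof (cases "x = 0 \<or> y = 0")
    case True then show ?thesis by (auto simp: Add)
  next
    case False
    then have "bits x \<noteq> 0" "bits y \<noteq> 0" by (auto simp: floorlog_eq_zero_iff)
    then have "(2::nat) ^ 1 \<le> 2 ^ bits x" "(2::nat) ^ 1 \<le> 2 ^ bits y"
      by (intro power_increasing; simp)+
    then have "x + y < 2 ^ bits x * 2 ^ bits y"
      by (intro * bits_less) auto
    then show ?thesis unfolding Add arith.simps by (intro bits_leI) (simp only: power_add)
  qed
next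
  case Sub
  then show ?thesis using floorlog_mono[of "x - y" x 2] by simp
next
  case Mult
  have "x * y < 2 ^ (bits x + bits y)"
    unfolding power_add by (rule mult_strict_mono) (use bits_less in auto)
  then show ?thesis unfolding Mult arith.simps by (rule bits_leI)
next
  case Div
  then show ?thesis using floorlog_mono[of "x div y" x 2] by simp
qed

lemma bits_fold_arith:
  assumes "\<And>k. k < n \<Longrightarrow> bits (g k) \<le> B"
  shows "bits (fold (\<lambda>k acc. arith f acc (g k)) [0..<n] (unit_of f)) \<le> 1 + n * B"
  using assms
proof (induction n)
  case 0
  then show ?case by (cases f) (auto simp: floorlog_def)
next
  case (Suc n)
  have "bits (arith f (fold (\<lambda>k acc. arith f acc (g k)) [0..<n] (unit_of f)) (g n))
    \<le> (1 + n * B) + B"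
    using Suc bits_arith[of f "fold (\<lambda>k acc. arith f acc (g k)) [0..<n] (unit_of f)" "g n"]
    by (meson add_mono le_trans less_Suc_eq)
  then show ?case by simp
qed

text \<open>An environment \<open>\<rho>\<close> places the variables in registers outside the temporaries from \<open>t\<close> on.\<close>

definition env :: "(nat \<Rightarrow> nat) \<Rightarrow> nat \<Rightarrow> nat list \<Rightarrow> (nat \<Rightarrow> nat) \<Rightarrow> (nat \<Rightarrow> nat) \<Rightarrow> bool" where
  "env \<rho> t xs r \<sigma> \<longleftrightarrow> (\<forall>j. r (\<rho> j) = \<sigma> j) \<and> (\<forall>j k. t \<le> k \<longrightarrow> \<rho> j \<noteq> tmp k) \<and> 1 \<le> t \<and> r 1 = length xs"

definition rep_mem :: "nat list \<Rightarrow> (nat \<Rightarrow> nat) \<Rightarrow> arrays \<Rightarrow> bool" where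
  "rep_mem xs m A \<longleftrightarrow> (\<forall>i<length xs. m i = xs ! i) \<and> (\<forall>g<8. \<forall>i. m (length xs + 8 * i + g) = A g i)"

definition same_below :: "nat \<Rightarrow> (nat \<Rightarrow> nat) \<Rightarrow> (nat \<Rightarrow> nat) \<Rightarrow> bool" where
  "same_below t r r' \<longleftrightarrow> (\<forall>k. (\<forall>j\<ge>t. k \<noteq> tmp j) \<longrightarrow> r' k = r k)"

lemma same_below_trans: "same_below t r r' \<Longrightarrow> same_below t r' r'' \<Longrightarrow> same_below t r r''"
  by (simp add: same_below_def)

lemma same_below_mono: "same_below t r r' \<Longrightarrow> t' \<le> t \<Longrightarrow> same_below t' r r'"
  unfolding same_below_def by (meson order_trans)

lemma same_below_upd: "t \<le> j \<Longrightarrow> same_below t r (r(tmp j := x))"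
  by (auto simp: same_below_def)

lemma same_below_tmp: "same_below t r r' \<Longrightarrow> j < t \<Longrightarrow> r' (tmp j) = r (tmp j)"
  by (auto simp: same_below_def)

lemma env_same: "env \<rho> t xs r \<sigma> \<Longrightarrow> same_below t r r' \<Longrightarrow> env \<rho> t xs r' \<sigma>"
  by (auto simp: env_def same_below_def)

lemma env_mono: "env \<rho> t xs r \<sigma> \<Longrightarrow> t \<le> t' \<Longrightarrow> env \<rho> t' xs r \<sigma>"
  unfolding env_def by auto

lemma env_same_le: "env \<rho> t xs r \<sigma> \<Longrightarrow> same_below t r r' \<Longrightarrow> t \<le> t' \<Longrightarrow> env \<rho> t' xs r' \<sigma>"
  using env_same env_mono by blast

lemma env_bind: "env \<rho> t xs r \<sigma> \<Longrightarrow> t \<le> j \<Longrightarrow> j < t' \<Longrightarrow> env (\<rho>(i := tmp j)) t' xs r (\<sigma>(i := r (tmp j)))"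
  unfolding env_def by auto

lemma rep_mem_inp: "rep_mem xs m A \<Longrightarrow> m v = inp xs A v"
proof (cases "v < length xs")
  case False
  assume "rep_mem xs m A"
  then have "\<forall>i. m (length xs + 8 * i + (v - length xs) mod 8) = A ((v - length xs) mod 8) i"
    using rep_mem_def by auto
  moreover have "length xs + 8 * ((v - length xs) div 8) + (v - length xs) mod 8 = v"
    using False by simp
  ultimately show ?thesis using False unfolding inp_def by metis
qed (auto simp: rep_mem_def inp_def)

lemma bits_mono: "x \<le> y \<Longrightarrow> bits x \<le> bits y"
  by (rule floorlog_mono)

lemma exec_le_address:
  assumes "r 1 = length xs" "1 \<le> t" "g < 8" "bits (r (tmp t)) \<le> B" "bits (length xs) \<le> B"
  obtains r' where "exec_le (address t g) (r, m) (40 + 6 * B) (r', m)"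
    "r' (tmp t) = length xs + 8 * r (tmp t) + g" "same_below t r r'" "bits (r' (tmp t)) \<le> 2 * B + 8"
proof -
  define v where "v = r (tmp t)"
  have b8: "bits 8 \<le> 4" by (rule floorlog_leI) auto
  have bg: "bits g \<le> 4" using assms(3) bits_mono[of g 8] b8 by linarith
  have b1: "bits (v * 8) \<le> B + 4" using bits_arith[of Mult v 8] b8 assms(4) by (simp add: v_def)
  have b2: "bits (v * 8 + g) \<le> B + 8" using bits_arith[of Add "v*8" g] bg b1 by simp
  have b3: "bits (v * 8 + g + length xs) \<le> 2 * B + 8"
    using bits_arith[of Add "v*8+g" "length xs"] b2 assms(5) by simp
  let ?r1 = "r(tmp (t+1) := 8)" let ?r2 = "?r1(tmp t := v * 8)" let ?r3 = "?r2(tmp (t+1) := g)"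
  let ?r4 = "?r3(tmp t := v * 8 + g)" let ?r5 = "?r4(tmp t := v * 8 + g + length xs)"
  have "exec_le (address t g) (r, m) (5 + ((B + 5) + (5 + ((B + 9) + (2 * B + 9))))) (?r5, m)"
    unfolding address_def
  proof (intro exec_le_Seq)
    show "exec_le (Const (tmp (t + 1)) 8) (r, m) 5 (?r1, m)" using b8 by (intro exec_le_Const) auto
    show "exec_le (Arith Mult (tmp t) (tmp t) (tmp (t + 1))) (?r1, m) (B + 5) (?r2, m)"
      using exec_le_Arith[of ?r1 "tmp t" "tmp (t+1)" "B + 5" Mult "tmp t" m] b8 assms(4) by (simp add: v_def)
    show "exec_le (Const (tmp (t + 1)) g) (?r2, m) 5 (?r3, m)" using bg by (intro exec_le_Const) auto
    show "exec_le (Arith Add (tmp t) (tmp t) (tmp (t + 1))) (?r3, m) (B + 9) (?r4, m)"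
      using exec_le_Arith[of ?r3 "tmp t" "tmp (t+1)" "B + 9" Add "tmp t" m] bg b1 by simp
    show "exec_le (Arith Add (tmp t) (tmp t) 1) (?r4, m) (2 * B + 9) (?r5, m)"
      using exec_le_Arith[of ?r4 "tmp t" "1" "2 * B + 9" Add "tmp t" m] assms(1,2,5) b2 by simp
  qed
  then have "exec_le (address t g) (r, m) (40 + 6 * B) (?r5, m)" by (rule exec_le_mono) simp
  moreover have "same_below t r ?r5" by (auto simp: same_below_def)
  moreover have "?r5 (tmp t) = length xs + 8 * r (tmp t) + g" by (simp add: v_def)
  ultimately show thesis using that b3 by (metis fun_upd_same)
qed

text \<open>Constant factors move into the exponent, because k is at most \<open>2 ^ k\<close> and
  \<open>X\<close> is at least 2. This keeps every cost bound below in the form of a single power of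
  \<open>X\<close>.\<close>

lemma mult_le_power: "k * X ^ p \<le> X ^ (p + k)" if "2 \<le> X" for X :: nat
proof -
  have "k \<le> 2 ^ k" by (simp add: less_imp_le)
  also have "\<dots> \<le> X ^ k" using that by (rule power_mono) simp
  finally show ?thesis by (simp add: power_add)
qed

section \<open>Cost of compiled expressions\<close>

lemma bounded_vars_mono: "bounded_vars B S \<sigma> \<Longrightarrow> B \<le> B' \<Longrightarrow> bounded_vars B' S \<sigma>"
  unfolding bounded_vars_def by (meson order_trans)

lemma bounded_mem_mono: "bounded_mem B xs A \<Longrightarrow> B \<le> B' \<Longrightarrow> bounded_mem B' xs A"
  unfolding bounded_mem_def by (meson order_trans)

lemma bounded_vars_bind:
  "bounded_vars B S \<sigma> \<Longrightarrow> k \<le> B \<Longrightarrow> bounded_vars B (insert i S) (\<sigma>(i := k))"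
  unfolding bounded_vars_def using bits_le[of k] by (auto intro: order_trans)

lemma bits_inp: "bounded_mem B xs A \<Longrightarrow> bits (inp xs A v) \<le> B"
  by (auto simp: bounded_mem_def inp_def)

text \<open>The exponents \<open>c\<close> and \<open>d\<close> stand outside the quantifier over
  \<open>X\<close>, the input and the state: they are constants of the expression. For small
  expressions the value is bounded too, not only its length, since it may serve as a loop
  bound.\<close>

definition exp_correct :: "nat set \<Rightarrow> nat \<Rightarrow> exp \<Rightarrow> nat \<Rightarrow> bool" where
  "exp_correct S c e d \<longleftrightarrow> (\<forall>X xs A m r \<sigma> \<rho> t.
     2 \<le> X \<and> bounded_vars (X ^ c) S \<sigma> \<and> bounded_mem (X ^ c) xs A \<and> rep_mem xs m A \<and> env \<rho> t xs r \<sigma> \<longrightarrow>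
     bits (eval xs A e \<sigma>) \<le> X ^ d \<and> (small S e \<longrightarrow> eval xs A e \<sigma> \<le> X ^ d) \<and>
     (\<exists>r'. exec_le (compile_exp e \<rho> t) (r, m) (X ^ d) (r', m) \<and> r' (tmp t) = eval xs A e \<sigma> \<and>
        same_below t r r'))"

lemma exp_correctD:
  assumes "exp_correct S c e d" "2 \<le> X" "bounded_vars (X ^ c) S \<sigma>" "bounded_mem (X ^ c) xs A"
    "rep_mem xs m A" "env \<rho> t xs r \<sigma>"
  obtains r' where "bits (eval xs A e \<sigma>) \<le> X ^ d" "small S e \<longrightarrow> eval xs A e \<sigma> \<le> X ^ d"
    "exec_le (compile_exp e \<rho> t) (r, m) (X ^ d) (r', m)" "r' (tmp t) = eval xs A e \<sigma>"
    "same_below t r r'"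
  using assms unfolding exp_correct_def by blast

lemma exp_correct_conclusion:
  assumes "eval xs A e \<sigma> = v" "bits v \<le> Y" "small S e \<longrightarrow> v \<le> Y"
    "exec_le (compile_exp e \<rho> t) (r, m) Y (r', m)" "r' (tmp t) = v" "same_below t r r'"
  shows "bits (eval xs A e \<sigma>) \<le> Y \<and> (small S e \<longrightarrow> eval xs A e \<sigma> \<le> Y) \<and>
     (\<exists>r'. exec_le (compile_exp e \<rho> t) (r, m) Y (r', m) \<and> r' (tmp t) = eval xs A e \<sigma> \<and>
        same_below t r r')"
  using assms by blast

lemma exp_correct_N: "exp_correct S c (N x) (x + 2)"
  unfolding exp_correct_def
proof (intro allI impI, elim conjE)
  fix X xs A m r \<sigma> \<rho> t
  assume X: "2 \<le> (X :: nat)"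
  have "x + 2 \<le> 2 ^ (x + 2)" by (rule less_imp_le[OF less_exp])
  also have "\<dots> \<le> X ^ (x + 2)" using X by (rule power_mono) simp
  finally have x: "x + 2 \<le> X ^ (x + 2)" .
  then have ex: "exec_le (compile_exp (N x) \<rho> t) (r, m) (X ^ (x + 2)) (r(tmp t := x), m)"
    using bits_le[of x] by (auto intro!: exec_le_Const)
  show "bits (eval xs A (N x) \<sigma>) \<le> X ^ (x + 2) \<and>
      (small S (N x) \<longrightarrow> eval xs A (N x) \<sigma> \<le> X ^ (x + 2)) \<and>
      (\<exists>r'. exec_le (compile_exp (N x) \<rho> t) (r, m) (X ^ (x + 2)) (r', m) \<and>
         r' (tmp t) = eval xs A (N x) \<sigma> \<and> same_below t r r')"
  proof (rule exp_correct_conclusion[OF _ _ _ ex _ same_below_upd[OF le_refl]])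
    show "bits x \<le> X ^ (x + 2)" "small S (N x) \<longrightarrow> x \<le> X ^ (x + 2)" using x bits_le[of x] by linarith+
  qed auto
qed

lemma exp_correct_V: "exp_correct S c (V i) (c + 3)"
  unfolding exp_correct_def
proof (intro allI impI, elim conjE)
  fix X xs A m r \<sigma> \<rho> t
  assume X: "2 \<le> (X :: nat)" and bv: "bounded_vars (X ^ c) S \<sigma>" and env: "env \<rho> t xs r \<sigma>"
  have le: "3 * X ^ c \<le> X ^ (c + 3)" using X by (rule mult_le_power)
  have pos: "1 \<le> X ^ c" using X by simp
  have le': "X ^ c \<le> X ^ (c + 3)" using le by linarith
  have b: "bits (\<sigma> i) \<le> X ^ c" "i \<in> S \<Longrightarrow> \<sigma> i \<le> X ^ c" using bv by (auto simp: bounded_vars_def)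
  have ne: "\<rho> i \<noteq> tmp t" and ri: "r (\<rho> i) = \<sigma> i" using env by (auto simp: env_def)
  have z: "bits 0 = 0" by (simp add: floorlog_eq_zero_iff)
  have "exec_le (compile_exp (V i) \<rho> t) (r, m) (1 + (1 + X ^ c)) (r(tmp t := 0, tmp t := \<sigma> i), m)"
    unfolding compile_exp.simps
  proof (rule exec_le_Seq)
    show "exec_le (Const (tmp t) 0) (r, m) 1 (r(tmp t := 0), m)"
      by (rule exec_le_Const) (simp add: z)
    show "exec_le (Arith Add (tmp t) (\<rho> i) (tmp t)) (r(tmp t := 0), m) (1 + X ^ c)
        (r(tmp t := 0, tmp t := \<sigma> i), m)"
      using exec_le_Arith[of "r(tmp t := 0)" "\<rho> i" "tmp t" "1 + X ^ c" Add "tmp t" m] b ne ri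
      by (simp add: z)
  qed
  then have ex: "exec_le (compile_exp (V i) \<rho> t) (r, m) (X ^ (c + 3)) (r(tmp t := \<sigma> i), m)"
    unfolding fun_upd_upd by (rule exec_le_mono) (use le pos in linarith)
  show "bits (eval xs A (V i) \<sigma>) \<le> X ^ (c + 3) \<and>
      (small S (V i) \<longrightarrow> eval xs A (V i) \<sigma> \<le> X ^ (c + 3)) \<and>
      (\<exists>r'. exec_le (compile_exp (V i) \<rho> t) (r, m) (X ^ (c + 3)) (r', m) \<and>
         r' (tmp t) = eval xs A (V i) \<sigma> \<and> same_below t r r')"
  proof (rule exp_correct_conclusion[OF _ _ _ ex _ same_below_upd[OF le_refl]])
    show "bits (\<sigma> i) \<le> X ^ (c + 3)" using b(1) le' by (rule order_trans)
    show "small S (V i) \<longrightarrow> \<sigma> i \<le> X ^ (c + 3)" using b(2) le' order_trans by auto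
  qed auto
qed

lemma exp_correct_In:
  assumes "exp_correct S c e d"
  shows "exp_correct S c (In e) (d + c + 4)"
  unfolding exp_correct_def
proof (intro allI impI, elim conjE)
  fix X xs A m r \<sigma> \<rho> t
  assume X: "2 \<le> (X :: nat)" and bv: "bounded_vars (X ^ c) S \<sigma>" and bm: "bounded_mem (X ^ c) xs A"
    and rep: "rep_mem xs m A" and env: "env \<rho> t xs r \<sigma>"
  obtain r' where r': "bits (eval xs A e \<sigma>) \<le> X ^ d"
    "exec_le (compile_exp e \<rho> t) (r, m) (X ^ d) (r', m)" "r' (tmp t) = eval xs A e \<sigma>"
    "same_below t r r'"
    by (rule exp_correctD[OF assms X bv bm rep env])
  define B where "B = X ^ (d + c)"
  have B: "1 \<le> B" "X ^ d \<le> B" "X ^ c \<le> B" "4 * B \<le> X ^ (d + c + 4)"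
    using X mult_le_power[of X 4 "d + c"] by (auto simp: B_def power_increasing)
  have b: "bits (inp xs A (eval xs A e \<sigma>)) \<le> X ^ c" using bits_inp[OF bm] .
  have "exec_le (compile_exp (In e) \<rho> t) (r, m) (X ^ d + (1 + X ^ d + X ^ c))
      (r'(tmp t := inp xs A (eval xs A e \<sigma>)), m)"
    unfolding compile_exp.simps using r' b
      exec_le_Load[of r' "tmp t" m "1 + X ^ d + X ^ c" "tmp t"] rep_mem_inp[OF rep]
    by (intro exec_le_Seq[OF r'(2)]) simp
  then have ex: "exec_le (compile_exp (In e) \<rho> t) (r, m) (X ^ (d + c + 4))
      (r'(tmp t := inp xs A (eval xs A e \<sigma>)), m)"
    using B by (elim exec_le_mono) linarith
  have sb: "same_below t r (r'(tmp t := inp xs A (eval xs A e \<sigma>)))"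
    using r'(4) same_below_upd[of t t] same_below_trans by blast
  show "bits (eval xs A (In e) \<sigma>) \<le> X ^ (d + c + 4) \<and>
      (small S (In e) \<longrightarrow> eval xs A (In e) \<sigma> \<le> X ^ (d + c + 4)) \<and>
      (\<exists>r'. exec_le (compile_exp (In e) \<rho> t) (r, m) (X ^ (d + c + 4)) (r', m) \<and>
         r' (tmp t) = eval xs A (In e) \<sigma> \<and> same_below t r r')"
  proof (rule exp_correct_conclusion[OF _ _ _ ex _ sb])
    show "bits (inp xs A (eval xs A e \<sigma>)) \<le> X ^ (d + c + 4)" using b B by linarith
  qed auto
qed

lemma exp_correct_Arr:
  assumes "exp_correct S c e d" "g < 8"
  shows "exp_correct S c (Arr g e) (d + c + 59)"
  unfolding exp_correct_def
proof (intro allI impI, elim conjE)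
  fix X xs A m r \<sigma> \<rho> t
  assume X: "2 \<le> (X :: nat)" and bv: "bounded_vars (X ^ c) S \<sigma>" and bm: "bounded_mem (X ^ c) xs A"
    and rep: "rep_mem xs m A" and env: "env \<rho> t xs r \<sigma>"
  obtain r' where r': "bits (eval xs A e \<sigma>) \<le> X ^ d"
    "exec_le (compile_exp e \<rho> t) (r, m) (X ^ d) (r', m)" "r' (tmp t) = eval xs A e \<sigma>"
    "same_below t r r'"
    by (rule exp_correctD[OF assms(1) X bv bm rep env])
  define B where "B = X ^ (d + c)"
  have B: "1 \<le> B" "X ^ d \<le> B" "X ^ c \<le> B" "59 * B \<le> X ^ (d + c + 59)"
    using X mult_le_power[of X 59 "d + c"] by (auto simp: B_def power_increasing)
  let ?v = "A g (eval xs A e \<sigma>)"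
  have b: "bits ?v \<le> B" "bits (length xs) \<le> B" using bm B by (auto simp: bounded_mem_def intro: order_trans)
  have t: "r' 1 = length xs" "1 \<le> t" using env_same[OF env r'(4)] by (auto simp: env_def)
  have "bits (r' (tmp t)) \<le> B" using r'(1,3) B by simp
  then obtain r2 where r2: "exec_le (address t g) (r', m) (40 + 6 * B) (r2, m)"
    "r2 (tmp t) = length xs + 8 * r' (tmp t) + g" "same_below t r' r2" "bits (r2 (tmp t)) \<le> 2 * B + 8"
    by (rule exec_le_address[where r = r' and xs = xs and B = B, OF t assms(2) _ b(2)])
  have m: "m (r2 (tmp t)) = ?v" using rep assms(2) by (simp add: rep_mem_def r2(2) r'(3))
  have "exec_le (compile_exp (Arr g e) \<rho> t) (r, m)
      (X ^ d + ((40 + 6 * B) + (1 + (2 * B + 8) + B))) (r2(tmp t := ?v), m)"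
    unfolding compile_exp.simps using b m r2(4)
      exec_le_Load[of r2 "tmp t" m "1 + (2 * B + 8) + B" "tmp t"]
    by (intro exec_le_Seq[OF r'(2)] exec_le_Seq[OF r2(1)]) simp
  then have ex: "exec_le (compile_exp (Arr g e) \<rho> t) (r, m) (X ^ (d + c + 59)) (r2(tmp t := ?v), m)"
    using B by (elim exec_le_mono) linarith
  have sb: "same_below t r (r2(tmp t := ?v))"
    using r'(4) r2(3) same_below_upd[of t t] same_below_trans by blast
  show "bits (eval xs A (Arr g e) \<sigma>) \<le> X ^ (d + c + 59) \<and>
      (small S (Arr g e) \<longrightarrow> eval xs A (Arr g e) \<sigma> \<le> X ^ (d + c + 59)) \<and>
      (\<exists>r'. exec_le (compile_exp (Arr g e) \<rho> t) (r, m) (X ^ (d + c + 59)) (r', m) \<and>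
         r' (tmp t) = eval xs A (Arr g e) \<sigma> \<and> same_below t r r')"
  proof (rule exp_correct_conclusion[OF _ _ _ ex _ sb])
    show "bits ?v \<le> X ^ (d + c + 59)" using b B by linarith
  qed auto
qed

lemma arith_le: "x \<le> a \<Longrightarrow> y \<le> b \<Longrightarrow> 1 \<le> a \<Longrightarrow> 1 \<le> b \<Longrightarrow> arith f x y \<le> 2 * (a * b)"
proof (cases f)
  case Add
  assume "x \<le> a" "y \<le> b" "1 \<le> a" "1 \<le> b"
  then have "a * 1 \<le> a * b" "1 * b \<le> a * b" by (intro mult_le_mono; simp)+
  then show ?thesis unfolding Add arith.simps using \<open>x \<le> a\<close> \<open>y \<le> b\<close> by linarith
next
  case Sub
  assume "x \<le> a" "y \<le> b" "1 \<le> a" "1 \<le> b"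
  then have "a * 1 \<le> a * b" by (intro mult_le_mono; simp)
  then show ?thesis unfolding Sub arith.simps using \<open>x \<le> a\<close> by linarith
next
  case Mult
  assume "x \<le> a" "y \<le> b"
  then have "x * y \<le> a * b" by (intro mult_le_mono)
  then show ?thesis unfolding Mult arith.simps by linarith
next
  case Div
  assume "x \<le> a" "y \<le> b" "1 \<le> a" "1 \<le> b"
  then have "a * 1 \<le> a * b" by (intro mult_le_mono; simp)
  moreover have "x div y \<le> x" by simp
  ultimately show ?thesis unfolding Div arith.simps using \<open>x \<le> a\<close> by linarith
qed

lemma exp_correct_Op:
  assumes "exp_correct S c a d1" "exp_correct S c b d2"
  shows "exp_correct S c (Op f a b) (d1 + d2 + 5)"
  unfolding exp_correct_def
proof (intro allI impI, elim conjE)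
  fix X xs A m r \<sigma> \<rho> t
  assume X: "2 \<le> (X :: nat)" and bdv: "bounded_vars (X ^ c) S \<sigma>" and bm: "bounded_mem (X ^ c) xs A"
    and rep: "rep_mem xs m A" and env: "env \<rho> t xs r \<sigma>"
  obtain r1 where r1: "bits (eval xs A a \<sigma>) \<le> X ^ d1" "small S a \<longrightarrow> eval xs A a \<sigma> \<le> X ^ d1"
    "exec_le (compile_exp a \<rho> t) (r, m) (X ^ d1) (r1, m)" "r1 (tmp t) = eval xs A a \<sigma>"
    "same_below t r r1"
    by (rule exp_correctD[OF assms(1) X bdv bm rep env])
  have env1: "env \<rho> (t + 1) xs r1 \<sigma>" using env_same_le[OF env r1(5)] by simp
  obtain r2 where r2: "bits (eval xs A b \<sigma>) \<le> X ^ d2" "small S b \<longrightarrow> eval xs A b \<sigma> \<le> X ^ d2"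
    "exec_le (compile_exp b \<rho> (t + 1)) (r1, m) (X ^ d2) (r2, m)" "r2 (tmp (t + 1)) = eval xs A b \<sigma>"
    "same_below (t + 1) r1 r2"
    by (rule exp_correctD[OF assms(2) X bdv bm rep env1])
  define B where "B = X ^ (d1 + d2)"
  have B: "1 \<le> B" "X ^ d1 \<le> B" "X ^ d2 \<le> B" "5 * B \<le> X ^ (d1 + d2 + 5)" "B = X ^ d1 * X ^ d2"
    using X mult_le_power[of X 5 "d1 + d2"] by (auto simp: B_def power_increasing power_add)
  let ?v = "eval xs A (Op f a b) \<sigma>"
  have r2t: "r2 (tmp t) = eval xs A a \<sigma>" using same_below_tmp[OF r2(5), of t] r1(4) by simp
  have "exec_le (compile_exp (Op f a b) \<rho> t) (r, m) (X ^ d1 + (X ^ d2 + (1 + X ^ d1 + X ^ d2)))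
      (r2(tmp t := ?v), m)"
    unfolding compile_exp.simps using r1(1) r2(1,4) r2t
      exec_le_Arith[of r2 "tmp t" "tmp (t + 1)" "1 + X ^ d1 + X ^ d2" f "tmp t" m]
    by (intro exec_le_Seq[OF r1(3)] exec_le_Seq[OF r2(3)]) simp
  then have ex: "exec_le (compile_exp (Op f a b) \<rho> t) (r, m) (X ^ (d1 + d2 + 5)) (r2(tmp t := ?v), m)"
    using B by (elim exec_le_mono) linarith
  have sb: "same_below t r (r2(tmp t := ?v))"
    using r1(5) r2(5) same_below_upd[of t t] same_below_trans same_below_mono[OF r2(5), of t]
    by (metis le_add1 le_refl)
  have bv: "bits ?v \<le> X ^ (d1 + d2 + 5)"
    using bits_arith[of f "eval xs A a \<sigma>" "eval xs A b \<sigma>"] r1(1) r2(1) B(1-4)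
    unfolding eval.simps by linarith
  have sm: "small S (Op f a b) \<longrightarrow> ?v \<le> X ^ (d1 + d2 + 5)"
  proof
    assume "small S (Op f a b)"
    then have "eval xs A a \<sigma> \<le> X ^ d1" "eval xs A b \<sigma> \<le> X ^ d2" using r1(2) r2(2) by auto
    then have "?v \<le> 2 * B" unfolding B(5) eval.simps by (rule arith_le) (use X in auto)
    then show "?v \<le> X ^ (d1 + d2 + 5)" using B by linarith
  qed
  show "bits ?v \<le> X ^ (d1 + d2 + 5) \<and>
      (small S (Op f a b) \<longrightarrow> ?v \<le> X ^ (d1 + d2 + 5)) \<and>
      (\<exists>r'. exec_le (compile_exp (Op f a b) \<rho> t) (r, m) (X ^ (d1 + d2 + 5)) (r', m) \<and>
         r' (tmp t) = ?v \<and> same_below t r r')"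
    by (rule exp_correct_conclusion[OF refl bv sm ex _ sb]) simp
qed

text \<open>There are at most \<open>X ^ d1\<close> iterations, and the accumulator grows by at most
  \<open>X ^ d2\<close> bits in each, so that one iteration costs a constant times
  \<open>X ^ (d1 + d2)\<close>. The body is analysed with \<open>c + d1\<close> in place of
  \<open>c\<close>, since the bound variable is only known to be below
  \<open>X ^ d1\<close>.\<close>

lemma exp_correct_Big:
  assumes "exp_correct S c a d1" "exp_correct (insert i S) (c + d1) b d2" "small S a"
  shows "exp_correct S c (Big f i a b) (2 * d1 + d2 + 30)"
  unfolding exp_correct_def
proof (intro allI impI, elim conjE)
  fix X xs A m r \<sigma> \<rho> t
  assume X: "2 \<le> (X :: nat)" and bv: "bounded_vars (X ^ c) S \<sigma>" and bm: "bounded_mem (X ^ c) xs A"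
    and rep: "rep_mem xs m A" and env: "env \<rho> t xs r \<sigma>"
  have env0: "env \<rho> (t + 2) xs r \<sigma>" using env by (rule env_mono) simp
  define n where "n = eval xs A a \<sigma>"
  obtain r1 where r1: "n \<le> X ^ d1"
    "exec_le (compile_exp a \<rho> (t + 2)) (r, m) (X ^ d1) (r1, m)" "r1 (tmp (t + 2)) = n"
    "same_below (t + 2) r r1"
    using exp_correctD[OF assms(1) X bv bm rep env0] assms(3) n_def by metis
  define Z where "Z = X ^ (d1 + d2)"
  have Z: "1 \<le> Z" "X ^ d1 \<le> Z" "X ^ d2 \<le> Z" "Z = X ^ d1 * X ^ d2"
    using X by (auto simp: Z_def power_increasing power_add)
  have bm': "bounded_mem (X ^ (c + d1)) xs A"
    using bm by (rule bounded_mem_mono) (use X in \<open>simp add: power_increasing\<close>)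
  have bv': "bounded_vars (X ^ (c + d1)) (insert i S) (\<sigma>(i := k))" if "k < n" for k
  proof (rule bounded_vars_bind)
    show "bounded_vars (X ^ (c + d1)) S \<sigma>"
      using bv by (rule bounded_vars_mono) (use X in \<open>simp add: power_increasing\<close>)
    have "X ^ d1 \<le> X ^ (c + d1)" using X by (simp add: power_increasing)
    then show "k \<le> X ^ (c + d1)" using that r1(1) by linarith
  qed
  define g where "g k = eval xs A b (\<sigma>(i := k))" for k
  define acc where "acc k = fold (\<lambda>k acc. arith f acc (g k)) [0..<k] (unit_of f)" for k
  have body: "\<exists>r'. bits (g k) \<le> X ^ d2 \<and>
      exec_le (compile_exp b (\<rho>(i := tmp (t + 1))) (t + 3)) (rk, m) (X ^ d2) (r', m) \<and>
      r' (tmp (t + 3)) = g k \<and> same_below (t + 3) rk r'"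
    if "k < n" "same_below t r rk" "rk (tmp (t + 1)) = k" for k rk
  proof -
    have "env (\<rho>(i := tmp (t + 1))) (t + 3) xs rk (\<sigma>(i := k))"
      using env_bind[OF env_same[OF env that(2)], of "t + 1" "t + 3" i] that(3) by simp
    from exp_correctD[OF assms(2) X bv'[OF that(1)] bm' rep this] show ?thesis
      unfolding g_def by metis
  qed
  have bg: "bits (g k) \<le> X ^ d2" if "k < n" for k
  proof -
    have "same_below t r (r(tmp (t + 1) := k))" by (rule same_below_upd) simp
    from body[OF that this] show ?thesis by auto
  qed
  have bacc: "bits (acc k) \<le> 1 + Z" if "k \<le> n" for k
  proof -
    have "bits (acc k) \<le> 1 + k * X ^ d2"
      unfolding acc_def by (rule bits_fold_arith) (use bg that in auto)
    also have "k * X ^ d2 \<le> Z" unfolding Z(4) using that r1(1) by (intro mult_le_mono) auto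
    finally show ?thesis by simp
  qed
  have bn: "bits k \<le> Z" if "k \<le> n" for k using bits_le[of k] that r1(1) Z(2) by linarith
  define W where "W = While (tmp (t + 2))
         (Seq (compile_exp b (\<rho>(i := tmp (t + 1))) (t + 3))
         (Seq (Arith f (tmp t) (tmp t) (tmp (t + 3)))
         (Seq (Const (tmp (t + 3)) 1)
         (Seq (Arith Add (tmp (t + 1)) (tmp (t + 1)) (tmp (t + 3)))
              (Arith Sub (tmp (t + 2)) (tmp (t + 2)) (tmp (t + 3)))))))"
  have b1: "bits 1 \<le> 1" by (rule bits_le)
  \<comment> \<open>Backward induction over the iterations: a run of the remaining loop is its first
    iteration followed by a run of the rest. The registers are quantified inside the claim, as each
    iteration leaves different ones.\<close>
  have loop: "k \<le> n \<Longrightarrow> \<forall>rk. rk (tmp (t + 2)) = n - k \<and> rk (tmp (t + 1)) = k \<and> rk (tmp t) = acc k \<and>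
      same_below t r rk \<longrightarrow> (\<exists>r'. exec_le W (rk, m) ((n - k) * (15 * Z) + 1) (r', m) \<and>
      r' (tmp t) = acc n \<and> same_below t r r')" for k
  proof (induction k rule: inc_induct)
    case base
    show ?case
    proof (intro allI impI, elim conjE)
      fix rk assume rk: "rk (tmp (t + 2)) = n - n" "rk (tmp t) = acc n" "same_below t r rk"
      have "exec_le W (rk, m) 1 (rk, m)"
        unfolding W_def by (rule exec_le_While_False) (use rk(1) in simp_all)
      with rk show "\<exists>r'. exec_le W (rk, m) ((n - n) * (15 * Z) + 1) (r', m) \<and>
          r' (tmp t) = acc n \<and> same_below t r r'" by (intro exI[of _ rk]) simp
    qed
  next
    case (step k)
    show ?case
    proof (intro allI impI, elim conjE)
      fix rk assume rk: "rk (tmp (t + 2)) = n - k" "rk (tmp (t + 1)) = k" "rk (tmp t) = acc k"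
        "same_below t r rk"
      obtain r2 where r2: "bits (g k) \<le> X ^ d2"
          "exec_le (compile_exp b (\<rho>(i := tmp (t + 1))) (t + 3)) (rk, m) (X ^ d2) (r2, m)"
          "r2 (tmp (t + 3)) = g k" "same_below (t + 3) rk r2"
        using body[OF step(2) rk(4,2)] by blast
      have r2v: "r2 (tmp (t + 2)) = n - k" "r2 (tmp (t + 1)) = k" "r2 (tmp t) = acc k"
        using rk same_below_tmp[OF r2(4)] by simp_all
      have acc: "acc (Suc k) = arith f (acc k) (g k)" by (simp add: acc_def)
      let ?r3 = "r2(tmp t := acc (Suc k))" let ?r4 = "?r3(tmp (t + 3) := 1)"
      let ?r5 = "?r4(tmp (t + 1) := Suc k)" let ?r6 = "?r5(tmp (t + 2) := n - Suc k)"
      have kn: "k \<le> n" "n - k \<le> n" using step(2) by auto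
      have iter: "exec_le (Seq (compile_exp b (\<rho>(i := tmp (t + 1))) (t + 3))
         (Seq (Arith f (tmp t) (tmp t) (tmp (t + 3)))
         (Seq (Const (tmp (t + 3)) 1)
         (Seq (Arith Add (tmp (t + 1)) (tmp (t + 1)) (tmp (t + 3)))
              (Arith Sub (tmp (t + 2)) (tmp (t + 2)) (tmp (t + 3))))))) (rk, m)
          (X ^ d2 + ((1 + (1 + Z) + X ^ d2) + (2 + ((2 + Z) + (2 + Z))))) (?r6, m)"
      proof (intro exec_le_Seq)
        show "exec_le (compile_exp b (\<rho>(i := tmp (t + 1))) (t + 3)) (rk, m) (X ^ d2) (r2, m)" by (rule r2(2))
        show "exec_le (Arith f (tmp t) (tmp t) (tmp (t + 3))) (r2, m) (1 + (1 + Z) + X ^ d2) (?r3, m)"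
          using exec_le_Arith[of r2 "tmp t" "tmp (t + 3)" "1 + (1 + Z) + X ^ d2" f "tmp t" m]
            bacc[OF kn(1)] r2(1,3) r2v acc by simp
        show "exec_le (Const (tmp (t + 3)) 1) (?r3, m) 2 (?r4, m)" using b1 by (intro exec_le_Const) simp
        show "exec_le (Arith Add (tmp (t + 1)) (tmp (t + 1)) (tmp (t + 3))) (?r4, m) (2 + Z) (?r5, m)"
          using exec_le_Arith[of ?r4 "tmp (t + 1)" "tmp (t + 3)" "2 + Z" Add "tmp (t + 1)" m]
            bn[OF kn(1)] b1 r2v by simp
        show "exec_le (Arith Sub (tmp (t + 2)) (tmp (t + 2)) (tmp (t + 3))) (?r5, m) (2 + Z) (?r6, m)"
          using exec_le_Arith[of ?r5 "tmp (t + 2)" "tmp (t + 3)" "2 + Z" Sub "tmp (t + 2)" m]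
            bn[OF kn(2)] b1 r2v by (simp add: fun_upd_twist)
      qed
      have "same_below t r r2" using rk(4) same_below_mono[OF r2(4), of t] same_below_trans by auto
      then have sb: "same_below t r ?r6" by (auto simp: same_below_def)
      have vals: "?r6 (tmp (t + 2)) = n - Suc k" "?r6 (tmp (t + 1)) = Suc k" "?r6 (tmp t) = acc (Suc k)"
        by simp_all
      obtain r' where r': "exec_le W (?r6, m) ((n - Suc k) * (15 * Z) + 1) (r', m)"
          "r' (tmp t) = acc n" "same_below t r r'"
        using step.IH vals sb by blast
      have "rk (tmp (t + 2)) \<noteq> 0" using rk(1) step(2) by simp
      from exec_le_While_True[OF this iter r'(1)[unfolded W_def]]
      have "exec_le W (rk, m) (1 + bits (n - k) +
          (X ^ d2 + ((1 + (1 + Z) + X ^ d2) + (2 + ((2 + Z) + (2 + Z))))) +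
          ((n - Suc k) * (15 * Z) + 1)) (r', m)" unfolding W_def rk(1) .
      moreover have "1 + bits (n - k) + (X ^ d2 + ((1 + (1 + Z) + X ^ d2) + (2 + ((2 + Z) + (2 + Z)))))
          \<le> 15 * Z" using bn[OF kn(2)] Z by linarith
      moreover have "(n - k) * (15 * Z) = 15 * Z + (n - Suc k) * (15 * Z)"
        using step(2) by (metis Suc_diff_Suc mult_Suc)
      ultimately have "exec_le W (rk, m) ((n - k) * (15 * Z) + 1) (r', m)"
        by (elim exec_le_mono) linarith
      then show "\<exists>r'. exec_le W (rk, m) ((n - k) * (15 * Z) + 1) (r', m) \<and>
          r' (tmp t) = acc n \<and> same_below t r r'" using r' by blast
    qed
  qed
  let ?r2 = "r1(tmp t := unit_of f, tmp (t + 1) := 0)"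
  have "same_below t r r1" using same_below_mono[OF r1(4), of t] by simp
  then have sb: "same_below t r ?r2" by (auto simp: same_below_def)
  obtain r' where r': "exec_le W (?r2, m) ((n - 0) * (15 * Z) + 1) (r', m)" "r' (tmp t) = acc n"
      "same_below t r r'"
  proof -
    have "?r2 (tmp (t + 2)) = n - 0 \<and> ?r2 (tmp (t + 1)) = 0 \<and> ?r2 (tmp t) = acc 0 \<and> same_below t r ?r2"
      using sb r1(3) by (simp add: acc_def)
    from loop[of 0, THEN spec, THEN mp, OF _ this] show thesis using that by blast
  qed
  have bu: "bits (unit_of f) \<le> 1" using bits_fold_arith[of 0] by simp
  have "exec_le (compile_exp (Big f i a b) \<rho> t) (r, m)
      (X ^ d1 + (2 + (2 + ((n - 0) * (15 * Z) + 1)))) (r', m)"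
    unfolding compile_exp.simps W_def[symmetric]
  proof (intro exec_le_Seq)
    show "exec_le (compile_exp a \<rho> (t + 2)) (r, m) (X ^ d1) (r1, m)" by (rule r1)
    show "exec_le (Const (tmp t) (unit_of f)) (r1, m) 2 (r1(tmp t := unit_of f), m)"
      using bu by (intro exec_le_Const) simp
    show "exec_le (Const (tmp (t + 1)) 0) (r1(tmp t := unit_of f), m) 2 (?r2, m)"
      using bits_le[of 0] by (intro exec_le_Const) simp
    show "exec_le W (?r2, m) ((n - 0) * (15 * Z) + 1) (r', m)" by (rule r')
  qed
  moreover have "X ^ d1 + (2 + (2 + ((n - 0) * (15 * Z) + 1))) \<le> X ^ (2 * d1 + d2 + 30)"
  proof -
    have "n * (15 * Z) \<le> X ^ d1 * (15 * Z)" using r1(1) by simp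
    moreover have "1 \<le> X ^ d1" using X by simp
    moreover have "Z \<le> X ^ d1 * Z" using \<open>1 \<le> X ^ d1\<close> by simp
    moreover have "X ^ d1 * Z = X ^ (2 * d1 + d2)" unfolding Z(4) mult_2 power_add by (simp only: mult.assoc)
    then have "30 * (X ^ d1 * Z) \<le> X ^ (2 * d1 + d2 + 30)" using mult_le_power[OF X] by metis
    ultimately show ?thesis unfolding diff_zero using Z(1-3) by linarith
  qed
  ultimately have ex: "exec_le (compile_exp (Big f i a b) \<rho> t) (r, m) (X ^ (2 * d1 + d2 + 30)) (r', m)"
    by (rule exec_le_mono)
  have ev: "eval xs A (Big f i a b) \<sigma> = acc n" by (simp add: acc_def g_def n_def)
  have "1 + Z \<le> X ^ (2 * d1 + d2 + 30)"
    using mult_le_power[OF X, of 30 "d1 + d2"] power_increasing[of "d1 + d2 + 30" "2 * d1 + d2 + 30" X] X Z(1)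
    unfolding Z_def[symmetric] by linarith
  then have "bits (acc n) \<le> X ^ (2 * d1 + d2 + 30)" using bacc[of n] by linarith
  then show "bits (eval xs A (Big f i a b) \<sigma>) \<le> X ^ (2 * d1 + d2 + 30) \<and>
      (small S (Big f i a b) \<longrightarrow> eval xs A (Big f i a b) \<sigma> \<le> X ^ (2 * d1 + d2 + 30)) \<and>
      (\<exists>r'. exec_le (compile_exp (Big f i a b) \<rho> t) (r, m) (X ^ (2 * d1 + d2 + 30)) (r', m) \<and>
         r' (tmp t) = eval xs A (Big f i a b) \<sigma> \<and> same_below t r r')"
    by (rule exp_correct_conclusion[OF ev _ _ ex r'(2,3)]) simp
qed

lemma exp_correct_exists: "wt_exp S e \<Longrightarrow> \<exists>d. exp_correct S c e d"
proof (induction e arbitrary: S c)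
  case (Op f a b)
  then show ?case by (meson exp_correct_Op wt_exp.simps(5))
next
  case (Big f i a b)
  then obtain d1 where "exp_correct S c a d1" by fastforce
  moreover obtain d2 where "exp_correct (insert i S) (c + d1) b d2" using Big by fastforce
  ultimately show ?case using Big.prems exp_correct_Big by fastforce
next
  case (In e)
  then show ?case by (meson exp_correct_In wt_exp.simps(3))
next
  case (Arr g e)
  then show ?case by (meson exp_correct_Arr wt_exp.simps(4))
qed (auto intro: exp_correct_N exp_correct_V)

section \<open>Cost of compiled commands\<close>

definition bounded :: "nat \<Rightarrow> nat set \<Rightarrow> nat list \<Rightarrow> state \<Rightarrow> bool" where
  "bounded B S xs s \<longleftrightarrow> bounded_vars B S (fst s) \<and> bounded_mem B xs (snd s)"

text \<open>The last conjunct protects the temporaries below \<open>t\<close>: an enclosing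
  \<open>For\<close> keeps its counters in two of them while the body, compiled two places higher,
  runs.\<close>

definition cmd_correct :: "nat set \<Rightarrow> nat \<Rightarrow> cmd \<Rightarrow> nat \<Rightarrow> bool" where
  "cmd_correct S c0 c K \<longleftrightarrow> (\<forall>X xs t r m s.
     2 \<le> X \<and> safe xs (bounded (X ^ c0) S xs) c s \<and> rep_mem xs m (snd s) \<and> env ((*) 2) t xs r (fst s) \<longrightarrow>
     (\<exists>r' m'. exec_le (compile_cmd c t) (r, m) (steps xs c s * X ^ K) (r', m') \<and>
        rep_mem xs m' (snd (sem xs c s)) \<and> env ((*) 2) t xs r' (fst (sem xs c s)) \<and>
        (\<forall>j<t. r' (tmp j) = r (tmp j))))"

lemma cmd_correctD:
  assumes "cmd_correct S c0 c K" "2 \<le> X" "safe xs (bounded (X ^ c0) S xs) c s"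
    "rep_mem xs m (snd s)" "env ((*) 2) t xs r (fst s)"
  obtains r' m' where "exec_le (compile_cmd c t) (r, m) (steps xs c s * X ^ K) (r', m')"
    "rep_mem xs m' (snd (sem xs c s))" "env ((*) 2) t xs r' (fst (sem xs c s))"
    "\<forall>j<t. r' (tmp j) = r (tmp j)"
  using assms unfolding cmd_correct_def by blast

lemma exp_correctD':
  assumes "exp_correct S c e d" "2 \<le> X" "bounded (X ^ c) S xs s"
    "rep_mem xs m (snd s)" "env ((*) 2) t xs r (fst s)"
  obtains r' where "bits (eval xs (snd s) e (fst s)) \<le> X ^ d"
    "exec_le (compile_exp e ((*) 2) t) (r, m) (X ^ d) (r', m)" "r' (tmp t) = eval xs (snd s) e (fst s)"
    "same_below t r r'"
  using exp_correctD[OF assms(1,2) _ _ assms(4,5)] assms(3) unfolding bounded_def by metis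

lemma env_assign:
  assumes "env ((*) 2) t xs r \<sigma>"
  shows "env ((*) 2) t xs (r(2 * i := x)) (\<sigma>(i := x))"
  using assms unfolding env_def by (auto simp: doubleton_eq_iff; presburger)

lemma cmd_correct_Assign:
  assumes "exp_correct S c0 e d"
  shows "cmd_correct S c0 (Assign i e) (d + 4)"
  unfolding cmd_correct_def
proof (intro allI impI, elim conjE)
  fix X xs t r m and s :: state
  assume X: "2 \<le> (X :: nat)" and sf: "safe xs (bounded (X ^ c0) S xs) (Assign i e) s"
    and rep: "rep_mem xs m (snd s)" and env: "env ((*) 2) t xs r (fst s)"
  have bd: "bounded (X ^ c0) S xs s" using sf by simp
  obtain r1 where r1: "bits (eval xs (snd s) e (fst s)) \<le> X ^ d"
    "exec_le (compile_exp e ((*) 2) t) (r, m) (X ^ d) (r1, m)" "r1 (tmp t) = eval xs (snd s) e (fst s)"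
    "same_below t r r1"
    by (rule exp_correctD'[OF assms X bd rep env])
  let ?v = "eval xs (snd s) e (fst s)"
  have z: "bits 0 = 0" by (simp add: floorlog_eq_zero_iff)
  have "exec_le (compile_cmd (Assign i e) t) (r, m) (X ^ d + (1 + (1 + X ^ d))) (r1(2 * i := ?v), m)"
    unfolding compile_cmd.simps
  proof (intro exec_le_Seq[OF r1(2)] exec_le_Seq)
    show "exec_le (Const (2 * i) 0) (r1, m) 1 (r1(2 * i := 0), m)"
      by (rule exec_le_Const) (simp add: z)
    show "exec_le (Arith Add (2 * i) (2 * i) (tmp t)) (r1(2 * i := 0), m) (1 + X ^ d) (r1(2 * i := ?v), m)"
      using exec_le_Arith[of "r1(2 * i := 0)" "2 * i" "tmp t" "1 + X ^ d" Add "2 * i" m] r1 by (simp add: z)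
  qed
  moreover have "1 \<le> X ^ d" using X by simp
  moreover have "4 * X ^ d \<le> X ^ (d + 4)" using X by (rule mult_le_power)
  ultimately have "exec_le (compile_cmd (Assign i e) t) (r, m) (X ^ (d + 4)) (r1(2 * i := ?v), m)"
    by (elim exec_le_mono) linarith
  moreover have "env ((*) 2) t xs (r1(2 * i := ?v)) ((fst s)(i := ?v))"
    using env_same[OF env r1(4)] by (rule env_assign)
  ultimately show "\<exists>r' m'. exec_le (compile_cmd (Assign i e) t) (r, m)
      (steps xs (Assign i e) s * X ^ (d + 4)) (r', m') \<and>
      rep_mem xs m' (snd (sem xs (Assign i e) s)) \<and> env ((*) 2) t xs r' (fst (sem xs (Assign i e) s)) \<and>
      (\<forall>j<t. r' (tmp j) = r (tmp j))"
    using rep same_below_tmp[OF r1(4)] by (intro exI[of _ "r1(2 * i := ?v)"] exI[of _ m]) simp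
qed

lemma rep_mem_upd:
  assumes "rep_mem xs m A" "g < 8"
  shows "rep_mem xs (m(length xs + 8 * i + g := x)) (A(g := (A g)(i := x)))"
proof -
  have "length xs + 8 * j + g' = length xs + 8 * i + g \<longleftrightarrow> j = i \<and> g' = g" if "g' < 8" for j g'
    using that assms(2) by presburger
  then show ?thesis using assms by (auto simp: rep_mem_def)
qed

lemma cmd_correct_Put:
  assumes "exp_correct S c0 a d1" "exp_correct S c0 e d2" "g < 8"
  shows "cmd_correct S c0 (Put g a e) (d1 + d2 + c0 + 60)"
  unfolding cmd_correct_def
proof (intro allI impI, elim conjE)
  fix X xs t r m and s :: state
  assume X: "2 \<le> (X :: nat)" and sf: "safe xs (bounded (X ^ c0) S xs) (Put g a e) s"
    and rep: "rep_mem xs m (snd s)" and env: "env ((*) 2) t xs r (fst s)"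
  have bd: "bounded (X ^ c0) S xs s" using sf by simp
  obtain r1 where r1: "bits (eval xs (snd s) a (fst s)) \<le> X ^ d1"
    "exec_le (compile_exp a ((*) 2) t) (r, m) (X ^ d1) (r1, m)" "r1 (tmp t) = eval xs (snd s) a (fst s)"
    "same_below t r r1"
    by (rule exp_correctD'[OF assms(1) X bd rep env])
  define B where "B = X ^ (d1 + d2 + c0)"
  have B: "1 \<le> B" "X ^ d1 \<le> B" "X ^ d2 \<le> B" "X ^ c0 \<le> B" "60 * B \<le> X ^ (d1 + d2 + c0 + 60)"
    using X mult_le_power[of X 60 "d1 + d2 + c0"] by (auto simp: B_def power_increasing)
  have t: "r1 1 = length xs" "1 \<le> t" using env_same[OF env r1(4)] by (auto simp: env_def)
  have b: "bits (length xs) \<le> B" "bits (r1 (tmp t)) \<le> B"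
    using bd B r1(1,3) by (auto simp: bounded_mem_def bounded_def intro: order_trans)
  obtain r2 where r2: "exec_le (address t g) (r1, m) (40 + 6 * B) (r2, m)"
    "r2 (tmp t) = length xs + 8 * r1 (tmp t) + g" "same_below t r1 r2" "bits (r2 (tmp t)) \<le> 2 * B + 8"
    by (rule exec_le_address[where r = r1 and xs = xs and B = B, OF t assms(3) b(2) b(1)])
  have sb: "same_below t r r2" using r1(4) r2(3) same_below_trans by blast
  have env2: "env ((*) 2) (t + 1) xs r2 (fst s)" using env_same_le[OF env sb] by simp
  obtain r3 where r3: "bits (eval xs (snd s) e (fst s)) \<le> X ^ d2"
    "exec_le (compile_exp e ((*) 2) (t + 1)) (r2, m) (X ^ d2) (r3, m)"
    "r3 (tmp (t + 1)) = eval xs (snd s) e (fst s)" "same_below (t + 1) r2 r3"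
    by (rule exp_correctD'[OF assms(2) X bd rep env2])
  have r3t: "r3 (tmp t) = r2 (tmp t)" using same_below_tmp[OF r3(4), of t] by simp
  let ?m = "m(length xs + 8 * eval xs (snd s) a (fst s) + g := eval xs (snd s) e (fst s))"
  have "exec_le (compile_cmd (Put g a e) t) (r, m)
      (X ^ d1 + ((40 + 6 * B) + (X ^ d2 + (1 + (2 * B + 8) + B)))) (r3, ?m)"
    unfolding compile_cmd.simps using r2(2,4) r3 r3t r1(3) B
      exec_le_Store[of r3 "tmp t" "tmp (t + 1)" "1 + (2 * B + 8) + B" m]
    by (intro exec_le_Seq[OF r1(2)] exec_le_Seq[OF r2(1)] exec_le_Seq[OF r3(2)]) simp
  then have "exec_le (compile_cmd (Put g a e) t) (r, m) (X ^ (d1 + d2 + c0 + 60)) (r3, ?m)"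
    using B by (elim exec_le_mono) linarith
  moreover have sb3: "same_below t r r3"
    using sb same_below_mono[OF r3(4), of t] same_below_trans by auto
  moreover have "env ((*) 2) t xs r3 (fst s)" using env_same[OF env sb3] .
  ultimately show "\<exists>r' m'. exec_le (compile_cmd (Put g a e) t) (r, m)
      (steps xs (Put g a e) s * X ^ (d1 + d2 + c0 + 60)) (r', m') \<and>
      rep_mem xs m' (snd (sem xs (Put g a e) s)) \<and> env ((*) 2) t xs r' (fst (sem xs (Put g a e) s)) \<and>
      (\<forall>j<t. r' (tmp j) = r (tmp j))"
    using rep_mem_upd[OF rep assms(3)] same_below_tmp[OF sb3]
    by (intro exI[of _ r3] exI[of _ ?m]) simp
qed

lemma cmd_correct_Sq:
  assumes "cmd_correct S c0 c1 K1" "cmd_correct S c0 c2 K2"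
  shows "cmd_correct S c0 (Sq c1 c2) (K1 + K2)"
  unfolding cmd_correct_def
proof (intro allI impI, elim conjE)
  fix X xs t r m and s :: state
  assume X: "2 \<le> (X :: nat)" and sf: "safe xs (bounded (X ^ c0) S xs) (Sq c1 c2) s"
    and rep: "rep_mem xs m (snd s)" and env: "env ((*) 2) t xs r (fst s)"
  have sf': "safe xs (bounded (X ^ c0) S xs) c1 s" "safe xs (bounded (X ^ c0) S xs) c2 (sem xs c1 s)"
    using sf by auto
  obtain r1 m1 where r1: "exec_le (compile_cmd c1 t) (r, m) (steps xs c1 s * X ^ K1) (r1, m1)"
    "rep_mem xs m1 (snd (sem xs c1 s))" "env ((*) 2) t xs r1 (fst (sem xs c1 s))"
    "\<forall>j<t. r1 (tmp j) = r (tmp j)"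
    by (rule cmd_correctD[OF assms(1) X sf'(1) rep env])
  obtain r2 m2 where r2: "exec_le (compile_cmd c2 t) (r1, m1) (steps xs c2 (sem xs c1 s) * X ^ K2) (r2, m2)"
    "rep_mem xs m2 (snd (sem xs c2 (sem xs c1 s)))" "env ((*) 2) t xs r2 (fst (sem xs c2 (sem xs c1 s)))"
    "\<forall>j<t. r2 (tmp j) = r1 (tmp j)"
    by (rule cmd_correctD[OF assms(2) X sf'(2) r1(2,3)])
  have "steps xs c1 s * X ^ K1 + steps xs c2 (sem xs c1 s) * X ^ K2 \<le> steps xs (Sq c1 c2) s * X ^ (K1 + K2)"
    using X by (auto simp: add_mult_distrib intro!: add_mono mult_le_mono power_increasing)
  with exec_le_Seq[OF r1(1) r2(1)]
  have "exec_le (compile_cmd (Sq c1 c2) t) (r, m) (steps xs (Sq c1 c2) s * X ^ (K1 + K2)) (r2, m2)"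
    unfolding compile_cmd.simps by (rule exec_le_mono)
  then show "\<exists>r' m'. exec_le (compile_cmd (Sq c1 c2) t) (r, m)
      (steps xs (Sq c1 c2) s * X ^ (K1 + K2)) (r', m') \<and>
      rep_mem xs m' (snd (sem xs (Sq c1 c2) s)) \<and> env ((*) 2) t xs r' (fst (sem xs (Sq c1 c2) s)) \<and>
      (\<forall>j<t. r' (tmp j) = r (tmp j))"
    using r1 r2 by (intro exI[of _ r2] exI[of _ m2]) simp
qed

lemma cmd_correct_When:
  assumes "exp_correct S c0 e d" "cmd_correct S c0 c K"
  shows "cmd_correct S c0 (When e c) (d + K + 4)"
  unfolding cmd_correct_def
proof (intro allI impI, elim conjE)
  fix X xs t r m and s :: state
  assume X: "2 \<le> (X :: nat)" and sf: "safe xs (bounded (X ^ c0) S xs) (When e c) s"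
    and rep: "rep_mem xs m (snd s)" and env: "env ((*) 2) t xs r (fst s)"
  have bd: "bounded (X ^ c0) S xs s" using sf by simp
  define v where "v = eval xs (snd s) e (fst s)"
  obtain r1 where r1: "bits v \<le> X ^ d"
    "exec_le (compile_exp e ((*) 2) t) (r, m) (X ^ d) (r1, m)" "r1 (tmp t) = v"
    "same_below t r r1"
    using exp_correctD'[OF assms(1) X bd rep env] v_def by metis
  have env1: "env ((*) 2) t xs r1 (fst s)" by (rule env_same[OF env r1(4)])
  define Y where "Y = X ^ (d + K + 4)"
  have Y: "X ^ d + (1 + X ^ d + 1) \<le> Y" "X ^ K \<le> Y"
  proof -
    have "4 * X ^ d \<le> X ^ (d + 4)" using X by (rule mult_le_power)
    moreover have "X ^ (d + 4) \<le> Y" unfolding Y_def using X by (intro power_increasing) auto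
    moreover have "1 \<le> X ^ d" using X by simp
    ultimately show "X ^ d + (1 + X ^ d + 1) \<le> Y" by linarith
  qed (use X in \<open>simp add: Y_def power_increasing\<close>)
  have "\<exists>r' m'. exec_le (compile_cmd (When e c) t) (r, m) (steps xs (When e c) s * Y) (r', m') \<and>
      rep_mem xs m' (snd (sem xs (When e c) s)) \<and> env ((*) 2) t xs r' (fst (sem xs (When e c) s)) \<and>
      (\<forall>j<t. r' (tmp j) = r (tmp j))"
  proof (cases "v = 0")
    case True
    have "exec_le (Const (tmp t) 0) (r1, m) 1 (r1(tmp t := 0), m)"
      using bits_le[of 0] by (intro exec_le_Const) simp
    then have "exec_le (compile_cmd (When e c) t) (r, m) (X ^ d + (1 + bits (r1 (tmp t)) + 1)) (r1(tmp t := 0), m)"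
      unfolding compile_cmd.simps using True r1(3) by (intro exec_le_Seq[OF r1(2)] exec_le_If(2)) auto
    then have "exec_le (compile_cmd (When e c) t) (r, m) Y (r1(tmp t := 0), m)"
      unfolding r1(3) using r1(1) Y by (elim exec_le_mono) linarith
    moreover have "env ((*) 2) t xs (r1(tmp t := 0)) (fst s)"
      using env1 same_below_upd[of t t] by (rule env_same) simp
    ultimately show ?thesis using True rep same_below_tmp[OF r1(4)] unfolding v_def
      by (intro exI[of _ "r1(tmp t := 0)"] exI[of _ m]) simp
  next
    case False
    then have sf': "safe xs (bounded (X ^ c0) S xs) c s" using sf by (simp add: v_def)
    obtain r2 m2 where r2: "exec_le (compile_cmd c t) (r1, m) (steps xs c s * X ^ K) (r2, m2)"
      "rep_mem xs m2 (snd (sem xs c s))" "env ((*) 2) t xs r2 (fst (sem xs c s))"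
      "\<forall>j<t. r2 (tmp j) = r1 (tmp j)"
      by (rule cmd_correctD[OF assms(2) X sf' rep env1])
    have "exec_le (compile_cmd (When e c) t) (r, m) (X ^ d + (1 + bits (r1 (tmp t)) + steps xs c s * X ^ K)) (r2, m2)"
      unfolding compile_cmd.simps using False r1(3) by (intro exec_le_Seq[OF r1(2)] exec_le_If(1) r2(1)) auto
    moreover have "steps xs c s * X ^ K \<le> steps xs c s * Y" using Y(2) by simp
    then have "X ^ d + (1 + bits (r1 (tmp t)) + steps xs c s * X ^ K) \<le> (1 + steps xs c s) * Y"
      using r1(1) Y(1) unfolding add_mult_distrib r1(3) by linarith
    ultimately have "exec_le (compile_cmd (When e c) t) (r, m) ((1 + steps xs c s) * Y) (r2, m2)"
      by (rule exec_le_mono)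
    then show ?thesis using False r2 same_below_tmp[OF r1(4)] unfolding v_def
      by (intro exI[of _ r2] exI[of _ m2]) simp
  qed
  then show "\<exists>r' m'. exec_le (compile_cmd (When e c) t) (r, m)
      (steps xs (When e c) s * X ^ (d + K + 4)) (r', m') \<and>
      rep_mem xs m' (snd (sem xs (When e c) s)) \<and> env ((*) 2) t xs r' (fst (sem xs (When e c) s)) \<and>
      (\<forall>j<t. r' (tmp j) = r (tmp j))" unfolding Y_def .
qed

text \<open>In contrast to \<open>Big\<close>, the number of iterations need not be small: only its
  bit length enters the overhead, because the iterations are counted by \<open>steps\<close>. Loops
  over table rows therefore have to be commands.\<close>

lemma cmd_correct_For:
  assumes "exp_correct S c0 e d" "cmd_correct S c0 c K"
  shows "cmd_correct S c0 (For i e c) (d + K + 15)"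
  unfolding cmd_correct_def
proof (intro allI impI, elim conjE)
  fix X xs t r m and s :: state
  assume X: "2 \<le> (X :: nat)" and sf: "safe xs (bounded (X ^ c0) S xs) (For i e c) s"
    and rep: "rep_mem xs m (snd s)" and env: "env ((*) 2) t xs r (fst s)"
  have bd: "bounded (X ^ c0) S xs s" using sf by simp
  define n where "n = eval xs (snd s) e (fst s)"
  obtain r1 where r1: "bits n \<le> X ^ d"
    "exec_le (compile_exp e ((*) 2) t) (r, m) (X ^ d) (r1, m)" "r1 (tmp t) = n"
    "same_below t r r1"
    using exp_correctD'[OF assms(1) X bd rep env] n_def by metis
  define st where "st k = fold (\<lambda>k s. sem xs c ((fst s)(i := k), snd s)) [0..<k] s" for k
  define sk where "sk k = ((fst (st k))(i := k), snd (st k))" for k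
  have sfk: "safe xs (bounded (X ^ c0) S xs) c (sk k)" if "k < n" for k
    using sf that by (simp add: n_def[symmetric] st_def[symmetric] sk_def Let_def)
  have stS: "st (Suc k) = sem xs c (sk k)" for k by (simp add: st_def sk_def)
  have steps: "steps xs (For i e c) s = 1 + (\<Sum>k\<in>{0..<n}. 1 + steps xs c (sk k))"
    by (simp add: n_def[symmetric] st_def[symmetric] sk_def Let_def lessThan_atLeast0)
  have sem: "sem xs (For i e c) s = st n" by (simp add: st_def n_def)
  define Z where "Z = X ^ d"
  define Y where "Y = X ^ (d + K + 15)"
  have Z: "1 \<le> Z" "15 * Z \<le> Y" "X ^ K \<le> Y"
  proof -
    have "15 * Z \<le> X ^ (d + 15)" unfolding Z_def using X by (rule mult_le_power)
    also have "\<dots> \<le> Y" unfolding Y_def using X by (intro power_increasing) auto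
    finally show "15 * Z \<le> Y" .
  qed (use X in \<open>auto simp: Z_def Y_def power_increasing\<close>)
  have bn: "bits k \<le> Z" if "k \<le> n" for k using bits_mono[OF that] r1(1) unfolding Z_def by linarith
  have b1: "bits 1 \<le> 1" and b0: "bits 0 = 0" using bits_le[of 1] bits_le[of 0] by auto
  define W where "W = While (tmp t)
         (Seq (Const (2 * i) 0) (Seq (Arith Add (2 * i) (2 * i) (tmp (t + 1)))
         (Seq (compile_cmd c (t + 2))
         (Seq (Const (tmp (t + 2)) 1)
         (Seq (Arith Add (tmp (t + 1)) (tmp (t + 1)) (tmp (t + 2)))
              (Arith Sub (tmp t) (tmp t) (tmp (t + 2))))))))"
  have loop: "k \<le> n \<Longrightarrow> \<forall>rk mk. rk (tmp t) = n - k \<and> rk (tmp (t + 1)) = k \<and> rep_mem xs mk (snd (st k)) \<and>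
      env ((*) 2) t xs rk (fst (st k)) \<and> (\<forall>j<t. rk (tmp j) = r (tmp j)) \<longrightarrow>
      (\<exists>r' m'. exec_le W (rk, mk) ((\<Sum>k\<in>{k..<n}. 1 + steps xs c (sk k)) * Y + 1) (r', m') \<and>
      rep_mem xs m' (snd (st n)) \<and> env ((*) 2) t xs r' (fst (st n)) \<and> (\<forall>j<t. r' (tmp j) = r (tmp j)))" for k
  proof (induction k rule: inc_induct)
    case base
    show ?case
    proof (intro allI impI, elim conjE)
      fix rk mk assume rk: "rk (tmp t) = n - n" "rep_mem xs mk (snd (st n))"
        "env ((*) 2) t xs rk (fst (st n))" "\<forall>j<t. rk (tmp j) = r (tmp j)"
      have "exec_le W (rk, mk) 1 (rk, mk)"
        unfolding W_def by (rule exec_le_While_False) (use rk(1) in simp_all)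
      with rk show "\<exists>r' m'. exec_le W (rk, mk) ((\<Sum>k\<in>{n..<n}. 1 + steps xs c (sk k)) * Y + 1) (r', m') \<and>
          rep_mem xs m' (snd (st n)) \<and> env ((*) 2) t xs r' (fst (st n)) \<and> (\<forall>j<t. r' (tmp j) = r (tmp j))"
        by (intro exI[of _ rk] exI[of _ mk]) simp
    qed
  next
    case (step k)
    show ?case
    proof (intro allI impI, elim conjE)
      fix rk mk assume rk: "rk (tmp t) = n - k" "rk (tmp (t + 1)) = k" "rep_mem xs mk (snd (st k))"
        "env ((*) 2) t xs rk (fst (st k))" "\<forall>j<t. rk (tmp j) = r (tmp j)"
      have kn: "k \<le> n" "n - k \<le> n" using step(2) by auto
      let ?r2 = "rk(2 * i := k)"
      have env2: "env ((*) 2) (t + 2) xs ?r2 (fst (sk k))"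
        unfolding sk_def fst_conv using env_mono[OF rk(4), of "t + 2"] by (intro env_assign) simp
      have rep2: "rep_mem xs mk (snd (sk k))" using rk(3) by (simp add: sk_def)
      obtain r3 m3 where r3: "exec_le (compile_cmd c (t + 2)) (?r2, mk) (steps xs c (sk k) * X ^ K) (r3, m3)"
        "rep_mem xs m3 (snd (st (Suc k)))" "env ((*) 2) (t + 2) xs r3 (fst (st (Suc k)))"
        "\<forall>j<t + 2. r3 (tmp j) = ?r2 (tmp j)"
        unfolding stS by (rule cmd_correctD[OF assms(2) X sfk[OF step(2)] rep2 env2])
      have r3v: "r3 (tmp t) = n - k" "r3 (tmp (t + 1)) = k" using r3(4) rk by simp_all
      let ?r4 = "r3(tmp (t + 2) := 1)"
      let ?r5 = "?r4(tmp (t + 1) := Suc k)" let ?r6 = "?r5(tmp t := n - Suc k)"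
      have iter: "exec_le (Seq (Const (2 * i) 0) (Seq (Arith Add (2 * i) (2 * i) (tmp (t + 1)))
         (Seq (compile_cmd c (t + 2))
         (Seq (Const (tmp (t + 2)) 1)
         (Seq (Arith Add (tmp (t + 1)) (tmp (t + 1)) (tmp (t + 2)))
              (Arith Sub (tmp t) (tmp t) (tmp (t + 2)))))))) (rk, mk)
          (1 + ((1 + Z) + (steps xs c (sk k) * X ^ K + (2 + ((2 + Z) + (2 + Z)))))) (?r6, m3)"
      proof (intro exec_le_Seq)
        show "exec_le (Const (2 * i) 0) (rk, mk) 1 (rk(2 * i := 0), mk)" using b0 by (intro exec_le_Const) simp
        show "exec_le (Arith Add (2 * i) (2 * i) (tmp (t + 1))) (rk(2 * i := 0), mk) (1 + Z) (?r2, mk)"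
          using exec_le_Arith[of "rk(2 * i := 0)" "2 * i" "tmp (t + 1)" "1 + Z" Add "2 * i" mk]
            bn[OF kn(1)] rk(2) b0 by simp
        show "exec_le (compile_cmd c (t + 2)) (?r2, mk) (steps xs c (sk k) * X ^ K) (r3, m3)" by (rule r3)
        show "exec_le (Const (tmp (t + 2)) 1) (r3, m3) 2 (?r4, m3)" using b1 by (intro exec_le_Const) simp
        show "exec_le (Arith Add (tmp (t + 1)) (tmp (t + 1)) (tmp (t + 2))) (?r4, m3) (2 + Z) (?r5, m3)"
          using exec_le_Arith[of ?r4 "tmp (t + 1)" "tmp (t + 2)" "2 + Z" Add "tmp (t + 1)" m3]
            bn[OF kn(1)] b1 r3v by simp
        show "exec_le (Arith Sub (tmp t) (tmp t) (tmp (t + 2))) (?r5, m3) (2 + Z) (?r6, m3)"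
          using exec_le_Arith[of ?r5 "tmp t" "tmp (t + 2)" "2 + Z" Sub "tmp t" m3]
            bn[OF kn(2)] b1 r3v by simp
      qed
      have vals: "?r6 (tmp t) = n - Suc k" "?r6 (tmp (t + 1)) = Suc k" by simp_all
      have len: "r3 1 = length xs" "1 \<le> t" using r3(3) env by (auto simp: env_def)
      have "env ((*) 2) t xs ?r6 (fst (st (Suc k)))"
        using r3(3) len unfolding env_def by auto
      moreover have "\<forall>j<t. ?r6 (tmp j) = r (tmp j)" using r3(4) rk(5) by auto
      ultimately obtain r' m' where r': "exec_le W (?r6, m3) ((\<Sum>k\<in>{Suc k..<n}. 1 + steps xs c (sk k)) * Y + 1) (r', m')"
          "rep_mem xs m' (snd (st n))" "env ((*) 2) t xs r' (fst (st n))" "\<forall>j<t. r' (tmp j) = r (tmp j)"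
        using step.IH vals r3(2) by blast
      have "rk (tmp t) \<noteq> 0" using rk(1) step(2) by simp
      from exec_le_While_True[OF this iter r'(1)[unfolded W_def]]
      have "exec_le W (rk, mk) (1 + bits (n - k) +
          (1 + ((1 + Z) + (steps xs c (sk k) * X ^ K + (2 + ((2 + Z) + (2 + Z)))))) +
          ((\<Sum>k\<in>{Suc k..<n}. 1 + steps xs c (sk k)) * Y + 1)) (r', m')" unfolding W_def rk(1) .
      moreover have "steps xs c (sk k) * X ^ K \<le> steps xs c (sk k) * Y" using Z(3) by simp
      then have "1 + bits (n - k) + (1 + ((1 + Z) + (steps xs c (sk k) * X ^ K + (2 + ((2 + Z) + (2 + Z))))))
          \<le> Y + steps xs c (sk k) * Y" using bn[OF kn(2)] Z by linarith
      moreover have "(\<Sum>k\<in>{k..<n}. 1 + steps xs c (sk k)) * Y =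
          (Y + steps xs c (sk k) * Y) + (\<Sum>k\<in>{Suc k..<n}. 1 + steps xs c (sk k)) * Y"
        using step(2) by (simp add: sum.atLeast_Suc_lessThan add_mult_distrib)
      ultimately have "exec_le W (rk, mk) ((\<Sum>k\<in>{k..<n}. 1 + steps xs c (sk k)) * Y + 1) (r', m')"
        by (elim exec_le_mono) linarith
      then show "\<exists>r' m'. exec_le W (rk, mk) ((\<Sum>k\<in>{k..<n}. 1 + steps xs c (sk k)) * Y + 1) (r', m') \<and>
          rep_mem xs m' (snd (st n)) \<and> env ((*) 2) t xs r' (fst (st n)) \<and> (\<forall>j<t. r' (tmp j) = r (tmp j))"
        using r' by blast
    qed
  qed
  let ?r2 = "r1(tmp (t + 1) := 0)"
  have "same_below t r ?r2" using r1(4) same_below_upd[of t "t + 1" r1 0] same_below_trans by auto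
  then have "env ((*) 2) t xs ?r2 (fst (st 0))" "\<forall>j<t. ?r2 (tmp j) = r (tmp j)"
    using env_same[OF env] same_below_tmp[of t r ?r2] by (auto simp: st_def)
  moreover have "rep_mem xs m (snd (st 0))" using rep by (simp add: st_def)
  ultimately obtain r' m' where r': "exec_le W (?r2, m) ((\<Sum>k\<in>{0..<n}. 1 + steps xs c (sk k)) * Y + 1) (r', m')"
      "rep_mem xs m' (snd (st n))" "env ((*) 2) t xs r' (fst (st n))" "\<forall>j<t. r' (tmp j) = r (tmp j)"
  proof -
    assume a: "env ((*) 2) t xs ?r2 (fst (st 0))" "\<forall>j<t. ?r2 (tmp j) = r (tmp j)"
      "rep_mem xs m (snd (st 0))"
    have "?r2 (tmp t) = n - 0 \<and> ?r2 (tmp (t + 1)) = 0 \<and> rep_mem xs m (snd (st 0)) \<and>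
        env ((*) 2) t xs ?r2 (fst (st 0)) \<and> (\<forall>j<t. ?r2 (tmp j) = r (tmp j))"
      using a r1(3) by simp
    from loop[of 0, THEN spec, THEN spec, THEN mp, OF _ this] show thesis using that by blast
  qed
  have "exec_le (compile_cmd (For i e c) t) (r, m)
      (X ^ d + (1 + ((\<Sum>k\<in>{0..<n}. 1 + steps xs c (sk k)) * Y + 1))) (r', m')"
    unfolding compile_cmd.simps W_def[symmetric]
  proof (intro exec_le_Seq[OF r1(2)] exec_le_Seq)
    show "exec_le (Const (tmp (t + 1)) 0) (r1, m) 1 (?r2, m)"
      using b0 by (intro exec_le_Const) simp
    show "exec_le W (?r2, m) ((\<Sum>k\<in>{0..<n}. 1 + steps xs c (sk k)) * Y + 1) (r', m')" by (rule r')
  qed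
  moreover have "X ^ d + (1 + ((\<Sum>k\<in>{0..<n}. 1 + steps xs c (sk k)) * Y + 1)) \<le> steps xs (For i e c) s * Y"
    unfolding steps add_mult_distrib using Z unfolding Z_def by linarith
  ultimately have "exec_le (compile_cmd (For i e c) t) (r, m) (steps xs (For i e c) s * Y) (r', m')"
    by (rule exec_le_mono)
  then show "\<exists>r' m'. exec_le (compile_cmd (For i e c) t) (r, m)
      (steps xs (For i e c) s * X ^ (d + K + 15)) (r', m') \<and>
      rep_mem xs m' (snd (sem xs (For i e c) s)) \<and> env ((*) 2) t xs r' (fst (sem xs (For i e c) s)) \<and>
      (\<forall>j<t. r' (tmp j) = r (tmp j))" unfolding sem Y_def using r' by blast
qed

lemma cmd_correct_exists: "wt S c \<Longrightarrow> \<exists>K. cmd_correct S c0 c K"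
proof (induction c)
  case (Assign i e)
  then show ?case by (meson exp_correct_exists cmd_correct_Assign wt.simps)
next
  case (Put g a e)
  then show ?case by (meson exp_correct_exists cmd_correct_Put wt.simps)
next
  case (Sq c1 c2)
  then show ?case by (meson cmd_correct_Sq wt.simps)
next
  case (When e c)
  then show ?case by (meson exp_correct_exists cmd_correct_When wt.simps)
next
  case (For i e c)
  then show ?case by (meson exp_correct_exists cmd_correct_For wt.simps)
qed

definition init_state :: "nat list \<Rightarrow> state" where
  "init_state xs = ((\<lambda>_. 0)(0 := length xs), (\<lambda>_ _. 0))"

text \<open>\<open>K\<close> is chosen before \<open>X\<close> and \<open>xs\<close>. This
  uniformity is what allows the overhead to disappear in f and in the O(1) of the exponent. The
  terms besides \<open>steps\<close> pay for copying the input length.\<close>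

theorem compile_correct:
  assumes "wt S c"
  obtains K where "\<And>X xs. 2 \<le> X \<Longrightarrow> safe xs (bounded (X ^ c0) S xs) c (init_state xs) \<Longrightarrow>
    \<exists>t s. exec (compile c) (initial_config xs) t s \<and> fst s 0 = fst (sem xs c (init_state xs)) 0 \<and>
      t \<le> (steps xs c (init_state xs) + 2 * bits (length xs) + 3) * X ^ K"
proof -
  obtain K where K: "cmd_correct S c0 c K" using cmd_correct_exists[OF assms] by blast
  show thesis
  proof (rule that)
    fix X xs assume X: "2 \<le> (X :: nat)" and sf: "safe xs (bounded (X ^ c0) S xs) c (init_state xs)"
    obtain r m where rm: "initial_config xs = (r, m)" "r = (\<lambda>_. 0)(0 := length xs)"
      "m = (\<lambda>i. if i < length xs then xs ! i else 0)" by (simp add: initial_config_def)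
    let ?r = "r(1 := 0, 1 := length xs)"
    have rep: "rep_mem xs m (snd (init_state xs))" by (simp add: rep_mem_def rm init_state_def)
    have env: "env ((*) 2) 1 xs ?r (fst (init_state xs))"
      by (auto simp: env_def rm init_state_def)
    obtain r' m' where r': "exec_le (compile_cmd c 1) (?r, m) (steps xs c (init_state xs) * X ^ K) (r', m')"
      "env ((*) 2) 1 xs r' (fst (sem xs c (init_state xs)))"
      by (rule cmd_correctD[OF K X sf rep env])
    have "exec_le (compile c) (r, m) (1 + ((1 + bits (length xs)) + steps xs c (init_state xs) * X ^ K)) (r', m')"
      unfolding compile_def
    proof (intro exec_le_Seq)
      show "exec_le (Const 1 0) (r, m) 1 (r(1 := 0), m)"
        using bits_le[of 0] by (intro exec_le_Const) simp
      show "exec_le (Arith Add 1 0 1) (r(1 := 0), m) (1 + bits (length xs)) (?r, m)"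
        using exec_le_Arith[of "r(1 := 0)" 0 1 "1 + bits (length xs)" Add 1 m] bits_le[of 0] by (simp add: rm)
    qed (rule r')
    moreover have "1 + ((1 + bits (length xs)) + steps xs c (init_state xs) * X ^ K) \<le>
        (steps xs c (init_state xs) + 2 * bits (length xs) + 3) * X ^ K"
    proof -
      have "1 \<le> X ^ K" using X by simp
      then have "2 * bits (length xs) + 3 \<le> (2 * bits (length xs) + 3) * X ^ K" by simp
      then show ?thesis unfolding add_mult_distrib by linarith
    qed
    ultimately have "exec_le (compile c) (r, m) ((steps xs c (init_state xs) + 2 * bits (length xs) + 3) * X ^ K) (r', m')"
      by (rule exec_le_mono)
    moreover have "r' 0 = fst (sem xs c (init_state xs)) 0" using r'(2) unfolding env_def by (metis mult_0_right)
    ultimately show "\<exists>t s. exec (compile c) (initial_config xs) t s \<and> fst s 0 = fst (sem xs c (init_state xs)) 0 \<and>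
      t \<le> (steps xs c (init_state xs) + 2 * bits (length xs) + 3) * X ^ K"
      unfolding rm(1) exec_le_def by fastforce
  qed
qed

section \<open>Verification of loop programs\<close>

definition vr :: "state \<Rightarrow> nat \<Rightarrow> nat" where "vr s = fst s"
definition ar :: "state \<Rightarrow> nat \<Rightarrow> nat \<Rightarrow> nat" where "ar s = snd s"
definition setv :: "state \<Rightarrow> nat \<Rightarrow> nat \<Rightarrow> state" where "setv s i x = ((fst s)(i := x), snd s)"
definition seta :: "state \<Rightarrow> nat \<Rightarrow> nat \<Rightarrow> nat \<Rightarrow> state" where
  "seta s g j x = (fst s, (snd s)(g := (snd s g)(j := x)))"

lemma vr_setv [simp]: "vr (setv s i x) j = (if j = i then x else vr s j)"
  and vr_seta [simp]: "vr (seta s g k x) = vr s"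
  and ar_setv [simp]: "ar (setv s i x) = ar s"
  and ar_seta [simp]: "ar (seta s g k x) g' k' = (if g' = g \<and> k' = k then x else ar s g' k')"
  by (auto simp: vr_def ar_def setv_def seta_def)

text \<open>Truth means being nonzero. With truncated subtraction, \<open>1 - e\<close> is negation;
  sums and products act as disjunction and conjunction, and the iterated ones as bounded
  quantifiers. Two numbers are equal iff both truncated differences vanish.\<close>

definition NOT :: "exp \<Rightarrow> exp" where "NOT e = Op Sub (N 1) e"
definition Nz :: "exp \<Rightarrow> exp" where "Nz e = NOT (NOT e)"
definition And :: "exp \<Rightarrow> exp \<Rightarrow> exp" where "And = Op Mult"
definition Or :: "exp \<Rightarrow> exp \<Rightarrow> exp" where "Or = Op Add"
definition Eq :: "exp \<Rightarrow> exp \<Rightarrow> exp" where "Eq a b = NOT (Op Add (Op Sub a b) (Op Sub b a))"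
definition EX' :: "nat \<Rightarrow> exp \<Rightarrow> exp \<Rightarrow> exp" where "EX' = Big Add"
definition ALL' :: "nat \<Rightarrow> exp \<Rightarrow> exp \<Rightarrow> exp" where "ALL' = Big Mult"
definition Mod :: "exp \<Rightarrow> exp \<Rightarrow> exp" where "Mod a b = Op Sub a (Op Mult b (Op Div a b))"

lemmas connective_defs = NOT_def Nz_def And_def Or_def Eq_def EX'_def ALL'_def Mod_def

text \<open>Variable 5 is the reading position in the input. Only its bit length is under control
  here, so it must not count as small.\<close>

locale machine =
  fixes xs :: "nat list" and B :: nat and S :: "nat set"
  assumes bounded_input: "\<And>x. x \<in> set xs \<Longrightarrow> bits x \<le> B" "bits (length xs) \<le> B" "1 \<le> B"
    and S5: "5 \<notin> S"
begin

definition ok :: "state \<Rightarrow> bool" where "ok s \<longleftrightarrow> bounded B S xs s"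

definition ev :: "exp \<Rightarrow> state \<Rightarrow> nat" where "ev e s = eval xs (snd s) e (fst s)"

abbreviation tr :: "exp \<Rightarrow> state \<Rightarrow> bool" where "tr e s \<equiv> ev e s \<noteq> 0"

lemma ev_simps [simp]:
  "ev (N x) s = x"
  "ev (V i) s = vr s i"
  "ev (Arr g e) s = ar s g (ev e s)"
  "ev (Op f a b) s = arith f (ev a s) (ev b s)"
  by (auto simp: ev_def vr_def ar_def)

lemma ev_In: "ev e s < length xs \<Longrightarrow> ev (In e) s = xs ! ev e s"
  by (auto simp: ev_def inp_def)

lemma ev_Sum [simp]: "ev (Big Add i a b) s = (\<Sum>k<ev a s. ev b (setv s i k))"
proof -
  have "fold (\<lambda>k acc. acc + g k) [0..<n] 0 = (\<Sum>k<n. g k)" for g :: "nat \<Rightarrow> nat" and n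
    by (induction n) auto
  then show ?thesis by (simp add: ev_def setv_def)
qed

lemma ev_Prod [simp]: "ev (Big Mult i a b) s = (\<Prod>k<ev a s. ev b (setv s i k))"
proof -
  have "fold (\<lambda>k acc. acc * g k) [0..<n] 1 = (\<Prod>k<n. g k)" for g :: "nat \<Rightarrow> nat" and n
    by (induction n) auto
  then show ?thesis by (simp add: ev_def setv_def)
qed

lemma ev_Not [simp]: "ev (NOT e) s = of_bool (\<not> tr e s)" by (simp add: NOT_def)
lemma ev_Nz [simp]: "ev (Nz e) s = of_bool (tr e s)" by (simp add: Nz_def)
lemma tr_And [simp]: "(0 < ev (And a b) s) = (tr a s \<and> tr b s)" "(ev (And a b) s = 0) = (\<not> (tr a s \<and> tr b s))"
  by (auto simp: And_def)
lemma tr_Or [simp]: "(0 < ev (Or a b) s) = (tr a s \<or> tr b s)" "(ev (Or a b) s = 0) = (\<not> (tr a s \<or> tr b s))"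
  by (auto simp: Or_def)
lemma ev_Eq [simp]: "ev (Eq a b) s = of_bool (ev a s = ev b s)" by (auto simp: Eq_def)
lemma sum_pos_iff: "(\<Sum>k<n. g k) > 0 \<longleftrightarrow> (\<exists>k<n. g k \<noteq> (0::nat))" for n :: nat
  by (induction n) (auto simp: less_Suc_eq)

lemma tr_Ex [simp]: "(0 < ev (EX' i n b) s) = (\<exists>k<ev n s. tr b (setv s i k))"
    "(ev (EX' i n b) s = 0) = (\<forall>k<ev n s. \<not> tr b (setv s i k))"
  by (auto simp: EX'_def sum_pos_iff)
lemma tr_All [simp]: "(0 < ev (ALL' i n b) s) = (\<forall>k<ev n s. tr b (setv s i k))"
    "(ev (ALL' i n b) s = 0) = (\<exists>k<ev n s. \<not> tr b (setv s i k))"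
  by (auto simp: ALL'_def)
lemma ev_Mod [simp]: "ev (Mod a b) s = ev a s mod ev b s"
  by (simp add: Mod_def minus_mult_div_eq_mod)

lemma ok_setv: "ok s \<Longrightarrow> x < 2 ^ B \<Longrightarrow> (i \<in> S \<Longrightarrow> x \<le> B) \<Longrightarrow> ok (setv s i x)"
  using bits_leI[of x B] by (auto simp: ok_def bounded_def bounded_vars_def setv_def)

lemma ok_seta: "ok s \<Longrightarrow> x < 2 ^ B \<Longrightarrow> ok (seta s g j x)"
  using bits_leI[of x B] by (auto simp: ok_def bounded_def bounded_mem_def seta_def)

lemma ok_setv_small: "ok s \<Longrightarrow> x \<le> B \<Longrightarrow> ok (setv s i x)"
  by (rule ok_setv) (auto intro: le_less_trans)

lemma ok_seta_bool: "ok s \<Longrightarrow> ok (seta s g j (of_bool P))"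
  using bounded_input(3) one_less_power[of "2 :: nat" B] by (intro ok_seta) auto

text \<open>Safety, step count and postcondition share one judgement, so that each piece of the
  program is traversed only once for all three.\<close>

definition runs :: "cmd \<Rightarrow> state \<Rightarrow> nat \<Rightarrow> (state \<Rightarrow> bool) \<Rightarrow> bool" where
  "runs c s n Q \<longleftrightarrow> safe xs ok c s \<and> steps xs c s \<le> n \<and> Q (sem xs c s)"

lemma runs_Assign:
  "ok s \<Longrightarrow> ok (setv s i (ev e s)) \<Longrightarrow> Q (setv s i (ev e s)) \<Longrightarrow> runs (Assign i e) s 1 Q"
  by (simp add: runs_def setv_def ev_def)

lemma runs_Put:
  "ok s \<Longrightarrow> ok (seta s g (ev a s) (ev e s)) \<Longrightarrow> Q (seta s g (ev a s) (ev e s)) \<Longrightarrow> runs (Put g a e) s 1 Q"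
  by (simp add: runs_def seta_def ev_def)

lemma runs_Sq: "runs c1 s n1 R \<Longrightarrow> (\<And>s'. R s' \<Longrightarrow> runs c2 s' n2 Q) \<Longrightarrow> runs (Sq c1 c2) s (n1 + n2) Q"
  by (simp add: runs_def add_mono)

lemma runs_When:
  "ok s \<Longrightarrow> (tr e s \<Longrightarrow> runs c s n Q) \<Longrightarrow> (\<not> tr e s \<Longrightarrow> Q s) \<Longrightarrow> runs (When e c) s (1 + n) Q"
  by (auto simp: runs_def ev_def)

lemma runs_mono: "runs c s n R \<Longrightarrow> n \<le> n' \<Longrightarrow> (\<And>s'. R s' \<Longrightarrow> Q s') \<Longrightarrow> runs c s n' Q"
  by (auto simp: runs_def)

lemma runs_For:
  assumes "ok s" "ev e s = n" "I 0 s"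
    "\<And>k s'. k < n \<Longrightarrow> I k s' \<Longrightarrow> ok s' \<and> runs c (setv s' i k) b (I (Suc k))"
    "\<And>s'. I n s' \<Longrightarrow> Q s'"
  shows "runs (For i e c) s (1 + n * (1 + b)) Q"
proof -
  define st where "st k = fold (\<lambda>k s. sem xs c ((fst s)(i := k), snd s)) [0..<k] s" for k
  have stS: "st (Suc k) = sem xs c (setv (st k) i k)" for k by (simp add: st_def setv_def)
  have I: "k \<le> n \<Longrightarrow> I k (st k)" for k
  proof (induction k)
    case 0 then show ?case using assms(3) by (simp add: st_def)
  next
    case (Suc k) then show ?case using assms(4)[of k "st k"] by (simp add: stS runs_def)
  qed
  have *: "ok (st k) \<and> runs c (setv (st k) i k) b (I (Suc k))" if "k < n" for k
    using assms(4)[OF that] I[of k] that by simp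
  have n: "eval xs (snd s) e (fst s) = n" using assms(2) by (simp add: ev_def)
  have "safe xs ok (For i e c) s"
    using * assms(1) by (simp add: n st_def[symmetric] Let_def runs_def setv_def)
  moreover have "steps xs (For i e c) s = 1 + (\<Sum>k<n. 1 + steps xs c (setv (st k) i k))"
    by (simp add: n st_def[symmetric] Let_def setv_def)
  moreover have "(\<Sum>k<n. 1 + steps xs c (setv (st k) i k)) \<le> (\<Sum>k<n. 1 + b)"
    using * by (intro sum_mono) (auto simp: runs_def)
  moreover have "sem xs (For i e c) s = st n" by (simp add: n st_def)
  ultimately show ?thesis using I[of n] assms(5) by (simp add: runs_def)
qed

end

fun seq :: "cmd list \<Rightarrow> cmd" where
  "seq [c] = c"
| "seq (c # cs) = Sq c (seq cs)"
| "seq [] = Assign 63 (N 0)"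

abbreviation Plus (infixl \<open>\<oplus>\<close> 65) where "a \<oplus> b \<equiv> Op Add a b"
abbreviation Minus (infixl \<open>\<ominus>\<close> 65) where "a \<ominus> b \<equiv> Op Sub a b"
abbreviation Times (infixl \<open>\<otimes>\<close> 70) where "a \<otimes> b \<equiv> Op Mult a b"
abbreviation Quot (infixl \<open>\<oslash>\<close> 70) where "a \<oslash> b \<equiv> Op Div a b"

section \<open>Reading the adjacency lists\<close>

text \<open>The arrays are zero at the start, so only the arcs need to be written to obtain the
  adjacency matrix. Variable 5 is left behind the encoding just read, where the second digraph
  begins.\<close>

definition parse :: "nat \<Rightarrow> nat \<Rightarrow> cmd" where
  "parse g nv = seq
    [Assign nv (In (V 5)),
     Assign 5 (V 5 \<oplus> N 1),
     For 7 (V nv) (seq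
       [Assign 6 (In (V 5)),
        Assign 5 (V 5 \<oplus> N 1),
        For 8 (V 6) (Put g (V 7 \<otimes> V nv \<oplus> In (V 5 \<oplus> V 8)) (N 1)),
        Assign 5 (V 5 \<oplus> V 6)])]"

definition blocks :: "(nat \<Rightarrow> nat list) \<Rightarrow> nat \<Rightarrow> nat list" where
  "blocks nb k = concat (map (\<lambda>u. length (nb u) # nb u) [0..<k])"

lemma blocks_Suc: "blocks nb (Suc k) = blocks nb k @ length (nb k) # nb k"
  by (simp add: blocks_def)

lemma blocks_prefix: "k < n \<Longrightarrow> \<exists>ys. blocks nb n = blocks nb k @ length (nb k) # nb k @ ys"
proof (induction n)
  case (Suc n)
  then show ?case by (cases "k = n") (auto simp: blocks_Suc)
qed simp

lemma mult_add_eq_iff: "y < n \<Longrightarrow> y' < n \<Longrightarrow> a * n + y = b * n + y' \<longleftrightarrow> a = b \<and> y = (y' :: nat)"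
proof
  assume y: "y < n" "y' < n" and eq: "a * n + y = b * n + y'"
  have "a = (a * n + y) div n" "b = (b * n + y') div n" using y by simp_all
  then show "a = b \<and> y = y'" using eq by simp
qed simp

context machine
begin

lemma runs_parse:
  assumes xs: "xs = pre @ (n # blocks nb n) @ post"
    and nb: "\<And>u. u < n \<Longrightarrow> set (nb u) \<subseteq> {..<n} \<and> length (nb u) \<le> n"
    and s: "ok s" "vr s 5 = length pre" "\<And>j. ar s g j = 0"
    and n: "n \<le> B" and nv: "nv < 3"
  shows "runs (parse g nv) s (3 + n * (6 + 2 * n)) (\<lambda>s'. ok s' \<and> vr s' nv = n \<and>
     vr s' 5 = length pre + Suc (length (blocks nb n)) \<and>
     (\<forall>u v. u < n \<longrightarrow> v < n \<longrightarrow> ar s' g (u * n + v) = of_bool (v \<in> set (nb u))) \<and>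
     (\<forall>i. i \<notin> {nv, 5, 6, 7, 8} \<longrightarrow> vr s' i = vr s i) \<and> (\<forall>g'. g' \<noteq> g \<longrightarrow> ar s' g' = ar s g'))"
proof -
  have pos: "x < 2 ^ B" if "x \<le> length xs" for x
    using bits_less[of "length xs"] that bounded_input(2)
    by (meson le_less_trans less_le_trans one_le_numeral power_increasing)
  have small: "x < 2 ^ B" if "x \<le> n" for x using that n less_exp[of B] by linarith
  have nv': "nv \<noteq> 5" "nv \<noteq> 6" "nv \<noteq> 7" "nv \<noteq> 8" using nv by auto
  have xn: "xs ! length pre = n" "length pre < length xs" by (simp_all add: xs nth_append)
  define fr where "fr s' \<longleftrightarrow> (\<forall>i. i \<notin> {nv, 5, 6, 7, 8} \<longrightarrow> vr s' i = vr s i) \<and> (\<forall>g'. g' \<noteq> g \<longrightarrow> ar s' g' = ar s g')" for s'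
  define I where "I k s' \<longleftrightarrow> ok s' \<and> vr s' nv = n \<and> vr s' 5 = length pre + Suc (length (blocks nb k)) \<and>
     (\<forall>u v. u < n \<longrightarrow> v < n \<longrightarrow> ar s' g (u * n + v) = of_bool (u < k \<and> v \<in> set (nb u))) \<and> fr s'" for k s'
  define J where "J k l s' \<longleftrightarrow> ok s' \<and> vr s' nv = n \<and> vr s' 5 = length pre + Suc (Suc (length (blocks nb k))) \<and>
     vr s' 6 = length (nb k) \<and> vr s' 7 = k \<and>
     (\<forall>u v. u < n \<longrightarrow> v < n \<longrightarrow> ar s' g (u * n + v) =
       of_bool (u < k \<and> v \<in> set (nb u) \<or> u = k \<and> v \<in> set (take l (nb k)))) \<and> fr s'" for k l s'
  have inner: "runs (For 8 (V 6) (Put g (V 7 \<otimes> V nv \<oplus> In (V 5 \<oplus> V 8)) (N 1))) s' (1 + n * (1 + 1)) (J k (length (nb k)))"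
    if k: "k < n" and J: "J k 0 s'" for k s'
  proof -
    obtain ys where ys: "blocks nb n = blocks nb k @ length (nb k) # nb k @ ys"
      using blocks_prefix[OF k] by blast
    have "runs (For 8 (V 6) (Put g (V 7 \<otimes> V nv \<oplus> In (V 5 \<oplus> V 8)) (N 1))) s' (1 + length (nb k) * (1 + 1)) (J k (length (nb k)))"
    proof (rule runs_For[where I = "J k"])
      fix l s2 assume l: "l < length (nb k)" and J: "J k l s2"
      have ok: "ok s2" using J by (simp add: J_def)
      let ?s = "setv s2 8 l"
      have "length (nb k) \<le> n" using nb[OF k] by simp
      then have oks: "ok ?s" using l n by (intro ok_setv_small ok) linarith
      have lt: "length pre + Suc (Suc (length (blocks nb k))) + l < length xs"
        using l by (simp add: xs ys)
      have nth: "xs ! (length pre + Suc (Suc (length (blocks nb k))) + l) = nb k ! l"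
        using l by (simp add: xs ys nth_append)
      have "ev (In (V 5 \<oplus> V 8)) ?s = nb k ! l"
        using J lt nth by (subst ev_In) (simp_all add: J_def)
      then have addr: "ev (V 7 \<otimes> V nv \<oplus> In (V 5 \<oplus> V 8)) ?s = k * n + nb k ! l"
        using J nv' by (simp add: J_def)
      have v: "nb k ! l < n" using nb[OF k] l nth_mem by blast
      have "J k (Suc l) (seta ?s g (k * n + nb k ! l) 1)"
        using J v k l nv' ok_seta_bool[OF oks, of g _ True] unfolding J_def fr_def
        by (auto simp: mult_add_eq_iff take_Suc_conv_app_nth)
      then show "ok s2 \<and> runs (Put g (V 7 \<otimes> V nv \<oplus> In (V 5 \<oplus> V 8)) (N 1)) ?s 1 (J k (Suc l))"
        using ok oks ok_seta_bool[OF oks, of g _ True] addr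
        by (intro conjI runs_Put) (simp_all del: ev_simps(4))
    qed (use J in \<open>auto simp: J_def\<close>)
    then show ?thesis by (rule runs_mono) (use nb[OF k] in auto)
  qed
  have body: "runs (seq [Assign 6 (In (V 5)), Assign 5 (V 5 \<oplus> N 1),
        For 8 (V 6) (Put g (V 7 \<otimes> V nv \<oplus> In (V 5 \<oplus> V 8)) (N 1)),
        Assign 5 (V 5 \<oplus> V 6)]) (setv s' 7 k) (1 + (1 + ((1 + n * (1 + 1)) + 1))) (I (Suc k))"
    if k: "k < n" and I: "I k s'" for k s'
  proof -
    obtain ys where ys: "blocks nb n = blocks nb k @ length (nb k) # nb k @ ys"
      using blocks_prefix[OF k] by blast
    have len: "length pre + Suc (length (blocks nb k)) < length xs"
      "length pre + Suc (Suc (length (blocks nb k))) \<le> length xs"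
      "length pre + Suc (Suc (length (blocks nb k))) + length (nb k) \<le> length xs"
      by (simp_all add: xs ys)
    have nth: "xs ! (length pre + Suc (length (blocks nb k))) = length (nb k)"
      by (simp add: xs ys nth_append)
    have ok: "ok s'" using I by (simp add: I_def)
    let ?s1 = "setv s' 7 k" let ?s2 = "setv ?s1 6 (length (nb k))"
    let ?s3 = "setv ?s2 5 (length pre + Suc (Suc (length (blocks nb k))))"
    have e: "ev (In (V 5)) ?s1 = length (nb k)"
      using I len nth by (subst ev_In) (simp_all add: I_def)
    have ok1: "ok ?s1" using k n by (intro ok_setv_small ok) simp
    have ok2: "ok ?s2" using nb[OF k] n by (intro ok_setv_small ok1) simp
    have ok3: "ok ?s3" using len by (intro ok_setv ok2 pos) (auto intro: order_trans[OF _ ] simp: S5)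
    have J: "J k 0 ?s3" using I ok3 nv' unfolding I_def J_def fr_def by auto
    show ?thesis unfolding seq.simps
    proof (intro runs_Sq)
      show "runs (Assign 6 (In (V 5))) ?s1 1 (\<lambda>s''. s'' = ?s2)"
        using ok1 ok2 e by (intro runs_Assign) simp_all
      fix s'' assume "s'' = ?s2"
      then show "runs (Assign 5 (V 5 \<oplus> N 1)) s'' 1 (\<lambda>s''. s'' = ?s3)"
        using ok2 ok3 I by (intro runs_Assign) (simp_all add: I_def)
    next
      fix s'' assume "s'' = ?s3"
      then show "runs (For 8 (V 6) (Put g (V 7 \<otimes> V nv \<oplus> In (V 5 \<oplus> V 8)) (N 1))) s'' (1 + n * (1 + 1)) (J k (length (nb k)))"
        using inner[OF k J] by simp
    next
      fix s'' assume J: "J k (length (nb k)) s''"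
      have okS: "ok (setv s'' 5 (length pre + Suc (length (blocks nb (Suc k)))))"
        using J len by (intro ok_setv pos) (auto simp: J_def blocks_Suc S5)
      then have IS: "I (Suc k) (setv s'' 5 (length pre + Suc (length (blocks nb (Suc k)))))"
        using J nv' unfolding I_def J_def fr_def by (auto simp: less_Suc_eq)
      have e: "ev (V 5 \<oplus> V 6) s'' = length pre + Suc (length (blocks nb (Suc k)))"
        using J by (simp add: J_def blocks_Suc)
      have "ok s''" using J by (simp add: J_def)
      then show "runs (Assign 5 (V 5 \<oplus> V 6)) s'' 1 (I (Suc k))"
        by (rule runs_Assign; unfold e) (rule okS IS)+
    qed
  qed
  have "runs (parse g nv) s (1 + (1 + (1 + n * (1 + (1 + (1 + ((1 + n * (1 + 1)) + 1))))))) (I n)"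
    unfolding parse_def seq.simps(1,2)
  proof (intro runs_Sq)
    have e: "ev (In (V 5)) s = n" using s xn by (subst ev_In) simp_all
    have ok1: "ok (setv s nv n)" using n by (intro ok_setv_small s)
    then show "runs (Assign nv (In (V 5))) s 1 (\<lambda>s'. s' = setv s nv n)"
      using s e by (intro runs_Assign) simp_all
    have ok2: "ok (setv (setv s nv n) 5 (length pre + 1))"
      using xn by (intro ok_setv ok1 pos) (auto simp: S5)
    fix s' assume s': "s' = setv s nv n"
    show "runs (Assign 5 (V 5 \<oplus> N 1)) s' 1 (I 0)"
      using ok1 ok2 s nv' unfolding s' by (intro runs_Assign) (auto simp: I_def fr_def blocks_def)
  next
    fix s' assume I: "I 0 s'"
    show "runs (For 7 (V nv) (Sq (Assign 6 (In (V 5))) (Sq (Assign 5 (V 5 \<oplus> N 1))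
        (Sq (For 8 (V 6) (Put g (V 7 \<otimes> V nv \<oplus> In (V 5 \<oplus> V 8)) (N 1)))
        (Assign 5 (V 5 \<oplus> V 6)))))) s' (1 + n * (1 + (1 + (1 + ((1 + n * (1 + 1)) + 1))))) (I n)"
      using I body by (intro runs_For[where I = I]) (auto simp: I_def)
  qed
  then show ?thesis by (rule runs_mono) (auto simp: I_def fr_def algebra_simps)
qed

end

section \<open>Bounded reachability\<close>

text \<open>The same recursion serves two purposes. In \<open>H\<close>, a length bound that is at
  least the number of arcs makes it full reachability (\<open>reach_rtrancl\<close>). In
  \<open>G\<close>, the bound keeps the set reachable from one vertex small
  (\<open>card_ball\<close>).\<close>

primrec reach :: "nat \<Rightarrow> (nat \<Rightarrow> nat \<Rightarrow> bool) \<Rightarrow> nat \<Rightarrow> nat \<Rightarrow> nat \<Rightarrow> bool" where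
  "reach n E 0 x y = (x = y)"
| "reach n E (Suc j) x y = (reach n E j x y \<or> (\<exists>z<n. reach n E j x z \<and> E z y))"

text \<open>Every length gets a layer of its own in the array, so that a round reads one layer while
  writing the next. Only the last layer is consulted afterwards.\<close>

definition closure :: "nat \<Rightarrow> nat \<Rightarrow> nat \<Rightarrow> cmd" where
  "closure gE gD nv = seq
    [For 7 (V nv) (For 8 (V nv) (Put gD (V 7 \<otimes> V nv \<oplus> V 8) (Eq (V 7) (V 8)))),
     For 9 (V 4) (For 7 (V nv) (For 8 (V nv)
       (Put gD (((V 9 \<oplus> N 1) \<otimes> V nv \<oplus> V 7) \<otimes> V nv \<oplus> V 8)
         (Nz (Or (Arr gD ((V 9 \<otimes> V nv \<oplus> V 7) \<otimes> V nv \<oplus> V 8))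
           (EX' 40 (V nv) (And (Arr gD ((V 9 \<otimes> V nv \<oplus> V 7) \<otimes> V nv \<oplus> V 40))
             (Arr gE (V 40 \<otimes> V nv \<oplus> V 8)))))))))]"

definition idx :: "nat \<Rightarrow> nat \<Rightarrow> nat \<Rightarrow> nat \<Rightarrow> nat" where
  "idx n j x y = (j * n + x) * n + y"

lemma idx_eq_iff: "x < n \<Longrightarrow> y < n \<Longrightarrow> x' < n \<Longrightarrow> y' < n \<Longrightarrow>
    idx n j x y = idx n j' x' y' \<longleftrightarrow> j = j' \<and> x = x' \<and> y = y'"
  by (auto simp: idx_def mult_add_eq_iff)

context machine
begin

lemma runs_closure:
  assumes s: "ok s" "vr s nv = n" "vr s 4 = L"
    and E: "\<And>u v. u < n \<Longrightarrow> v < n \<Longrightarrow> ar s gE (u * n + v) = of_bool (E u v)"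
    and n: "n \<le> B" "L \<le> B" and nv: "nv < 3" and g: "gE \<noteq> gD"
  shows "runs (closure gE gD nv) s (2 + n * (2 + 2 * n) + L * (2 + n * (2 + 2 * n))) (\<lambda>s'. ok s' \<and>
     (\<forall>x y. x < n \<longrightarrow> y < n \<longrightarrow> ar s' gD (idx n L x y) = of_bool (reach n E L x y)) \<and>
     (\<forall>i. i \<notin> {7, 8, 9} \<longrightarrow> vr s' i = vr s i) \<and> (\<forall>g'. g' \<noteq> gD \<longrightarrow> ar s' g' = ar s g'))"
proof -
  have nv': "nv \<noteq> 7" "nv \<noteq> 8" "nv \<noteq> 9" "nv \<noteq> 40" using nv by auto
  define fr where "fr s' \<longleftrightarrow> ok s' \<and> (\<forall>i. i \<notin> {7, 8, 9} \<longrightarrow> vr s' i = vr s i) \<and> (\<forall>g'. g' \<noteq> gD \<longrightarrow> ar s' g' = ar s g')" for s'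
  have frD: "ok s'" "vr s' nv = n" "vr s' 4 = L" "ar s' gE = ar s gE" if "fr s'" for s'
    using that nv' s g by (auto simp: fr_def)
  have fr_setv: "fr (setv s' i k)" if "fr s'" "i \<in> {7, 8, 9}" "k < n \<or> k < L" for s' i k
    using that n ok_setv_small[of s' k i] by (auto simp: fr_def)
  have fr_seta: "fr (seta s' gD a (of_bool P))" if "fr s'" for s' a P
    using that ok_seta_bool[of s'] by (auto simp: fr_def fun_eq_iff)
  define filled where "filled s' j x y \<longleftrightarrow> (x < n \<longrightarrow> y < n \<longrightarrow> ar s' gD (idx n j x y) = of_bool (reach n E j x y))" for s' j x y
  have filled_setv: "filled (setv s' i k) = filled s'" for s' i k by (simp add: filled_def fun_eq_iff)
  have filled_seta: "filled (seta s' gD (idx n j x y) (of_bool (reach n E j x y))) j' x' y' \<longleftrightarrow>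
      (j' = j \<and> x' = x \<and> y' = y) \<or> filled s' j' x' y'" if "x < n" "y < n" for s' j x y j' x' y'
    using that by (auto simp: filled_def idx_eq_iff)
  define IJ where "IJ j s' \<longleftrightarrow> fr s' \<and> (\<forall>j'<j. \<forall>x y. filled s' j' x y)" for j s'
  define IX where "IX j x s' \<longleftrightarrow> IJ j s' \<and> (\<forall>x'<x. \<forall>y. filled s' j x' y)" for j x s'
  define IY where "IY j x y s' \<longleftrightarrow> IX j x s' \<and> (\<forall>y'<y. filled s' j x y') \<and> vr s' 7 = x" for j x y s'
  \<comment> \<open>The initialisation and each later round fill one layer by the same double loop.
    \<open>P\<close> carries what the value of the written expression depends on besides the layers
    already filled, namely the number of the round.\<close>
  have fill: "runs (For 7 (V nv) (For 8 (V nv) (Put gD a e))) s0 (1 + n * (1 + (1 + n * (1 + 1)))) (IJ (Suc j))"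
    if I0: "IJ j s0" and P: "P s0" and P1: "\<And>s' k. P s' \<Longrightarrow> P (setv s' 7 k) \<and> P (setv s' 8 k)"
      "\<And>s' k z. P s' \<Longrightarrow> P (seta s' gD k z)" and
     val: "\<And>s' x y. IJ j s' \<Longrightarrow> P s' \<Longrightarrow> x < n \<Longrightarrow> y < n \<Longrightarrow> vr s' 7 = x \<Longrightarrow> vr s' 8 = y \<Longrightarrow>
       ev a s' = idx n j x y \<and> ev e s' = of_bool (reach n E j x y)" for j a e s0 P
  proof (rule runs_For[where I = "\<lambda>x s'. IX j x s' \<and> P s'"])
    fix x s' assume x: "x < n" and IX: "IX j x s' \<and> P s'"
    have "runs (For 8 (V nv) (Put gD a e)) (setv s' 7 x) (1 + n * (1 + 1)) (\<lambda>s'. IX j (Suc x) s' \<and> P s')"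
    proof (rule runs_For[where I = "\<lambda>y s'. IY j x y s' \<and> P s'"])
      show "ok (setv s' 7 x)" "ev (V nv) (setv s' 7 x) = n" "IY j x 0 (setv s' 7 x) \<and> P (setv s' 7 x)"
        using IX x fr_setv[of s' 7 x] frD P1 nv' by (auto simp: IX_def IY_def IJ_def filled_setv)
      fix y s'' assume y: "y < n" and IY: "IY j x y s'' \<and> P s''"
      let ?s = "setv s'' 8 y"
      have fr: "fr ?s" using IY y fr_setv[of s'' 8 y] by (auto simp: IX_def IY_def IJ_def)
      have IJ: "IJ j ?s" using IY fr by (auto simp: IX_def IY_def IJ_def filled_setv)
      have 7: "vr ?s 7 = x" using IY by (simp add: IY_def)
      have v: "ev a ?s = idx n j x y" "ev e ?s = of_bool (reach n E j x y)"
        using val[OF IJ _ x y 7] P1 IY by auto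
      have fr2: "fr (seta ?s gD (idx n j x y) (of_bool (reach n E j x y)))" using fr by (rule fr_seta)
      define s3 where "s3 = seta ?s gD (idx n j x y) (of_bool (reach n E j x y))"
      have f3: "filled s3 j' x' y' \<longleftrightarrow> j' = j \<and> x' = x \<and> y' = y \<or> filled s'' j' x' y'" for j' x' y'
        unfolding s3_def filled_seta[OF x y] filled_setv ..
      have 73: "vr s3 7 = x" using 7 by (simp add: s3_def)
      have fr3: "fr s3" using fr2 by (simp add: s3_def)
      have IY3: "IY j x (Suc y) s3"
        using IY fr3 73 unfolding IX_def IY_def IJ_def f3 by (auto simp: less_Suc_eq)
      have P3: "P s3" using P1 IY by (auto simp: s3_def)
      have "runs (Put gD a e) ?s 1 (\<lambda>s'. IY j x (Suc y) s' \<and> P s')"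
        by (rule runs_Put, rule frD(1)[OF fr]) (use frD(1)[OF fr3] IY3 P3 in \<open>simp_all only: v s3_def[symmetric] simp_thms\<close>)
      moreover have "ok s''" using IY frD(1) by (auto simp: IX_def IY_def IJ_def)
      ultimately show "ok s'' \<and> runs (Put gD a e) ?s 1 (\<lambda>s'. IY j x (Suc y) s' \<and> P s')" by simp
    next
      fix s' assume "IY j x n s' \<and> P s'"
      moreover have "filled s' j x y" if "\<not> y < n" for y using that by (simp add: filled_def)
      ultimately show "IX j (Suc x) s' \<and> P s'"
        by (auto simp: IX_def IY_def less_Suc_eq)
    qed
    then show "ok s' \<and> runs (For 8 (V nv) (Put gD a e)) (setv s' 7 x) (1 + n * (1 + 1)) (\<lambda>s'. IX j (Suc x) s' \<and> P s')"
      using IX frD(1) by (auto simp: IX_def IJ_def)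
  next
    fix s' assume "IX j n s' \<and> P s'"
    moreover have "filled s' j x y" if "\<not> x < n" for x y using that by (simp add: filled_def)
    ultimately show "IJ (Suc j) s'" unfolding IX_def IJ_def less_Suc_eq by metis
  qed (use I0 P frD in \<open>auto simp: IX_def IJ_def\<close>)
  have "runs (closure gE gD nv) s ((1 + n * (1 + (1 + n * (1 + 1)))) + (1 + L * (1 + (1 + n * (1 + (1 + n * (1 + 1))))))) (IJ (Suc L))"
    unfolding closure_def seq.simps(1,2)
  proof (rule runs_Sq[where R = "IJ 1"])
    have "IJ 0 s" using s by (simp add: IJ_def fr_def)
    then show "runs (For 7 (V nv) (For 8 (V nv) (Put gD (V 7 \<otimes> V nv \<oplus> V 8) (Eq (V 7) (V 8))))) s
        (1 + n * (1 + (1 + n * (1 + 1)))) (IJ 1)"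
      unfolding One_nat_def[of] by (rule fill[where P = "\<lambda>_. True", unfolded One_nat_def])
        (use frD nv' in \<open>auto simp: IJ_def idx_def\<close>)
    fix s' assume IJ1: "IJ 1 s'"
    show "runs (For 9 (V 4) (For 7 (V nv) (For 8 (V nv)
       (Put gD (((V 9 \<oplus> N 1) \<otimes> V nv \<oplus> V 7) \<otimes> V nv \<oplus> V 8)
         (Nz (Or (Arr gD ((V 9 \<otimes> V nv \<oplus> V 7) \<otimes> V nv \<oplus> V 8))
           (EX' 40 (V nv) (And (Arr gD ((V 9 \<otimes> V nv \<oplus> V 7) \<otimes> V nv \<oplus> V 40))
             (Arr gE (V 40 \<otimes> V nv \<oplus> V 8)))))))))) s' (1 + L * (1 + (1 + n * (1 + (1 + n * (1 + 1)))))) (IJ (Suc L))"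
    proof (rule runs_For[where I = "\<lambda>j. IJ (Suc j)"])
      fix j s' assume j: "j < L" and I: "IJ (Suc j) s'"
      have fr: "fr (setv s' 9 j)" using I j fr_setv[of s' 9 j] by (auto simp: IJ_def)
      have "IJ (Suc j) (setv s' 9 j)" using I fr by (auto simp: IJ_def filled_setv)
      then have "runs (For 7 (V nv) (For 8 (V nv)
       (Put gD (((V 9 \<oplus> N 1) \<otimes> V nv \<oplus> V 7) \<otimes> V nv \<oplus> V 8)
         (Nz (Or (Arr gD ((V 9 \<otimes> V nv \<oplus> V 7) \<otimes> V nv \<oplus> V 8))
           (EX' 40 (V nv) (And (Arr gD ((V 9 \<otimes> V nv \<oplus> V 7) \<otimes> V nv \<oplus> V 40))
             (Arr gE (V 40 \<otimes> V nv \<oplus> V 8))))))))) (setv s' 9 j) (1 + n * (1 + (1 + n * (1 + 1)))) (IJ (Suc (Suc j)))"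
      proof (rule fill[where P = "\<lambda>s'. vr s' 9 = j"])
        fix s' x y assume I: "IJ (Suc j) s'" and v: "vr s' 9 = j" "vr s' 7 = x" "vr s' 8 = y" and xy: "x < n" "y < n"
        have f: "fr s'" and d: "\<And>x y. x < n \<Longrightarrow> y < n \<Longrightarrow> ar s' gD (idx n j x y) = of_bool (reach n E j x y)"
          using I by (auto simp: IJ_def filled_def)
        have e: "\<And>u v. u < n \<Longrightarrow> v < n \<Longrightarrow> ar s' gE (u * n + v) = of_bool (E u v)"
          using frD(4)[OF f] E by simp
        show "ev (((V 9 \<oplus> N 1) \<otimes> V nv \<oplus> V 7) \<otimes> V nv \<oplus> V 8) s' = idx n (Suc j) x y \<and>
          ev (Nz (Or (Arr gD ((V 9 \<otimes> V nv \<oplus> V 7) \<otimes> V nv \<oplus> V 8))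
           (EX' 40 (V nv) (And (Arr gD ((V 9 \<otimes> V nv \<oplus> V 7) \<otimes> V nv \<oplus> V 40))
             (Arr gE (V 40 \<otimes> V nv \<oplus> V 8)))))) s' = of_bool (reach n E (Suc j) x y)"
          using v xy nv' frD(2)[OF f] e d[unfolded idx_def] by (auto simp: idx_def)
      qed auto
      then show "ok s' \<and> runs (For 7 (V nv) (For 8 (V nv)
       (Put gD (((V 9 \<oplus> N 1) \<otimes> V nv \<oplus> V 7) \<otimes> V nv \<oplus> V 8)
         (Nz (Or (Arr gD ((V 9 \<otimes> V nv \<oplus> V 7) \<otimes> V nv \<oplus> V 8))
           (EX' 40 (V nv) (And (Arr gD ((V 9 \<otimes> V nv \<oplus> V 7) \<otimes> V nv \<oplus> V 40))
             (Arr gE (V 40 \<otimes> V nv \<oplus> V 8))))))))) (setv s' 9 j) (1 + n * (1 + (1 + n * (1 + 1)))) (IJ (Suc (Suc j)))"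
        using I frD(1) by (auto simp: IJ_def)
    qed (use IJ1 frD in \<open>auto simp: IJ_def\<close>)
  qed
  then show ?thesis
    by (rule runs_mono) (auto simp: IJ_def fr_def filled_def algebra_simps)
qed

end

section \<open>Counting homomorphisms by elimination\<close>

definition restr :: "(nat \<Rightarrow> nat) \<Rightarrow> nat set \<Rightarrow> nat \<Rightarrow> nat" where
  "restr a X = (\<lambda>u. if u \<in> X then a u else 0)"

text \<open>The default value 0 outside the domain lets assignments with disjoint domains be
  combined by pointwise addition, and it makes the digit of an absent vertex vanish in
  \<open>code\<close>.\<close>

definition asg :: "nat \<Rightarrow> nat set \<Rightarrow> (nat \<Rightarrow> nat) set" where
  "asg n X = {a. (\<forall>u\<in>X. a u < n) \<and> (\<forall>u. u \<notin> X \<longrightarrow> a u = 0)}"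

definition code :: "nat \<Rightarrow> nat \<Rightarrow> (nat \<Rightarrow> nat) \<Rightarrow> nat" where
  "code h n a = (\<Sum>u<h. a u * n ^ u)"

definition decode :: "nat \<Rightarrow> nat \<Rightarrow> nat \<Rightarrow> nat \<Rightarrow> nat" where
  "decode h n c = (\<lambda>u. if u < h then c div n ^ u mod n else 0)"

lemma asg_insert: "v \<notin> X \<Longrightarrow> asg n (insert v X) = (\<lambda>(a, x). a(v := x)) ` (asg n X \<times> {..<n})"
proof (intro equalityI subsetI)
  fix a assume v: "v \<notin> X" and a: "a \<in> asg n (insert v X)"
  have "a = (\<lambda>(a, x). a(v := x)) (a(v := 0), a v)" by simp
  moreover have "(a(v := 0), a v) \<in> asg n X \<times> {..<n}" using a v by (auto simp: asg_def)
  ultimately show "a \<in> (\<lambda>(a, x). a(v := x)) ` (asg n X \<times> {..<n})" by (rule image_eqI)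
qed (auto simp: asg_def split: if_splits)

lemma finite_asg: "finite X \<Longrightarrow> finite (asg n X)"
proof (induction X rule: finite_induct)
  case empty
  have "asg n {} = {\<lambda>_. 0}" by (auto simp: asg_def)
  then show ?case by simp
qed (simp add: asg_insert)

lemma card_asg_le: "finite X \<Longrightarrow> card (asg n X) \<le> n ^ card X"
proof (induction X rule: finite_induct)
  case empty
  have "asg n {} = {\<lambda>_. 0}" by (auto simp: asg_def)
  then show ?case by simp
next
  case (insert v X)
  have "card (asg n (insert v X)) \<le> card (asg n X \<times> {..<n})"
    unfolding asg_insert[OF insert(2)] by (rule card_image_le) (use insert finite_asg in auto)
  also have "\<dots> \<le> n ^ card X * n" using insert by (simp add: card_cartesian_product)
  finally show ?case using insert by (simp add: mult.commute)
qed

text \<open>Decoding does not need the domain: the digits outside it are 0, which is the default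
  value there. The empty target needs care, as no nonempty domain then has an assignment.\<close>

lemma decode_code:
  assumes "X \<subseteq> {..<h}" "a \<in> asg n X"
  shows "decode h n (code h n a) = a"
proof
  fix u
  show "decode h n (code h n a) u = a u"
  proof (cases "u < h \<and> X \<noteq> {}")
    case False
    then show ?thesis using assms by (force simp: asg_def decode_def code_def)
  next
    case True
    then obtain w where "w \<in> X" by blast
    then have n: "0 < n" using assms by (auto simp: asg_def)
    have *: "(\<Sum>u<h. a u * n ^ u) div n ^ v mod n = a v" if "v < h" "\<And>u. a u < n" for v h a
      using that
    proof (induction h arbitrary: v a)
      case (Suc h)
      have s: "(\<Sum>u<Suc h. a u * n ^ u) = a 0 + n * (\<Sum>u<h. a (Suc u) * n ^ u)"
        by (simp add: sum.lessThan_Suc_shift sum_distrib_left mult_ac del: sum.lessThan_Suc)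
      show ?case
      proof (cases v)
        case 0
        then show ?thesis using Suc.prems by (simp add: s del: sum.lessThan_Suc)
      next
        case (Suc v')
        have "(a 0 + n * (\<Sum>u<h. a (Suc u) * n ^ u)) div n ^ Suc v' =
            (\<Sum>u<h. a (Suc u) * n ^ u) div n ^ v'"
          using n Suc.prems(2)[of 0] by (simp add: div_mult2_eq)
        then show ?thesis using Suc.IH[of v' "\<lambda>u. a (Suc u)"] Suc.prems Suc
          by (simp only: s)
      qed
    qed simp
    have "\<And>u. a u < n" using assms n by (auto simp: asg_def)
    then show ?thesis using True * by (simp add: decode_def code_def)
  qed
qed

lemma code_eq_iff:
  assumes "X \<subseteq> {..<h}" "Y \<subseteq> {..<h}" "a \<in> asg n X" "b \<in> asg n Y"
  shows "code h n a = code h n b \<longleftrightarrow> a = b"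
  using assms decode_code by metis

lemma code_less:
  assumes "X \<subseteq> {..<h}" "a \<in> asg n X" "0 < n"
  shows "code h n a < n ^ h"
proof -
  have "(\<Sum>u<k. a u * n ^ u) < n ^ k" for k
  proof (induction k)
    case (Suc k)
    have "a k < n" using assms by (cases "k \<in> X") (auto simp: asg_def)
    have "(\<Sum>u<Suc k. a u * n ^ u) < n ^ k + a k * n ^ k" using Suc by simp
    also have "\<dots> = Suc (a k) * n ^ k" by simp
    also have "\<dots> \<le> n * n ^ k" using \<open>a k < n\<close> by (intro mult_le_mono) auto
    finally show ?case by simp
  qed simp
  then show ?thesis by (simp add: code_def)
qed

lemma code_zero [simp]: "code h n (\<lambda>_. 0) = 0"
  by (simp add: code_def)

lemma code_upd:
  assumes "u < h" "a u = 0"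
  shows "code h n (a(u := x)) = code h n a + x * n ^ u"
proof -
  have "code h n (a(u := x)) = (\<Sum>v<h. a v * n ^ v + (if v = u then x * n ^ u else 0))"
    unfolding code_def using assms by (intro sum.cong) auto
  then show ?thesis using assms by (simp add: sum.distrib code_def)
qed

lemma restr_in_asg: "a \<in> asg n X \<Longrightarrow> Y \<subseteq> X \<Longrightarrow> restr a Y \<in> asg n Y"
  by (auto simp: asg_def restr_def)

lemma restr_restr: "Y \<subseteq> X \<Longrightarrow> restr (restr a X) Y = restr a Y"
  by (intro ext) (auto simp: restr_def)

text \<open>The restrictions to the disjoint sets determine an assignment and can be chosen
  independently; their sum glues them together again. This is where counts multiply over
  components.\<close>

lemma card_asg_Union:
  assumes "finite F" "\<And>C. C \<in> F \<Longrightarrow> finite C" "\<And>C D. C \<in> F \<Longrightarrow> D \<in> F \<Longrightarrow> C \<noteq> D \<Longrightarrow> C \<inter> D = {}"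
  shows "card {a \<in> asg n (\<Union>F). \<forall>C\<in>F. R C (restr a C)} = (\<Prod>C\<in>F. card {a \<in> asg n C. R C a})"
  using assms
proof (induction F rule: finite_induct)
  case empty
  have "asg n {} = {\<lambda>_. 0}" by (auto simp: asg_def)
  then show ?case by simp
next
  case (insert C F)
  let ?A = "{a \<in> asg n C. R C a}" and ?B = "{a \<in> asg n (\<Union>F). \<forall>C\<in>F. R C (restr a C)}"
  let ?D = "{a \<in> asg n (\<Union>(insert C F)). \<forall>C\<in>insert C F. R C (restr a C)}"
  have disj: "C \<inter> D = {}" if "D \<in> F" for D using insert.prems(2)[of C D] insert.hyps that by auto
  have "bij_betw (\<lambda>a. (restr a C, restr a (\<Union>F))) ?D (?A \<times> ?B)"
  proof (rule bij_betwI[where g = "\<lambda>(a, b) u. a u + b u"])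
    show "(\<lambda>a. (restr a C, restr a (\<Union>F))) \<in> ?D \<rightarrow> ?A \<times> ?B"
    proof
      fix a assume a: "a \<in> ?D"
      then have "restr a C \<in> ?A" by (auto intro: restr_in_asg)
      moreover have "restr a (\<Union>F) \<in> ?B"
        using a restr_restr[of _ "\<Union>F" a] by (auto intro: restr_in_asg simp: Sup_upper)
      ultimately show "(restr a C, restr a (\<Union>F)) \<in> ?A \<times> ?B" by blast
    qed
    have CF: "u \<notin> \<Union>F" if "u \<in> C" for u using disj that by blast
    have r1: "restr (\<lambda>u. a u + b u) C = a" if "a \<in> asg n C" "b \<in> asg n (\<Union>F)" for a b
    proof
      fix u
      show "restr (\<lambda>u. a u + b u) C u = a u"
        using that CF[of u] by (cases "u \<in> C") (auto simp: restr_def asg_def)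
    qed
    have r2: "restr (\<lambda>u. a u + b u) D = restr b D" if "a \<in> asg n C" "D \<subseteq> \<Union>F" for a b D
    proof
      fix u
      show "restr (\<lambda>u. a u + b u) D u = restr b D u"
      proof (cases "u \<in> D")
        case True
        then have "u \<notin> C" using that(2) CF by blast
        then have "a u = 0" using that(1) by (auto simp: asg_def)
        then show ?thesis by (simp add: restr_def)
      qed (simp add: restr_def)
    qed
    have r3: "restr b (\<Union>F) = b" if "b \<in> asg n (\<Union>F)" for b
      using that unfolding restr_def asg_def by (intro ext) auto
    show "(\<lambda>(a, b) u. a u + b u) \<in> ?A \<times> ?B \<rightarrow> ?D"
    proof
      fix p assume "p \<in> ?A \<times> ?B"
      then obtain a b where p: "p = (a, b)" and a: "a \<in> asg n C" "R C a" and b: "b \<in> asg n (\<Union>F)" "\<forall>C\<in>F. R C (restr b C)"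
        by auto
      have 1: "R D (restr (\<lambda>u. a u + b u) D)" if "D \<in> insert C F" for D
      proof (cases "D = C")
        case True
        then show ?thesis using r1[OF a(1) b(1)] a(2) by simp
      next
        case False
        then have "D \<in> F" using that by simp
        then show ?thesis using r2[OF a(1), of D b] b(2) by (simp add: Sup_upper)
      qed
      have 2: "(\<lambda>u. a u + b u) \<in> asg n (\<Union>(insert C F))"
        unfolding asg_def mem_Collect_eq
      proof (intro conjI ballI allI impI)
        fix u assume "u \<in> \<Union>(insert C F)"
        then consider "u \<in> C" "u \<notin> \<Union>F" | "u \<notin> C" "u \<in> \<Union>F" using disj by blast
        then show "a u + b u < n" using a(1) b(1) by cases (auto simp: asg_def)
      next
        fix u assume "u \<notin> \<Union>(insert C F)"
        then show "a u + b u = 0" using a(1) b(1) by (auto simp: asg_def)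
      qed
      show "(case p of (a, b) \<Rightarrow> \<lambda>u. a u + b u) \<in> ?D" using 1 2 by (simp add: p)
    qed
    show "(case (restr a C, restr a (\<Union>F)) of (a, b) \<Rightarrow> \<lambda>u. a u + b u) = a" if "a \<in> ?D" for a
    proof
      fix u
      have "u \<notin> C \<or> u \<notin> \<Union>F" using disj by blast
      moreover have "a u = 0" if "u \<notin> C" "u \<notin> \<Union>F" using \<open>a \<in> ?D\<close> that by (auto simp: asg_def)
      ultimately show "(case (restr a C, restr a (\<Union>F)) of (a, b) \<Rightarrow> \<lambda>u. a u + b u) u = a u"
        by (auto simp: restr_def)
    qed
    show "(restr (case p of (a, b) \<Rightarrow> \<lambda>u. a u + b u) C, restr (case p of (a, b) \<Rightarrow> \<lambda>u. a u + b u) (\<Union>F)) = p"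
      if "p \<in> ?A \<times> ?B" for p using that r1 r2[of _ "\<Union>F"] r3 by auto
  qed
  then have "card ?D = card (?A \<times> ?B)" by (rule bij_betw_same_card)
  also have "\<dots> = card ?A * (\<Prod>C\<in>F. card {a \<in> asg n C. R C a})"
    using insert by (simp add: card_cartesian_product)
  finally show ?case using insert.hyps by simp
qed

text \<open>The length bound is left open, as elimination is correct for every positive one. It must
  be positive for the ends of an arc of \<open>H\<close> to be adjacent (\<open>edge_adj\<close>);
  only the estimates need a particular value.\<close>

locale homs_instance =
  fixes h n L :: nat and EH EG :: "nat \<Rightarrow> nat \<Rightarrow> bool"
  assumes EH: "\<And>u v. EH u v \<Longrightarrow> u < h \<and> v < h" and EG: "\<And>u v. EG u v \<Longrightarrow> u < n \<and> v < n"
    and L: "0 < h \<Longrightarrow> 0 < L"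
begin

abbreviation rH :: "nat \<Rightarrow> nat \<Rightarrow> bool" where "rH \<equiv> reach h EH L"
abbreviation rG :: "nat \<Rightarrow> nat \<Rightarrow> bool" where "rG \<equiv> reach n EG L"

text \<open>With full reachability this means lying in a common hyperedge, although \<open>s\<close>
  ranges over all vertices and not just over the sources: by \<open>rH_above\<close> the set
  reachable from any vertex is contained in a hyperedge.\<close>

definition adj :: "nat \<Rightarrow> nat \<Rightarrow> bool" where
  "adj u v \<longleftrightarrow> (\<exists>s<h. rH s u \<and> rH s v)"

definition nbr :: "nat set \<Rightarrow> nat set" where
  "nbr C = {v. v < h \<and> v \<notin> C \<and> (\<exists>u<h. u \<in> C \<and> adj u v)}"

text \<open>Necessary for extending to a homomorphism, with \<open>y\<close> the image of
  \<open>s\<close>, because homomorphisms preserve bounded walks. The empty set is exempted so that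
  the empty assignment, the start of every enumeration, is consistent even if \<open>G\<close> has
  no vertices.\<close>

definition cons :: "nat set \<Rightarrow> (nat \<Rightarrow> nat) \<Rightarrow> bool" where
  "cons W a \<longleftrightarrow> W = {} \<or> (\<forall>s<h. \<exists>y<n. \<forall>w\<in>W. rH s w \<longrightarrow> rG y (a w))"

definition edgeok :: "nat set \<Rightarrow> (nat \<Rightarrow> nat) \<Rightarrow> bool" where
  "edgeok W a \<longleftrightarrow> (\<forall>u\<in>W. \<forall>v\<in>W. EH u v \<longrightarrow> EG (a u) (a v))"

definition closed_in :: "nat set \<Rightarrow> nat set \<Rightarrow> bool" where
  "closed_in D X \<longleftrightarrow> (\<forall>u<h. \<forall>v<h. u \<in> D \<longrightarrow> v \<in> X \<longrightarrow> v \<notin> D \<longrightarrow> \<not> adj u v)"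

text \<open>Connected components for \<open>adj\<close> within \<open>X\<close>, described as
  minimal nonempty closed sets. A quantifier over subsets translates directly into a loop over bit
  masks, which paths would not.\<close>

definition comps :: "nat set \<Rightarrow> nat set set" where
  "comps X = {C. C \<noteq> {} \<and> C \<subseteq> X \<and> closed_in C X \<and> (\<forall>D. D \<noteq> {} \<longrightarrow> D \<subset> C \<longrightarrow> \<not> closed_in D X)}"

definition hom :: "(nat \<Rightarrow> nat) \<Rightarrow> bool" where
  "hom a \<longleftrightarrow> (\<forall>u<h. a u < n) \<and> (\<forall>u v. EH u v \<longrightarrow> EG (a u) (a v))"

abbreviation code' where "code' \<equiv> code h n"
abbreviation decode' where "decode' \<equiv> decode h n"

text \<open>Filtering after each added vertex, rather than once at the end, keeps every intermediate
  layer within the cardinality bound for its prefix. The order of the list is the one in which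
  \<open>extend\<close> writes to memory, so the two can be compared by equality.\<close>

primrec lay :: "nat set \<Rightarrow> nat \<Rightarrow> nat list" where
  "lay W 0 = [0]"
| "lay W (Suc u) = (if u \<in> W then filter (\<lambda>c. cons (W \<inter> {..u}) (decode' c))
      (concat (map (\<lambda>c. map (\<lambda>x. c + x * n ^ u) [0..<n]) (lay W u))) else lay W u)"

text \<open>A count \<open>\<tau>\<close> over the extensions to \<open>C\<close> of an assignment to its neighbours may discard
  assignments that do not extend to a homomorphism of the whole graph: the constraint \<open>P\<close> only has
  to lie between being a homomorphism and respecting the arcs that meet \<open>C\<close>.\<close>

definition counts_by :: "nat set \<Rightarrow> (nat \<Rightarrow> nat) \<Rightarrow> ((nat \<Rightarrow> nat) \<Rightarrow> bool) \<Rightarrow> bool" where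
  "counts_by C \<tau> P \<longleftrightarrow> (\<forall>a b. (\<forall>u\<in>C \<union> nbr C. a u = b u) \<longrightarrow> P a = P b) \<and> (\<forall>a. hom a \<longrightarrow> P a) \<and>
     (\<forall>a. P a \<longrightarrow> (\<forall>u v. EH u v \<longrightarrow> u \<in> C \<or> v \<in> C \<longrightarrow> EG (a u) (a v))) \<and>
     (\<forall>b\<in>asg n (nbr C). \<tau> (code' b) = card {a \<in> asg n C. P (\<lambda>u. a u + b u)})"

definition counts :: "nat set \<Rightarrow> (nat \<Rightarrow> nat) \<Rightarrow> bool" where
  "counts C \<tau> \<longleftrightarrow> (\<exists>P. counts_by C \<tau> P)"

lemma counts_byD:
  assumes "counts_by C \<tau> P"
  shows "(\<And>u. u \<in> C \<union> nbr C \<Longrightarrow> a u = b u) \<Longrightarrow> P a = P b" and "hom a \<Longrightarrow> P a"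
    and "P a \<Longrightarrow> EH u v \<Longrightarrow> u \<in> C \<or> v \<in> C \<Longrightarrow> EG (a u) (a v)"
    and "e \<in> asg n (nbr C) \<Longrightarrow> \<tau> (code' e) = card {a \<in> asg n C. P (\<lambda>u. a u + e u)}"
  using assms unfolding counts_by_def by blast+

lemma adj_sym: "adj u v \<Longrightarrow> adj v u"
  by (auto simp: adj_def)

lemma reach_refl: "reach k E j x x"
  by (induction j) auto

lemma reach_edge: "E x y \<Longrightarrow> x < k \<Longrightarrow> 0 < j \<Longrightarrow> reach k E j x y"
  using reach_refl by (cases j) auto

lemma edge_adj: "EH u v \<Longrightarrow> adj u v"
  unfolding adj_def using EH[of u v] L reach_refl reach_edge[of EH u v h L] by auto

lemma reach_hom: "hom a \<Longrightarrow> reach h EH j s w \<Longrightarrow> reach n EG j (a s) (a w)"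
proof (induction j arbitrary: w)
  case (Suc j)
  from Suc.prems(2) consider "reach h EH j s w" | z where "z < h" "reach h EH j s z" "EH z w" by auto
  then show ?case
  proof cases
    case 2
    then show ?thesis using Suc.IH[of z] Suc.prems(1) unfolding hom_def by auto
  qed (use Suc in auto)
qed simp

lemma hom_cons: "hom a \<Longrightarrow> cons W a"
  unfolding cons_def using reach_hom by (metis hom_def)

lemma cons_mono: "cons W a \<Longrightarrow> W' \<subseteq> W \<Longrightarrow> cons W' a"
  unfolding cons_def by blast

lemma cons_cong: "(\<And>u. u \<in> W \<Longrightarrow> a u = b u) \<Longrightarrow> cons W a = cons W b"
  unfolding cons_def by metis

lemma edgeok_cong: "(\<And>u. u \<in> W \<Longrightarrow> a u = b u) \<Longrightarrow> edgeok W a = edgeok W b"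
  unfolding edgeok_def by auto

section \<open>Layers of consistent assignments\<close>

lemma lay_correct:
  assumes "W \<subseteq> {..<h}" "u \<le> h"
  shows "distinct (lay W u) \<and> set (lay W u) = code' ` {a \<in> asg n (W \<inter> {..<u}). cons (W \<inter> {..<u}) a}"
  using assms(2)
proof (induction u)
  case 0
  have "asg n {} = {\<lambda>_. 0}" by (auto simp: asg_def)
  then show ?case by (auto simp: cons_def)
next
  case (Suc u)
  show ?case
  proof (cases "u \<in> W")
    case False
    then have "W \<inter> {..<Suc u} = W \<inter> {..<u}" by (auto simp: less_Suc_eq)
    then show ?thesis using Suc False by simp
  next
    case True
    define W' where "W' = W \<inter> {..<u}"
    have W: "W \<inter> {..<Suc u} = insert u W'" "u \<notin> W'" "W \<inter> {..u} = insert u W'" "W' \<subseteq> {..<h}" "insert u W' \<subseteq> {..<h}"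
      using True assms Suc.prems by (auto simp: W'_def less_Suc_eq)
    have IH: "distinct (lay W u)" "set (lay W u) = code' ` {a \<in> asg n W'. cons W' a}"
      using Suc by (auto simp: W'_def)
    have up: "code' (a(u := x)) = code' a + x * n ^ u" "a(u := x) \<in> asg n (insert u W')"
      if "a \<in> asg n W'" "x < n" for a x
      using that W code_upd[of u h a n x] Suc.prems by (auto simp: asg_def)
    have inj: "a = b \<and> x = y"
      if "a \<in> asg n W'" "x < n" "b \<in> asg n W'" "y < n" "code' a + x * n ^ u = code' b + y * n ^ u" for a b x y
    proof -
      have "a(u := x) = b(u := y)"
        using code_eq_iff[OF W(5,5) up(2)[OF that(1,2)] up(2)[OF that(3,4)]] that up(1) by simp
      then have "x = y" "\<And>v. v \<noteq> u \<Longrightarrow> a v = b v" by (metis fun_upd_same, metis fun_upd_other)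
      moreover have "a u = 0" "b u = 0" using that W by (auto simp: asg_def)
      ultimately show ?thesis by (metis ext)
    qed
    define ls where "ls = concat (map (\<lambda>c. map (\<lambda>x. c + x * n ^ u) [0..<n]) (lay W u))"
    have lay: "lay W (Suc u) = filter (\<lambda>c. cons (insert u W') (decode' c)) ls"
      using True W by (simp add: ls_def)
    have "distinct ls"
      unfolding ls_def
    proof (rule distinct_concat)
      show "distinct (map (\<lambda>c. map (\<lambda>x. c + x * n ^ u) [0..<n]) (lay W u))"
      \<comment> \<open>The rule \<open>distinct_concat\<close> asks for pairwise different rows.
        Without vertices in \<open>G\<close> all rows are empty, so the layer must be seen to have
        at most one element.\<close>
      proof (cases "n = 0")
        case True
        have "lay W u = [] \<or> lay W u = [0]"
        proof (cases "W' = {}")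
          case True
          have "asg n {} = {\<lambda>_. 0}" by (auto simp: asg_def)
          then have "set (lay W u) \<subseteq> {0}" using IH(2) True by auto
          then show ?thesis using IH(1) by (cases "lay W u"; cases "tl (lay W u)") auto
        next
          case False
          then have "asg n W' = {}" using True by (auto simp: asg_def \<open>n = 0\<close>)
          then show ?thesis using IH(2) by simp
        qed
        then show ?thesis by auto
      next
        case False
        have "inj_on (\<lambda>c. map (\<lambda>x. c + x * n ^ u) [0..<n]) (set (lay W u))"
        proof (rule inj_onI)
          fix c d assume "map (\<lambda>x. c + x * n ^ u) [0..<n] = map (\<lambda>x. d + x * n ^ u) [0..<n]"
          then show "c = d" using False by (metis (no_types, lifting) add_diff_cancel_right' atLeastLessThan_iff gr_zeroI le0 map_eq_conv set_upt)
        qed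
        then show ?thesis using IH(1) by (simp add: distinct_map)
      qed
      show "distinct ys" if ys: "ys \<in> set (map (\<lambda>c. map (\<lambda>x. c + x * n ^ u) [0..<n]) (lay W u))" for ys
      proof -
        obtain c where c: "ys = map (\<lambda>x. c + x * n ^ u) [0..<n]" "c \<in> set (lay W u)" using ys by auto
        have "inj_on (\<lambda>x. c + x * n ^ u) {0..<n}" by (rule inj_onI) auto
        then show ?thesis by (simp add: c distinct_map)
      qed
      show "set ys \<inter> set zs = {}"
        if ys: "ys \<in> set (map (\<lambda>c. map (\<lambda>x. c + x * n ^ u) [0..<n]) (lay W u))"
          and zs: "zs \<in> set (map (\<lambda>c. map (\<lambda>x. c + x * n ^ u) [0..<n]) (lay W u))" and neq: "ys \<noteq> zs" for ys zs
      proof (rule ccontr)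
        assume "set ys \<inter> set zs \<noteq> {}"
        then obtain z where z: "z \<in> set ys" "z \<in> set zs" by blast
        obtain a where a: "a \<in> asg n W'" "ys = map (\<lambda>x. code' a + x * n ^ u) [0..<n]" using ys IH(2) by auto
        obtain b where b: "b \<in> asg n W'" "zs = map (\<lambda>x. code' b + x * n ^ u) [0..<n]" using zs IH(2) by auto
        obtain x where x: "x < n" "z = code' a + x * n ^ u" using z(1) a(2) by auto
        obtain y where y: "y < n" "z = code' b + y * n ^ u" using z(2) b(2) by auto
        have "a = b" using inj[OF a(1) x(1) b(1) y(1)] x(2) y(2) by simp
        then show False using neq a(2) b(2) by simp
      qed
    qed
    moreover have "set ls = code' ` {a \<in> asg n (insert u W'). cons W' a}"
    proof -
      have "set ls = (\<lambda>(a, x). code' a + x * n ^ u) ` ({a \<in> asg n W'. cons W' a} \<times> {..<n})"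
        using IH(2) by (force simp: ls_def image_iff)
      also have "\<dots> = (\<lambda>(a, x). code' (a(u := x))) ` ({a \<in> asg n W'. cons W' a} \<times> {..<n})"
        by (rule image_cong[OF refl]) (use up(1) in auto)
      also have "\<dots> = code' ` (\<lambda>(a, x). a(u := x)) ` ({a \<in> asg n W'. cons W' a} \<times> {..<n})"
        by (simp add: image_image split_def)
      also have "(\<lambda>(a, x). a(u := x)) ` ({a \<in> asg n W'. cons W' a} \<times> {..<n}) =
          {a \<in> asg n (insert u W'). cons W' a}"
      proof -
        have c: "cons W' (a(u := x)) = cons W' a" for a x using W(2) by (intro cons_cong) auto
        show ?thesis unfolding asg_insert[OF W(2)] by (force simp: c)
      qed
      finally show ?thesis .
    qed
    then have "set (lay W (Suc u)) = code' ` {a \<in> asg n (insert u W'). cons (insert u W') a}"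
      unfolding lay set_filter using decode_code[OF W(5)] cons_mono[of "insert u W'" _ W'] by (auto; force)
    ultimately show ?thesis unfolding W(1) using lay by simp
  qed
qed

lemma length_lay:
  assumes "W \<subseteq> {..<h}" "u \<le> h"
  shows "length (lay W u) = card {a \<in> asg n (W \<inter> {..<u}). cons (W \<inter> {..<u}) a}"
proof -
  have "length (lay W u) = card (set (lay W u))" using lay_correct[OF assms] distinct_card by metis
  also have "\<dots> = card {a \<in> asg n (W \<inter> {..<u}). cons (W \<inter> {..<u}) a}"
    using lay_correct[OF assms] code_eq_iff[of "W \<inter> {..<u}" h "W \<inter> {..<u}"] assms
    by (auto intro!: card_image inj_onI)
  finally show ?thesis .
qed

section \<open>Components and neighbourhoods\<close>

lemma closed_in_Diff: "closed_in D X \<Longrightarrow> closed_in D' X \<Longrightarrow> D \<subseteq> X \<Longrightarrow> closed_in (D - D') X"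
  unfolding closed_in_def using adj_sym by blast

lemma comps_disjoint: "C \<in> comps X \<Longrightarrow> C' \<in> comps X \<Longrightarrow> C \<noteq> C' \<Longrightarrow> C \<inter> C' = {}"
proof (rule ccontr)
  assume C: "C \<in> comps X" "C' \<in> comps X" "C \<noteq> C'" "C \<inter> C' \<noteq> {}"
  have cl: "closed_in (C \<inter> C') X" using C(1,2) unfolding comps_def closed_in_def by blast
  have min: "\<not> closed_in D X" if "E \<in> comps X" "D \<noteq> {}" "D \<subset> E" for D E
    using that unfolding comps_def by simp
  have "C \<inter> C' \<subset> C \<or> C \<inter> C' \<subset> C'" using C(3) by blast
  then show False using min[OF C(1,4)] min[OF C(2,4)] cl by blast
qed

text \<open>A smallest closed set around \<open>w\<close> is a component: if it had a proper
  nonempty closed part, either that part or its complement, closed by symmetry of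
  \<open>adj\<close>, would be a smaller closed set containing \<open>w\<close>.\<close>

lemma Union_comps:
  assumes "finite X"
  shows "\<Union>(comps X) = X"
proof (intro equalityI subsetI)
  fix w assume w: "w \<in> X"
  have "closed_in X X" by (auto simp: closed_in_def)
  then have ex: "\<exists>D. D \<subseteq> X \<and> closed_in D X \<and> w \<in> D" using w by blast
  define D where "D = arg_min card (\<lambda>D. D \<subseteq> X \<and> closed_in D X \<and> w \<in> D)"
  have D: "D \<subseteq> X \<and> closed_in D X \<and> w \<in> D" unfolding D_def using ex by (metis (mono_tags, lifting) arg_min_natI)
  have min: "card D \<le> card D'" if "D' \<subseteq> X" "closed_in D' X" "w \<in> D'" for D'
    unfolding D_def using that by (intro arg_min_nat_le) auto
  have fin: "finite D" using D assms finite_subset by blast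
  have "\<not> closed_in D' X" if "D' \<noteq> {}" "D' \<subset> D" for D'
  proof
    assume cl: "closed_in D' X"
    have "D' \<subseteq> X" using that(2) D by blast
    show False
    proof (cases "w \<in> D'")
      case True
      have "card D' < card D" using fin that(2) by (rule psubset_card_mono)
      then show False using min[of D'] \<open>D' \<subseteq> X\<close> True cl by simp
    next
      case False
      have "closed_in (D - D') X" using D cl by (intro closed_in_Diff) auto
      moreover have "card (D - D') < card D" using fin that by (intro psubset_card_mono) auto
      ultimately show False using min[of "D - D'"] D False by auto
    qed
  qed
  then have "D \<in> comps X" using D by (auto simp: comps_def)
  then show "w \<in> \<Union>(comps X)" using D by blast
qed (auto simp: comps_def)

lemma finite_comps: "finite X \<Longrightarrow> finite (comps X)"
  by (rule finite_subset[of _ "Pow X"]) (auto simp: comps_def)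

text \<open>A neighbour of \<open>C'\<close> cannot lie in the rest of \<open>C - {v}\<close>, in
  which \<open>C'\<close> is closed. So it is \<open>v\<close> or outside \<open>C\<close>, and the
  table of \<open>C'\<close> is keyed by assignments on a subset of the bag.\<close>

lemma nbr_comps: "C' \<in> comps (C - {v}) \<Longrightarrow> nbr C' \<subseteq> insert v (nbr C)"
  unfolding comps_def closed_in_def nbr_def by blast

lemma nbr_subset: "nbr C \<subseteq> {..<h}" by (auto simp: nbr_def)

text \<open>Fix an assignment \<open>b\<close> of the neighbourhood and sum over the values of
  \<open>v\<close>. The rest of \<open>C\<close> splits into components whose constraints depend
  only on the component and its neighbours inside the bag, hence the product. Rows of the bag that
  are dropped as inconsistent do not extend to homomorphisms, which \<open>counts\<close>
  permits.\<close>

theorem counts_step: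
  assumes C: "C \<subseteq> {..<h}" "v \<in> C" and \<tau>: "\<And>C'. C' \<in> comps (C - {v}) \<Longrightarrow> counts C' (\<tau> C')"
    and \<tau>': "\<And>k. \<tau>' k = (\<Sum>c\<leftarrow>lay (insert v (nbr C)) h.
        if edgeok (insert v (nbr C)) (decode' c) \<and> code' (restr (decode' c) (nbr C)) = k
        then \<Prod>C'\<in>comps (C - {v}). \<tau> C' (code' (restr (decode' c) (nbr C'))) else 0)"
  shows "counts C \<tau>'"
proof -
  define F where "F = comps (C - {v})"
  define W where "W = insert v (nbr C)"
  have "\<forall>C'\<in>F. \<exists>P. counts_by C' (\<tau> C') P"
    using \<tau> unfolding counts_def F_def by blast
  then obtain P where byP: "\<And>C'. C' \<in> F \<Longrightarrow> counts_by C' (\<tau> C') (P C')" by metis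
  note P = counts_byD(1)[OF byP] and Phom = counts_byD(2)[OF byP] and Pedge = counts_byD(3)[OF byP]
    and Pcard = counts_byD(4)[OF byP]
  have finC: "finite C" using C(1) finite_subset by blast
  have F: "\<Union>F = C - {v}" "finite F" unfolding F_def using finC by (auto simp: Union_comps finite_comps)
  have Fsub: "C' \<subseteq> C - {v}" "finite C'" "nbr C' \<subseteq> W" if "C' \<in> F" for C'
  proof -
    show sub: "C' \<subseteq> C - {v}" using F(1) that by blast
    then show "finite C'" using finC by (meson Diff_subset finite_subset order_trans)
    show "nbr C' \<subseteq> W" using that nbr_comps[of C' C v] by (simp add: F_def W_def)
  qed
  have Fdisj: "\<And>D E. D \<in> F \<Longrightarrow> E \<in> F \<Longrightarrow> D \<noteq> E \<Longrightarrow> D \<inter> E = {}" unfolding F_def by (rule comps_disjoint)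
  have W: "W \<subseteq> {..<h}" "W \<subseteq> C \<union> nbr C" "W \<inter> (C - {v}) = {}" "v \<notin> nbr C"
    using C nbr_subset by (auto simp: W_def nbr_def)
  \<comment> \<open>The constraint that witnesses \<open>counts\<close> for \<open>C\<close>: the
    two tests made on the bag together with the constraints that the tables of the components
    already satisfy.\<close>
  define Q where "Q a \<longleftrightarrow> cons W a \<and> edgeok W a \<and> (\<forall>C'\<in>F. P C' a)" for a
  have Q1: "Q a = Q b" if "\<forall>u\<in>C \<union> nbr C. a u = b u" for a b
  proof -
    have "cons W a = cons W b" "edgeok W a = edgeok W b"
      using that W(2) by (auto intro!: cons_cong edgeok_cong)
    moreover have "P C' a = P C' b" if "C' \<in> F" for C'
      using Fsub[OF that] W(2) \<open>\<forall>u\<in>C \<union> nbr C. a u = b u\<close> by (intro P that) auto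
    ultimately show ?thesis unfolding Q_def by simp
  qed
  have Q2: "Q a" if "hom a" for a
    using that hom_cons Phom unfolding Q_def by (auto simp: edgeok_def hom_def)
  \<comment> \<open>An arc meeting \<open>C\<close> either meets a component of
    \<open>C - {v}\<close>, where that component's constraint enforces it, or has one end equal to
    \<open>v\<close>. Its ends being adjacent, the other end then lies in the bag too.\<close>
  have Q3: "EG (a u) (a w)" if "Q a" "EH u w" "u \<in> C \<or> w \<in> C" for a u w
  proof (cases "\<exists>C'\<in>F. u \<in> C' \<or> w \<in> C'")
    case True
    then show ?thesis using Pedge that unfolding Q_def by blast
  next
    case False
    then have "u \<notin> C - {v}" "w \<notin> C - {v}" using F(1) by blast+
    moreover have "adj u w" "adj w u" "u < h" "w < h" using edge_adj adj_sym EH that(2) by blast+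
    ultimately have "u \<in> W" "w \<in> W" using that(3) by (auto simp: W_def nbr_def)
    then show ?thesis using that unfolding Q_def edgeok_def by blast
  qed
  have Q4: "\<tau>' (code' b) = card {a \<in> asg n C. Q (\<lambda>u. a u + b u)}" if b: "b \<in> asg n (nbr C)" for b
  proof -
    let ?e = "\<lambda>x. b(v := x)"
    have e: "?e x \<in> asg n W" if "x < n" for x
      using b that by (auto simp: asg_def W_def)
    define T where "T e = (\<Prod>C'\<in>F. \<tau> C' (code' (restr e (nbr C'))))" for e
    define I where "I = {x. x < n \<and> cons W (?e x) \<and> edgeok W (?e x)}"
    have lay: "distinct (lay W h)" "set (lay W h) = code' ` {a \<in> asg n W. cons W a}"
      using lay_correct[of W h] W(1) by (auto simp: Int_absorb2)
    have inj: "inj_on code' {a \<in> asg n W. cons W a}"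
      using code_eq_iff[OF W(1,1)] by (auto intro: inj_onI)
    have dec: "decode' (code' a) = a" if "a \<in> asg n W" for a using decode_code W(1) that by blast
    have "\<tau>' (code' b) = (\<Sum>c\<in>set (lay W h). if edgeok W (decode' c) \<and> code' (restr (decode' c) (nbr C)) = code' b
        then T (decode' c) else 0)"
      using lay(1) unfolding \<tau>' W_def[symmetric] F_def[symmetric] T_def by (subst sum_list_distinct_conv_sum_set) auto
    also have "\<dots> = (\<Sum>a\<in>{a \<in> asg n W. cons W a}. if edgeok W a \<and> restr a (nbr C) = b then T a else 0)"
      unfolding lay(2) sum.reindex[OF inj] o_def
    proof (rule sum.cong[OF refl])
      fix a assume a: "a \<in> {a \<in> asg n W. cons W a}"
      then have "code' (restr a (nbr C)) = code' b \<longleftrightarrow> restr a (nbr C) = b"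
        using code_eq_iff[OF nbr_subset nbr_subset _ b, of "restr a (nbr C)"] restr_in_asg[of a n W "nbr C"]
        by (auto simp: W_def)
      then show "(if edgeok W (decode' (code' a)) \<and> code' (restr (decode' (code' a)) (nbr C)) = code' b then T (decode' (code' a)) else 0)
         = (if edgeok W a \<and> restr a (nbr C) = b then T a else 0)" using dec a by simp
    qed
    also have "\<dots> = (\<Sum>a\<in>{a \<in> asg n W. cons W a \<and> edgeok W a \<and> restr a (nbr C) = b}. T a)"
      using finite_asg[of W n] finite_subset[OF W(1)] by (subst sum.inter_filter[symmetric]) (auto intro!: sum.cong)
    also have "{a \<in> asg n W. cons W a \<and> edgeok W a \<and> restr a (nbr C) = b} = ?e ` I"
    proof (intro equalityI subsetI)
      fix a assume a: "a \<in> {a \<in> asg n W. cons W a \<and> edgeok W a \<and> restr a (nbr C) = b}"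
      have "a = ?e (a v)"
      proof
        fix u
        show "a u = (?e (a v)) u"
        proof (cases "u = v \<or> u \<in> nbr C")
          case True
          then show ?thesis using a by (auto simp: restr_def)
        next
          case False
          then have "a u = 0" using a by (auto simp: asg_def W_def)
          moreover have "b u = 0" using False b by (auto simp: asg_def)
          ultimately show ?thesis using False by simp
        qed
      qed
      moreover have "a v < n" using a by (auto simp: asg_def W_def)
      ultimately show "a \<in> ?e ` I" using a unfolding I_def by (metis (mono_tags, lifting) image_eqI mem_Collect_eq)
    next
      fix a assume "a \<in> ?e ` I"
      then obtain x where x: "x \<in> I" "a = ?e x" by blast
      have "restr (?e x) (nbr C) = b" using b W(4) unfolding restr_def asg_def by (intro ext) auto
      then show "a \<in> {a \<in> asg n W. cons W a \<and> edgeok W a \<and> restr a (nbr C) = b}"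
        using x e by (simp add: I_def)
    qed
    also have "(\<Sum>a\<in>?e ` I. T a) = (\<Sum>x\<in>I. T (?e x))"
      by (subst sum.reindex) (auto intro!: inj_onI dest: fun_upd_eqD)
    also have "\<dots> = (\<Sum>x\<in>I. card {a \<in> asg n (C - {v}). \<forall>C'\<in>F. P C' (\<lambda>u. a u + (?e x) u)})"
    proof (rule sum.cong[OF refl])
      fix x assume "x \<in> I"
      then have ex: "?e x \<in> asg n W" using e by (simp add: I_def)
      have "T (?e x) = (\<Prod>C'\<in>F. card {a \<in> asg n C'. P C' (\<lambda>u. a u + restr (?e x) (nbr C') u)})"
        unfolding T_def using Fsub(3) restr_in_asg[OF ex] by (intro prod.cong refl Pcard) auto
      also have "\<dots> = card {a \<in> asg n (\<Union>F). \<forall>C'\<in>F. P C' (\<lambda>u. restr a C' u + restr (?e x) (nbr C') u)}"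
        by (rule card_asg_Union[symmetric]) (use F Fsub Fdisj in auto)
      also have "{a \<in> asg n (\<Union>F). \<forall>C'\<in>F. P C' (\<lambda>u. restr a C' u + restr (?e x) (nbr C') u)} =
          {a \<in> asg n (C - {v}). \<forall>C'\<in>F. P C' (\<lambda>u. a u + (?e x) u)}"
      proof -
        have "P C' (\<lambda>u. restr a C' u + restr (?e x) (nbr C') u) = P C' (\<lambda>u. a u + (?e x) u)"
          if C': "C' \<in> F" and a: "a \<in> asg n (C - {v})" for C' a
        proof (rule P[OF C'])
          fix u assume u: "u \<in> C' \<union> nbr C'"
          show "restr a C' u + restr (?e x) (nbr C') u = a u + (?e x) u"
          proof (cases "u \<in> C'")
            case True
            then have "u \<notin> W" using Fsub(1)[OF C'] W(3) by blast
            then have "(?e x) u = 0" using ex by (auto simp: asg_def)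
            then show ?thesis using True by (simp add: restr_def)
          next
            case False
            then have "u \<in> W" "u \<in> nbr C'" using u Fsub(3)[OF C'] by auto
            then have "a u = 0" using a W(3) by (auto simp: asg_def)
            then show ?thesis using False \<open>u \<in> nbr C'\<close> by (simp add: restr_def)
          qed
        qed
        then show ?thesis unfolding F(1) by blast
      qed
      finally show "T (?e x) = card {a \<in> asg n (C - {v}). \<forall>C'\<in>F. P C' (\<lambda>u. a u + (?e x) u)}" .
    qed
    also have "\<dots> = card (SIGMA x:I. {a \<in> asg n (C - {v}). \<forall>C'\<in>F. P C' (\<lambda>u. a u + (?e x) u)})"
      using finite_asg finC by (subst card_SigmaI) (auto simp: I_def)
    also have "\<dots> = card {a \<in> asg n C. Q (\<lambda>u. a u + b u)}"
    proof (rule bij_betw_same_card[of "\<lambda>(x, a). a(v := x)"], rule bij_betwI[where g = "\<lambda>a. (a v, a(v := 0))"])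
      have bv: "b v = 0" using b W(4) by (auto simp: asg_def)
      have eq: "(\<lambda>u. (a(v := x)) u + b u) = (\<lambda>u. a u + (?e x) u)" if "a v = 0" for a x
        using that bv by auto
      have W': "cons W (\<lambda>u. a u + (?e x) u) = cons W (?e x)" "edgeok W (\<lambda>u. a u + (?e x) u) = edgeok W (?e x)"
        if "a \<in> asg n (C - {v})" for a x
        using that W(3) by (auto intro!: cons_cong edgeok_cong simp: asg_def)
      show "(\<lambda>(x, a). a(v := x)) \<in> (SIGMA x:I. {a \<in> asg n (C - {v}). \<forall>C'\<in>F. P C' (\<lambda>u. a u + (?e x) u)}) \<rightarrow> {a \<in> asg n C. Q (\<lambda>u. a u + b u)}"
      proof
        fix p assume "p \<in> (SIGMA x:I. {a \<in> asg n (C - {v}). \<forall>C'\<in>F. P C' (\<lambda>u. a u + (?e x) u)})"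
        then obtain x a where p: "p = (x, a)" and x: "x \<in> I" and a: "a \<in> asg n (C - {v})" and PP: "\<forall>C'\<in>F. P C' (\<lambda>u. a u + (?e x) u)" by blast
        have "a v = 0" using a by (simp add: asg_def)
        from eq[where a = a and x = x, OF this]
        have "Q (\<lambda>u. (a(v := x)) u + b u) = Q (\<lambda>u. a u + (?e x) u)" by (rule arg_cong)
        then have "Q (\<lambda>u. (a(v := x)) u + b u)" unfolding Q_def[of "\<lambda>u. a u + (?e x) u"] W'[OF a] using x PP by (simp add: I_def)
        moreover have "a(v := x) \<in> asg n C" using a x C(2) by (auto simp: asg_def I_def)
        ultimately show "(case p of (x, a) \<Rightarrow> a(v := x)) \<in> {a \<in> asg n C. Q (\<lambda>u. a u + b u)}" by (simp add: p)
      qed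
      show "(\<lambda>a. (a v, a(v := 0))) \<in> {a \<in> asg n C. Q (\<lambda>u. a u + b u)} \<rightarrow> (SIGMA x:I. {a \<in> asg n (C - {v}). \<forall>C'\<in>F. P C' (\<lambda>u. a u + (?e x) u)})"
      proof
        fix a assume a: "a \<in> {a \<in> asg n C. Q (\<lambda>u. a u + b u)}"
        have a0: "a(v := 0) \<in> asg n (C - {v})" using a by (auto simp: asg_def)
        have "(\<lambda>u. a u + b u) = (\<lambda>u. (a(v := 0)) u + (?e (a v)) u)" using bv by auto
        then have "Q (\<lambda>u. (a(v := 0)) u + (?e (a v)) u)" using a by simp
        then have "a v \<in> I" "\<forall>C'\<in>F. P C' (\<lambda>u. (a(v := 0)) u + (?e (a v)) u)"
          using a C(2) unfolding Q_def W'[OF a0] by (auto simp: I_def asg_def)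
        then show "(a v, a(v := 0)) \<in> (SIGMA x:I. {a \<in> asg n (C - {v}). \<forall>C'\<in>F. P C' (\<lambda>u. a u + (?e x) u)})"
          using a0 by blast
      qed
      show "(((case p of (x, a) \<Rightarrow> a(v := x)) v), (case p of (x, a) \<Rightarrow> a(v := x))(v := 0)) = p"
        if "p \<in> (SIGMA x:I. {a \<in> asg n (C - {v}). \<forall>C'\<in>F. P C' (\<lambda>u. a u + (?e x) u)})" for p
        using that by (auto simp: asg_def)
      show "(case (a v, a(v := 0)) of (x, a) \<Rightarrow> a(v := x)) = a" for a by simp
    qed
    finally show ?thesis .
  qed
  have "counts_by C \<tau>' Q" unfolding counts_by_def using Q1 Q2 Q3 Q4 by blast
  then show ?thesis unfolding counts_def by blast
qed

text \<open>A component of the whole vertex set has no neighbours, so its table has the single key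
  0. Every arc lies in a component, whose constraint enforces it, and homomorphisms satisfy all the
  constraints: whatever freedom \<open>counts\<close> left is now gone.\<close>

theorem counts_homs:
  assumes \<tau>: "\<And>C. C \<in> comps {..<h} \<Longrightarrow> counts C (\<tau> C)"
  shows "(\<Prod>C\<in>comps {..<h}. \<tau> C 0) = card {a \<in> asg n {..<h}. hom a}"
proof -
  define F where "F = comps {..<h}"
  have "\<forall>C'\<in>F. \<exists>P. counts_by C' (\<tau> C') P"
    using \<tau> unfolding counts_def F_def by blast
  then obtain P where byP: "\<And>C'. C' \<in> F \<Longrightarrow> counts_by C' (\<tau> C') (P C')" by metis
  note P = counts_byD(1)[OF byP] and Phom = counts_byD(2)[OF byP] and Pedge = counts_byD(3)[OF byP]
    and Pcard = counts_byD(4)[OF byP]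
  have F: "\<Union>F = {..<h}" "finite F" unfolding F_def by (auto simp: Union_comps finite_comps)
  have Fdisj: "\<And>D E. D \<in> F \<Longrightarrow> E \<in> F \<Longrightarrow> D \<noteq> E \<Longrightarrow> D \<inter> E = {}" unfolding F_def by (rule comps_disjoint)
  have nb: "nbr C = {}" if "C \<in> F" for C
    using that unfolding F_def comps_def closed_in_def nbr_def by blast
  have fin: "finite C" if "C \<in> F" for C using F that by (metis Union_upper finite_lessThan finite_subset)
  have "(\<Prod>C\<in>F. \<tau> C 0) = (\<Prod>C\<in>F. card {a \<in> asg n C. P C a})"
  proof (rule prod.cong[OF refl])
    fix C assume C: "C \<in> F"
    have "(\<lambda>_. 0) \<in> asg n (nbr C)" by (simp add: nb[OF C] asg_def)
    from Pcard[OF C this] show "\<tau> C 0 = card {a \<in> asg n C. P C a}" by simp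
  qed
  also have "\<dots> = card {a \<in> asg n (\<Union>F). \<forall>C\<in>F. P C (restr a C)}"
    by (rule card_asg_Union[symmetric]) (use F fin Fdisj in auto)
  also have "{a \<in> asg n (\<Union>F). \<forall>C\<in>F. P C (restr a C)} = {a \<in> asg n {..<h}. hom a}"
  proof -
    have "P C (restr a C) = P C a" if "C \<in> F" for C a
      by (rule P[OF that]) (simp add: nb[OF that] restr_def)
    moreover have "(\<forall>C\<in>F. P C a) \<longleftrightarrow> hom a" if "a \<in> asg n {..<h}" for a
    proof
      assume PP: "\<forall>C\<in>F. P C a"
      have "EG (a u) (a v)" if "EH u v" for u v
      proof -
        have "u \<in> \<Union>F" using EH[OF that] F by auto
        then show ?thesis using Pedge PP that by blast
      qed
      then show "hom a" using \<open>a \<in> asg n {..<h}\<close> by (simp add: hom_def asg_def)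
    qed (use Phom in blast)
    ultimately show ?thesis unfolding F(1) by auto
  qed
  finally show ?thesis unfolding F_def .
qed

text \<open>Limits the size of the table entries, and with it the bit lengths that occur during
  tabulation.\<close>

lemma counts_zero_le:
  assumes "counts C \<tau>" "C \<subseteq> {..<h}" "b \<in> asg n (nbr C)"
  shows "\<tau> (code' b) \<le> n ^ card C"
proof -
  obtain P where "\<tau> (code' b) = card {a \<in> asg n C. P (\<lambda>u. a u + b u)}"
    using assms counts_byD(4) unfolding counts_def by blast
  also have "\<dots> \<le> card (asg n C)"
    using finite_asg[of C n] finite_subset[OF assms(2)] by (intro card_mono) auto
  also have "\<dots> \<le> n ^ card C" by (rule card_asg_le) (use finite_subset[OF assms(2)] in simp)
  finally show ?thesis .
qed

end

section \<open>The counting algorithm\<close>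

text \<open>Sets of vertices of \<open>H\<close> are represented by bit masks, partial assignments by numbers in base
  \<open>n\<close>. Variables 1 to 4 hold \<open>h\<close>, \<open>n\<close>, \<open>2 ^ h\<close> and the length bound for walks; arrays 0 to 3 hold the
  arcs of \<open>H\<close> and \<open>G\<close> and bounded reachability in \<open>G\<close> and \<open>H\<close>; arrays 4, 5 and 6 hold the
  layers of partial assignments, the tables of counts, and the masks whose table is complete.\<close>

definition pow2 :: "nat \<Rightarrow> exp" where "pow2 v = Big Mult 50 (V v) (N 2)"
definition powN :: "nat \<Rightarrow> exp" where "powN u = Big Mult 51 (V u) (V 2)"
definition bitE :: "nat \<Rightarrow> nat \<Rightarrow> exp" where "bitE c v = Mod (V c \<oslash> pow2 v) (N 2)"
definition digE :: "nat \<Rightarrow> nat \<Rightarrow> exp" where "digE a u = Mod (V a \<oslash> powN u) (V 2)"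
definition reachH :: "nat \<Rightarrow> nat \<Rightarrow> exp" where
  "reachH s v = Arr 3 ((V 4 \<otimes> V 1 \<oplus> V s) \<otimes> V 1 \<oplus> V v)"
definition reachG :: "nat \<Rightarrow> exp \<Rightarrow> exp" where
  "reachG y e = Arr 2 ((V 4 \<otimes> V 2 \<oplus> V y) \<otimes> V 2 \<oplus> e)"
definition adjE :: "nat \<Rightarrow> nat \<Rightarrow> exp" where
  "adjE u v = EX' 42 (V 1) (And (reachH 42 u) (reachH 42 v))"
definition nbrE :: "nat \<Rightarrow> nat \<Rightarrow> exp" where
  "nbrE c v = And (NOT (bitE c v)) (EX' 43 (V 1) (And (bitE c 43) (adjE 43 v)))"
definition bagE :: "nat \<Rightarrow> nat \<Rightarrow> nat \<Rightarrow> exp" where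
  "bagE c v u = Or (Eq (V u) (V v)) (nbrE c u)"
text \<open>The test runs over all vertices of both digraphs, yet as an expression it adds nothing
  to the step count. Its inner bound depends on \<open>u\<close>, which therefore has to be a small
  variable.\<close>

definition consE :: "nat \<Rightarrow> nat \<Rightarrow> nat \<Rightarrow> nat \<Rightarrow> exp" where
  "consE c v u a = ALL' 44 (V 1) (EX' 45 (V 2) (ALL' 46 (V u \<oplus> N 1)
     (Or (NOT (And (bagE c v 46) (reachH 44 46))) (reachG 45 (digE a 46)))))"
definition edgeE :: "nat \<Rightarrow> nat \<Rightarrow> nat \<Rightarrow> exp" where
  "edgeE c v a = ALL' 47 (V 1) (ALL' 48 (V 1)
     (Or (NOT (And (And (bagE c v 47) (bagE c v 48)) (Arr 0 (V 47 \<otimes> V 1 \<oplus> V 48))))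
       (Arr 1 (digE a 47 \<otimes> V 2 \<oplus> digE a 48))))"
definition closedE :: "nat \<Rightarrow> nat \<Rightarrow> exp" where
  "closedE d x = ALL' 49 (V 1) (ALL' 52 (V 1)
     (NOT (And (And (bitE d 49) (bitE x 52)) (And (NOT (bitE d 52)) (adjE 49 52)))))"
definition subE :: "nat \<Rightarrow> nat \<Rightarrow> exp" where
  "subE d c = ALL' 53 (V 1) (Or (NOT (bitE d 53)) (bitE c 53))"
definition compE :: "nat \<Rightarrow> nat \<Rightarrow> exp" where
  "compE c x = And (And (V c) (And (subE c x) (closedE c x))) (ALL' 54 (V 3)
     (NOT (And (And (V 54) (And (subE 54 c) (NOT (Eq (V 54) (V c))))) (closedE 54 x))))"
definition restE :: "nat \<Rightarrow> nat \<Rightarrow> exp" where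
  "restE a c = Big Add 55 (V 1) (Nz (nbrE c 55) \<otimes> (digE a 55 \<otimes> powN 55))"
text \<open>The product runs over all masks, with factor 1 for those that are not components. The
  number \<open>2 ^ h\<close> of masks depends on the parameter only, so it may be a small loop
  bound.\<close>

definition prodE :: "nat \<Rightarrow> nat \<Rightarrow> exp" where
  "prodE x a = Big Mult 56 (V 3)
     (NOT (compE 56 x) \<oplus> Nz (compE 56 x) \<otimes> Arr 5 (restE a 56 \<otimes> V 3 \<oplus> V 56))"
definition goodE :: "nat \<Rightarrow> exp" where
  "goodE x = ALL' 57 (V 3) (Or (NOT (compE 57 x)) (Arr 6 (V 57)))"

lemmas exp_defs = pow2_def powN_def bitE_def digE_def reachH_def reachG_def adjE_def nbrE_def
  bagE_def consE_def edgeE_def closedE_def subE_def compE_def restE_def prodE_def goodE_def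

section \<open>Bit masks for subsets of an initial segment\<close>

lemma bij_set_decode: "bij_betw set_decode {..<2 ^ h} (Pow {..<h})"
proof (rule bij_betwI[where g = set_encode])
  have enc: "set_encode X < 2 ^ h" if "X \<subseteq> {..<h}" for X
  proof -
    have "set_encode X \<le> (\<Sum>i<h. 2 ^ i)" unfolding set_encode_def using that by (intro sum_mono2) auto
    also have "\<dots> < 2 ^ h" by (induction h) auto
    finally show ?thesis .
  qed
  then show "set_encode \<in> Pow {..<h} \<rightarrow> {..<2 ^ h}" by auto
  show "set_decode \<in> {..<2 ^ h} \<rightarrow> Pow {..<h}"
  proof (intro funcsetI PowI subsetI)
    fix c v assume c: "c \<in> {..<(2 :: nat) ^ h}" and v: "v \<in> set_decode c"
    have "\<not> h \<le> v"
    proof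
      assume "h \<le> v"
      then have "(2 :: nat) ^ h \<le> 2 ^ v" by (rule power_increasing) simp
      moreover have "c < 2 ^ h" using c by simp
      ultimately have "c < 2 ^ v" by linarith
      then show False using v by (simp add: set_decode_def)
    qed
    then show "v \<in> {..<h}" by simp
  qed
  show "set_encode (set_decode c) = c" for c by simp
  show "set_decode (set_encode X) = X" if "X \<in> Pow {..<h}" for X
    using that finite_subset[of X "{..<h}"] by simp
qed

lemma set_decode_subset: "c < 2 ^ h \<Longrightarrow> set_decode c \<subseteq> {..<h}"
  using bij_betwE[OF bij_set_decode] by blast

lemma set_encode_less: "X \<subseteq> {..<h} \<Longrightarrow> set_encode X < 2 ^ h"
  using bij_betw_apply[OF bij_betw_inv_into[OF bij_set_decode[of h]]]
  by (metis PowI bij_betw_imp_surj_on bij_set_decode imageE lessThan_iff set_decode_inverse)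

lemma set_decode_encode: "X \<subseteq> {..<h} \<Longrightarrow> set_decode (set_encode X) = X"
  by (rule set_encode_inverse) (rule finite_subset, auto)

lemma set_decode_inject: "set_decode c = set_decode d \<longleftrightarrow> c = d"
  by (metis set_decode_inverse)

lemma set_decode_eq_empty: "set_decode c = {} \<longleftrightarrow> c = 0"
  by (metis set_decode_inverse set_encode_empty set_decode_zero)

lemma set_decode_minus: "v \<in> set_decode c \<Longrightarrow> set_decode (c - 2 ^ v) = set_decode c - {v}"
proof -
  assume v: "v \<in> set_decode c"
  have "c = set_encode (insert v (set_decode c - {v}))" using v by (simp add: insert_absorb)
  also have "\<dots> = 2 ^ v + set_encode (set_decode c - {v})" by (subst set_encode_insert) auto
  finally have "c - 2 ^ v = set_encode (set_decode c - {v})" by linarith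
  then show ?thesis by simp
qed

text \<open>Besides the constants of the instance in 1 to 4, these are the vertex to eliminate in 14
  and the current layer in 20, which bound the loops of \<open>pow2 14\<close> and
  \<open>powN 20\<close>.\<close>

definition small_vars :: "nat set" where "small_vars = {1, 2, 3, 4, 14, 20}"

lemma small_vars_iff: "i \<in> small_vars \<longleftrightarrow> i \<in> {1, 2, 3, 4, 14, 20}"
  by (simp add: small_vars_def)

text \<open>The term \<open>2 * (n * h)\<close> is a bit length. Codes are below
  \<open>n ^ h\<close>, hence below or equal to \<open>2 ^ (n * h)\<close>; table addresses and
  positions in array 4 involve at most the square of that, up to a constant. The other inequalities
  are for loop bounds inside expressions.\<close>

locale algorithm = machine xs B small_vars + homs_instance h n L EH EG
  for xs B h n L EH EG +
  assumes B: "2 * (n * h) + 3 \<le> B" "2 ^ h \<le> B" "n \<le> B" "h \<le> B" "L \<le> B"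
begin

definition ctx :: "state \<Rightarrow> bool" where
  "ctx s \<longleftrightarrow> vr s 1 = h \<and> vr s 2 = n \<and> vr s 3 = 2 ^ h \<and> vr s 4 = L \<and>
     (\<forall>u v. u < h \<longrightarrow> v < h \<longrightarrow> ar s 0 (u * h + v) = of_bool (EH u v)) \<and>
     (\<forall>u v. u < n \<longrightarrow> v < n \<longrightarrow> ar s 1 (u * n + v) = of_bool (EG u v)) \<and>
     (\<forall>u v. u < n \<longrightarrow> v < n \<longrightarrow> ar s 2 (idx n L u v) = of_bool (rG u v)) \<and>
     (\<forall>u v. u < h \<longrightarrow> v < h \<longrightarrow> ar s 3 (idx h L u v) = of_bool (rH u v))"

lemma ctx_setv [simp]: "i \<notin> {1, 2, 3, 4} \<Longrightarrow> ctx (setv s i x) = ctx s"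
  by (auto simp: ctx_def)

lemma ctx_seta [simp]: "g \<notin> {0, 1, 2, 3} \<Longrightarrow> ctx (seta s g j x) = ctx s"
  by (auto simp: ctx_def)

lemma ctx_vars: "ctx s \<Longrightarrow> vr s 1 = h" "ctx s \<Longrightarrow> vr s (Suc 0) = h" "ctx s \<Longrightarrow> vr s 2 = n"
    "ctx s \<Longrightarrow> vr s 3 = 2 ^ h" "ctx s \<Longrightarrow> vr s 4 = L"
  by (simp_all add: ctx_def)

abbreviation dec :: "state \<Rightarrow> nat \<Rightarrow> nat set" where "dec s c \<equiv> set_decode (vr s c)"

lemma tr_All': "tr (ALL' i e b) s \<longleftrightarrow> (\<forall>k<ev e s. tr b (setv s i k))" by simp

lemma ev_V_ctx: "ctx s \<Longrightarrow> ev (V 1) s = h" "ctx s \<Longrightarrow> ev (V 2) s = n" "ctx s \<Longrightarrow> ev (V 3) s = 2 ^ h"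
  by (simp_all add: ctx_vars)

section \<open>Meaning of the expressions\<close>

lemma ev_pow2: "ev (pow2 v) s = 2 ^ vr s v" by (simp add: pow2_def)
lemma ev_powN: "ctx s \<Longrightarrow> ev (powN u) s = n ^ vr s u" by (simp add: powN_def ctx_vars)

lemma tr_bitE: "tr (bitE c v) s \<longleftrightarrow> vr s v \<in> dec s c"
  by (simp add: bitE_def ev_pow2 set_decode_def odd_iff_mod_2_eq_one)

lemma ev_digE: "ctx s \<Longrightarrow> vr s u < h \<Longrightarrow> ev (digE a u) s = decode' (vr s a) (vr s u)"
  by (simp add: digE_def ev_powN ctx_vars decode_def)

lemma decode_less: "0 < n \<Longrightarrow> decode' c u < n"
  by (simp add: decode_def)

lemma ev_reachH: "ctx s \<Longrightarrow> vr s u < h \<Longrightarrow> vr s v < h \<Longrightarrow> ev (reachH u v) s = of_bool (rH (vr s u) (vr s v))"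
  unfolding reachH_def by (simp add: ctx_def idx_def)

lemma ev_reachG: "ctx s \<Longrightarrow> vr s y < n \<Longrightarrow> ev e s < n \<Longrightarrow> ev (reachG y e) s = of_bool (rG (vr s y) (ev e s))"
  unfolding reachG_def by (simp add: ctx_def idx_def)

text \<open>The conditions on variable numbers, here and in the following lemmas, prevent capture by
  the variables that the expression binds internally.\<close>

lemma tr_adjE: "ctx s \<Longrightarrow> u \<noteq> 42 \<Longrightarrow> v \<noteq> 42 \<Longrightarrow> vr s u < h \<Longrightarrow> vr s v < h \<Longrightarrow>
    tr (adjE u v) s \<longleftrightarrow> adj (vr s u) (vr s v)"
  by (simp add: adjE_def adj_def ctx_vars ev_reachH)

lemma tr_nbrE: "ctx s \<Longrightarrow> c \<notin> {42, 43} \<Longrightarrow> v \<notin> {42, 43} \<Longrightarrow> vr s v < h \<Longrightarrow>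
    tr (nbrE c v) s \<longleftrightarrow> vr s v \<in> nbr (dec s c)"
  by (simp add: nbrE_def nbr_def ctx_vars tr_bitE tr_adjE del: neq0_conv) blast

lemma tr_bagE: "ctx s \<Longrightarrow> c \<notin> {42, 43} \<Longrightarrow> u \<notin> {42, 43} \<Longrightarrow> vr s u < h \<Longrightarrow>
    tr (bagE c v u) s \<longleftrightarrow> vr s u \<in> insert (vr s v) (nbr (dec s c))"
  by (simp add: bagE_def tr_nbrE del: neq0_conv)

text \<open>The expression has no counterpart to the exemption of the empty set in
  \<open>cons\<close>, hence the assumption that \<open>W\<close> is nonempty. It is met in the
  enumeration, where the vertex just added belongs to the set.\<close>

lemma tr_consE:
  assumes "ctx s" "{c, v, u, a} \<inter> {42, 43, 44, 45, 46} = {}" "vr s u < h"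
    and W: "W = insert (vr s v) (nbr (dec s c)) \<inter> {..vr s u}" "W \<noteq> {}"
  shows "tr (consE c v u a) s \<longleftrightarrow> cons W (decode' (vr s a))"
proof -
  have 1: "tr (Or (NOT (And (bagE c v 46) (reachH 44 46))) (reachG 45 (digE a 46)))
      (setv (setv (setv s 44 r) 45 y) 46 w) \<longleftrightarrow>
      (w \<in> insert (vr s v) (nbr (dec s c)) \<longrightarrow> rH r w \<longrightarrow> rG y (decode' (vr s a) w))"
    if "r < h" "y < n" "w < Suc (vr s u)" for r y w
    using assms(1-3) that decode_less by (simp add: tr_bagE ev_reachH ev_reachG ev_digE del: neq0_conv) blast
  have "tr (consE c v u a) s \<longleftrightarrow> (\<forall>r<h. \<exists>y<n. \<forall>w<Suc (vr s u).
      tr (Or (NOT (And (bagE c v 46) (reachH 44 46))) (reachG 45 (digE a 46)))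
      (setv (setv (setv s 44 r) 45 y) 46 w))"
    using assms(1,2) by (simp add: consE_def ctx_vars)
  also have "\<dots> \<longleftrightarrow> (\<forall>r<h. \<exists>y<n. \<forall>w<Suc (vr s u).
      w \<in> insert (vr s v) (nbr (dec s c)) \<longrightarrow> rH r w \<longrightarrow> rG y (decode' (vr s a) w))"
    by (simp only: 1 cong: imp_cong conj_cong)
  also have "\<dots> \<longleftrightarrow> cons W (decode' (vr s a))"
  proof -
    have "(\<forall>w<Suc (vr s u). w \<in> insert (vr s v) (nbr (dec s c)) \<longrightarrow> Q w) = (\<forall>w\<in>W. Q w)" for Q
      unfolding W(1) by (auto simp: less_Suc_eq_le)
    then show ?thesis using W(2) unfolding cons_def by (simp only:) simp
  qed
  finally show ?thesis .
qed

text \<open>With \<open>n\<close> positive, all decoded digits are vertices of \<open>G\<close>, for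
  which array 1 is known to hold the adjacency matrix.\<close>

lemma tr_edgeE:
  assumes "ctx s" "{c, v, a} \<inter> {42, 43, 47, 48} = {}" "0 < n"
    and W: "W = insert (vr s v) (nbr (dec s c))"
  shows "tr (edgeE c v a) s \<longleftrightarrow> edgeok W (decode' (vr s a))"
proof -
  have 1: "tr (Or (NOT (And (And (bagE c v 47) (bagE c v 48)) (Arr 0 (V 47 \<otimes> V 1 \<oplus> V 48))))
       (Arr 1 (digE a 47 \<otimes> V 2 \<oplus> digE a 48))) (setv (setv s 47 u) 48 w) \<longleftrightarrow>
     (u \<in> W \<longrightarrow> w \<in> W \<longrightarrow> EH u w \<longrightarrow> EG (decode' (vr s a) u) (decode' (vr s a) w))"
    if "u < h" "w < h" for u w
  proof -
    let ?s = "setv (setv s 47 u) 48 w"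
    have d: "ev (digE a 47) ?s = decode' (vr s a) u" "ev (digE a 48) ?s = decode' (vr s a) w"
      using assms(1,2) that by (simp_all add: ev_digE)
    have e: "ar s 0 (u * h + w) = of_bool (EH u w)" "\<And>x y. x < n \<Longrightarrow> y < n \<Longrightarrow> ar s 1 (x * n + y) = of_bool (EG x y)"
      using assms(1) that by (simp_all add: ctx_def)
    have g: "ar s (Suc 0) (decode' (vr s a) u * n + decode' (vr s a) w) = of_bool (EG (decode' (vr s a) u) (decode' (vr s a) w))"
      using e(2)[OF decode_less decode_less] assms(3) by simp
    have t: "tr (bagE c v 47) ?s \<longleftrightarrow> u \<in> W" "tr (bagE c v 48) ?s \<longleftrightarrow> w \<in> W"
      using assms(1,2) that unfolding W by (simp_all add: tr_bagE del: neq0_conv)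
    have "tr (Arr 0 (V 47 \<otimes> V 1 \<oplus> V 48)) ?s \<longleftrightarrow> EH u w"
      "tr (Arr 1 (digE a 47 \<otimes> V 2 \<oplus> digE a 48)) ?s \<longleftrightarrow> EG (decode' (vr s a) u) (decode' (vr s a) w)"
      using e(1) g assms(1) by (simp_all add: d ctx_vars)
    then show ?thesis using t by (simp only: ev_Not tr_And tr_Or of_bool_eq_0_iff not_not) blast
  qed
  have "tr (edgeE c v a) s \<longleftrightarrow> (\<forall>u<h. \<forall>w<h. u \<in> W \<longrightarrow> w \<in> W \<longrightarrow> EH u w \<longrightarrow> EG (decode' (vr s a) u) (decode' (vr s a) w))"
  proof -
    have "ev (V 1) (setv s 47 u) = h" for u using assms(1) by (simp add: ctx_vars)
    then show ?thesis by (simp only: edgeE_def 1 tr_All' ev_V_ctx[OF assms(1)] cong: imp_cong)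
  qed
  then show ?thesis unfolding edgeok_def using EH by blast
qed

lemma tr_closedE:
  assumes "ctx s" "{d, x} \<inter> {42, 49, 52} = {}"
  shows "tr (closedE d x) s \<longleftrightarrow> closed_in (dec s d) (dec s x)"
proof -
  have "tr (NOT (And (And (bitE d 49) (bitE x 52)) (And (NOT (bitE d 52)) (adjE 49 52)))) (setv (setv s 49 u) 52 w)
      \<longleftrightarrow> (u \<in> dec s d \<longrightarrow> w \<in> dec s x \<longrightarrow> w \<notin> dec s d \<longrightarrow> \<not> adj u w)" if "u < h" "w < h" for u w
  proof -
    have "tr (adjE 49 52) (setv (setv s 49 u) 52 w) \<longleftrightarrow> adj u w"
      using assms that by (simp add: tr_adjE del: neq0_conv)
    moreover have "tr (bitE d 49) (setv (setv s 49 u) 52 w) \<longleftrightarrow> u \<in> dec s d"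
      "tr (bitE x 52) (setv (setv s 49 u) 52 w) \<longleftrightarrow> w \<in> dec s x"
      "tr (bitE d 52) (setv (setv s 49 u) 52 w) \<longleftrightarrow> w \<in> dec s d"
      using assms by (simp_all add: tr_bitE del: neq0_conv)
    ultimately show ?thesis by (simp only: ev_Not tr_And of_bool_eq_0_iff not_not) blast
  qed
  moreover have "ev (V 1) (setv s 49 u) = h" for u using assms(1) by (simp add: ctx_vars)
  ultimately show ?thesis
    by (simp only: closedE_def closed_in_def tr_All' ev_V_ctx[OF assms(1)] cong: imp_cong)
qed

lemma tr_subE:
  assumes "ctx s" "{d, c} \<inter> {53} = {}" "vr s d < 2 ^ h"
  shows "tr (subE d c) s \<longleftrightarrow> dec s d \<subseteq> dec s c"
proof -
  have "tr (Or (NOT (bitE d 53)) (bitE c 53)) (setv s 53 u) \<longleftrightarrow> (u \<in> dec s d \<longrightarrow> u \<in> dec s c)" for u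
  proof -
    have "tr (bitE d 53) (setv s 53 u) \<longleftrightarrow> u \<in> dec s d" "tr (bitE c 53) (setv s 53 u) \<longleftrightarrow> u \<in> dec s c"
      using assms by (simp_all add: tr_bitE del: neq0_conv)
    then show ?thesis by (simp only: ev_Not tr_Or of_bool_eq_0_iff not_not) blast
  qed
  then have "tr (subE d c) s \<longleftrightarrow> (\<forall>u<h. u \<in> dec s d \<longrightarrow> u \<in> dec s c)"
    by (simp only: subE_def tr_All' ev_V_ctx[OF assms(1)])
  then show ?thesis using set_decode_subset[OF assms(3)] by blast
qed

lemma tr_compE:
  assumes "ctx s" "{c, x} \<inter> {42, 49, 52, 53, 54} = {}" "vr s c < 2 ^ h"
  shows "tr (compE c x) s \<longleftrightarrow> dec s c \<in> comps (dec s x)"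
proof -
  have 1: "tr (NOT (And (And (V 54) (And (subE 54 c) (NOT (Eq (V 54) (V c))))) (closedE 54 x))) (setv s 54 d) \<longleftrightarrow>
     \<not> (set_decode d \<noteq> {} \<and> set_decode d \<subset> dec s c \<and> closed_in (set_decode d) (dec s x))"
    if "d < 2 ^ h" for d
  proof -
    have "tr (subE 54 c) (setv s 54 d) \<longleftrightarrow> set_decode d \<subseteq> dec s c"
      "tr (closedE 54 x) (setv s 54 d) \<longleftrightarrow> closed_in (set_decode d) (dec s x)"
      "tr (V 54) (setv s 54 d) \<longleftrightarrow> set_decode d \<noteq> {}"
      "tr (Eq (V 54) (V c)) (setv s 54 d) \<longleftrightarrow> set_decode d = dec s c"
      using assms that by (simp_all add: tr_subE tr_closedE set_decode_eq_empty set_decode_inject del: neq0_conv)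
    then show ?thesis by (simp only: ev_Not tr_And of_bool_eq_0_iff not_not) blast
  qed
  have "(\<forall>d<2 ^ h. \<not> (set_decode d \<noteq> {} \<and> set_decode d \<subset> dec s c \<and> closed_in (set_decode d) (dec s x))) \<longleftrightarrow>
     (\<forall>D. D \<noteq> {} \<longrightarrow> D \<subset> dec s c \<longrightarrow> \<not> closed_in D (dec s x))" (is "?l \<longleftrightarrow> ?r")
  proof
    assume l: ?l
    show ?r
    proof (intro allI impI)
      fix D assume D: "D \<noteq> {}" "D \<subset> dec s c"
      then have "D \<subseteq> {..<h}" using set_decode_subset[OF assms(3)] by blast
      from set_encode_less[OF this] set_decode_encode[OF this]
      have "set_encode D < 2 ^ h" "set_decode (set_encode D) = D" .
      then show "\<not> closed_in D (dec s x)" using l D by metis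
    qed
  qed blast
  then have "tr (ALL' 54 (V 3) (NOT (And (And (V 54) (And (subE 54 c) (NOT (Eq (V 54) (V c))))) (closedE 54 x)))) s
      \<longleftrightarrow> (\<forall>D. D \<noteq> {} \<longrightarrow> D \<subset> dec s c \<longrightarrow> \<not> closed_in D (dec s x))"
    by (simp only: 1 tr_All' ev_V_ctx[OF assms(1)] cong: imp_cong)
  moreover have "tr (subE c x) s \<longleftrightarrow> dec s c \<subseteq> dec s x" "tr (closedE c x) s \<longleftrightarrow> closed_in (dec s c) (dec s x)"
    "tr (V c) s \<longleftrightarrow> dec s c \<noteq> {}"
    using assms by (simp_all add: tr_subE tr_closedE set_decode_eq_empty del: neq0_conv)
  ultimately show ?thesis unfolding compE_def comps_def by (simp only: tr_And mem_Collect_eq) blast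
qed

lemma ev_restE:
  assumes "ctx s" "{c, a} \<inter> {42, 43, 55} = {}"
  shows "ev (restE a c) s = code' (restr (decode' (vr s a)) (nbr (dec s c)))"
proof -
  have "ev (Nz (nbrE c 55) \<otimes> (digE a 55 \<otimes> powN 55)) (setv s 55 u) =
      restr (decode' (vr s a)) (nbr (dec s c)) u * n ^ u" if "u < h" for u
  proof -
    have "tr (nbrE c 55) (setv s 55 u) \<longleftrightarrow> u \<in> nbr (dec s c)"
      using assms that by (simp add: tr_nbrE del: neq0_conv)
    then have "ev (Nz (nbrE c 55)) (setv s 55 u) = of_bool (u \<in> nbr (dec s c))" by simp
    then show ?thesis using assms that by (simp add: ev_digE ev_powN restr_def del: ev_Nz)
  qed
  then show ?thesis using assms(1) unfolding restE_def code_def ev_Sum by (auto simp: ctx_vars)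
qed

lemma prod_comps:
  assumes "x < 2 ^ h"
  shows "(\<Prod>c<2 ^ h. if set_decode c \<in> comps (set_decode x) then f (set_decode c) else 1) = (\<Prod>C\<in>comps (set_decode x). f C)"
proof -
  have "(\<Prod>c<2 ^ h. if set_decode c \<in> comps (set_decode x) then f (set_decode c) else 1) =
      (\<Prod>C\<in>Pow {..<h}. if C \<in> comps (set_decode x) then f C else 1)"
    using bij_set_decode by (rule prod.reindex_bij_betw)
  also have "\<dots> = (\<Prod>C\<in>Pow {..<h} \<inter> comps (set_decode x). f C)"
    by (simp add: prod.inter_restrict)
  also have "Pow {..<h} \<inter> comps (set_decode x) = comps (set_decode x)"
  proof -
    have "C \<subseteq> set_decode x" if "C \<in> comps (set_decode x)" for C using that by (simp add: comps_def)
    then show ?thesis using set_decode_subset[OF assms] by blast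
  qed
  finally show ?thesis .
qed

text \<open>The mask is the low digit in base \<open>2 ^ h\<close>, so tables of different sets
  occupy disjoint parts of the array.\<close>

definition table :: "state \<Rightarrow> nat set \<Rightarrow> nat \<Rightarrow> nat" where
  "table s C k = ar s 5 (k * 2 ^ h + set_encode C)"

lemma ev_prodE:
  assumes "ctx s" "{x, a} \<inter> {42, 43, 49, 52, 53, 54, 55, 56} = {}" "vr s x < 2 ^ h"
  shows "ev (prodE x a) s = (\<Prod>C\<in>comps (dec s x). table s C (code' (restr (decode' (vr s a)) (nbr C))))"
proof -
  have "ev (prodE x a) s = (\<Prod>c<2 ^ h. if set_decode c \<in> comps (dec s x)
      then table s (set_decode c) (code' (restr (decode' (vr s a)) (nbr (set_decode c)))) else 1)"
    unfolding prodE_def ev_Prod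
  proof (rule prod.cong)
    show "{..<ev (V 3) s} = {..<2 ^ h}" using assms by (simp add: ctx_vars)
    fix c assume c: "c \<in> {..<2 ^ h :: nat}"
    let ?s = "setv s 56 c"
    have "tr (compE 56 x) ?s \<longleftrightarrow> set_decode c \<in> comps (dec s x)"
      using assms c by (simp add: tr_compE del: neq0_conv)
    moreover have "ev (restE a 56) ?s = code' (restr (decode' (vr s a)) (nbr (set_decode c)))"
      using assms by (simp add: ev_restE)
    ultimately show "ev (NOT (compE 56 x) \<oplus> Nz (compE 56 x) \<otimes> Arr 5 (restE a 56 \<otimes> V 3 \<oplus> V 56)) ?s =
      (if set_decode c \<in> comps (dec s x)
      then table s (set_decode c) (code' (restr (decode' (vr s a)) (nbr (set_decode c)))) else 1)"
      using assms by (simp add: table_def ctx_vars)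
  qed
  then show ?thesis using prod_comps[OF assms(3)] by simp
qed

lemma tr_goodE:
  assumes "ctx s" "x \<notin> {42, 49, 52, 53, 54, 57}" "vr s x < 2 ^ h"
  shows "tr (goodE x) s \<longleftrightarrow> (\<forall>C\<in>comps (dec s x). ar s 6 (set_encode C) \<noteq> 0)"
proof -
  have "tr (Or (NOT (compE 57 x)) (Arr 6 (V 57))) (setv s 57 c) \<longleftrightarrow>
      (set_decode c \<in> comps (dec s x) \<longrightarrow> ar s 6 c \<noteq> 0)" if "c < 2 ^ h" for c
  proof -
    have "tr (compE 57 x) (setv s 57 c) \<longleftrightarrow> set_decode c \<in> comps (dec s x)"
      using assms that by (simp add: tr_compE del: neq0_conv)
    then show ?thesis by simp
  qed
  then have "tr (goodE x) s \<longleftrightarrow> (\<forall>c<2 ^ h. set_decode c \<in> comps (dec s x) \<longrightarrow> ar s 6 c \<noteq> 0)"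
    by (simp only: goodE_def tr_All' ev_V_ctx[OF assms(1)] cong: imp_cong)
  also have "\<dots> \<longleftrightarrow> (\<forall>C\<in>comps (dec s x). ar s 6 (set_encode C) \<noteq> 0)" (is "?l \<longleftrightarrow> ?r")
  proof
    assume l: ?l
    show ?r
    proof
      fix C assume C: "C \<in> comps (dec s x)"
      then have "C \<subseteq> {..<h}" using set_decode_subset[OF assms(3)] by (auto simp: comps_def)
      from set_encode_less[OF this] set_decode_encode[OF this]
      have "set_encode C < 2 ^ h" "set_decode (set_encode C) = C" .
      then show "ar s 6 (set_encode C) \<noteq> 0" using l C by simp
    qed
  next
    assume r: ?r
    show ?l
    proof (intro allI impI)
      fix c assume "set_decode c \<in> comps (dec s x)"
      then have "ar s 6 (set_encode (set_decode c)) \<noteq> 0" using r by blast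
      then show "ar s 6 c \<noteq> 0" by simp
    qed
  qed
  finally show ?thesis .
qed

end

section \<open>Memory segments and the program\<close>

definition segment :: "(nat \<Rightarrow> nat) \<Rightarrow> nat \<Rightarrow> nat \<Rightarrow> nat list" where
  "segment f lo hi = map f [lo..<hi]"

lemma segment_empty [simp]: "segment f a a = []"
  by (simp add: segment_def)

lemma segment_upd: "hi \<le> j \<Longrightarrow> segment (f(j := x)) lo hi = segment f lo hi"
  by (auto simp: segment_def)

lemma segment_snoc: "lo \<le> hi \<Longrightarrow> segment (f(hi := x)) lo (Suc hi) = segment f lo hi @ [x]"
  by (auto simp: segment_def)

lemma length_segment [simp]: "length (segment f lo hi) = hi - lo"
  by (simp add: segment_def)

lemma segment_nth: "i < hi - lo \<Longrightarrow> segment f lo hi ! i = f (lo + i)"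
  by (simp add: segment_def)

text \<open>Consecutive layers lie one behind the other in array 4. The current one occupies the
  positions from variable 16 up to 17, and variable 18 is the growing end of its successor.\<close>

definition extend :: cmd where
  "extend = For 21 (V 17 \<ominus> V 16) (For 22 (V 2) (seq
     [Assign 23 (Arr 4 (V 16 \<oplus> V 21) \<oplus> V 22 \<otimes> powN 20),
      When (consE 13 14 20 23) (seq [Put 4 (V 18) (V 23), Assign 18 (V 18 \<oplus> N 1)])]))"

text \<open>Variable 19 records that all layers so far had at most as many entries as variable 10
  says. The check comes after a layer has been built, which is affordable since its predecessor was
  within the bound. A truncated difference is 0 iff the length does not exceed the bound.\<close>

definition list_bag :: cmd where
  "list_bag = seq
    [Put 4 (N 0) (N 0), Assign 16 (N 0), Assign 17 (N 1), Assign 19 (N 1),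
     For 20 (V 1) (When (And (bagE 13 14 20) (V 19)) (seq
       [Assign 18 (V 17), extend, Assign 16 (V 17), Assign 17 (V 18),
        Assign 19 (NOT ((V 17 \<ominus> V 16) \<ominus> V 10))]))]"

text \<open>Each row of the bag adds its product to the entry of its restriction to the
  neighbourhood. Entries that no row reaches keep the initial 0, which is the correct count.\<close>

definition tabulate :: cmd where
  "tabulate = seq
    [For 21 (V 17 \<ominus> V 16) (seq
       [Assign 23 (Arr 4 (V 16 \<oplus> V 21)),
        When (edgeE 13 14 23) (seq
          [Assign 24 (restE 23 13 \<otimes> V 3 \<oplus> V 13),
           Put 5 (V 24) (Arr 5 (V 24) \<oplus> prodE 15 23)])]),
     Put 6 (V 13) (N 1)]"

text \<open>The guard on array 6 prevents accumulating into a finished table. An abandoned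
  enumeration never reaches \<open>tabulate\<close>, so an unfinished table still consists of zeros
  when a later attempt starts.\<close>

definition attempt :: cmd where
  "attempt = When (And (bitE 13 14) (NOT (Arr 6 (V 13)))) (seq
    [Assign 15 (V 13 \<ominus> pow2 14),
     When (goodE 15) (seq [list_bag, When (V 19) tabulate])])"

text \<open>The bound starts at 1 and is doubled after each round, so it is
  \<open>2 ^ (n * h)\<close> in the last possible round, more than any layer requires. Once variable
  11 is set, the remaining rounds do nothing.\<close>

definition search :: cmd where
  "search = For 12 (V 2 \<otimes> V 1 \<oplus> N 1) (When (NOT (V 11)) (seq
    [For 13 (V 3) (For 14 (V 1) attempt),
     Assign 15 (V 3 \<ominus> N 1), Assign 11 (Nz (goodE 15)), Assign 10 (V 10 \<oplus> V 10)]))"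

text \<open>The length bound \<open>h * h\<close> is at least the number of arcs of
  \<open>H\<close>, which makes reachability in \<open>H\<close> exact. The last three commands
  multiply the entries with key 0 over the components of the full mask \<open>2 ^ h - 1\<close>;
  variable 0 is the output register.\<close>

definition count_homs :: cmd where
  "count_homs = seq
    [Assign 5 (N 0), parse 0 1, parse 1 2, Assign 3 (pow2 1), Assign 4 (V 1 \<otimes> V 1),
     closure 0 3 1, closure 1 2 2, Assign 10 (N 1), search,
     Assign 15 (V 3 \<ominus> N 1), Assign 23 (N 0), Assign 0 (prodE 15 23)]"

lemma wt_count_homs: "wt small_vars count_homs"
  by (simp add: small_vars_def count_homs_def parse_def closure_def search_def attempt_def tabulate_def
    list_bag_def extend_def exp_defs connective_defs)

section \<open>Enumeration of a bag\<close>

context algorithm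
begin

text \<open>Crude, but only the bit length \<open>n * h\<close> of these numbers matters, and it is
  polynomial in the sizes of the two digraphs.\<close>

lemma pow_n_le: "n ^ k \<le> 2 ^ (n * k)"
proof -
  have "n ^ k \<le> (2 ^ n) ^ k" by (rule power_mono) (auto simp: less_imp_le)
  then show ?thesis by (simp add: power_mult)
qed

lemma less_B: "x \<le> B \<Longrightarrow> x < 2 ^ B"
  using less_exp[of B] by linarith

lemma code_bound: "W \<subseteq> {..<h} \<Longrightarrow> a \<in> asg n W \<Longrightarrow> code' a < 2 ^ B"
proof (cases "n = 0")
  case True
  assume "W \<subseteq> {..<h}" "a \<in> asg n W"
  then have "a = (\<lambda>_. 0)" using True by (auto simp: asg_def)
  then show ?thesis by simp
next
  case False
  assume "W \<subseteq> {..<h}" "a \<in> asg n W"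
  then have "code' a < n ^ h" using code_less False by auto
  also have "\<dots> \<le> 2 ^ (n * h)" by (rule pow_n_le)
  also have "\<dots> \<le> 2 ^ B" using B(1) by (intro power_increasing) auto
  finally show ?thesis .
qed

text \<open>The part of the state that the enumeration of a bag leaves alone.\<close>

definition frame :: "state \<Rightarrow> state \<Rightarrow> bool" where
  "frame s0 s \<longleftrightarrow> ok s \<and> ctx s \<and> (\<forall>i\<in>{10, 11, 12, 13, 14, 15}. vr s i = vr s0 i) \<and> ar s 5 = ar s0 5 \<and> ar s 6 = ar s0 6"

lemma frameD:
  assumes "frame s0 s"
  shows "ok s" "ctx s" "vr s 10 = vr s0 10" "vr s 11 = vr s0 11" "vr s 12 = vr s0 12" "vr s 13 = vr s0 13"
    "vr s 14 = vr s0 14" "vr s 15 = vr s0 15" "ar s 5 = ar s0 5" "ar s 6 = ar s0 6"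
  using assms by (auto simp: frame_def)

lemma frame_setv: "frame s0 s \<Longrightarrow> i \<in> {16, 17, 18, 19, 21, 22, 23, 24} \<Longrightarrow> x < 2 ^ B \<Longrightarrow> frame s0 (setv s i x)"
  unfolding frame_def by (auto simp: small_vars_iff intro!: ok_setv)

lemma frame_setv_20: "frame s0 s \<Longrightarrow> x \<le> B \<Longrightarrow> frame s0 (setv s 20 x)"
  unfolding frame_def by (auto intro!: ok_setv_small)

lemma frame_seta: "frame s0 s \<Longrightarrow> x < 2 ^ B \<Longrightarrow> frame s0 (seta s 4 j x)"
  unfolding frame_def by (auto intro!: ok_seta simp: fun_eq_iff)

lemma ar_seta_same: "ar (seta s g j x) g = (ar s g)(j := x)"
  by (auto simp: fun_eq_iff)

text \<open>Each of the first \<open>u\<close> layers adds at most \<open>b * n\<close> entries to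
  array 4; the summand 1 is the single entry of the layer that starts the enumeration.\<close>

lemma position_bound:
  assumes "x \<le> 1 + u * (b * n)" "u \<le> h" "b \<le> 2 ^ (n * h)"
  shows "x < 2 ^ B"
proof -
  have "u * (b * n) \<le> h * (2 ^ (n * h) * n)" using assms by (intro mult_le_mono) auto
  also have "\<dots> = 2 ^ (n * h) * (n * h)" by simp
  also have "\<dots> \<le> 2 ^ (n * h) * 2 ^ (n * h)" using less_exp[of "n * h"] by (intro mult_le_mono) auto
  also have "\<dots> = 2 ^ (2 * (n * h))" by (simp add: mult_2 power_add)
  finally have "x \<le> 1 + 2 ^ (2 * (n * h))" using assms(1) by linarith
  also have "\<dots> < 2 ^ Suc (2 * (n * h)) + 1" by simp
  also have "\<dots> \<le> 2 ^ Suc (Suc (2 * (n * h)))" by simp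
  also have "\<dots> \<le> 2 ^ B" using B(1) by (intro power_increasing) auto
  finally show ?thesis .
qed

lemma runs_extend:
  assumes fr: "frame s0 s" and u: "u < h" "vr s 20 = u" and W: "W = insert (vr s0 14) (nbr (dec s0 13))" "W \<subseteq> {..<h}" "u \<in> W"
    and lo: "vr s 16 = lo" "vr s 17 = hi" "vr s 18 = hi" "lo \<le> hi" "segment (ar s 4) lo hi = lay W u"
    and b: "length (lay W u) \<le> b" "b \<le> 2 ^ (n * h)" "hi \<le> 1 + u * (b * n)"
  shows "runs extend s (1 + b * (2 + 5 * n)) (\<lambda>s'. frame s0 s' \<and> vr s' 20 = u \<and> vr s' 16 = lo \<and> vr s' 17 = hi \<and> vr s' 19 = vr s 19 \<and>
     hi \<le> vr s' 18 \<and> vr s' 18 \<le> 1 + Suc u * (b * n) \<and> segment (ar s' 4) hi (vr s' 18) = lay W (Suc u))"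
proof -
  define l where "l = lay W u"
  define P where "P c \<longleftrightarrow> cons (W \<inter> {..u}) (decode' c)" for c
  \<comment> \<open>What has been written after \<open>i\<close> rows of the old layer and
    \<open>x\<close> values for the next row. With this description the nested loops need only one
    invariant, and the end of a row coincides with the beginning of the next.\<close>
  define F where "F i x = filter P (concat (map (\<lambda>c. map (\<lambda>x. c + x * n ^ u) [0..<n]) (take i l)) @ map (\<lambda>y. l ! i + y * n ^ u) [0..<x])" for i x
  have len: "length l = hi - lo" using arg_cong[OF lo(5), of length] by (simp add: l_def)
  have lenF: "length (F i x) \<le> i * n + x" if "i \<le> length l" for i x
  proof -
    have "length (concat (map (\<lambda>c. map (\<lambda>x. c + x * n ^ u) [0..<n]) (take i l))) = i * n"
      using that by (simp add: length_concat sum_list_replicate o_def map_replicate_const)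
    moreover have "length (F i x) \<le> length (concat (map (\<lambda>c. map (\<lambda>x. c + x * n ^ u) [0..<n]) (take i l)) @ map (\<lambda>y. l ! i + y * n ^ u) [0..<x])"
      unfolding F_def by (rule length_filter_le)
    ultimately show ?thesis by simp
  qed
  have "P = (\<lambda>c. cons (W \<inter> {..u}) (decode' c))" by (rule ext) (simp add: P_def)
  then have lay: "lay W (Suc u) = F (length l) 0" using W(3) by (simp add: F_def l_def)
  have Fn: "F (Suc i) 0 = F i n" if "i < length l" for i
    using that by (simp add: F_def take_Suc_conv_app_nth)
  have Fx: "F i (Suc x) = F i x @ (if P (l ! i + x * n ^ u) then [l ! i + x * n ^ u] else [])" for i x
    by (simp add: F_def)
  define I where "I i x s' \<longleftrightarrow> frame s0 s' \<and> vr s' 20 = u \<and> vr s' 16 = lo \<and> vr s' 17 = hi \<and> vr s' 19 = vr s 19 \<and>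
     vr s' 18 = hi + length (F i x) \<and> segment (ar s' 4) lo hi = l \<and> segment (ar s' 4) hi (vr s' 18) = F i x" for i x s'
  have Iok: "ok s'" if "I i x s'" for i x s' using that frameD(1)[of s0 s'] by (simp add: I_def)
  have bound: "hi + length (F i x) \<le> 1 + Suc u * (b * n)" if "i * n + x \<le> b * n" "i \<le> length l" for i x
    using lenF[OF that(2), of x] that b(3) by simp
  have in_b: "i * n + x \<le> b * n" if "i < length l" "x \<le> n" for i x
  proof -
    have "i * n + x \<le> Suc i * n" using that by simp
    also have "\<dots> \<le> b * n" using that b(1) by (intro mult_le_mono) (auto simp: l_def)
    finally show ?thesis .
  qed
  have step: "runs (seq [Assign 23 (Arr 4 (V 16 \<oplus> V 21) \<oplus> V 22 \<otimes> powN 20),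
      When (consE 13 14 20 23) (seq [Put 4 (V 18) (V 23), Assign 18 (V 18 \<oplus> N 1)])]) (setv s' 22 x) (1 + (1 + (1 + 1)))
      (\<lambda>s'. I i (Suc x) s' \<and> vr s' 21 = i)"
    if i: "i < length l" and x: "x < n" and I: "I i x s' \<and> vr s' 21 = i" for i x s'
  proof -
    let ?c = "l ! i + x * n ^ u"
    let ?s1 = "setv s' 22 x" let ?s2 = "setv ?s1 23 ?c"
    have fr': "frame s0 s'" using I by (simp add: I_def)
    have f1: "frame s0 ?s1" by (rule frame_setv[OF fr']) (use x B(3) less_B[of x] in auto)
    have "l ! i \<in> set (lay W u)" using i by (simp add: l_def)
    then obtain a where a: "a \<in> asg n (W \<inter> {..<u})" "l ! i = code' a"
      using lay_correct[OF W(2), of u] u(1) by auto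
    have "?c = code' (a(u := x))" using a u(1) by (subst code_upd) (auto simp: asg_def)
    moreover have "a(u := x) \<in> asg n W'" if "W' = insert u (W \<inter> {..<u})" for W' using a x that by (auto simp: asg_def)
    ultimately have cB: "?c < 2 ^ B" using code_bound[of "insert u (W \<inter> {..<u})"] W(2,3) by auto
    have f2: "frame s0 ?s2" by (rule frame_setv[OF f1]) (use cB in auto)
    have l: "ar s' 4 (lo + i) = l ! i" using I segment_nth[of i hi lo "ar s' 4"] i len by (simp add: I_def)
    have e1: "ev (Arr 4 (V 16 \<oplus> V 21) \<oplus> V 22 \<otimes> powN 20) ?s1 = ?c"
      using I l frameD(2)[OF f1] by (simp add: I_def ev_powN)
    have e2: "tr (consE 13 14 20 23) ?s2 \<longleftrightarrow> P ?c"
    proof -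
      have "W \<inter> {..u} = insert (vr ?s2 14) (nbr (dec ?s2 13)) \<inter> {..vr ?s2 20}"
        using I frameD[OF fr'] by (simp add: W(1) I_def)
      moreover have "W \<inter> {..u} \<noteq> {}" using W(3) by auto
      moreover have "vr ?s2 20 < h" using I u(1) by (simp add: I_def)
      moreover have "vr ?s2 23 = ?c" by simp
      ultimately show ?thesis using tr_consE[OF frameD(2)[OF f2], of 13 14 20 23 "W \<inter> {..u}"]
        unfolding P_def by simp
    qed
    have pos: "hi + length (F i x) < 2 ^ B" "Suc (hi + length (F i x)) < 2 ^ B" if "P ?c"
    proof -
      have "Suc (hi + length (F i x)) = hi + length (F i (Suc x))" using that by (simp add: Fx)
      also have "\<dots> \<le> 1 + Suc u * (b * n)" using i x by (intro bound in_b) auto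
      finally have "Suc (hi + length (F i x)) \<le> 1 + Suc u * (b * n)" .
      then show "Suc (hi + length (F i x)) < 2 ^ B" by (rule position_bound) (use u b in auto)
      then show "hi + length (F i x) < 2 ^ B" by simp
    qed
    show ?thesis unfolding seq.simps
    proof (rule runs_Sq[where R = "\<lambda>s''. s'' = ?s2"])
      show "runs (Assign 23 (Arr 4 (V 16 \<oplus> V 21) \<oplus> V 22 \<otimes> powN 20)) ?s1 1 (\<lambda>s''. s'' = ?s2)"
        by (rule runs_Assign; (unfold e1)?) (use frameD(1)[OF f1] frameD(1)[OF f2] in auto)
      fix s'' assume s'': "s'' = ?s2"
      show "runs (When (consE 13 14 20 23) (Sq (Put 4 (V 18) (V 23)) (Assign 18 (V 18 \<oplus> N 1)))) s'' (1 + (1 + 1))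
          (\<lambda>s'. I i (Suc x) s' \<and> vr s' 21 = i)"
      proof (rule runs_When)
        show "ok s''" using frameD(1)[OF f2] s'' by simp
        assume "\<not> tr (consE 13 14 20 23) s''"
        then have "\<not> P ?c" using e2 s'' by simp
        then show "I i (Suc x) s'' \<and> vr s'' 21 = i" using I f2 unfolding s'' I_def by (auto simp: Fx)
      next
        assume "tr (consE 13 14 20 23) s''"
        then have Pc: "P ?c" using e2 s'' by simp
        let ?s3 = "seta ?s2 4 (hi + length (F i x)) ?c" let ?s4 = "setv ?s3 18 (Suc (hi + length (F i x)))"
        have f3: "frame s0 ?s3" using f2 cB by (rule frame_seta)
        have f4: "frame s0 ?s4" by (rule frame_setv[OF f3]) (use pos[OF Pc] in auto)
        have sg: "segment (ar s' 4) hi (hi + length (F i x)) = F i x" using I by (auto simp: I_def)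
        have I4: "I i (Suc x) ?s4 \<and> vr ?s4 21 = i"
          using I f4 Pc unfolding I_def Fx by (simp add: ar_seta_same segment_upd segment_snoc sg del: ar_seta)
        show "runs (Sq (Put 4 (V 18) (V 23)) (Assign 18 (V 18 \<oplus> N 1))) s'' (1 + 1) (\<lambda>s'. I i (Suc x) s' \<and> vr s' 21 = i)"
        proof (rule runs_Sq[where R = "\<lambda>s''. s'' = ?s3"])
          have e: "ev (V 18) s'' = hi + length (F i x)" "ev (V 23) s'' = ?c" using I by (simp_all add: s'' I_def)
          show "runs (Put 4 (V 18) (V 23)) s'' 1 (\<lambda>s''. s'' = ?s3)"
            by (rule runs_Put; (unfold e)?) (use frameD(1)[OF f2] frameD(1)[OF f3] s'' in auto)
          fix s3 assume s3: "s3 = ?s3"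
          have e: "ev (V 18 \<oplus> N 1) s3 = Suc (hi + length (F i x))" using I by (simp add: s3 I_def)
          show "runs (Assign 18 (V 18 \<oplus> N 1)) s3 1 (\<lambda>s'. I i (Suc x) s' \<and> vr s' 21 = i)"
            by (rule runs_Assign; (unfold e)?) (use frameD(1)[OF f3] frameD(1)[OF f4] I4 s3 in auto)
        qed
      qed
    qed
  qed
  have row: "runs (For 22 (V 2) (seq [Assign 23 (Arr 4 (V 16 \<oplus> V 21) \<oplus> V 22 \<otimes> powN 20),
      When (consE 13 14 20 23) (seq [Put 4 (V 18) (V 23), Assign 18 (V 18 \<oplus> N 1)])])) (setv s' 21 i) (1 + n * (1 + (1 + (1 + (1 + 1)))))
      (I (Suc i) 0)" if i: "i < length l" and I: "I i 0 s'" for i s'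
  proof (rule runs_For[where I = "\<lambda>x s'. I i x s' \<and> vr s' 21 = i"])
    have fr': "frame s0 s'" using I by (simp add: I_def)
    have "i \<le> hi" using i len by linarith
    moreover have "hi < 2 ^ B" using b(3) by (rule position_bound) (use u b in auto)
    ultimately have "i < 2 ^ B" by linarith
    then have f1: "frame s0 (setv s' 21 i)" using frame_setv[OF fr'] by simp
    then show "ok (setv s' 21 i)" by (rule frameD)
    show "ev (V 2) (setv s' 21 i) = n" using frameD(2)[OF f1] by (simp add: ctx_vars)
    show "I i 0 (setv s' 21 i) \<and> vr (setv s' 21 i) 21 = i" using I f1 by (auto simp: I_def)
    fix x s'' assume xI: "x < n" "I i x s'' \<and> vr s'' 21 = i"
    have "ok s''" using xI(2) Iok by blast
    with step[OF i xI] show "ok s'' \<and> runs (seq [Assign 23 (Arr 4 (V 16 \<oplus> V 21) \<oplus> V 22 \<otimes> powN 20),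
      When (consE 13 14 20 23) (seq [Put 4 (V 18) (V 23), Assign 18 (V 18 \<oplus> N 1)])]) (setv s'' 22 x) (1 + (1 + (1 + 1)))
      (\<lambda>s'. I i (Suc x) s' \<and> vr s' 21 = i)" by blast
  next
    fix s'' assume "I i n s'' \<and> vr s'' 21 = i"
    then show "I (Suc i) 0 s''" unfolding I_def Fn[OF i] by auto
  qed
  have "runs extend s (1 + (hi - lo) * (1 + (1 + n * (1 + (1 + (1 + (1 + 1))))))) (I (hi - lo) 0)"
    unfolding extend_def
  proof (rule runs_For[where I = "\<lambda>i. I i 0"])
    show "ok s" using fr by (rule frameD)
    show "ev (V 17 \<ominus> V 16) s = hi - lo" using lo by simp
    show "I 0 0 s" using fr u lo by (simp add: I_def F_def l_def)
    fix i s' assume iI: "i < hi - lo" "I i 0 s'"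
    then have il: "i < length l" using len by simp
    have "ok s'" using iI(2) by (rule Iok)
    with row[OF il iI(2)] show "ok s' \<and> runs (For 22 (V 2) (seq [Assign 23 (Arr 4 (V 16 \<oplus> V 21) \<oplus> V 22 \<otimes> powN 20),
      When (consE 13 14 20 23) (seq [Put 4 (V 18) (V 23), Assign 18 (V 18 \<oplus> N 1)])])) (setv s' 21 i) (1 + n * (1 + (1 + (1 + (1 + 1)))))
      (I (Suc i) 0)" by blast
  qed
  then show ?thesis
  proof (rule runs_mono)
    have "(hi - lo) * (1 + (1 + n * (1 + (1 + (1 + (1 + 1)))))) \<le> b * (1 + (1 + n * (1 + (1 + (1 + (1 + 1))))))"
      using b(1) len by (intro mult_le_mono) (auto simp: l_def)
    then show "1 + (hi - lo) * (1 + (1 + n * (1 + (1 + (1 + (1 + 1)))))) \<le> 1 + b * (2 + 5 * n)" by (simp add: algebra_simps)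
    fix s' assume I: "I (hi - lo) 0 s'"
    have "(hi - lo) * n + 0 \<le> b * n" using b(1) len by (auto simp: l_def)
    then have "hi + length (F (hi - lo) 0) \<le> 1 + Suc u * (b * n)" using len by (intro bound) auto
    then show "frame s0 s' \<and> vr s' 20 = u \<and> vr s' 16 = lo \<and> vr s' 17 = hi \<and> vr s' 19 = vr s 19 \<and>
     hi \<le> vr s' 18 \<and> vr s' 18 \<le> 1 + Suc u * (b * n) \<and> segment (ar s' 4) hi (vr s' 18) = lay W (Suc u)"
      using I unfolding I_def lay len by auto
  qed
qed

text \<open>The last implication makes giving up harmless: it happens only if some layer really
  exceeds \<open>b\<close>, so a bag whose layers all fit is never abandoned. The upper limit on
  \<open>b\<close> keeps the array positions within the word length.\<close>

lemma runs_list_bag: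
  assumes fr: "frame s0 s" and v: "vr s0 14 < h" and b: "vr s0 10 = b" "1 \<le> b" "b \<le> 2 ^ (n * h)"
    and W: "W = insert (vr s0 14) (nbr (dec s0 13))"
  shows "runs list_bag s (5 + h * (8 + b * (2 + 5 * n))) (\<lambda>s'. frame s0 s' \<and>
     (vr s' 19 \<noteq> 0 \<longrightarrow> vr s' 16 \<le> vr s' 17 \<and> vr s' 17 < 2 ^ B \<and> segment (ar s' 4) (vr s' 16) (vr s' 17) = lay W h \<and> length (lay W h) \<le> b) \<and>
     (vr s' 19 = 0 \<longrightarrow> (\<exists>u\<le>h. b < length (lay W u))))"
proof -
  have W': "W \<subseteq> {..<h}" using v nbr_subset unfolding W by auto
  define I where "I u s' \<longleftrightarrow> frame s0 s' \<and>
     (vr s' 19 \<noteq> 0 \<longrightarrow> vr s' 16 \<le> vr s' 17 \<and> vr s' 17 \<le> 1 + u * (b * n) \<and> segment (ar s' 4) (vr s' 16) (vr s' 17) = lay W u \<and> length (lay W u) \<le> b) \<and>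
     (vr s' 19 = 0 \<longrightarrow> (\<exists>u\<le>h. b < length (lay W u)))" for u s'
  have one: "1 < (2 :: nat) ^ B" using less_B[of 1] B(1) by simp
  have body: "runs (When (And (bagE 13 14 20) (V 19)) (seq
       [Assign 18 (V 17), extend, Assign 16 (V 17), Assign 17 (V 18),
        Assign 19 (NOT ((V 17 \<ominus> V 16) \<ominus> V 10))])) (setv s' 20 u) (1 + (1 + ((1 + b * (2 + 5 * n)) + (1 + (1 + 1))))) (I (Suc u))"
    if u: "u < h" and I: "I u s'" for u s'
  proof (rule runs_When)
    let ?s1 = "setv s' 20 u"
    have fr': "frame s0 s'" using I by (simp add: I_def)
    have f1: "frame s0 ?s1" using fr' u B(4) by (intro frame_setv_20) auto
    show "ok ?s1" using f1 by (rule frameD)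
    have bag: "tr (bagE 13 14 20) ?s1 \<longleftrightarrow> u \<in> W"
      using u frameD[OF fr'] frameD(2)[OF f1] by (simp add: tr_bagE W del: neq0_conv)
    have uh: "Suc u \<le> h" using u by simp
    {
      assume "\<not> tr (And (bagE 13 14 20) (V 19)) ?s1"
      then have "vr s' 19 = 0 \<or> u \<notin> W" using bag by auto
      moreover have "1 + u * (b * n) \<le> 1 + Suc u * (b * n)" by simp
      ultimately show "I (Suc u) ?s1" using I f1 unfolding I_def by auto
    }
    assume "tr (And (bagE 13 14 20) (V 19)) ?s1"
    then have uW: "u \<in> W" and 19: "vr s' 19 \<noteq> 0" using bag by auto
    define lo hi where "lo = vr s' 16" and "hi = vr s' 17"
    have lo: "lo \<le> hi" "hi \<le> 1 + u * (b * n)" "segment (ar s' 4) lo hi = lay W u" "length (lay W u) \<le> b"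
      using I 19 by (auto simp: I_def lo_def hi_def)
    have hiB: "hi < 2 ^ B" using lo(2) by (rule position_bound) (use u b in auto)
    let ?s2 = "setv ?s1 18 hi"
    have f2: "frame s0 ?s2" by (rule frame_setv[OF f1]) (use hiB in auto)
    define R where "R s' \<longleftrightarrow> frame s0 s' \<and> vr s' 20 = u \<and> vr s' 16 = lo \<and> vr s' 17 = hi \<and> vr s' 19 = vr ?s2 19 \<and>
     hi \<le> vr s' 18 \<and> vr s' 18 \<le> 1 + Suc u * (b * n) \<and> segment (ar s' 4) hi (vr s' 18) = lay W (Suc u)" for s'
    show "runs (seq [Assign 18 (V 17), extend, Assign 16 (V 17), Assign 17 (V 18),
        Assign 19 (NOT ((V 17 \<ominus> V 16) \<ominus> V 10))]) ?s1 (1 + ((1 + b * (2 + 5 * n)) + (1 + (1 + 1)))) (I (Suc u))"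
      unfolding seq.simps
    proof (rule runs_Sq[where R = "\<lambda>s''. s'' = ?s2"], goal_cases)
      case 1
      have e: "ev (V 17) ?s1 = hi" by (simp add: hi_def)
      show ?case by (rule runs_Assign; (unfold e)?) (use frameD(1)[OF f1] frameD(1)[OF f2] in auto)
    next
      case (2 s2)
      show ?case
      proof (rule runs_Sq[where R = R], goal_cases)
        case 1
        show ?case unfolding 2 R_def
          by (rule runs_extend[OF f2 u _ W W' uW]) (use lo b in \<open>auto simp: lo_def hi_def\<close>)
      next
        case (2 s3)
        then have f3: "frame s0 s3" by (simp add: R_def)
        define e where "e = vr s3 18"
        have eB: "e < 2 ^ B" using 2 unfolding R_def e_def by (intro position_bound[of _ "Suc u"]) (use u b in auto)
        let ?s4 = "setv s3 16 hi" let ?s5 = "setv ?s4 17 e" let ?s6 = "setv ?s5 19 (of_bool (e - hi \<le> b))"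
        have f4: "frame s0 ?s4" by (rule frame_setv[OF f3]) (use hiB in auto)
        have f5: "frame s0 ?s5" by (rule frame_setv[OF f4]) (use eB in auto)
        have f6: "frame s0 ?s6" by (rule frame_setv[OF f5]) (use one in auto)
        have e4: "ev (V 17) s3 = hi" "ev (V 18) ?s4 = e" "ev (NOT ((V 17 \<ominus> V 16) \<ominus> V 10)) ?s5 = of_bool (e - hi \<le> b)"
          using 2 frameD(3)[OF f3] b(1) by (auto simp: R_def e_def)
        have "length (lay W (Suc u)) = e - hi" using 2 by (metis R_def e_def length_segment)
        then have I6: "I (Suc u) ?s6" using 2 f6 uh unfolding I_def R_def e_def by auto
        show ?case
        proof (rule runs_Sq[where R = "\<lambda>s''. s'' = ?s4"], goal_cases)
          case 1
          show ?case by (rule runs_Assign; (unfold e4)?) (use frameD(1)[OF f3] frameD(1)[OF f4] in auto)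
        next
          case (2 s4)
          show ?case unfolding 2
          proof (rule runs_Sq[where R = "\<lambda>s''. s'' = ?s5"], goal_cases)
            case 1
            show ?case by (rule runs_Assign; (unfold e4)?) (use frameD(1)[OF f4] frameD(1)[OF f5] in auto)
          next
            case (2 s5)
            show ?case unfolding 2
              by (rule runs_Assign; (unfold e4)?) (use frameD(1)[OF f5] frameD(1)[OF f6] I6 in auto)
          qed
        qed
      qed
    qed
  qed
  let ?t1 = "seta s 4 0 0" let ?t2 = "setv ?t1 16 0" let ?t3 = "setv ?t2 17 1" let ?t4 = "setv ?t3 19 1"
  have f: "frame s0 ?t1" using fr by (intro frame_seta) auto
  have f2: "frame s0 ?t2" by (rule frame_setv[OF f]) auto
  have f3: "frame s0 ?t3" by (rule frame_setv[OF f2]) (use one in auto)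
  have f4: "frame s0 ?t4" by (rule frame_setv[OF f3]) (use one in auto)
  have I0: "I 0 ?t4" using f4 b by (simp add: I_def segment_def)
  have "runs list_bag s (1 + (1 + (1 + (1 + (1 + h * (1 + (1 + (1 + ((1 + b * (2 + 5 * n)) + (1 + (1 + 1)))))))))))  (I h)"
    unfolding list_bag_def seq.simps(1,2)
  proof (rule runs_Sq[where R = "\<lambda>s''. s'' = ?t1"], goal_cases)
    case 1
    show ?case by (rule runs_Put) (use frameD(1)[OF fr] frameD(1)[OF f] in auto)
  next
    case (2 s1)
    show ?case unfolding 2
    proof (rule runs_Sq[where R = "\<lambda>s''. s'' = ?t2"], goal_cases)
      case 1
      show ?case by (rule runs_Assign) (use frameD(1)[OF f] frameD(1)[OF f2] in auto)
    next
      case (2 s2)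
      show ?case unfolding 2
      proof (rule runs_Sq[where R = "\<lambda>s''. s'' = ?t3"], goal_cases)
        case 1
        show ?case by (rule runs_Assign) (use frameD(1)[OF f2] frameD(1)[OF f3] in auto)
      next
        case (2 s3)
        show ?case unfolding 2
        proof (rule runs_Sq[where R = "\<lambda>s''. s'' = ?t4"], goal_cases)
          case 1
          show ?case by (rule runs_Assign) (use frameD(1)[OF f3] frameD(1)[OF f4] in auto)
        next
          case (2 s4)
          show ?case unfolding 2
          proof (rule runs_For[where I = I])
            show "ok ?t4" using f4 by (rule frameD)
            show "ev (V 1) ?t4 = h" using frameD(2)[OF f4] by (rule ev_V_ctx)
            show "I 0 ?t4" by (rule I0)
            fix u s' assume uI: "u < h" "I u s'"
            have "frame s0 s'" using uI(2) by (simp add: I_def)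
            then have "ok s'" by (rule frameD)
            with body[OF uI] show "ok s' \<and> runs (When (And (bagE 13 14 20) (V 19)) (Sq (Assign 18 (V 17)) (Sq extend
                (Sq (Assign 16 (V 17)) (Sq (Assign 17 (V 18)) (Assign 19 (NOT ((V 17 \<ominus> V 16) \<ominus> V 10)))))))) (setv s' 20 u)
                (1 + (1 + ((1 + b * (2 + 5 * n)) + (1 + (1 + 1))))) (I (Suc u))" by simp
          qed
        qed
      qed
    qed
  qed
  then show ?thesis
  proof (rule runs_mono)
    fix s' assume I: "I h s'"
    have "x < 2 ^ B" if "x \<le> 1 + h * (b * n)" for x using that by (rule position_bound) (use b in auto)
    then show "frame s0 s' \<and>
     (vr s' 19 \<noteq> 0 \<longrightarrow> vr s' 16 \<le> vr s' 17 \<and> vr s' 17 < 2 ^ B \<and> segment (ar s' 4) (vr s' 16) (vr s' 17) = lay W h \<and> length (lay W h) \<le> b) \<and>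
     (vr s' 19 = 0 \<longrightarrow> (\<exists>u\<le>h. b < length (lay W u)))" using I unfolding I_def by blast
  qed (simp add: algebra_simps)
qed

end

lemma set_decode_full: "set_decode (2 ^ h - 1) = {..<h}"
proof -
  have "set_encode {..<h} = 2 ^ h - 1"
    unfolding set_encode_def by (induction h) auto
  then show ?thesis by (metis set_encode_inverse finite_lessThan)
qed

lemma sum_list_take_le: "(\<Sum>x\<leftarrow>take i xs. f x) \<le> (\<Sum>x\<leftarrow>xs. f x :: nat)"
  by (metis append_take_drop_id le_add1 map_append sum_list_append)

section \<open>Filling the tables\<close>

context algorithm
begin

text \<open>There is no third case: a table is written only after its bag has been enumerated
  completely, so a set without a finished table still has all entries 0, from which later rounds can
  accumulate.\<close>

definition tables :: "state \<Rightarrow> bool" where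
  "tables s \<longleftrightarrow> (\<forall>c<2 ^ h. (ar s 6 c = 0 \<and> (\<forall>k. ar s 5 (k * 2 ^ h + c) = 0)) \<or>
     (ar s 6 c \<noteq> 0 \<and> counts (set_decode c) (\<lambda>k. ar s 5 (k * 2 ^ h + c))))"

lemma tables_cong: "ar s' 5 = ar s 5 \<Longrightarrow> ar s' 6 = ar s 6 \<Longrightarrow> tables s' = tables s"
  by (simp add: tables_def)

lemma tablesD:
  assumes "tables s" "c < 2 ^ h"
  shows "ar s 6 c \<noteq> 0 \<Longrightarrow> counts (set_decode c) (\<lambda>k. ar s 5 (k * 2 ^ h + c))"
    and "ar s 6 c = 0 \<Longrightarrow> ar s 5 (k * 2 ^ h + c) = 0"
  using assms unfolding tables_def by auto

lemma comps_subset: "C \<in> comps X \<Longrightarrow> C \<subseteq> X"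
  by (simp add: comps_def)

lemma runs_tabulate:
  assumes s: "ok s" "ctx s" "tables s" and c: "vr s 13 = c" "c < 2 ^ h" "ar s 6 c = 0"
    and v: "vr s 14 = v" "v \<in> set_decode c" and x: "vr s 15 = c - 2 ^ v"
    and W: "W = insert v (nbr (set_decode c))"
    and l: "segment (ar s 4) (vr s 16) (vr s 17) = lay W h" "length (lay W h) \<le> b" "vr s 17 < 2 ^ B"
    and good: "\<forall>C'\<in>comps (set_decode c - {v}). ar s 6 (set_encode C') \<noteq> 0"
  shows "runs tabulate s (2 + 5 * b) (\<lambda>s'. ok s' \<and> ctx s' \<and> tables s' \<and> ar s' 6 c \<noteq> 0 \<and>
     (\<forall>c'. c' \<noteq> c \<longrightarrow> ar s' 6 c' = ar s 6 c') \<and> (\<forall>i\<in>{10, 11, 12, 13, 14}. vr s' i = vr s i))"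
proof -
  define C where "C = set_decode c"
  define l where "l = lay W h"
  define F where "F cd k = (if edgeok W (decode' cd) \<and> code' (restr (decode' cd) (nbr C)) = k
        then \<Prod>C'\<in>comps (C - {v}). table s C' (code' (restr (decode' cd) (nbr C'))) else 0)" for cd k
  define \<tau> where "\<tau> k = (\<Sum>cd\<leftarrow>l. F cd k)" for k
  have C: "C \<subseteq> {..<h}" "v \<in> C" using set_decode_subset[OF c(2)] v by (auto simp: C_def)
  have W': "W \<subseteq> {..<h}" using C nbr_subset by (auto simp: W)
  have "c - 2 ^ v < 2 ^ h" using c(2) by linarith
  have dx: "set_decode (c - 2 ^ v) = C - {v}" using set_decode_minus[OF v(2)] by (simp add: C_def)
  have child: "C' \<subseteq> C - {v}" "set_encode C' < 2 ^ h" "set_decode (set_encode C') = C'" "set_encode C' \<noteq> c"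
    if "C' \<in> comps (C - {v})" for C'
  proof -
    show sub: "C' \<subseteq> C - {v}" using that by (rule comps_subset)
    then have h: "C' \<subseteq> {..<h}" using C by blast
    show "set_encode C' < 2 ^ h" using h by (rule set_encode_less)
    show d: "set_decode (set_encode C') = C'" using h by (rule set_decode_encode)
    show "set_encode C' \<noteq> c" using d sub C(2) by (auto simp: C_def)
  qed
  \<comment> \<open>Correctness of the final table is settled before the loop is examined: the sum
    over all rows is the right-hand side of \<open>counts_step\<close>. The loop then only has to be
    shown to compute this sum.\<close>
  have cnt: "counts C \<tau>"
  proof (rule counts_step[OF C])
    show "counts C' (table s C')" if "C' \<in> comps (C - {v})" for C'
    proof -
      have "ar s 6 (set_encode C') \<noteq> 0" using good that by (simp add: C_def)
      then have "counts (set_decode (set_encode C')) (\<lambda>k. ar s 5 (k * 2 ^ h + set_encode C'))"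
        by (rule tablesD(1)[OF s(3) child(2)[OF that]])
      then show ?thesis by (simp add: child(3)[OF that] table_def[abs_def])
    qed
    show "\<tau> k = (\<Sum>ca\<leftarrow>lay (insert v (nbr C)) h.
        if edgeok (insert v (nbr C)) (decode' ca) \<and> code' (restr (decode' ca) (nbr C)) = k
        then \<Prod>C'\<in>comps (C - {v}). table s C' (code' (restr (decode' ca) (nbr C'))) else 0)" for k
      unfolding \<tau>_def l_def F_def W C_def ..
  qed
  define lo where "lo = vr s 16"
  define hi where "hi = vr s 17"
  have seg: "segment (ar s 4) lo hi = l" using l(1) by (simp add: l_def lo_def hi_def)
  have len: "length l = hi - lo" using arg_cong[OF seg, of length] by simp
  \<comment> \<open>The entries of all other masks stay fixed; in particular the tables of the
    components, from which the products are read, do not change while the table of \<open>c\<close>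
    is being written.\<close>
  define I where "I i s' \<longleftrightarrow> ok s' \<and> ctx s' \<and> (\<forall>i\<in>{10, 11, 12, 13, 14, 15, 16, 17}. vr s' i = vr s i) \<and>
     ar s' 4 = ar s 4 \<and> ar s' 6 = ar s 6 \<and> (\<forall>k. ar s' 5 (k * 2 ^ h + c) = (\<Sum>cd\<leftarrow>take i l. F cd k)) \<and>
     (\<forall>c' k. c' < 2 ^ h \<longrightarrow> c' \<noteq> c \<longrightarrow> ar s' 5 (k * 2 ^ h + c') = ar s 5 (k * 2 ^ h + c'))" for i s'
  have I_setv: "I i (setv s' j y)" if "I i s'" "j \<in> {21, 23, 24}" "y < 2 ^ B" for i s' j y
    using that ok_setv[of s' y j] by (auto simp: I_def small_vars_iff)
  have step: "runs (seq [Assign 23 (Arr 4 (V 16 \<oplus> V 21)),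
        When (edgeE 13 14 23) (seq [Assign 24 (restE 23 13 \<otimes> V 3 \<oplus> V 13),
           Put 5 (V 24) (Arr 5 (V 24) \<oplus> prodE 15 23)])]) (setv s' 21 i) (1 + (1 + (1 + 1))) (I (Suc i))"
    if i: "i < length l" and I: "I i s'" for i s'
  proof -
    define cd where "cd = l ! i"
    have "cd \<in> set (lay W h)" using i by (simp add: cd_def l_def)
    then obtain a where a: "a \<in> asg n W" "cd = code' a"
      using lay_correct[OF W', of h] W' by (auto simp: Int_absorb2)
    have "v \<in> W" by (simp add: W)
    then have n: "0 < n" using a(1) by (auto simp: asg_def)
    have da: "decode' cd = a" using decode_code[OF W' a(1)] a(2) by simp
    have cdB: "cd < 2 ^ B" using code_bound[OF W' a(1)] a(2) by simp
    let ?s1 = "setv s' 21 i" let ?s2 = "setv ?s1 23 cd"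
    have "i < 2 ^ B" using i len l(3) by (simp add: hi_def)
    then have I1: "I i ?s1" using I by (intro I_setv) auto
    have I2: "I i ?s2" by (rule I_setv[OF I1]) (use cdB in auto)
    have "ar s 4 (lo + i) = cd" using segment_nth[of i hi lo "ar s 4"] seg i len by (simp add: cd_def)
    then have e1: "ev (Arr 4 (V 16 \<oplus> V 21)) ?s1 = cd" using I by (simp add: I_def lo_def)
    have ok: "ok s'" "ok ?s1" "ok ?s2" "ctx ?s2" using I I1 I2 by (simp_all add: I_def)
    have v2: "vr ?s2 13 = c" "vr ?s2 14 = v" "vr ?s2 15 = c - 2 ^ v" "vr ?s2 23 = cd"
      using I2 c(1) v(1) x by (simp_all add: I_def)
    have e2: "tr (edgeE 13 14 23) ?s2 \<longleftrightarrow> edgeok W (decode' cd)"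
      using tr_edgeE[OF ok(4), of 13 14 23, OF _ n refl] v2 W by simp
    define k0 where "k0 = code' (restr (decode' cd) (nbr C))"
    have k0: "restr (decode' cd) (nbr C) \<in> asg n (nbr C)" using a(1) unfolding da by (rule restr_in_asg) (auto simp: W C_def)
    have Fk: "F cd k = (if edgeok W (decode' cd) \<and> k0 = k then F cd k0 else 0)" for k by (simp add: F_def k0_def)
    have tk: "(\<Sum>cd\<leftarrow>take (Suc i) l. F cd k) = (\<Sum>cd\<leftarrow>take i l. F cd k) + F cd k" for k
      using i by (simp add: take_Suc_conv_app_nth cd_def)
    show ?thesis unfolding seq.simps
    proof (rule runs_Sq[where R = "\<lambda>s''. s'' = ?s2"], goal_cases)
      case 1
      show ?case by (rule runs_Assign; (unfold e1)?) (use ok in auto)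
    next
      case (2 s2)
      show ?case unfolding 2
      proof (rule runs_When)
        show "ok ?s2" by (rule ok)
        assume "\<not> tr (edgeE 13 14 23) ?s2"
        then have "F cd k = 0" for k using e2 by (simp add: F_def)
        then show "I (Suc i) ?s2" using I2 unfolding I_def tk by simp
      next
        assume "tr (edgeE 13 14 23) ?s2"
        then have edge: "edgeok W (decode' cd)" using e2 by simp
        define j where "j = k0 * 2 ^ h + c"
        have "k0 < n ^ h" unfolding k0_def by (rule code_less[OF nbr_subset k0 n])
        have "j < Suc k0 * 2 ^ h" using c(2) by (simp add: j_def)
        also have "\<dots> \<le> n ^ h * 2 ^ h" using \<open>k0 < n ^ h\<close> by (intro mult_le_mono) auto
        also have "\<dots> \<le> 2 ^ (n * h) * 2 ^ (n * h)"
          using n by (intro mult_le_mono pow_n_le power_increasing) auto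
        also have "\<dots> = 2 ^ (2 * (n * h))" by (simp add: mult_2 power_add)
        also have "\<dots> \<le> 2 ^ B" using B(1) by (intro power_increasing) auto
        finally have jB: "j < 2 ^ B" .
        let ?s3 = "setv ?s2 24 j"
        have I3: "I i ?s3" by (rule I_setv[OF I2]) (use jB in auto)
        have ok3: "ok ?s3" "ctx ?s3" using I3 by (simp_all add: I_def)
        have e3: "ev (restE 23 13 \<otimes> V 3 \<oplus> V 13) ?s2 = j"
        proof -
          have "ev (restE 23 13) ?s2 = k0" using ev_restE[OF ok(4), of 13 23] v2 by (simp add: k0_def C_def)
          then show ?thesis using v2 ev_V_ctx(3)[OF ok(4)] by (simp add: j_def)
        qed
        have prod: "ev (prodE 15 23) ?s3 = F cd k0"
        proof -
          have "ev (prodE 15 23) ?s3 = (\<Prod>C'\<in>comps (C - {v}). table ?s3 C' (code' (restr (decode' cd) (nbr C'))))"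
            using ev_prodE[OF ok3(2), of 15 23] v2 dx \<open>c - 2 ^ v < 2 ^ h\<close> by simp
          also have "\<dots> = (\<Prod>C'\<in>comps (C - {v}). table s C' (code' (restr (decode' cd) (nbr C'))))"
            using I3 child unfolding table_def I_def by (intro prod.cong) auto
          finally show ?thesis using edge by (simp add: F_def k0_def)
        qed
        define y where "y = (\<Sum>cd\<leftarrow>take (Suc i) l. F cd k0)"
        have e4: "ev (V 24) ?s3 = j" "ev (Arr 5 (V 24) \<oplus> prodE 15 23) ?s3 = y"
          using I3 prod by (simp_all add: y_def tk I_def j_def)
        \<comment> \<open>A partial sum is at most the final entry, which counts assignments on
          \<open>C\<close>. This bounds the intermediate values without a separate estimate of the
          products.\<close>
        have "y \<le> \<tau> k0" unfolding y_def \<tau>_def by (rule sum_list_take_le)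
        also have "\<dots> \<le> n ^ card C" unfolding k0_def by (rule counts_zero_le[OF cnt C(1) k0])
        also have "\<dots> \<le> n ^ h" using n card_mono[OF _ C(1)] by (intro power_increasing) auto
        also have "\<dots> \<le> 2 ^ (n * h)" by (rule pow_n_le)
        also have "\<dots> < 2 ^ B" using B(1) by (intro power_strict_increasing) auto
        finally have yB: "y < 2 ^ B" .
        have ok4: "ok (seta ?s3 5 j y)" using ok3(1) yB by (rule ok_seta)
        have I4: "I (Suc i) (seta ?s3 5 j y)"
        proof -
          have 1: "ar (seta ?s3 5 j y) 5 (k * 2 ^ h + c) = (\<Sum>cd\<leftarrow>take (Suc i) l. F cd k)" for k
          proof (cases "k = k0")
            case True
            then show ?thesis by (simp add: j_def y_def)
          next
            case False
            then have "k * 2 ^ h + c \<noteq> j" unfolding j_def using mult_add_eq_iff[OF c(2) c(2), of k k0] by simp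
            then show ?thesis using I3 Fk[of k] False unfolding tk by (simp add: I_def)
          qed
          have 2: "ar (seta ?s3 5 j y) 5 (k * 2 ^ h + c') = ar s 5 (k * 2 ^ h + c')" if "c' < 2 ^ h" "c' \<noteq> c" for c' k
          proof -
            have "k * 2 ^ h + c' \<noteq> j" unfolding j_def using mult_add_eq_iff[OF that(1) c(2), of k k0] that by simp
            then show ?thesis using I3 that by (simp add: I_def)
          qed
          have 3: "ctx (seta ?s3 5 j y)" using ok3(2) by simp
          have 4: "ar (seta ?s3 5 j y) 4 = ar s 4" "ar (seta ?s3 5 j y) 6 = ar s 6"
            using I3 by (auto simp: I_def fun_eq_iff)
          show ?thesis unfolding I_def using 1 2 3 4 ok4 I3 unfolding I_def by simp
        qed
        show "runs (Sq (Assign 24 (restE 23 13 \<otimes> V 3 \<oplus> V 13)) (Put 5 (V 24) (Arr 5 (V 24) \<oplus> prodE 15 23))) ?s2 (1 + 1) (I (Suc i))"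
        proof (rule runs_Sq[where R = "\<lambda>s''. s'' = ?s3"], goal_cases)
          case 1
          show ?case by (rule runs_Assign; (unfold e3)?) (use ok ok3 in auto)
        next
          case (2 s3)
          show ?case unfolding 2 by (rule runs_Put; (unfold e4)?) (use ok3 ok4 I4 in auto)
        qed
      qed
    qed
  qed
  have one: "1 < (2 :: nat) ^ B" using less_B[of 1] B(1) by simp
  have I0: "I 0 s"
  proof -
    have "ar s 5 (k * 2 ^ h + c) = 0" for k by (rule tablesD(2)[OF s(3) c(2,3)])
    then show ?thesis using s by (simp add: I_def)
  qed
  have "runs tabulate s ((1 + (hi - lo) * (1 + (1 + (1 + (1 + 1))))) + 1) (\<lambda>s'. ok s' \<and> ctx s' \<and> tables s' \<and> ar s' 6 c \<noteq> 0 \<and>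
     (\<forall>c'. c' \<noteq> c \<longrightarrow> ar s' 6 c' = ar s 6 c') \<and> (\<forall>i\<in>{10, 11, 12, 13, 14}. vr s' i = vr s i))"
    unfolding tabulate_def seq.simps(1,2)
  proof (rule runs_Sq[where R = "I (hi - lo)"], goal_cases)
    case 1
    show ?case
    proof (rule runs_For[where I = I])
      show "ev (V 17 \<ominus> V 16) s = hi - lo" by (simp add: hi_def lo_def)
      fix i s' assume "i < hi - lo" "I i s'"
      then show "ok s' \<and> runs (Sq (Assign 23 (Arr 4 (V 16 \<oplus> V 21)))
        (When (edgeE 13 14 23) (Sq (Assign 24 (restE 23 13 \<otimes> V 3 \<oplus> V 13))
           (Put 5 (V 24) (Arr 5 (V 24) \<oplus> prodE 15 23))))) (setv s' 21 i) (1 + (1 + (1 + 1))) (I (Suc i))"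
        using step[of i s'] len by (simp add: I_def)
    qed (use s I0 in auto)
  next
    case (2 s')
    have e: "ev (V 13) s' = c" "ev (N 1) s' = 1" using 2 c(1) by (simp_all add: I_def)
    have ok': "ok s'" "ok (seta s' 6 c 1)" using 2 one by (auto simp: I_def intro: ok_seta)
    have T: "tables (seta s' 6 c 1)" unfolding tables_def
    proof (intro allI impI)
      fix c' assume c': "c' < (2 :: nat) ^ h"
      show "(ar (seta s' 6 c 1) 6 c' = 0 \<and> (\<forall>k. ar (seta s' 6 c 1) 5 (k * 2 ^ h + c') = 0)) \<or>
         (ar (seta s' 6 c 1) 6 c' \<noteq> 0 \<and> counts (set_decode c') (\<lambda>k. ar (seta s' 6 c 1) 5 (k * 2 ^ h + c')))"
      proof (cases "c' = c")
        case True
        have "(\<lambda>k. ar (seta s' 6 c 1) 5 (k * 2 ^ h + c')) = \<tau>"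
          using 2 True len by (auto simp: I_def \<tau>_def fun_eq_iff)
        then show ?thesis using cnt True by (simp add: C_def)
      next
        case False
        then show ?thesis using 2 s(3) c' unfolding tables_def I_def by simp
      qed
    qed
    show ?case
      by (rule runs_Put; (unfold e)?) (use ok' T 2 in \<open>auto simp: I_def\<close>)
  qed
  then show ?thesis
  proof (rule runs_mono)
    have "(hi - lo) * (1 + (1 + (1 + (1 + 1)))) \<le> b * (1 + (1 + (1 + (1 + 1))))"
      using l(2) len unfolding l_def by (intro mult_le_mono) auto
    then show "1 + (hi - lo) * (1 + (1 + (1 + (1 + 1)))) + 1 \<le> 2 + 5 * b" by simp
  qed
qed

definition attempt_steps :: "nat \<Rightarrow> nat" where
  "attempt_steps b = 1 + (1 + (1 + ((5 + h * (8 + b * (2 + 5 * n))) + (1 + (2 + 5 * b)))))"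

lemma runs_attempt:
  assumes s: "ok s" "ctx s" "tables s" and c: "vr s 13 = c" "c < 2 ^ h" and v: "vr s 14 = v" "v < h"
    and b: "vr s 10 = b" "1 \<le> b" "b \<le> 2 ^ (n * h)"
  shows "runs attempt s (attempt_steps b) (\<lambda>s'. ok s' \<and> ctx s' \<and> tables s' \<and>
     (\<forall>c'. ar s 6 c' \<noteq> 0 \<longrightarrow> ar s' 6 c' \<noteq> 0) \<and> (\<forall>i\<in>{10, 11, 12, 13, 14}. vr s' i = vr s i) \<and>
     (v \<in> set_decode c \<and> (\<forall>C'\<in>comps (set_decode c - {v}). ar s 6 (set_encode C') \<noteq> 0) \<and>
        (\<forall>u\<le>h. length (lay (insert v (nbr (set_decode c))) u) \<le> b) \<longrightarrow> ar s' 6 c \<noteq> 0))"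
proof -
  define Q where "Q s' \<longleftrightarrow> ok s' \<and> ctx s' \<and> tables s' \<and>
     (\<forall>c'. ar s 6 c' \<noteq> 0 \<longrightarrow> ar s' 6 c' \<noteq> 0) \<and> (\<forall>i\<in>{10, 11, 12, 13, 14}. vr s' i = vr s i) \<and>
     (v \<in> set_decode c \<and> (\<forall>C'\<in>comps (set_decode c - {v}). ar s 6 (set_encode C') \<noteq> 0) \<and>
        (\<forall>u\<le>h. length (lay (insert v (nbr (set_decode c))) u) \<le> b) \<longrightarrow> ar s' 6 c \<noteq> 0)" for s'
  have bit: "tr (bitE 13 14) s \<longleftrightarrow> v \<in> set_decode c" using c v by (simp add: tr_bitE del: neq0_conv)
  let ?s1 = "setv s 15 (c - 2 ^ v)"
  have "c - 2 ^ v \<le> B" using c(2) B(2) by linarith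
  then have ok1: "ok ?s1" using s(1) by (intro ok_setv_small)
  have ctx1: "ctx ?s1" using s(2) by simp
  have x: "c - 2 ^ v < 2 ^ h" using c(2) by linarith
  have "runs attempt s (1 + (1 + (1 + ((5 + h * (8 + b * (2 + 5 * n))) + (1 + (2 + 5 * b)))))) Q"
    unfolding attempt_def
  proof (rule runs_When)
    show "ok s" by (rule s)
    {
      assume "\<not> tr (And (bitE 13 14) (NOT (Arr 6 (V 13)))) s"
      then have "v \<notin> set_decode c \<or> ar s 6 c \<noteq> 0" using bit c by auto
      then show "Q s" using s by (auto simp: Q_def)
    }
    assume "tr (And (bitE 13 14) (NOT (Arr 6 (V 13)))) s"
    then have v': "v \<in> set_decode c" and g0: "ar s 6 c = 0" using bit c by auto
    have dx: "set_decode (c - 2 ^ v) = set_decode c - {v}" using v' by (rule set_decode_minus)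
    show "runs (seq [Assign 15 (V 13 \<ominus> pow2 14), When (goodE 15) (seq [list_bag, When (V 19) tabulate])]) s
      (1 + (1 + ((5 + h * (8 + b * (2 + 5 * n))) + (1 + (2 + 5 * b))))) Q"
      unfolding seq.simps
    proof (rule runs_Sq[where R = "\<lambda>s''. s'' = ?s1"], goal_cases)
      case 1
      have e: "ev (V 13 \<ominus> pow2 14) s = c - 2 ^ v" using c v by (simp add: ev_pow2)
      show ?case by (rule runs_Assign; (unfold e)?) (use s ok1 in auto)
    next
      case (2 s1)
      have good: "tr (goodE 15) ?s1 \<longleftrightarrow> (\<forall>C'\<in>comps (set_decode c - {v}). ar s 6 (set_encode C') \<noteq> 0)"
        using tr_goodE[OF ctx1, of 15] x dx by simp
      show ?case unfolding 2
      proof (rule runs_When)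
        show "ok ?s1" by (rule ok1)
        {
          assume "\<not> tr (goodE 15) ?s1"
          then show "Q ?s1" using good ok1 ctx1 s(3) tables_cong[of ?s1 s] by (auto simp: Q_def)
        }
        assume g: "tr (goodE 15) ?s1"
        define W where "W = insert v (nbr (set_decode c))"
        have fr: "frame ?s1 ?s1" using ok1 ctx1 by (simp add: frame_def)
        show "runs (Sq list_bag (When (V 19) tabulate)) ?s1 ((5 + h * (8 + b * (2 + 5 * n))) + (1 + (2 + 5 * b))) Q"
        proof (rule runs_Sq)
          have W2: "W = insert (vr ?s1 14) (nbr (dec ?s1 13))" using c v by (simp add: W_def)
          show "runs list_bag ?s1 (5 + h * (8 + b * (2 + 5 * n))) (\<lambda>s'. frame ?s1 s' \<and>
             (vr s' 19 \<noteq> 0 \<longrightarrow> vr s' 16 \<le> vr s' 17 \<and> vr s' 17 < 2 ^ B \<and> segment (ar s' 4) (vr s' 16) (vr s' 17) = lay W h \<and> length (lay W h) \<le> b) \<and>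
             (vr s' 19 = 0 \<longrightarrow> (\<exists>u\<le>h. b < length (lay W u))))"
            by (rule runs_list_bag[OF fr _ _ b(2,3) W2]) (use v b in auto)
        next
          fix s2 assume 6: "frame ?s1 s2 \<and>
             (vr s2 19 \<noteq> 0 \<longrightarrow> vr s2 16 \<le> vr s2 17 \<and> vr s2 17 < 2 ^ B \<and> segment (ar s2 4) (vr s2 16) (vr s2 17) = lay W h \<and> length (lay W h) \<le> b) \<and>
             (vr s2 19 = 0 \<longrightarrow> (\<exists>u\<le>h. b < length (lay W u)))"
          then have f2: "frame ?s1 s2" by blast
          note fd = frameD[OF f2]
          have vr2: "vr s2 10 = b" "vr s2 13 = c" "vr s2 14 = v" "vr s2 15 = c - 2 ^ v" "vr s2 11 = vr s 11" "vr s2 12 = vr s 12"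
            using fd b c v by simp_all
          have ar2: "ar s2 5 = ar s 5" "ar s2 6 = ar s 6" using fd by simp_all
          have T2: "tables s2" using tables_cong[OF ar2] s(3) by simp
          show "runs (When (V 19) tabulate) s2 (1 + (2 + 5 * b)) Q"
          proof (rule runs_When)
            show "ok s2" by (rule fd)
            {
              assume "\<not> tr (V 19) s2"
              then have "\<exists>u\<le>h. b < length (lay W u)" using 6 by simp
              then have "\<not> (\<forall>u\<le>h. length (lay W u) \<le> b)" by (meson not_le)
              then show "Q s2" using fd(1,2) T2 ar2 vr2 b(1) c(1) v(1) unfolding Q_def W_def[symmetric] by auto
            }
            assume "tr (V 19) s2"
            then have seg: "vr s2 17 < 2 ^ B" "segment (ar s2 4) (vr s2 16) (vr s2 17) = lay W h" "length (lay W h) \<le> b"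
              using 6 by simp_all
            have g2: "ar s2 6 c = 0" "\<forall>C'\<in>comps (set_decode c - {v}). ar s2 6 (set_encode C') \<noteq> 0"
              using g0 g good ar2 by simp_all
            from runs_tabulate[OF fd(1,2) T2 vr2(2) c(2) g2(1) vr2(3) v' vr2(4) W_def seg(2,3,1) g2(2)]
            show "runs tabulate s2 (2 + 5 * b) Q"
            proof (rule runs_mono)
              fix s' assume s': "ok s' \<and> ctx s' \<and> tables s' \<and> ar s' 6 c \<noteq> 0 \<and>
                (\<forall>c'. c' \<noteq> c \<longrightarrow> ar s' 6 c' = ar s2 6 c') \<and> (\<forall>i\<in>{10, 11, 12, 13, 14}. vr s' i = vr s2 i)"
              have "ar s' 6 c' \<noteq> 0" if "ar s 6 c' \<noteq> 0" for c' using s' that ar2 by (cases "c' = c") auto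
              then show "Q s'" using s' vr2 b c v unfolding Q_def by simp
            qed simp
          qed
        qed
      qed
    qed
  qed
  then show ?thesis unfolding attempt_steps_def Q_def .
qed

end

section \<open>The search over all sets and bounds\<close>

context algorithm
begin

definition pass_steps :: "nat \<Rightarrow> nat" where
  "pass_steps b = 1 + 2 ^ h * (1 + (1 + h * (1 + attempt_steps b)))"

definition search_steps :: "nat \<Rightarrow> nat" where
  "search_steps b = 1 + (n * h + 1) * (1 + (1 + (pass_steps b + (1 + (1 + 1)))))"

lemma pass_steps_mono: "b \<le> b' \<Longrightarrow> pass_steps b \<le> pass_steps b'"
  unfolding pass_steps_def attempt_steps_def by (intro add_mono mult_le_mono order_refl) auto

text \<open>The sets satisfying \<open>nice\<close> are those for which the vertex \<open>ch\<close> yields a small bag; in the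
  application they are read off a tree decomposition.\<close>

lemma runs_pass:
  assumes s: "ok s" "ctx s" "tables s" and b: "vr s 10 = b" "1 \<le> b" "b \<le> 2 ^ (n * h)"
    and nice: "\<And>C. nice C \<Longrightarrow> C \<subseteq> {..<h} \<and> ch C \<in> C \<and> (\<forall>C'\<in>comps (C - {ch C}). nice C') \<and>
       (\<forall>u\<le>h. length (lay (insert (ch C) (nbr C)) u) \<le> bound)"
  shows "runs (For 13 (V 3) (For 14 (V 1) attempt)) s (pass_steps b) (\<lambda>s'. ok s' \<and> ctx s' \<and> tables s' \<and>
     (\<forall>i\<in>{10, 11, 12}. vr s' i = vr s i) \<and>
     (bound \<le> b \<longrightarrow> (\<forall>c<2 ^ h. nice (set_decode c) \<longrightarrow> ar s' 6 c \<noteq> 0)))"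
proof -
  define I where "I c s' \<longleftrightarrow> ok s' \<and> ctx s' \<and> tables s' \<and> (\<forall>i\<in>{10, 11, 12}. vr s' i = vr s i) \<and>
     (bound \<le> b \<longrightarrow> (\<forall>c'<c. nice (set_decode c') \<longrightarrow> ar s' 6 c' \<noteq> 0))" for c s'
  define J where "J c v s' \<longleftrightarrow> I c s' \<and> vr s' 13 = c \<and>
     (bound \<le> b \<longrightarrow> nice (set_decode c) \<longrightarrow> ch (set_decode c) < v \<longrightarrow> ar s' 6 c \<noteq> 0)" for c v s'
  have tab: "tables (setv s' i x) = tables s'" for s' i x by (rule tables_cong) auto
  have step: "runs attempt (setv s' 14 v) (attempt_steps b) (J c (Suc v))"
    if c: "c < 2 ^ h" and v: "v < h" and J: "J c v s'" for c v s'
  proof -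
    let ?s = "setv s' 14 v"
    have ok: "ok ?s" using J v B(4) by (intro ok_setv_small) (auto simp: J_def I_def)
    have c1: "ctx ?s" "tables ?s" "vr ?s 13 = c" "vr ?s 14 = v" "vr ?s 10 = b"
      using J b by (auto simp: J_def I_def tab)
    from runs_attempt[OF ok c1(1,2,3) c c1(4) v c1(5) b(2,3)] show ?thesis
    proof (rule runs_mono)
      fix s2 assume s2: "ok s2 \<and> ctx s2 \<and> tables s2 \<and>
         (\<forall>c'. ar ?s 6 c' \<noteq> 0 \<longrightarrow> ar s2 6 c' \<noteq> 0) \<and> (\<forall>i\<in>{10, 11, 12, 13, 14}. vr s2 i = vr ?s i) \<and>
         (v \<in> set_decode c \<and> (\<forall>C'\<in>comps (set_decode c - {v}). ar ?s 6 (set_encode C') \<noteq> 0) \<and>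
            (\<forall>u\<le>h. length (lay (insert v (nbr (set_decode c))) u) \<le> b) \<longrightarrow> ar s2 6 c \<noteq> 0)"
      have keep: "ar s2 6 c' \<noteq> 0" if "ar s' 6 c' \<noteq> 0" for c' using s2 that by simp
      have "I c s2" using s2 J keep unfolding J_def I_def by simp
      moreover have "vr s2 13 = c" using s2 c1 by simp
      moreover have "ar s2 6 c \<noteq> 0" if n: "bound \<le> b" "nice (set_decode c)" "ch (set_decode c) < Suc v"
      proof (cases "ch (set_decode c) < v")
        case True
        then show ?thesis using keep J n unfolding J_def by blast
      next
        case False
        then have ch: "ch (set_decode c) = v" using n(3) by simp
        note N = nice[OF n(2), unfolded ch]
        have "ar s' 6 (set_encode C') \<noteq> 0" if C': "C' \<in> comps (set_decode c - {v})" for C'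
        proof -
          have sub: "C' \<subseteq> set_decode c - {v}" using C' by (rule comps_subset)
          then have fin: "C' \<subseteq> {..<h}" using N by blast
          have dec: "set_decode (set_encode C') = C'" using fin by (rule set_decode_encode)
          \<comment> \<open>A proper subset has a smaller mask. Processing the masks in increasing
            order thus finishes the components before the set itself, and one pass with a sufficient
            bound completes all sets satisfying \<open>nice\<close>.\<close>
          have "set_encode C' \<le> c" using sub dec by (intro subset_decode_imp_le) auto
          moreover have "set_encode C' \<noteq> c" using sub dec N by auto
          ultimately have "set_encode C' < c" by simp
          moreover have "nice (set_decode (set_encode C'))" using N C' dec by simp
          ultimately show ?thesis using J n(1) unfolding J_def I_def by blast
        qed
        moreover have "\<forall>u\<le>h. length (lay (insert v (nbr (set_decode c))) u) \<le> b"
          using N n(1) order_trans by blast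
        ultimately show ?thesis using s2 N by simp
      qed
      ultimately show "J c (Suc v) s2" unfolding J_def by blast
    qed simp
  qed
  have row: "runs (For 14 (V 1) attempt) (setv s' 13 c) (1 + h * (1 + attempt_steps b)) (I (Suc c))"
    if c: "c < 2 ^ h" and I: "I c s'" for c s'
  proof (rule runs_For[where I = "J c"])
    have "c \<le> B" using c B(2) by linarith
    then show ok: "ok (setv s' 13 c)" using I by (intro ok_setv_small) (auto simp: I_def)
    show "ev (V 1) (setv s' 13 c) = h" using I by (intro ev_V_ctx) (simp add: I_def)
    show "J c 0 (setv s' 13 c)" using I ok by (simp add: J_def I_def tab)
    fix v s2 assume vJ: "v < h" "J c v s2"
    have "ok s2" using vJ(2) by (simp add: J_def I_def)
    with step[OF c vJ] show "ok s2 \<and> runs attempt (setv s2 14 v) (attempt_steps b) (J c (Suc v))" by blast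
  next
    fix s2 assume J: "J c h s2"
    have "ch (set_decode c) < h" if "nice (set_decode c)" using nice[OF that] by auto
    then show "I (Suc c) s2" using J unfolding J_def I_def by (auto simp: less_Suc_eq)
  qed
  have "runs (For 13 (V 3) (For 14 (V 1) attempt)) s (1 + 2 ^ h * (1 + (1 + h * (1 + attempt_steps b)))) (I (2 ^ h))"
  proof (rule runs_For[where I = I])
    show "ev (V 3) s = 2 ^ h" using s(2) by (rule ev_V_ctx)
    show "I 0 s" using s by (simp add: I_def)
    fix c s' assume cI: "c < 2 ^ h" "I c s'"
    have "ok s'" using cI(2) by (simp add: I_def)
    with row[OF cI] show "ok s' \<and> runs (For 14 (V 1) attempt) (setv s' 13 c) (1 + h * (1 + attempt_steps b)) (I (Suc c))"
      by blast
  qed (use s in auto)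
  then show ?thesis unfolding pass_steps_def by (rule runs_mono) (auto simp: I_def)
qed

text \<open>A round whose limit is at least \<open>bound\<close> succeeds. The limit of any round
  that is really carried out is hence at most \<open>2 * bound\<close>, which explains the argument
  of \<open>search_steps\<close>, and the upper limit on \<open>bound\<close> guarantees success
  within the allotted rounds.\<close>

lemma runs_search:
  assumes s: "ok s" "ctx s" "tables s" "vr s 10 = 1" "vr s 11 = 0"
    and nice: "\<And>C. nice C \<Longrightarrow> C \<subseteq> {..<h} \<and> ch C \<in> C \<and> (\<forall>C'\<in>comps (C - {ch C}). nice C') \<and>
       (\<forall>u\<le>h. length (lay (insert (ch C) (nbr C)) u) \<le> bound)"
    and root: "\<And>C. C \<in> comps {..<h} \<Longrightarrow> nice C" and bound: "1 \<le> bound" "bound \<le> 2 ^ (n * h)"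
  shows "runs search s (search_steps (2 * bound)) (\<lambda>s'. ok s' \<and> ctx s' \<and> tables s' \<and>
     (\<forall>C\<in>comps {..<h}. ar s' 6 (set_encode C) \<noteq> 0))"
proof -
  have tab: "tables (setv s' i x) = tables s'" for s' i x by (rule tables_cong) auto
  have one: "1 < (2 :: nat) ^ B" using less_B[of 1] B(1) by simp
  \<comment> \<open>While variable 11 is 0, the previous round has failed, so its limit
    \<open>2 ^ (t - 1)\<close> was still below \<open>bound\<close>.\<close>
  define I where "I t s' \<longleftrightarrow> ok s' \<and> ctx s' \<and> tables s' \<and>
     (vr s' 11 \<noteq> 0 \<and> (\<forall>C\<in>comps {..<h}. ar s' 6 (set_encode C) \<noteq> 0) \<or>
      vr s' 11 = 0 \<and> vr s' 10 = 2 ^ t \<and> (t = 0 \<or> 2 ^ (t - 1) < bound))" for t s'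
  define body where "body = seq [For 13 (V 3) (For 14 (V 1) attempt),
     Assign 15 (V 3 \<ominus> N 1), Assign 11 (Nz (goodE 15)), Assign 10 (V 10 \<oplus> V 10)]"
  have step: "runs (When (NOT (V 11)) body) (setv s' 12 t) (1 + (pass_steps (2 * bound) + (1 + (1 + 1)))) (I (Suc t))"
    if t: "t < n * h + 1" and I: "I t s'" for t s'
  proof (rule runs_When)
    let ?s = "setv s' 12 t"
    have "t \<le> B" using t B(1) by linarith
    then show ok: "ok ?s" using I by (intro ok_setv_small) (auto simp: I_def)
    {
      assume "\<not> tr (NOT (V 11)) ?s"
      then show "I (Suc t) ?s" using I ok by (auto simp: I_def tab)
    }
    assume "tr (NOT (V 11)) ?s"
    then have 11: "vr s' 11 = 0" by simp
    then have 10: "vr ?s 10 = 2 ^ t" "t = 0 \<or> 2 ^ (t - 1) < bound" using I by (auto simp: I_def)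
    have b: "(1 :: nat) \<le> 2 ^ t" "(2 :: nat) ^ t \<le> 2 ^ (n * h)" using t by (auto intro: power_increasing)
    have b2: "2 ^ t \<le> 2 * bound" using 10(2) bound(1) by (cases t) auto
    have c: "ctx ?s" "tables ?s" using I by (auto simp: I_def tab)
    have "runs body ?s (pass_steps (2 ^ t) + (1 + (1 + 1))) (I (Suc t))"
      unfolding body_def seq.simps
    proof (rule runs_Sq[OF runs_pass[OF ok c 10(1) b nice]], goal_cases)
      case (1 C)
      then show ?case .
    next
      case (2 s1)
      have g: "bound \<le> 2 ^ t \<longrightarrow> (\<forall>c<2 ^ h. nice (set_decode c) \<longrightarrow> ar s1 6 c \<noteq> 0)" using 2 by blast
      have s1: "ok s1" "ctx s1" "tables s1" "vr s1 10 = 2 ^ t" "vr s1 11 = 0" using 2 10 11 by auto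
      let ?s2 = "setv s1 15 (2 ^ h - 1)"
      have hB: "(2 :: nat) ^ h - 1 \<le> B" using B(2) by linarith
      have ok2: "ok ?s2" by (rule ok_setv_small[OF s1(1) hB])
      have c2: "ctx ?s2" using s1(2) by simp
      define G where "G \<longleftrightarrow> (\<forall>C\<in>comps {..<h}. ar s1 6 (set_encode C) \<noteq> 0)"
      let ?s3 = "setv ?s2 11 (of_bool G)"
      have ok3: "ok ?s3" by (rule ok_setv[OF ok2]) (use one in \<open>auto simp: small_vars_iff\<close>)
      let ?s4 = "setv ?s3 10 (2 ^ Suc t)"
      have "(2 :: nat) ^ Suc t < 2 ^ B" using t B(1) by (intro power_strict_increasing) auto
      then have ok4: "ok ?s4" by (intro ok_setv[OF ok3]) (auto simp: small_vars_iff)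
      have I4: "I (Suc t) ?s4"
      proof (cases G)
        case True
        then show ?thesis using ok4 s1 by (simp add: I_def tab G_def)
      next
        case False
        have "2 ^ t < bound"
        proof (rule ccontr)
          assume "\<not> 2 ^ t < bound"
          then have le: "bound \<le> 2 ^ t" by simp
          have "ar s1 6 (set_encode C) \<noteq> 0" if C: "C \<in> comps {..<h}" for C
          proof -
            have sub: "C \<subseteq> {..<h}" using C by (rule comps_subset)
            have "nice (set_decode (set_encode C))" using root[OF C] set_decode_encode[OF sub] by simp
            then show ?thesis using g le set_encode_less[OF sub] by blast
          qed
          then show False using False G_def by blast
        qed
        then show ?thesis using ok4 s1 False by (simp add: I_def tab)
      qed
      show ?case
      proof (rule runs_Sq[where R = "\<lambda>s''. s'' = ?s2"], goal_cases)
        case 1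
        have e: "ev (V 3 \<ominus> N 1) s1 = 2 ^ h - 1" using ev_V_ctx(3)[OF s1(2)] by simp
        show ?case by (rule runs_Assign; (unfold e)?) (use s1 ok2 in auto)
      next
        case (2 s2)
        show ?case unfolding 2
        proof (rule runs_Sq[where R = "\<lambda>s''. s'' = ?s3"], goal_cases)
          case 1
          have "tr (goodE 15) ?s2 \<longleftrightarrow> G"
            using tr_goodE[OF c2, of 15] set_decode_full[of h] unfolding G_def by simp
          then have e: "ev (Nz (goodE 15)) ?s2 = of_bool G" by simp
          show ?case by (rule runs_Assign; (unfold e)?) (use ok2 ok3 in auto)
        next
          case (2 s3)
          have e: "ev (V 10 \<oplus> V 10) ?s3 = 2 ^ Suc t" using s1 by simp
          show ?case unfolding 2 by (rule runs_Assign; (unfold e)?) (use ok3 ok4 I4 in auto)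
        qed
      qed
    qed
    then show "runs body ?s (pass_steps (2 * bound) + (1 + (1 + 1))) (I (Suc t))"
      by (rule runs_mono) (use pass_steps_mono[OF b2] in auto)
  qed
  have "runs search s (1 + (n * h + 1) * (1 + (1 + (pass_steps (2 * bound) + (1 + (1 + 1)))))) (I (n * h + 1))"
    unfolding search_def body_def[symmetric]
  proof (rule runs_For[where I = I])
    show "ev (V 2 \<otimes> V 1 \<oplus> N 1) s = n * h + 1" using ev_V_ctx[OF s(2)] by simp
    show "I 0 s" using s by (simp add: I_def)
    fix t s' assume tI: "t < n * h + 1" "I t s'"
    have "ok s'" using tI(2) by (simp add: I_def)
    with step[OF tI] show "ok s' \<and> runs (When (NOT (V 11)) body) (setv s' 12 t)
        (1 + (pass_steps (2 * bound) + (1 + (1 + 1)))) (I (Suc t))" by blast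
  qed (use s in auto)
  then show ?thesis unfolding search_steps_def
  proof (rule runs_mono)
    fix s' assume I: "I (n * h + 1) s'"
    have "vr s' 11 \<noteq> 0"
    proof
      assume "vr s' 11 = 0"
      then have "2 ^ (n * h) < bound" using I by (auto simp: I_def)
      then show False using bound(2) by simp
    qed
    then show "ok s' \<and> ctx s' \<and> tables s' \<and> (\<forall>C\<in>comps {..<h}. ar s' 6 (set_encode C) \<noteq> 0)"
      using I by (auto simp: I_def)
  qed simp
qed

definition total_steps :: "nat \<Rightarrow> nat" where
  "total_steps b = 1 + ((3 + h * (6 + 2 * h)) + ((3 + n * (6 + 2 * n)) + (1 + (1 +
     ((2 + h * (2 + 2 * h) + L * (2 + h * (2 + 2 * h))) + ((2 + n * (2 + 2 * n) + L * (2 + n * (2 + 2 * n))) +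
     (1 + (search_steps (2 * b) + (1 + (1 + 1))))))))))"

theorem runs_count_homs:
  assumes xs: "xs = (h # blocks nbH h) @ (n # blocks nbG n)" and Lh: "L = h * h"
    and nbH: "\<And>u. u < h \<Longrightarrow> set (nbH u) = {v. EH u v} \<and> length (nbH u) \<le> h"
    and nbG: "\<And>u. u < n \<Longrightarrow> set (nbG u) = {v. EG u v} \<and> length (nbG u) \<le> n"
    and nice: "\<And>C. nice C \<Longrightarrow> C \<subseteq> {..<h} \<and> ch C \<in> C \<and> (\<forall>C'\<in>comps (C - {ch C}). nice C') \<and>
       (\<forall>u\<le>h. length (lay (insert (ch C) (nbr C)) u) \<le> bound)"
    and root: "\<And>C. C \<in> comps {..<h} \<Longrightarrow> nice C" and bound: "1 \<le> bound" "bound \<le> 2 ^ (n * h)"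
  shows "runs count_homs (init_state xs) (total_steps bound) (\<lambda>s. vr s 0 = card {a \<in> asg n {..<h}. hom a})"
proof -
  have z: "bits 0 = 0" using bits_le[of 0] by simp
  have one: "1 < (2 :: nat) ^ B" using less_B[of 1] B(1) by simp
  define s0 where "s0 = init_state xs"
  have v0: "vr s0 i = (if i = 0 then length xs else 0)" "ar s0 g j = 0" for i g j
    by (auto simp: s0_def init_state_def vr_def ar_def)
  have ok0: "ok s0"
    using bounded_input by (auto simp: ok_def bounded_def bounded_vars_def bounded_mem_def s0_def init_state_def z small_vars_iff)
  let ?s1 = "setv s0 5 0"
  have ok1: "ok ?s1" by (rule ok_setv_small[OF ok0]) simp
  define R2 where "R2 s \<longleftrightarrow> ok s \<and> vr s 1 = h \<and> vr s 5 = Suc (length (blocks nbH h)) \<and>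
     (\<forall>u v. u < h \<longrightarrow> v < h \<longrightarrow> ar s 0 (u * h + v) = of_bool (EH u v)) \<and> (\<forall>g j. g \<noteq> 0 \<longrightarrow> ar s g j = 0) \<and> vr s 11 = 0" for s
  define R3 where "R3 s \<longleftrightarrow> ok s \<and> vr s 1 = h \<and> vr s 2 = n \<and>
     (\<forall>u v. u < h \<longrightarrow> v < h \<longrightarrow> ar s 0 (u * h + v) = of_bool (EH u v)) \<and>
     (\<forall>u v. u < n \<longrightarrow> v < n \<longrightarrow> ar s 1 (u * n + v) = of_bool (EG u v)) \<and> (\<forall>g j. g \<notin> {0, 1} \<longrightarrow> ar s g j = 0) \<and> vr s 11 = 0" for s
  define R5 where "R5 s \<longleftrightarrow> R3 s \<and> vr s 3 = 2 ^ h \<and> vr s 4 = L" for s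
  define R6 where "R6 s \<longleftrightarrow> ok s \<and> vr s 1 = h \<and> vr s 2 = n \<and>
     (\<forall>u v. u < h \<longrightarrow> v < h \<longrightarrow> ar s 0 (u * h + v) = of_bool (EH u v)) \<and>
     (\<forall>u v. u < n \<longrightarrow> v < n \<longrightarrow> ar s 1 (u * n + v) = of_bool (EG u v)) \<and>
     (\<forall>u v. u < h \<longrightarrow> v < h \<longrightarrow> ar s 3 (idx h L u v) = of_bool (rH u v)) \<and>
     (\<forall>g j. g \<notin> {0, 1, 3} \<longrightarrow> ar s g j = 0) \<and> vr s 11 = 0 \<and> vr s 3 = 2 ^ h \<and> vr s 4 = L" for s
  define R7 where "R7 s \<longleftrightarrow> ok s \<and> ctx s \<and> (\<forall>g j. g \<in> {5, 6} \<longrightarrow> ar s g j = 0) \<and> vr s 11 = 0" for s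
  define R9 where "R9 s \<longleftrightarrow> ok s \<and> ctx s \<and> tables s \<and> (\<forall>C\<in>comps {..<h}. ar s 6 (set_encode C) \<noteq> 0)" for s
  have p1: "runs (parse 0 1) ?s1 (3 + h * (6 + 2 * h)) R2"
  proof -
    have R: "vr ?s1 5 = length ([] :: nat list)" "\<And>j. ar ?s1 0 j = 0" by (simp_all add: v0)
    have "runs (parse 0 1) ?s1 (3 + h * (6 + 2 * h)) (\<lambda>s'. ok s' \<and> vr s' 1 = h \<and>
     vr s' 5 = length ([] :: nat list) + Suc (length (blocks nbH h)) \<and>
     (\<forall>u v. u < h \<longrightarrow> v < h \<longrightarrow> ar s' 0 (u * h + v) = of_bool (v \<in> set (nbH u))) \<and>
     (\<forall>i. i \<notin> {1, 5, 6, 7, 8} \<longrightarrow> vr s' i = vr ?s1 i) \<and> (\<forall>g'. g' \<noteq> 0 \<longrightarrow> ar s' g' = ar ?s1 g'))"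
    proof (rule runs_parse[OF _ _ ok1 R])
      show "xs = [] @ (h # blocks nbH h) @ n # blocks nbG n" using xs by simp
      show "set (nbH u) \<subseteq> {..<h} \<and> length (nbH u) \<le> h" if "u < h" for u using nbH[OF that] EH by auto
    qed (use B in auto)
    then show ?thesis
      by (rule runs_mono) (use nbH v0 in \<open>auto simp: R2_def\<close>)
  qed
  have p2: "runs (parse 1 2) s (3 + n * (6 + 2 * n)) R3" if "R2 s" for s
  proof -
    have R: "ok s" "vr s 5 = length (h # blocks nbH h)" "\<And>j. ar s 1 j = 0" using that by (auto simp: R2_def)
    have "runs (parse 1 2) s (3 + n * (6 + 2 * n)) (\<lambda>s'. ok s' \<and> vr s' 2 = n \<and>
     vr s' 5 = length (h # blocks nbH h) + Suc (length (blocks nbG n)) \<and>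
     (\<forall>u v. u < n \<longrightarrow> v < n \<longrightarrow> ar s' 1 (u * n + v) = of_bool (v \<in> set (nbG u))) \<and>
     (\<forall>i. i \<notin> {2, 5, 6, 7, 8} \<longrightarrow> vr s' i = vr s i) \<and> (\<forall>g'. g' \<noteq> 1 \<longrightarrow> ar s' g' = ar s g'))"
    proof (rule runs_parse[OF _ _ R])
      show "xs = (h # blocks nbH h) @ (n # blocks nbG n) @ []" using xs by simp
      show "set (nbG u) \<subseteq> {..<n} \<and> length (nbG u) \<le> n" if "u < n" for u using nbG[OF that] EG by auto
    qed (use B in auto)
    then show ?thesis
      by (rule runs_mono) (use that nbG in \<open>auto simp: R2_def R3_def\<close>)
  qed
  have p3: "runs (Assign 3 (pow2 1)) s 1 (\<lambda>s. R3 s \<and> vr s 3 = 2 ^ h)" if "R3 s" for s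
  proof -
    have e: "ev (pow2 1) s = 2 ^ h" using that by (simp add: ev_pow2 R3_def)
    have "ok s" "ok (setv s 3 (2 ^ h))" using that B(2) by (auto simp: R3_def intro: ok_setv_small)
    then show ?thesis by (intro runs_Assign; (unfold e)?) (use that in \<open>auto simp: R3_def\<close>)
  qed
  have p4: "runs (Assign 4 (V 1 \<otimes> V 1)) s 1 R5" if "R3 s \<and> vr s 3 = 2 ^ h" for s
  proof -
    have e: "ev (V 1 \<otimes> V 1) s = L" using that Lh by (simp add: R3_def)
    have "ok s" "ok (setv s 4 L)" using that B(5) by (auto simp: R3_def intro: ok_setv_small)
    then show ?thesis by (intro runs_Assign; (unfold e)?) (use that in \<open>auto simp: R3_def R5_def\<close>)
  qed
  have p5: "runs (closure 0 3 1) s (2 + h * (2 + 2 * h) + L * (2 + h * (2 + 2 * h))) R6" if "R5 s" for s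
  proof -
    have "ok s" "vr s 1 = h" "vr s 4 = L" "\<And>u v. u < h \<Longrightarrow> v < h \<Longrightarrow> ar s 0 (u * h + v) = of_bool (EH u v)"
      using that by (auto simp: R5_def R3_def)
    from runs_closure[OF this B(4,5), of 3] show ?thesis
      by (rule runs_mono) (use that in \<open>auto simp: R3_def R5_def R6_def\<close>)
  qed
  have p6: "runs (closure 1 2 2) s (2 + n * (2 + 2 * n) + L * (2 + n * (2 + 2 * n))) R7" if "R6 s" for s
  proof -
    have "ok s" "vr s 2 = n" "vr s 4 = L" "\<And>u v. u < n \<Longrightarrow> v < n \<Longrightarrow> ar s 1 (u * n + v) = of_bool (EG u v)"
      using that by (auto simp: R6_def)
    from runs_closure[OF this B(3,5), of 2] show ?thesis
      by (rule runs_mono) (use that in \<open>auto simp: R6_def R7_def ctx_def\<close>)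
  qed
  have p7: "runs (Assign 10 (N 1)) s 1 (\<lambda>s. R7 s \<and> vr s 10 = 1)" if "R7 s" for s
  proof -
    have "ok s" "ok (setv s 10 1)" using that B(1) by (auto simp: R7_def intro: ok_setv_small)
    then show ?thesis by (intro runs_Assign) (use that in \<open>auto simp: R7_def\<close>)
  qed
  have p8: "runs search s (search_steps (2 * bound)) R9" if "R7 s \<and> vr s 10 = 1" for s
  proof -
    have "ok s" "ctx s" "tables s" "vr s 10 = 1" "vr s 11 = 0" using that by (auto simp: R7_def tables_def)
    from runs_search[OF this nice root bound] show ?thesis unfolding R9_def[abs_def] by simp
  qed
  have p9: "runs (seq [Assign 15 (V 3 \<ominus> N 1), Assign 23 (N 0), Assign 0 (prodE 15 23)]) s (1 + (1 + 1))
      (\<lambda>s. vr s 0 = card {a \<in> asg n {..<h}. hom a})" if R: "R9 s" for s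
  proof -
    define r where "r = card {a \<in> asg n {..<h}. hom a}"
    let ?s2 = "setv s 15 (2 ^ h - 1)" let ?s3 = "setv ?s2 23 0" let ?s4 = "setv ?s3 0 r"
    have s: "ok s" "ctx s" "tables s" using R by (auto simp: R9_def)
    have hB: "(2 :: nat) ^ h - 1 \<le> B" using B(2) by linarith
    have ok2: "ok ?s2" by (rule ok_setv_small[OF s(1) hB])
    have ok3: "ok ?s3" by (rule ok_setv_small[OF ok2]) simp
    have c3: "ctx ?s3" using s(2) by simp
    have "r \<le> card (asg n {..<h})" unfolding r_def by (rule card_mono) (auto intro: finite_asg)
    also have "\<dots> \<le> n ^ h" using card_asg_le[of "{..<h}" n] by simp
    also have "\<dots> \<le> 2 ^ (n * h)" by (rule pow_n_le)
    also have "\<dots> < 2 ^ B" using B(1) by (intro power_strict_increasing) auto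
    finally have ok4: "ok ?s4" by (intro ok_setv[OF ok3]) (auto simp: small_vars_iff)
    have "ev (prodE 15 23) ?s3 = (\<Prod>C\<in>comps {..<h}. table ?s3 C (code' (restr (decode' 0) (nbr C))))"
      using ev_prodE[OF c3, of 15 23] set_decode_full[of h] by simp
    also have "\<dots> = (\<Prod>C\<in>comps {..<h}. table s C 0)"
    proof (rule prod.cong[OF refl])
      fix C assume C: "C \<in> comps {..<h}"
      have "restr (decode' 0) (nbr C) = (\<lambda>_. 0)" by (auto simp: restr_def decode_def)
      then show "table ?s3 C (code' (restr (decode' 0) (nbr C))) = table s C 0" by (simp add: table_def)
    qed
    also have "\<dots> = r" unfolding r_def
    proof (rule counts_homs)
      fix C assume C: "C \<in> comps {..<h}"
      have sub: "C \<subseteq> {..<h}" using C by (rule comps_subset)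
      have "counts (set_decode (set_encode C)) (\<lambda>k. ar s 5 (k * 2 ^ h + set_encode C))"
        by (rule tablesD(1)[OF s(3) set_encode_less[OF sub]]) (use R C in \<open>simp add: R9_def\<close>)
      then show "counts C (table s C)" by (simp add: set_decode_encode[OF sub] table_def[abs_def])
    qed
    finally have e3: "ev (prodE 15 23) ?s3 = r" .
    show ?thesis unfolding seq.simps
    proof (rule runs_Sq[where R = "\<lambda>s''. s'' = ?s2"], goal_cases)
      case 1
      have e: "ev (V 3 \<ominus> N 1) s = 2 ^ h - 1" using ev_V_ctx(3)[OF s(2)] by simp
      show ?case by (rule runs_Assign; (unfold e)?) (use s ok2 in auto)
    next
      case (2 s2)
      show ?case unfolding 2
      proof (rule runs_Sq[where R = "\<lambda>s''. s'' = ?s3"], goal_cases)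
        case 1
        show ?case by (rule runs_Assign) (use ok2 ok3 in auto)
      next
        case (2 s3)
        show ?case unfolding 2 by (rule runs_Assign; (unfold e3)?) (use ok3 ok4 in \<open>auto simp: r_def\<close>)
      qed
    qed
  qed
  have p0: "runs (Assign 5 (N 0)) s0 1 (\<lambda>s. s = ?s1)" by (rule runs_Assign) (use ok0 ok1 in auto)
  have p1': "runs (parse 0 1) s (3 + h * (6 + 2 * h)) R2" if "s = ?s1" for s using p1 that by simp
  show ?thesis
    unfolding count_homs_def total_steps_def s0_def[symmetric] seq.simps(1,2)
    by (rule runs_Sq, rule p0, rule runs_Sq, erule p1', rule runs_Sq, erule p2, rule runs_Sq, erule p3,
      rule runs_Sq, erule p4, rule runs_Sq, erule p5, rule runs_Sq, erule p6, rule runs_Sq, erule p7,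
      rule runs_Sq, erule p8, erule p9[unfolded seq.simps(1,2)])
qed

end

section \<open>The size of the tables\<close>

text \<open>Hoelder's inequality for exponents whose sum is at least 1 instead of equal to 1. After
  dividing each function by its sum, the weighted inequality of arithmetic and geometric means
  applies with weights \<open>\<gamma> e / \<Gamma>\<close>, and raising the exponents to
  \<open>\<gamma> e\<close> only decreases powers of numbers that are at most 1.\<close>

lemma generalized_Hoelder:
  fixes z :: "'e \<Rightarrow> 'x \<Rightarrow> real"
  assumes E: "finite E" "\<And>e. e \<in> E \<Longrightarrow> 0 \<le> \<gamma> e" "1 \<le> (\<Sum>e\<in>E. \<gamma> e)"
    and X: "finite X" "\<And>e x. e \<in> E \<Longrightarrow> x \<in> X \<Longrightarrow> 0 < z e x"
  shows "(\<Sum>x\<in>X. \<Prod>e\<in>E. z e x powr \<gamma> e) \<le> (\<Prod>e\<in>E. (\<Sum>x\<in>X. z e x) powr \<gamma> e)"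
proof (cases "X = {}")
  case True
  then show ?thesis by (simp add: prod_nonneg)
next
  case False
  define Z where "Z e = (\<Sum>x\<in>X. z e x)" for e
  define \<Gamma> where "\<Gamma> = (\<Sum>e\<in>E. \<gamma> e)"
  define p where "p e x = z e x / Z e" for e x
  have Z: "0 < Z e" if "e \<in> E" for e unfolding Z_def using X that False by (intro sum_pos) auto
  have p: "0 < p e x" "p e x \<le> 1" if "e \<in> E" "x \<in> X" for e x
  proof -
    show "0 < p e x" using Z X(2) that by (simp add: p_def)
    have "z e x \<le> Z e" unfolding Z_def using X that by (intro member_le_sum) (auto intro: less_imp_le)
    then show "p e x \<le> 1" using Z[OF that(1)] by (simp add: p_def)
  qed
  have \<Gamma>: "1 \<le> \<Gamma>" using E(3) by (simp add: \<Gamma>_def)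
  have point: "(\<Prod>e\<in>E. p e x powr \<gamma> e) \<le> (\<Sum>e\<in>E. \<gamma> e / \<Gamma> * p e x)" if x: "x \<in> X" for x
  proof -
    define S where "S = (\<Sum>e\<in>E. \<gamma> e / \<Gamma> * p e x)"
    have "\<exists>e\<in>E. 0 < \<gamma> e"
    proof (rule ccontr)
      assume "\<not> (\<exists>e\<in>E. 0 < \<gamma> e)"
      then have "\<Gamma> \<le> 0" unfolding \<Gamma>_def by (intro sum_nonpos) (auto simp: not_less)
      then show False using \<Gamma> by simp
    qed
    then obtain e0 where e0: "e0 \<in> E" "0 < \<gamma> e0" by blast
    have nn: "0 \<le> \<gamma> e / \<Gamma> * p e x" if "e \<in> E" for e using E(2)[OF that] p[OF that x] \<Gamma> by simp
    have "\<gamma> e0 / \<Gamma> * p e0 x \<le> S" unfolding S_def using E(1) e0 nn by (intro member_le_sum) auto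
    moreover have "0 < \<gamma> e0 / \<Gamma> * p e0 x" using e0 p[OF e0(1) x] \<Gamma> by simp
    ultimately have S: "0 < S" by linarith
    have w: "(\<Sum>e\<in>E. \<gamma> e / \<Gamma>) = 1" using \<Gamma> by (simp add: sum_divide_distrib[symmetric] \<Gamma>_def[symmetric])
    \<comment> \<open>The inequality of the means in logarithmic form, obtained from
      \<open>ln t \<le> t - 1\<close> at \<open>t = p e x / S\<close>, where \<open>S\<close> is the
      arithmetic mean.\<close>
    have "(\<Sum>e\<in>E. \<gamma> e / \<Gamma> * ln (p e x / S)) \<le> (\<Sum>e\<in>E. \<gamma> e / \<Gamma> * (p e x / S - 1))"
    proof (rule sum_mono)
      fix e assume e: "e \<in> E"
      have "ln (p e x / S) \<le> p e x / S - 1" using p[OF e x] S by (intro ln_le_minus_one) simp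
      then show "\<gamma> e / \<Gamma> * ln (p e x / S) \<le> \<gamma> e / \<Gamma> * (p e x / S - 1)"
        using E(2)[OF e] \<Gamma> by (intro mult_left_mono) auto
    qed
    also have "\<dots> = (\<Sum>e\<in>E. \<gamma> e / \<Gamma> * p e x) / S - (\<Sum>e\<in>E. \<gamma> e / \<Gamma>)"
      by (simp add: right_diff_distrib sum_subtractf sum_divide_distrib)
    also have "\<dots> = S / S - 1" by (simp only: w S_def[symmetric])
    also have "\<dots> = 0" using S by simp
    finally have "(\<Sum>e\<in>E. \<gamma> e / \<Gamma> * ln (p e x / S)) \<le> 0" .
    moreover have "(\<Sum>e\<in>E. \<gamma> e / \<Gamma> * ln (p e x / S)) = (\<Sum>e\<in>E. \<gamma> e / \<Gamma> * (ln (p e x) - ln S))"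
    proof (rule sum.cong[OF refl])
      fix e assume "e \<in> E"
      then have "ln (p e x / S) = ln (p e x) - ln S" using p(1) x S by (intro ln_divide_pos) auto
      then show "\<gamma> e / \<Gamma> * ln (p e x / S) = \<gamma> e / \<Gamma> * (ln (p e x) - ln S)" by simp
    qed
    ultimately have "(\<Sum>e\<in>E. \<gamma> e / \<Gamma> * (ln (p e x) - ln S)) \<le> 0" by simp
    then have "(\<Sum>e\<in>E. \<gamma> e / \<Gamma> * ln (p e x)) - (\<Sum>e\<in>E. \<gamma> e / \<Gamma>) * ln S \<le> 0"
      by (simp add: right_diff_distrib sum_subtractf sum_distrib_right)
    then have 1: "(\<Sum>e\<in>E. \<gamma> e / \<Gamma> * ln (p e x)) \<le> ln S" using w by simp
    \<comment> \<open>Here \<open>1 \<le> \<Gamma>\<close> enters: the logarithms are not positive,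
      so replacing the normalised weight by the larger one decreases the sum.\<close>
    have 2: "(\<Sum>e\<in>E. \<gamma> e * ln (p e x)) \<le> (\<Sum>e\<in>E. \<gamma> e / \<Gamma> * ln (p e x))"
    proof (rule sum_mono)
      fix e assume e: "e \<in> E"
      have "ln (p e x) \<le> 0" using p[OF e x] by simp
      moreover have "\<gamma> e / \<Gamma> \<le> \<gamma> e" using E(2)[OF e] \<Gamma> by (simp add: divide_le_eq mult_le_cancel_left1)
      ultimately show "\<gamma> e * ln (p e x) \<le> \<gamma> e / \<Gamma> * ln (p e x)" by (rule mult_right_mono_neg[rotated])
    qed
    have "(\<Prod>e\<in>E. p e x powr \<gamma> e) = (\<Prod>e\<in>E. exp (\<gamma> e * ln (p e x)))"
    proof (rule prod.cong[OF refl])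
      fix e assume "e \<in> E"
      then have "p e x \<noteq> 0" using p(1) x by force
      then show "p e x powr \<gamma> e = exp (\<gamma> e * ln (p e x))" by (simp add: powr_def)
    qed
    also have "\<dots> = exp (\<Sum>e\<in>E. \<gamma> e * ln (p e x))" using E(1) by (simp add: exp_sum)
    also have "\<dots> \<le> exp (ln S)" using 1 2 by simp
    finally show ?thesis using S by (simp add: S_def)
  qed
  have fac: "(\<Prod>e\<in>E. z e x powr \<gamma> e) = (\<Prod>e\<in>E. Z e powr \<gamma> e) * (\<Prod>e\<in>E. p e x powr \<gamma> e)" if x: "x \<in> X" for x
  proof -
    have "(\<Prod>e\<in>E. z e x powr \<gamma> e) = (\<Prod>e\<in>E. Z e powr \<gamma> e * p e x powr \<gamma> e)"
    proof (rule prod.cong[OF refl])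
      fix e assume e: "e \<in> E"
      have "z e x = Z e * p e x" using Z[OF e] by (simp add: p_def)
      then show "z e x powr \<gamma> e = Z e powr \<gamma> e * p e x powr \<gamma> e"
        using Z[OF e] p[OF e x] by (simp add: powr_mult)
    qed
    then show ?thesis by (simp add: prod.distrib)
  qed
  have "(\<Sum>x\<in>X. \<Prod>e\<in>E. z e x powr \<gamma> e) = (\<Prod>e\<in>E. Z e powr \<gamma> e) * (\<Sum>x\<in>X. \<Prod>e\<in>E. p e x powr \<gamma> e)"
    using fac by (simp add: sum_distrib_left)
  also have "\<dots> \<le> (\<Prod>e\<in>E. Z e powr \<gamma> e) * (\<Sum>x\<in>X. \<Sum>e\<in>E. \<gamma> e / \<Gamma> * p e x)"
    using point by (intro mult_left_mono sum_mono prod_nonneg) auto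
  also have "(\<Sum>x\<in>X. \<Sum>e\<in>E. \<gamma> e / \<Gamma> * p e x) = (\<Sum>e\<in>E. \<gamma> e / \<Gamma> * (\<Sum>x\<in>X. p e x))"
    by (subst sum.swap) (simp add: sum_distrib_left)
  also have "\<dots> = (\<Sum>e\<in>E. \<gamma> e / \<Gamma>)"
  proof (rule sum.cong[OF refl])
    fix e assume "e \<in> E"
    then have "(\<Sum>x\<in>X. p e x) = 1" using Z[of e] by (simp add: p_def sum_divide_distrib[symmetric] Z_def[symmetric])
    then show "\<gamma> e / \<Gamma> * (\<Sum>x\<in>X. p e x) = \<gamma> e / \<Gamma>" by simp
  qed
  also have "\<dots> = 1" using \<Gamma> by (simp add: sum_divide_distrib[symmetric] \<Gamma>_def[symmetric])
  finally show ?thesis by (simp add: Z_def)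
qed

text \<open>The inequality of Atserias, Grohe and Marx, by induction on the number of variables: fix the
  value of one variable and combine the bounds for the slices by Hoelder's inequality over the
  hyperedges containing it.\<close>

lemma card_le_fractional_cover:
  assumes "finite W" "finite A" "A \<noteq> {}" "\<And>a u. a \<in> A \<Longrightarrow> u \<notin> W \<Longrightarrow> a u = 0"
    and E: "finite E" "\<And>e. e \<in> E \<Longrightarrow> 0 \<le> \<gamma> e"
    and "\<And>v. v \<in> W \<Longrightarrow> 1 \<le> (\<Sum>e\<in>{e\<in>E. v \<in> e}. \<gamma> e)"
  shows "real (card A) \<le> (\<Prod>e\<in>E. real (card ((\<lambda>a. restr a (e \<inter> W)) ` A)) powr \<gamma> e)"
  using assms(1-4,7)
proof (induction W arbitrary: A rule: finite_induct)
  case empty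
  have "a = (\<lambda>_. 0)" if "a \<in> A" for a using empty.prems(3)[OF that] by auto
  then have A: "A = {\<lambda>_. 0}" using empty.prems(2) by blast
  show ?case by (simp add: A)
next
  case (insert v W)
  define X where "X = (\<lambda>a. a v) ` A"
  define S where "S x = {a \<in> A. a v = x}" for x
  define R where "R e x = (\<lambda>a. restr a (e \<inter> insert v W)) ` S x" for e x
  define c where "c e = card ((\<lambda>a. restr a (e \<inter> insert v W)) ` A)" for e
  have finS: "finite (S x)" for x using insert.prems(1) by (simp add: S_def)
  have finX: "finite X" using insert.prems(1) by (simp add: X_def)
  have S: "S x \<noteq> {}" if "x \<in> X" for x using that by (auto simp: X_def S_def)
  have slice: "real (card (S x)) \<le> (\<Prod>e\<in>E. real (card (R e x)) powr \<gamma> e)" if x: "x \<in> X" for x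
  proof -
    \<comment> \<open>Within a slice the value at \<open>v\<close> is constant; setting it to 0
      loses nothing and turns the slice into a family over \<open>W\<close>, as the induction
      hypothesis requires.\<close>
    let ?A = "(\<lambda>a. a(v := 0)) ` S x"
    have "inj_on (\<lambda>a. a(v := 0)) (S x)"
    proof (rule inj_onI)
      fix a b assume "a \<in> S x" "b \<in> S x" and eq: "a(v := 0) = b(v := 0)"
      then have "a v = b v" by (simp add: S_def)
      then show "a = b" using eq by (metis fun_upd_triv fun_upd_upd)
    qed
    then have "card (S x) = card ?A" by (simp add: card_image)
    also have "real (card ?A) \<le> (\<Prod>e\<in>E. real (card ((\<lambda>a. restr a (e \<inter> W)) ` ?A)) powr \<gamma> e)"
    proof (rule insert.IH)
      show "a u = 0" if a: "a \<in> ?A" and u: "u \<notin> W" for a u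
      proof -
        obtain b where b: "b \<in> A" "a = b(v := 0)" using a by (auto simp: S_def)
        show ?thesis using insert.prems(3)[OF b(1), of u] u b(2) by auto
      qed
    qed (use finS S[OF x] insert.prems(4) in auto)
    also have "\<dots> \<le> (\<Prod>e\<in>E. real (card (R e x)) powr \<gamma> e)"
    proof (rule prod_mono)
      fix e assume e: "e \<in> E"
      have "(\<lambda>a. restr a (e \<inter> W)) ` ?A = (\<lambda>b. b(v := 0)) ` R e x"
      proof -
        have "restr (a(v := 0)) (e \<inter> W) = (restr a (e \<inter> insert v W))(v := 0)" for a
          using insert.hyps(2) by (auto simp: restr_def fun_eq_iff)
        then show ?thesis by (simp add: R_def image_image)
      qed
      then have "card ((\<lambda>a. restr a (e \<inter> W)) ` ?A) \<le> card (R e x)"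
        using finS by (simp add: R_def card_image_le)
      then show "0 \<le> real (card ((\<lambda>a. restr a (e \<inter> W)) ` ?A)) powr \<gamma> e \<and>
          real (card ((\<lambda>a. restr a (e \<inter> W)) ` ?A)) powr \<gamma> e \<le> real (card (R e x)) powr \<gamma> e"
        using E(2)[OF e] by (auto intro: powr_mono2)
    qed
    finally show ?thesis by simp
  qed
  have posR: "0 < card (R e x)" if "x \<in> X" for e x using S[OF that] finS by (simp add: R_def card_gt_0_iff)
  \<comment> \<open>Projections to a hyperedge containing \<open>v\<close> remember the value at
    \<open>v\<close>, so those of different slices are disjoint. For a hyperedge avoiding
    \<open>v\<close> nothing better is available than the whole projection, used once as a common
    factor.\<close>
  have sumR: "(\<Sum>x\<in>X. card (R e x)) \<le> c e" if "v \<in> e" for e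
  proof -
    have disj: "R e x \<inter> R e y = {}" if "x \<noteq> y" for x y
    proof -
      have "b v = z" if "b \<in> R e z" for b z using that \<open>v \<in> e\<close> by (auto simp: R_def S_def restr_def)
      then show ?thesis using that by blast
    qed
    have "(\<Sum>x\<in>X. card (R e x)) = card (\<Union>x\<in>X. R e x)"
      using finX finS disj by (intro card_UN_disjoint[symmetric]) (auto simp: R_def)
    also have "\<dots> \<le> c e" unfolding c_def
      using insert.prems(1) by (intro card_mono) (auto simp: R_def S_def)
    finally show ?thesis .
  qed
  define E1 where "E1 = {e \<in> E. v \<in> e}"
  define E0 where "E0 = {e \<in> E. v \<notin> e}"
  have split: "(\<Prod>e\<in>E. f e) = (\<Prod>e\<in>E0. f e) * (\<Prod>e\<in>E1. f e)" for f :: "nat set \<Rightarrow> real"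
  proof -
    have "E = E0 \<union> E1" "E0 \<inter> E1 = {}" by (auto simp: E0_def E1_def)
    then show ?thesis using E(1) prod.union_disjoint[of E0 E1 f] by (metis finite_Un)
  qed
  have "card A = (\<Sum>x\<in>X. card (S x))"
  proof -
    have "A = (\<Union>x\<in>X. S x)" by (auto simp: X_def S_def)
    moreover have "card (\<Union>x\<in>X. S x) = (\<Sum>x\<in>X. card (S x))"
      using finX finS by (intro card_UN_disjoint) (auto simp: S_def)
    ultimately show ?thesis by simp
  qed
  then have "real (card A) = (\<Sum>x\<in>X. real (card (S x)))" by simp
  also have "\<dots> \<le> (\<Sum>x\<in>X. (\<Prod>e\<in>E0. real (c e) powr \<gamma> e) * (\<Prod>e\<in>E1. real (card (R e x)) powr \<gamma> e))"
  proof (rule sum_mono)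
    fix x assume x: "x \<in> X"
    have "(\<Prod>e\<in>E0. real (card (R e x)) powr \<gamma> e) \<le> (\<Prod>e\<in>E0. real (c e) powr \<gamma> e)"
    proof (rule prod_mono)
      fix e assume e: "e \<in> E0"
      have "card (R e x) \<le> c e" unfolding R_def c_def using insert.prems(1) by (intro card_mono) (auto simp: S_def)
      then show "0 \<le> real (card (R e x)) powr \<gamma> e \<and> real (card (R e x)) powr \<gamma> e \<le> real (c e) powr \<gamma> e"
        using E(2) e by (auto intro: powr_mono2 simp: E0_def)
    qed
    then have "(\<Prod>e\<in>E0. real (card (R e x)) powr \<gamma> e) * (\<Prod>e\<in>E1. real (card (R e x)) powr \<gamma> e)
        \<le> (\<Prod>e\<in>E0. real (c e) powr \<gamma> e) * (\<Prod>e\<in>E1. real (card (R e x)) powr \<gamma> e)"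
      by (intro mult_right_mono prod_nonneg) auto
    then show "real (card (S x)) \<le> (\<Prod>e\<in>E0. real (c e) powr \<gamma> e) * (\<Prod>e\<in>E1. real (card (R e x)) powr \<gamma> e)"
      using slice[OF x] split by simp
  qed
  also have "\<dots> = (\<Prod>e\<in>E0. real (c e) powr \<gamma> e) * (\<Sum>x\<in>X. \<Prod>e\<in>E1. real (card (R e x)) powr \<gamma> e)"
    by (simp add: sum_distrib_left)
  also have "\<dots> \<le> (\<Prod>e\<in>E0. real (c e) powr \<gamma> e) * (\<Prod>e\<in>E1. (\<Sum>x\<in>X. real (card (R e x))) powr \<gamma> e)"
  proof (intro mult_left_mono generalized_Hoelder prod_nonneg)
    show "1 \<le> (\<Sum>e\<in>E1. \<gamma> e)" using insert.prems(4)[of v] by (simp add: E1_def)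
  qed (use E finX posR in \<open>auto simp: E1_def\<close>)
  also have "\<dots> \<le> (\<Prod>e\<in>E0. real (c e) powr \<gamma> e) * (\<Prod>e\<in>E1. real (c e) powr \<gamma> e)"
  proof (intro mult_left_mono prod_mono prod_nonneg)
    fix e assume e: "e \<in> E1"
    have "(\<Sum>x\<in>X. real (card (R e x))) \<le> real (c e)"
      using sumR[of e] e by (simp add: E1_def of_nat_sum[symmetric] del: of_nat_sum)
    then show "0 \<le> (\<Sum>x\<in>X. real (card (R e x))) powr \<gamma> e \<and>
        (\<Sum>x\<in>X. real (card (R e x))) powr \<gamma> e \<le> real (c e) powr \<gamma> e"
      using E(2) e by (auto intro!: powr_mono2 sum_nonneg simp: E1_def)
  qed auto
  finally show ?case using split by (simp add: c_def)
qed

section \<open>Length of the layers\<close>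

context homs_instance
begin

text \<open>One more step adds at most \<open>d\<close> out-neighbours for each vertex already
  reached.\<close>

lemma card_ball:
  assumes "\<And>y. y < n \<Longrightarrow> card {z. EG y z} \<le> d"
  shows "finite {z. reach n EG j y z} \<and> card {z. reach n EG j y z} \<le> (d + 1) ^ j"
proof (induction j)
  case (Suc j)
  let ?B = "{z. reach n EG j y z}"
  have out: "finite {z. EG x z}" for x
    by (rule finite_subset[of _ "{..<n}"]) (use EG in auto)
  have sub: "{z. reach n EG (Suc j) y z} \<subseteq> ?B \<union> (\<Union>x\<in>?B \<inter> {..<n}. {z. EG x z})" by auto
  have fin: "finite (?B \<union> (\<Union>x\<in>?B \<inter> {..<n}. {z. EG x z}))" using Suc out by auto
  have "card {z. reach n EG (Suc j) y z} \<le> card (?B \<union> (\<Union>x\<in>?B \<inter> {..<n}. {z. EG x z}))"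
    using fin sub by (rule card_mono)
  also have "\<dots> \<le> card ?B + card (\<Union>x\<in>?B \<inter> {..<n}. {z. EG x z})" by (rule card_Un_le)
  also have "card (\<Union>x\<in>?B \<inter> {..<n}. {z. EG x z}) \<le> (\<Sum>x\<in>?B \<inter> {..<n}. card {z. EG x z})"
    using Suc by (intro card_UN_le) auto
  also have "\<dots> \<le> (\<Sum>x\<in>?B \<inter> {..<n}. d)" using assms by (intro sum_mono) auto
  also have "\<dots> \<le> card ?B * d" using Suc by (auto intro!: mult_le_mono card_mono)
  finally have "card {z. reach n EG (Suc j) y z} \<le> card ?B * (d + 1)" by simp
  also have "\<dots> \<le> (d + 1) ^ j * (d + 1)" using Suc by (intro mult_le_mono) auto
  finally show ?case using finite_subset[OF sub fin] by (simp add: mult.commute)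
qed simp

text \<open>On a hyperedge, the vertices reachable from some \<open>s\<close>, consistency forces
  all images into one ball of radius \<open>L\<close>. With at most \<open>n\<close> centres, at
  most \<open>(d + 1) ^ L\<close> vertices in the ball and at most \<open>h\<close> positions to
  fill, the projections are few. The size \<open>g\<close> stands in for \<open>n\<close> so that
  the base of \<open>powr\<close> is at least 1 even for an empty digraph.\<close>

lemma length_lay_le:
  assumes d: "\<And>y. y < n \<Longrightarrow> card {z. EG y z} \<le> d" and g: "1 \<le> g" "n \<le> g"
    and W: "W \<subseteq> {..<h}" "u \<le> h"
    and E: "finite E" "\<And>e. e \<in> E \<Longrightarrow> 0 \<le> \<gamma> e" "\<And>e. e \<in> E \<Longrightarrow> \<exists>s<h. e = {w. rH s w}"
    and cover: "\<And>v. v \<in> W \<Longrightarrow> 1 \<le> (\<Sum>e\<in>{e\<in>E. v \<in> e}. \<gamma> e)"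
  shows "real (length (lay W u)) \<le> real g powr (\<Sum>e\<in>E. \<gamma> e) * real ((d + 1) ^ (L * h)) ^ card E"
proof -
  define U where "U = W \<inter> {..<u}"
  define A where "A = {a \<in> asg n U. cons U a}"
  define K where "K = (d + 1) ^ (L * h)"
  \<comment> \<open>Capping the weights at 1 bounds their sum by \<open>card E\<close>, so the power
    of \<open>K\<close> depends on the parameter only. The result is still a cover: at each vertex,
    either some weight was at least 1 and becomes 1, or nothing changes.\<close>
  define \<gamma>' where "\<gamma>' e = min (\<gamma> e) 1" for e
  have len: "length (lay W u) = card A" using length_lay[OF W] by (simp add: A_def U_def)
  have finU: "finite U" by (simp add: U_def)
  have finA: "finite A" using finite_asg[OF finU] by (simp add: A_def)
  have K1: "1 \<le> real K" by (simp add: K_def)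
  have \<gamma>': "0 \<le> \<gamma>' e" "\<gamma>' e \<le> \<gamma> e" "\<gamma>' e \<le> 1" if "e \<in> E" for e using E(2)[OF that] by (auto simp: \<gamma>'_def)
  have cover': "1 \<le> (\<Sum>e\<in>{e\<in>E. v \<in> e}. \<gamma>' e)" if v: "v \<in> W" for v
  proof (cases "\<exists>e\<in>{e\<in>E. v \<in> e}. 1 \<le> \<gamma> e")
    case True
    then obtain e where e: "e \<in> {e\<in>E. v \<in> e}" "1 \<le> \<gamma> e" by blast
    then have "1 = \<gamma>' e" by (simp add: \<gamma>'_def)
    also have "\<dots> \<le> (\<Sum>e\<in>{e\<in>E. v \<in> e}. \<gamma>' e)" using e E(1) \<gamma>' by (intro member_le_sum) auto
    finally show ?thesis .
  next
    case False
    then have "(\<Sum>e\<in>{e\<in>E. v \<in> e}. \<gamma>' e) = (\<Sum>e\<in>{e\<in>E. v \<in> e}. \<gamma> e)"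
      by (intro sum.cong) (auto simp: \<gamma>'_def not_le)
    then show ?thesis using cover[OF v] by simp
  qed
  have proj: "card ((\<lambda>a. restr a (e \<inter> U)) ` A) \<le> g * K" if e: "e \<in> E" for e
  proof (cases "U = {}")
    case True
    have "asg n {} = {\<lambda>_. 0}" by (auto simp: asg_def)
    then have "card A \<le> 1" unfolding A_def True by (metis (no_types, lifting) card_mono finite.emptyI finite_insert is_singletonI is_singleton_altdef mem_Collect_eq subsetI)
    then have "card ((\<lambda>a. restr a (e \<inter> U)) ` A) \<le> 1" using card_image_le[OF finA] le_trans by blast
    also have "1 \<le> g * K" using g(1) by (simp add: K_def)
    finally show ?thesis .
  next
    case False
    obtain s where s: "s < h" "e = {w. rH s w}" using E(3)[OF e] by blast
    define Y where "Y = e \<inter> U"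
    define T where "T y = {b. (\<forall>w\<in>Y. rG y (b w)) \<and> (\<forall>w. w \<notin> Y \<longrightarrow> b w = 0)}" for y
    have finY: "finite Y" using finU by (simp add: Y_def)
    have T: "finite (T y) \<and> card (T y) \<le> K" for y
    proof -
      let ?P = "Y \<rightarrow>\<^sub>E {z. rG y z}"
      have inj: "inj_on (\<lambda>b. restrict b Y) (T y)"
      proof (rule inj_onI, rule ext)
        fix a b w assume ab: "a \<in> T y" "b \<in> T y" and eq: "restrict a Y = restrict b Y"
        show "a w = b w"
        proof (cases "w \<in> Y")
          case True
          then show ?thesis using fun_cong[OF eq, of w] by simp
        next
          case False
          then show ?thesis using ab by (simp add: T_def)
        qed
      qed
      have im: "(\<lambda>b. restrict b Y) ` T y \<subseteq> ?P" by (auto simp: T_def)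
      note ball = card_ball[of d, OF d, of L y]
      have finP: "finite ?P" using finY ball by (intro finite_PiE) auto
      have "card (T y) \<le> card ?P" using inj im finP by (rule card_inj_on_le)
      also have "\<dots> = card {z. rG y z} ^ card Y" using finY by (simp add: card_PiE)
      also have "\<dots> \<le> ((d + 1) ^ L) ^ card Y" using ball by (intro power_mono) auto
      also have "\<dots> \<le> ((d + 1) ^ L) ^ h"
      proof -
        have "card Y \<le> card {..<h}" using W(1) by (intro card_mono) (auto simp: Y_def U_def)
        then show ?thesis by (intro power_increasing) auto
      qed
      also have "\<dots> = K" by (simp add: K_def power_mult)
      finally show ?thesis using inj im finP by (metis finite_subset finite_imageD)
    qed
    have sub: "(\<lambda>a. restr a (e \<inter> U)) ` A \<subseteq> (\<Union>y\<in>{..<n}. T y)"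
    proof
      fix b assume "b \<in> (\<lambda>a. restr a (e \<inter> U)) ` A"
      then obtain a where a: "a \<in> A" "b = restr a Y" by (auto simp: Y_def)
      then obtain y where y: "y < n" "\<forall>w\<in>U. rH s w \<longrightarrow> rG y (a w)"
        using s(1) False unfolding A_def cons_def by blast
      have "b \<in> T y" using y(2) a(2) s(2) by (auto simp: T_def Y_def restr_def)
      then show "b \<in> (\<Union>y\<in>{..<n}. T y)" using y(1) by blast
    qed
    have "card ((\<lambda>a. restr a (e \<inter> U)) ` A) \<le> card (\<Union>y\<in>{..<n}. T y)"
      using sub T by (intro card_mono) auto
    also have "\<dots> \<le> (\<Sum>y\<in>{..<n}. card (T y))" by (intro card_UN_le) auto
    also have "\<dots> \<le> (\<Sum>y\<in>{..<n}. K)" using T by (intro sum_mono) auto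
    also have "\<dots> \<le> g * K" using g by simp
    finally show ?thesis .
  qed
  have gK: "1 \<le> real g * real K" using g(1) K1 by (metis mult_mono' mult_1 of_nat_1 of_nat_le_iff zero_le_one)
  have s1: "(\<Sum>e\<in>E. \<gamma>' e) \<le> (\<Sum>e\<in>E. \<gamma> e)" using \<gamma>' by (intro sum_mono) auto
  have s2: "(\<Sum>e\<in>E. \<gamma>' e) \<le> real (card E)" using sum_mono[of E \<gamma>' "\<lambda>_. 1"] \<gamma>' by simp
  have "real (card A) \<le> (real g * real K) powr (\<Sum>e\<in>E. \<gamma>' e)"
  proof (cases "A = {}")
    case False
    have "real (card A) \<le> (\<Prod>e\<in>E. real (card ((\<lambda>a. restr a (e \<inter> U)) ` A)) powr \<gamma>' e)"
      by (rule card_le_fractional_cover[OF finU finA False])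
        (use E(1) \<gamma>' cover' in \<open>auto simp: A_def U_def asg_def\<close>)
    also have "\<dots> \<le> (\<Prod>e\<in>E. (real g * real K) powr \<gamma>' e)"
    proof (rule prod_mono)
      fix e assume e: "e \<in> E"
      have "real (card ((\<lambda>a. restr a (e \<inter> U)) ` A)) \<le> real g * real K"
        using proj[OF e] by (metis of_nat_le_iff of_nat_mult)
      then show "0 \<le> real (card ((\<lambda>a. restr a (e \<inter> U)) ` A)) powr \<gamma>' e \<and>
          real (card ((\<lambda>a. restr a (e \<inter> U)) ` A)) powr \<gamma>' e \<le> (real g * real K) powr \<gamma>' e"
        using \<gamma>'[OF e] by (auto intro: powr_mono2)
    qed
    also have "\<dots> = (real g * real K) powr (\<Sum>e\<in>E. \<gamma>' e)"
      using g(1) K1 E(1) by (subst powr_sum) auto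
    finally show ?thesis .
  qed simp
  also have "\<dots> = real g powr (\<Sum>e\<in>E. \<gamma>' e) * real K powr (\<Sum>e\<in>E. \<gamma>' e)" by (simp add: powr_mult)
  also have "\<dots> \<le> real g powr (\<Sum>e\<in>E. \<gamma> e) * real K powr real (card E)"
    using g(1) K1 s1 s2 by (intro mult_mono powr_mono) auto
  also have "real K powr real (card E) = real K ^ card E" using K1 by (simp add: powr_realpow)
  finally show ?thesis unfolding len K_def .
qed

end

section \<open>Tree decompositions\<close>

lemma pawalk_verts_snoc: "pcas u p y \<Longrightarrow> pawalk_verts u (p @ [(y, x)]) = pawalk_verts u p @ [x]"
  by (induction p arbitrary: u) auto

lemma pawalk_verts_Cons: "\<exists>vs. pawalk_verts u p = (if p = [] then u else fst (hd p)) # vs"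
  by (cases p) auto

text \<open>A path from x to y that avoids the arc between them has at least two arcs, as
  \<open>x\<close> and \<open>y\<close> differ. The reverse arc closes it to a cycle of length at
  least 3, which an undirected tree does not have.\<close>

lemma bridge:
  assumes T: "undirected_tree T" and xy: "(x, y) \<in> parcs T" "(x, y) \<in> (parcs T - {(x, y)})\<^sup>*"
  shows False
proof -
  interpret pair_graph T using T by (simp add: undirected_tree_def)
  have ne: "x \<noteq> y" using xy(1) pair_no_loops by fastforce
  have walk: "\<exists>p. awalk x p z \<and> set p \<subseteq> parcs T - {(x, y)}" if "(x, z) \<in> (parcs T - {(x, y)})\<^sup>*" for z
    using that
  proof (induction rule: rtrancl_induct)
    case base
    have "awalk x [] x" using xy(1) by (auto simp: awalk_def dest: in_arcsD1)
    then show ?case by (intro exI[of _ "[]"]) simp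
  next
    case (step a b)
    then obtain p where p: "awalk x p a" "set p \<subseteq> parcs T - {(x, y)}" by blast
    have "awalk a [(a, b)] b" using step(2) by (auto simp: awalk_def dest: in_arcsD1)
    then have "awalk x (p @ [(a, b)]) b" using p(1) by (rule awalk_appendI[rotated])
    then show ?case using p step(2) by (intro exI[of _ "p @ [(a, b)]"]) auto
  qed
  obtain p where p: "awalk x p y" "set p \<subseteq> parcs T - {(x, y)}" using walk[OF xy(2)] by blast
  define q where "q = awalk_to_apath p"
  have q: "apath x q y" "set q \<subseteq> parcs T - {(x, y)}"
    using apath_awalk_to_apath[OF p(1)] awalk_to_apath_subset[OF p(1)] p(2) by (auto simp: q_def)
  have cas: "pcas x q y" and dist: "distinct (pawalk_verts x q)" and wq: "awalk x q y"
    using q(1) by (auto simp: apath_def awalk_def)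
  have "2 \<le> length q"
  proof (rule ccontr)
    assume "\<not> 2 \<le> length q"
    then consider "q = []" | e where "q = [e]" by (cases q; cases "tl q") auto
    then show False
    proof cases
      case 1 then show ?thesis using cas ne by simp
    next
      case 2 then show ?thesis using cas q(2) by (cases e) auto
    qed
  qed
  have yx: "(y, x) \<in> parcs T" using xy(1) arcs_symmetric by blast
  have "awalk y [(y, x)] x" using yx by (auto simp: awalk_def dest: in_arcsD1)
  then have "awalk x (q @ [(y, x)]) x" using wq by (rule awalk_appendI[rotated])
  moreover have "distinct (tl (pawalk_verts x (q @ [(y, x)])))"
  proof -
    obtain vs where vs: "pawalk_verts x q = x # vs"
      using pawalk_verts_Cons[of x q] cas by (cases q) auto
    then show ?thesis using dist by (simp add: pawalk_verts_snoc[OF cas])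
  qed
  ultimately have "cycle (q @ [(y, x)])" unfolding cycle_def by auto
  moreover have "3 \<le> length (q @ [(y, x)])" using \<open>2 \<le> length q\<close> by simp
  ultimately show False using T unfolding undirected_tree_def by blast
qed

lemma connected_rtrancl:
  assumes "connected (with_proj T \<restriction> X)" "sym (parcs T)" "u \<in> X" "v \<in> X"
  shows "(u, v) \<in> (parcs T \<inter> X \<times> X)\<^sup>*"
proof -
  have ends: "arcs_ends (with_proj T \<restriction> X) = parcs T \<inter> X \<times> X"
    by (auto simp: arcs_ends_conv)
  have "(u, v) \<in> rtrancl_on X ((parcs T \<inter> X \<times> X)\<^sup>s)"
    using assms(1,3,4) unfolding connected_conv ends by simp
  then have "(u, v) \<in> ((parcs T \<inter> X \<times> X)\<^sup>s)\<^sup>*" by (rule rtrancl_on_rtranclI)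
  moreover have "(parcs T \<inter> X \<times> X)\<^sup>s = parcs T \<inter> X \<times> X" using assms(2) by (auto simp: symcl_def dest: symD)
  ultimately show ?thesis by simp
qed

lemma rtrancl_exit:
  assumes "(a, b) \<in> r\<^sup>*" "a \<in> X" "b \<notin> X"
  shows "\<exists>u v. (u, v) \<in> r \<and> u \<in> X \<and> v \<notin> X"
  using assms by (induction rule: rtrancl_induct) blast+

text \<open>As long as a node is missing, connectivity provides an arc leaving the nodes already
  listed, whose head can be appended. Rooting the tree this way reduces later arguments to indices
  with \<open>par i < i\<close>.\<close>

lemma tree_order:
  assumes T: "undirected_tree T"
  obtains ts par where "distinct ts" "set ts = pverts T" "ts \<noteq> []"
    "\<And>i. 0 < i \<Longrightarrow> i < length ts \<Longrightarrow> par i < i \<and> (ts ! par i, ts ! i) \<in> parcs T"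
proof -
  interpret pair_graph T using T by (simp add: undirected_tree_def)
  have con: "connected (with_proj T)" using T by (simp add: undirected_tree_def)
  have sym: "sym (parcs T)" using pair_sym_arcs by (simp add: symmetric_def)
  have reach: "(u, v) \<in> (parcs T)\<^sup>*" if "u \<in> pverts T" "v \<in> pverts T" for u v
  proof -
    have "(u, v) \<in> rtrancl_on (pverts T) ((parcs T)\<^sup>s)" using con that unfolding connected_conv by simp
    then have "(u, v) \<in> ((parcs T)\<^sup>s)\<^sup>*" by (rule rtrancl_on_rtranclI)
    moreover have "(parcs T)\<^sup>s = parcs T" using sym by (auto simp: symcl_def dest: symD)
    ultimately show ?thesis by simp
  qed
  define ok where "ok ts \<longleftrightarrow> distinct ts \<and> set ts \<subseteq> pverts T \<and>
    (\<exists>par. \<forall>i. 0 < i \<longrightarrow> i < length ts \<longrightarrow> par i < i \<and> (ts ! par i, ts ! i) \<in> parcs T)" for ts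
  obtain r where r: "r \<in> pverts T" using con unfolding connected_conv by auto
  have "\<exists>ts. ok ts \<and> length ts = Suc k" if "Suc k \<le> card (pverts T)" for k
    using that
  proof (induction k)
    case 0
    have "ok [r]" using r by (auto simp: ok_def)
    then show ?case by (intro exI[of _ "[r]"]) simp
  next
    case (Suc k)
    then obtain ts where ts: "ok ts" "length ts = Suc k" by auto
    then have "card (set ts) < card (pverts T)" using Suc.prems by (simp add: ok_def distinct_card)
    then obtain z where z: "z \<in> pverts T" "z \<notin> set ts"
      by (metis List.finite_set card_mono not_le subsetI)
    have "ts ! 0 \<in> set ts" using ts(2) by simp
    then have z0: "(ts ! 0, z) \<in> (parcs T)\<^sup>*" using ts(1) z by (intro reach) (auto simp: ok_def)
    then obtain u v where uv: "(u, v) \<in> parcs T" "u \<in> set ts" "v \<notin> set ts"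
      using rtrancl_exit[OF z0 \<open>ts ! 0 \<in> set ts\<close> z(2)] by blast
    then obtain j where j: "j < length ts" "ts ! j = u" by (metis in_set_conv_nth)
    obtain par where par: "\<And>i. 0 < i \<Longrightarrow> i < length ts \<Longrightarrow> par i < i \<and> (ts ! par i, ts ! i) \<in> parcs T"
      using ts(1) unfolding ok_def by blast
    have par': "\<forall>i. 0 < i \<longrightarrow> i < length (ts @ [v]) \<longrightarrow> (par(length ts := j)) i < i \<and>
        ((ts @ [v]) ! (par(length ts := j)) i, (ts @ [v]) ! i) \<in> parcs T"
    proof (intro allI impI)
      fix i assume i: "0 < i" "i < length (ts @ [v])"
      show "(par(length ts := j)) i < i \<and> ((ts @ [v]) ! (par(length ts := j)) i, (ts @ [v]) ! i) \<in> parcs T"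
      proof (cases "i = length ts")
        case True
        then show ?thesis using j uv by (simp add: nth_append)
      next
        case False
        then have "i < length ts" using i by simp
        then show ?thesis using par[OF i(1)] False by (auto simp: nth_append)
      qed
    qed
    have "v \<in> pverts T" using uv(1) in_arcsD2 by blast
    have "ok (ts @ [v])" unfolding ok_def
    proof (intro conjI exI[of _ "par(length ts := j)"])
      show "distinct (ts @ [v])" "set (ts @ [v]) \<subseteq> pverts T"
        using ts(1) uv(3) \<open>v \<in> pverts T\<close> by (auto simp: ok_def)
    qed (rule par')
    then show ?case using ts(2) by (intro exI[of _ "ts @ [v]"]) simp
  qed
  moreover have "card (pverts T) \<noteq> 0" using r pair_finite_verts by auto
  ultimately obtain ts where ts: "ok ts" "length ts = card (pverts T)"
    by (metis Suc_pred order_refl neq0_conv)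
  have "set ts = pverts T"
    using ts pair_finite_verts unfolding ok_def by (metis card_subset_eq distinct_card)
  moreover have "ts \<noteq> []" using ts(2) \<open>card (pverts T) \<noteq> 0\<close> by auto
  ultimately show thesis using ts(1) that unfolding ok_def by blast
qed

text \<open>If the first arc of the tree path from an earlier node to \<open>ts ! i\<close> avoided the parent, the arc
  from the parent would close a cycle.\<close>

lemma running_intersection:
  assumes T: "undirected_tree T" and ts: "distinct ts"
    and par: "\<And>i. 0 < i \<Longrightarrow> i < length ts \<Longrightarrow> par i < i \<and> (ts ! par i, ts ! i) \<in> parcs T"
    and X: "connected (with_proj T \<restriction> X)" and ij: "j < i" "i < length ts" "ts ! i \<in> X" "ts ! j \<in> X"
  shows "ts ! par i \<in> X"
proof (rule ccontr)
  assume pX: "ts ! par i \<notin> X"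
  interpret pair_graph T using T by (simp add: undirected_tree_def)
  have sym: "sym (parcs T)" using pair_sym_arcs by (simp add: symmetric_def)
  define p where "p = ts ! par i"
  define x where "x = ts ! i"
  define r where "r = parcs T - {(p, x)}"
  have px: "(p, x) \<in> parcs T" "par i < i" using par[of i] ij by (auto simp: p_def x_def)
  have arc: "(ts ! par m, ts ! m) \<in> r \<and> (ts ! m, ts ! par m) \<in> r" if m: "0 < m" "m < i" for m
  proof -
    have e: "par m < m" "(ts ! par m, ts ! m) \<in> parcs T" using par[of m] m ij(2) by auto
    have ne: "ts ! k \<noteq> x" if "k < i" for k using that ij(2) nth_eq_iff_index_eq[OF ts, of k i] by (simp add: x_def)
    have "(ts ! m, ts ! par m) \<in> parcs T" using e(2) sym by (rule symD[rotated])
    then show ?thesis using e ne[of m] ne[of "par m"] m by (auto simp: r_def)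
  qed
  \<comment> \<open>The nodes before \<open>i\<close> are joined to the root through parents that
    also come before \<open>i\<close>. So these connections do not touch \<open>x\<close> and
    survive the removal of the arc.\<close>
  have root: "(ts ! 0, ts ! m) \<in> r\<^sup>* \<and> (ts ! m, ts ! 0) \<in> r\<^sup>*" if "m < i" for m
    using that
  proof (induction m rule: less_induct)
    case (less m)
    show ?case
    proof (cases "m = 0")
      case False
      then have "par m < m" using par[of m] less.prems ij(2) by auto
      then have "(ts ! 0, ts ! par m) \<in> r\<^sup>* \<and> (ts ! par m, ts ! 0) \<in> r\<^sup>*" using less by auto
      then show ?thesis using arc[of m] False less.prems
        by (meson neq0_conv rtrancl.rtrancl_into_rtrancl converse_rtrancl_into_rtrancl)
    qed simp
  qed
  have "(p, ts ! j) \<in> r\<^sup>*" using root[OF px(2)] root[OF ij(1)] unfolding p_def by (meson rtrancl_trans)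
  \<comment> \<open>The walk within \<open>X\<close> cannot use the removed arc, since the parent is
    assumed to lie outside \<open>X\<close>.\<close>
  moreover have "(ts ! j, x) \<in> (parcs T \<inter> X \<times> X)\<^sup>*" using connected_rtrancl[OF X sym ij(4,3)] by (simp add: x_def)
  then have "(ts ! j, x) \<in> r\<^sup>*"
    by (rule rtrancl_mono[THEN subsetD, rotated]) (use pX in \<open>auto simp: r_def p_def\<close>)
  ultimately have "(p, x) \<in> r\<^sup>*" by (rule rtrancl_trans)
  then show False using bridge[OF T px(1)] by (simp add: r_def)
qed

section \<open>Elimination along a tree decomposition\<close>

context homs_instance
begin

text \<open>The vertex to eliminate from a component is one whose topmost bag is highest; that bag then
  contains all neighbours of the component.\<close>

lemma nice_elimination:
  fixes N :: nat and par :: "nat \<Rightarrow> nat" and bag :: "nat \<Rightarrow> nat set"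
  assumes par: "\<And>i. 0 < i \<Longrightarrow> i < N \<Longrightarrow> par i < i"
    and rip: "\<And>i j v. j < i \<Longrightarrow> i < N \<Longrightarrow> v \<in> bag i \<Longrightarrow> v \<in> bag j \<Longrightarrow> v \<in> bag (par i)"
    and adj: "\<And>u w. u < h \<Longrightarrow> w < h \<Longrightarrow> adj u w \<Longrightarrow> \<exists>m<N. u \<in> bag m \<and> w \<in> bag m"
  obtains nice ch where
    "\<And>C. nice C \<Longrightarrow> C \<subseteq> {..<h} \<and> ch C \<in> C \<and> (\<forall>C'\<in>comps (C - {ch C}). nice C') \<and>
       (\<exists>m<N. insert (ch C) (nbr C) \<subseteq> bag m)"
    "\<And>C. C \<in> comps {..<h} \<Longrightarrow> nice C"
proof -
  define top where "top v = (LEAST i. i < N \<and> v \<in> bag i)" for v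
  define P where "P = {(a, par a) | a. 0 < a \<and> a < N}"
  have sv: "single_valued P" by (auto simp: single_valued_def P_def)
  have P_le: "i \<le> m" if "(m, i) \<in> P\<^sup>*" for m i
    using that
  proof (induction rule: rtrancl_induct)
    case (step y z)
    then have "z < y" using par by (auto simp: P_def)
    then show ?case using step by simp
  qed simp
  have top: "top v < N" "v \<in> bag (top v)" "top v \<le> m" if "m < N" "v \<in> bag m" for v m
    using LeastI[of "\<lambda>i. i < N \<and> v \<in> bag i" m] Least_le[of "\<lambda>i. i < N \<and> v \<in> bag i" m] that
    by (auto simp: top_def)
  have up: "(m, top v) \<in> P\<^sup>*" if "m < N" "v \<in> bag m" for v m
    using that
  proof (induction m rule: less_induct)
    case (less m)
    show ?case
    proof (cases "m = top v")
      case False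
      then have lt: "top v < m" using top[OF less.prems] by simp
      then have "0 < m" by simp
      then have "par m < m" "(m, par m) \<in> P" using par less.prems by (auto simp: P_def)
      moreover have "v \<in> bag (par m)" using rip[OF lt less.prems] top[OF less.prems] by simp
      ultimately have "(par m, top v) \<in> P\<^sup>*" using less by auto
      then show ?thesis using \<open>(m, par m) \<in> P\<close> by (rule converse_rtrancl_into_rtrancl[rotated])
    qed simp
  qed
  \<comment> \<open>Each node has one parent, so the ancestors of a node form a chain, ordered by
    their indices.\<close>
  have above: "(i, j) \<in> P\<^sup>*" if "(m, i) \<in> P\<^sup>*" "(m, j) \<in> P\<^sup>*" "j \<le> i" for m i j
  proof (cases "(i, j) \<in> P\<^sup>*")
    case False
    then have "(j, i) \<in> P\<^sup>*" using single_valued_confluent[OF sv that(1,2)] by blast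
    then have "i = j" using P_le that(3) by fastforce
    then show ?thesis by simp
  qed
  have inbag: "v \<in> bag i" if "(m, i) \<in> P\<^sup>*" "m < N" "v \<in> bag m" "top v \<le> i" for m i v
    using that(1,4)
  proof (induction rule: rtrancl_induct)
    case (step y z)
    then have y: "z = par y" "0 < y" "y < N" by (auto simp: P_def)
    then have lt: "top v < y" using par[of y] step.prems by simp
    then have "v \<in> bag y" using step by simp
    then show ?case using rip[OF lt y(3) _ top(2)[OF that(2,3)]] y(1) by simp
  qed (use that in simp)
  \<comment> \<open>Being a component of some set supplies the connectedness of \<open>C\<close>.
    The second condition says that the neighbours, all eliminated earlier, have topmost bags at
    least as high; it is what carries a neighbour up into the chosen bag.\<close>
  define nice where "nice C \<longleftrightarrow> (\<exists>X\<subseteq>{..<h}. C \<in> comps X) \<and> (\<forall>u\<in>nbr C. \<forall>c\<in>C. top u \<le> top c)" for C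
  define ch where "ch C = arg_min top (\<lambda>c. c \<in> C)" for C
  have chC: "ch C \<in> C" "\<And>c. c \<in> C \<Longrightarrow> top (ch C) \<le> top c" if "C \<noteq> {}" for C
    using arg_min_natI[of "\<lambda>c. c \<in> C" _ top] arg_min_nat_le[of "\<lambda>c. c \<in> C" _ top] that by (auto simp: ch_def)
  show thesis
  proof (rule that[of nice ch])
    fix C assume C: "C \<in> comps {..<h}"
    then have "nbr C = {}" unfolding comps_def closed_in_def nbr_def by auto
    then show "nice C" using C by (auto simp: nice_def)
  next
    fix C assume "nice C"
    then obtain X where X: "X \<subseteq> {..<h}" "C \<in> comps X" and low: "\<And>u c. u \<in> nbr C \<Longrightarrow> c \<in> C \<Longrightarrow> top u \<le> top c"
      by (auto simp: nice_def)
    have C: "C \<noteq> {}" "C \<subseteq> X" "closed_in C X" "\<And>D. D \<noteq> {} \<Longrightarrow> D \<subset> C \<Longrightarrow> \<not> closed_in D X"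
      using X(2) by (auto simp: comps_def)
    have Ch: "C \<subseteq> {..<h}" using C X by blast
    define v where "v = ch C"
    define i where "i = top v"
    have v: "v \<in> C" "\<And>c. c \<in> C \<Longrightarrow> i \<le> top c" using chC[OF C(1)] by (auto simp: v_def i_def)
    \<comment> \<open>The part of \<open>C\<close> whose topmost bags lie below the highest one in
      the tree. Adjacent vertices share a bag, whose ancestors form a chain, so this part is closed;
      it is all of \<open>C\<close> by minimality.\<close>
    define D where "D = {c \<in> C. (top c, i) \<in> P\<^sup>*}"
    have "closed_in D X" unfolding closed_in_def
    proof (intro allI impI notI)
      fix c w assume h: "c < h" "w < h" and c: "c \<in> D" and w: "w \<in> X" "w \<notin> D" and a: "adj c w"
      have "w \<in> C" using C(3) c w(1) a h unfolding closed_in_def D_def by blast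
      obtain m where m: "m < N" "c \<in> bag m" "w \<in> bag m" using adj[OF h a] by blast
      have "(m, i) \<in> P\<^sup>*" using up[OF m(1,2)] c unfolding D_def by (auto intro: rtrancl_trans)
      then have "(top w, i) \<in> P\<^sup>*" using above[OF up[OF m(1,3)]] v(2)[OF \<open>w \<in> C\<close>] by blast
      then show False using w(2) \<open>w \<in> C\<close> by (simp add: D_def)
    qed
    moreover have "v \<in> D" using v(1) by (simp add: D_def i_def)
    ultimately have DC: "D = C" using C(4)[of D] by (auto simp: D_def)
    have vbag: "i < N \<and> v \<in> bag i"
    proof -
      have "v < h" using v(1) Ch by auto
      moreover have "adj v v"
        unfolding adj_def using \<open>v < h\<close> reach_refl by blast
      ultimately obtain m where "m < N" "v \<in> bag m" using adj[of v v] by blast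
      then show ?thesis using top unfolding i_def by blast
    qed
    have "nbr C \<subseteq> bag i"
    proof
      fix u assume u: "u \<in> nbr C"
      then obtain c where c: "c < h" "u < h" "c \<in> C" "adj c u" by (auto simp: nbr_def)
      obtain m where m: "m < N" "c \<in> bag m" "u \<in> bag m" using adj[OF c(1,2,4)] by blast
      have "(top c, i) \<in> P\<^sup>*" using c(3) DC by (auto simp: D_def)
      then have "(m, i) \<in> P\<^sup>*" using up[OF m(1,2)] by (auto intro: rtrancl_trans)
      \<comment> \<open>The neighbour \<open>u\<close> occurs in a bag below \<open>i\<close>, and
        its topmost bag has an index of at most \<open>i\<close>. On the way up from that bag to
        \<open>i\<close>, it cannot disappear.\<close>
      then show "u \<in> bag i" by (rule inbag[OF _ m(1,3)]) (use low[OF u v(1)] in \<open>simp add: i_def\<close>)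
    qed
    then have "\<exists>m<N. insert v (nbr C) \<subseteq> bag m" using vbag by blast
    moreover have "nice C'" if C': "C' \<in> comps (C - {v})" for C'
    proof -
      have sub: "C' \<subseteq> C - {v}" using C' by (simp add: comps_def)
      have "top u \<le> top c" if u: "u \<in> nbr C'" and c: "c \<in> C'" for u c
      proof (cases "u = v")
        case True
        then show ?thesis using v(2) c sub by (auto simp: i_def)
      next
        case False
        then have "u \<in> nbr C" using nbr_comps[OF C'] u by blast
        then show ?thesis using low c sub by blast
      qed
      then show ?thesis using C' Ch unfolding nice_def by blast
    qed
    ultimately show "C \<subseteq> {..<h} \<and> ch C \<in> C \<and> (\<forall>C'\<in>comps (C - {ch C}). nice C') \<and>
       (\<exists>m<N. insert (ch C) (nbr C) \<subseteq> bag m)" using Ch v(1) unfolding v_def by blast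
  qed
qed

end

section \<open>Reachability hypergraphs\<close>

lemma numberedD:
  assumes "numbered_digraph G"
  shows "pair_fin_digraph G" "pverts G = {..<card (pverts G)}"
    "(u, v) \<in> parcs G \<Longrightarrow> u < card (pverts G) \<and> v < card (pverts G)"
proof -
  obtain n where n: "pair_fin_digraph G" "pverts G = {..<n}" using assms by (auto simp: numbered_digraph_def)
  then show 1: "pair_fin_digraph G" "pverts G = {..<card (pverts G)}" by auto
  interpret pair_fin_digraph G by (rule n(1))
  show "u < card (pverts G) \<and> v < card (pverts G)" if "(u, v) \<in> parcs G"
    using in_arcsD1[OF that] in_arcsD2[OF that] 1(2) by blast
qed

definition nbrs :: "nat pair_pre_digraph \<Rightarrow> nat \<Rightarrow> nat list" where
  "nbrs G v = sorted_list_of_set {w. (v, w) \<in> parcs G}"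

lemma nbrs:
  assumes "numbered_digraph G"
  shows "set (nbrs G v) = {w. (v, w) \<in> parcs G}" "length (nbrs G v) = card {w. (v, w) \<in> parcs G}"
    "length (nbrs G v) \<le> card (pverts G)" "out_degree (with_proj G) v = length (nbrs G v)"
proof -
  have sub: "{w. (v, w) \<in> parcs G} \<subseteq> {..<card (pverts G)}" using numberedD(3)[OF assms] by auto
  then have fin: "finite {w. (v, w) \<in> parcs G}" by (rule finite_subset) simp
  then show "set (nbrs G v) = {w. (v, w) \<in> parcs G}" "length (nbrs G v) = card {w. (v, w) \<in> parcs G}"
    by (auto simp: nbrs_def)
  then show "length (nbrs G v) \<le> card (pverts G)" using card_mono[OF _ sub] by simp
  have "out_arcs (with_proj G) v = Pair v ` {w. (v, w) \<in> parcs G}" by (auto simp: out_arcs_def)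
  then have "out_degree (with_proj G) v = card {w. (v, w) \<in> parcs G}"
    by (simp add: out_degree_def card_image inj_on_def)
  then show "out_degree (with_proj G) v = length (nbrs G v)" by (simp add: nbrs_def fin)
qed

lemma adj_list_blocks:
  assumes "numbered_digraph G"
  shows "adj_list G = card (pverts G) # blocks (nbrs G) (card (pverts G))"
  unfolding adj_list_def blocks_def nbrs(4)[OF assms] by (simp add: nbrs_def)

lemma dg_size_ge:
  assumes "numbered_digraph G"
  shows "card (pverts G) + 1 \<le> dg_size G"
proof -
  have "k \<le> length (blocks nb k)" for nb k by (induction k) (auto simp: blocks_Suc blocks_def)
  then show ?thesis unfolding dg_size_def adj_list_blocks[OF assms] by simp
qed

lemma adj_list_le:
  assumes "numbered_digraph G" "x \<in> set (adj_list G)"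
  shows "x \<le> card (pverts G)"
proof -
  consider "x = card (pverts G)" | u where "x = length (nbrs G u)" | u where "x \<in> set (nbrs G u)"
    using assms(2) unfolding adj_list_blocks[OF assms(1)] by (auto simp: blocks_def)
  then show ?thesis
  proof cases
    case 3
    then show ?thesis using nbrs(1)[OF assms(1)] numberedD(3)[OF assms(1)] by fastforce
  qed (use nbrs(3)[OF assms(1)] in auto)
qed

lemma card_out_le:
  assumes "numbered_digraph G" "v < card (pverts G)"
  shows "card {w. (v, w) \<in> parcs G} \<le> max_out_degree G"
proof -
  have "v \<in> pverts G" using numberedD(2)[OF assms(1)] assms(2) by blast
  moreover have "finite (pverts G)" using numberedD(2)[OF assms(1)] by (metis finite_lessThan)
  ultimately have "out_degree (with_proj G) v \<le> max_out_degree G"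
    unfolding max_out_degree_def by (intro Max_ge) auto
  then show ?thesis using nbrs(2,4)[OF assms(1)] by simp
qed

lemma reach_relpow:
  assumes "\<And>u v. (u, v) \<in> R \<Longrightarrow> u < n"
  shows "reach n (\<lambda>u v. (u, v) \<in> R) j x y \<longleftrightarrow> (\<exists>k\<le>j. (x, y) \<in> R ^^ k)"
proof (induction j arbitrary: y)
  case (Suc j)
  have step: "reach n (\<lambda>u v. (u, v) \<in> R) (Suc j) x y \<longleftrightarrow> reach n (\<lambda>u v. (u, v) \<in> R) j x y \<or>
    (\<exists>z<n. reach n (\<lambda>u v. (u, v) \<in> R) j x z \<and> (z, y) \<in> R)" by simp
  show ?case
  proof
    assume "reach n (\<lambda>u v. (u, v) \<in> R) (Suc j) x y"
    then consider "\<exists>k\<le>j. (x, y) \<in> R ^^ k" | z k where "k \<le> j" "(x, z) \<in> R ^^ k" "(z, y) \<in> R"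
      unfolding step Suc by blast
    then show "\<exists>k\<le>Suc j. (x, y) \<in> R ^^ k"
    proof cases
      case 1
      then show ?thesis using le_SucI by blast
    next
      case 2
      then have "(x, y) \<in> R ^^ Suc k" by (auto simp: relcomp_unfold)
      then show ?thesis using 2(1) by blast
    qed
  next
    assume "\<exists>k\<le>Suc j. (x, y) \<in> R ^^ k"
    then obtain k where k: "k \<le> Suc j" "(x, y) \<in> R ^^ k" by blast
    show "reach n (\<lambda>u v. (u, v) \<in> R) (Suc j) x y"
    proof (cases "k \<le> j")
      case True
      then show ?thesis unfolding step Suc using k(2) by blast
    next
      case False
      then have "(x, y) \<in> R ^^ j O R" using k le_Suc_eq by auto
      then obtain z where z: "(x, z) \<in> R ^^ j" "(z, y) \<in> R" by (auto simp: relcomp_unfold)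
      then show ?thesis unfolding step Suc using assms[OF z(2)] by blast
    qed
  qed
qed simp

text \<open>A walk need not be longer than the number of arcs, and \<open>n * n\<close> is a bound
  on that number which the program obtains by one multiplication.\<close>

lemma reach_rtrancl:
  assumes "R \<subseteq> {..<n} \<times> {..<n}"
  shows "reach n (\<lambda>u v. (u, v) \<in> R) (n * n) x y \<longleftrightarrow> (x, y) \<in> R\<^sup>*"
proof -
  have fin: "finite R" using assms by (rule finite_subset) simp
  have "card R \<le> n * n" using card_mono[OF _ assms] by simp
  moreover have "(x, y) \<in> R\<^sup>* \<longleftrightarrow> (\<exists>k\<le>card R. (x, y) \<in> R ^^ k)"
    unfolding rtrancl_finite_eq_relpow[OF fin] by auto
  ultimately have "(\<exists>k\<le>n * n. (x, y) \<in> R ^^ k) \<longleftrightarrow> (x, y) \<in> R\<^sup>*"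
    by (meson relpow_imp_rtrancl order_trans)
  then show ?thesis using reach_relpow[of R n] assms by auto
qed

lemma hedges_reach:
  assumes "e \<in> hedges (reachability_hypergraph H)" "pair_wf_digraph H"
  obtains s where "s \<in> pverts H" "e = {v. s \<rightarrow>\<^sup>*\<^bsub>with_proj H\<^esub> v}"
proof -
  interpret pair_wf_digraph H by (rule assms(2))
  obtain s S where "S \<in> source_components H" "s \<in> S" "e = {v. s \<rightarrow>\<^sup>*\<^bsub>with_proj H\<^esub> v}"
    using assms(1) by (auto simp: reachability_hypergraph_def)
  moreover then have "s \<in> pverts H"
    using sccs_verts_subsets by (auto simp: source_components_def condensation_def)
  ultimately show thesis using that by blast
qed

text \<open>Among the vertices from which \<open>v\<close> is reachable, one reaching the most vertices lies in a
  source component.\<close>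

lemma source_above:
  assumes H: "pair_fin_digraph H" and v: "v \<in> pverts H"
  shows "\<exists>e\<in>hedges (reachability_hypergraph H). {w. v \<rightarrow>\<^sup>*\<^bsub>with_proj H\<^esub> w} \<subseteq> e"
proof -
  interpret pair_fin_digraph H by (rule H)
  define R where "R s = {w. s \<rightarrow>\<^sup>*\<^bsub>with_proj H\<^esub> w}" for s
  have R: "R s \<subseteq> pverts H" for s using reachable_in_verts(2) by (auto simp: R_def)
  then have finR: "finite (R s)" for s using pair_finite_verts finite_subset by blast
  define s where "s = arg_max (\<lambda>s. card (R s)) (\<lambda>s. s \<rightarrow>\<^sup>*\<^bsub>with_proj H\<^esub> v)"
  have bound: "\<forall>y. y \<rightarrow>\<^sup>*\<^bsub>with_proj H\<^esub> v \<longrightarrow> card (R y) \<le> card (pverts H)"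
    using card_mono[OF pair_finite_verts R] by blast
  have vv: "v \<rightarrow>\<^sup>*\<^bsub>with_proj H\<^esub> v" using v by simp
  have s: "s \<rightarrow>\<^sup>*\<^bsub>with_proj H\<^esub> v" and max: "\<And>y. y \<rightarrow>\<^sup>*\<^bsub>with_proj H\<^esub> v \<Longrightarrow> card (R y) \<le> card (R s)"
    using arg_max_nat_lemma[of "\<lambda>s. s \<rightarrow>\<^sup>*\<^bsub>with_proj H\<^esub> v" v "\<lambda>s. card (R s)" "Suc (card (pverts H))"] vv bound
    unfolding s_def by (auto simp: less_Suc_eq_le)
  have sH: "s \<in> pverts H" using reachable_in_verts(1)[OF s] by simp
  define S where "S = scc_of s"
  have S: "S \<in> sccs_verts" "s \<in> S" using scc_of_in_sccs_verts in_scc_of_self sH by (auto simp: S_def)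
  have "in_arcs (with_proj (condensation H)) S = {}"
  proof (rule ccontr)
    assume "in_arcs (with_proj (condensation H)) S \<noteq> {}"
    then obtain S' u w where S': "S' \<in> sccs_verts" "S' \<noteq> S" "u \<in> S'" "w \<in> S" "(u, w) \<in> parcs H"
      by (auto simp: in_arcs_def condensation_def)
    have "w \<rightarrow>\<^sup>*\<^bsub>with_proj H\<^esub> s" using S'(4) by (auto simp: S_def scc_of_def)
    then have us: "u \<rightarrow>\<^sup>*\<^bsub>with_proj H\<^esub> s" using S'(5) adj_reachable_trans by blast
    then have "u \<rightarrow>\<^sup>*\<^bsub>with_proj H\<^esub> v" using s reachable_trans by blast
    \<comment> \<open>As \<open>u\<close> reaches \<open>s\<close>, its reachable set contains that
      of \<open>s\<close>. By maximality the sets coincide, so \<open>s\<close> reaches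
      \<open>u\<close> as well and \<open>u\<close> belongs to the component of \<open>s\<close>
      after all.\<close>
    then have "card (R u) \<le> card (R s)" by (rule max)
    moreover have "R s \<subseteq> R u" using us reachable_trans by (auto simp: R_def)
    ultimately have "R s = R u" using card_seteq[OF finR] by blast
    then have "s \<rightarrow>\<^sup>*\<^bsub>with_proj H\<^esub> u" using reachable_in_verts(1)[OF us] by (auto simp: R_def)
    then have "u \<in> S" using us by (simp add: S_def scc_of_def)
    then show False using sccs_verts_disjoint[OF S'(1) S(1) S'(2)] S'(3) by blast
  qed
  then have "S \<in> source_components H"
    using S(1) by (simp add: source_components_def in_degree_def condensation_def)
  then have "R s \<in> hedges (reachability_hypergraph H)"
    using S(2) by (auto simp: reachability_hypergraph_def R_def)
  moreover have "R v \<subseteq> R s" using s reachable_trans by (auto simp: R_def)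
  ultimately show ?thesis unfolding R_def by blast
qed

section \<open>Nearly optimal covers and decompositions\<close>

lemma in_nonempty: "x \<in> A \<Longrightarrow> A \<noteq> {}"
  by blast

text \<open>Settling for a slack of 1 avoids a compactness argument for the minimum. Giving weight 1
  to every hyperedge shows that covers exist, which is all that is required to get below the infimum
  plus 1.\<close>

lemma near_optimal_cover:
  fixes \<H> :: "'a hypergraph"
  assumes "finite (hedges \<H>)" "\<And>v. v \<in> X \<Longrightarrow> \<exists>e\<in>hedges \<H>. v \<in> e"
  obtains \<gamma> where "\<And>e. e \<in> hedges \<H> \<Longrightarrow> 0 \<le> \<gamma> e"
    "\<And>v. v \<in> X \<Longrightarrow> 1 \<le> (\<Sum>e\<in>{e\<in>hedges \<H>. v \<in> e}. \<gamma> e)" "(\<Sum>e\<in>hedges \<H>. \<gamma> e) < frac_cover_number \<H> X + 1"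
proof -
  let ?S = "{(\<Sum>e\<in>hedges \<H>. \<gamma> e :: real) | \<gamma>. (\<forall>e\<in>hedges \<H>. 0 \<le> \<gamma> e) \<and>
    (\<forall>v\<in>X. 1 \<le> (\<Sum>e\<in>{e\<in>hedges \<H>. v \<in> e}. \<gamma> e))}"
  define g :: "'a set \<Rightarrow> real" where "g = (\<lambda>_. 1)"
  have g1: "1 \<le> (\<Sum>e\<in>{e\<in>hedges \<H>. v \<in> e}. g e)" if "v \<in> X" for v
  proof -
    have "{e\<in>hedges \<H>. v \<in> e} \<noteq> {}" using assms(2)[OF that] by blast
    then have "0 < card {e\<in>hedges \<H>. v \<in> e}" using assms(1) by (auto simp: card_gt_0_iff)
    then show ?thesis by (simp add: g_def)
  qed
  have g0: "0 \<le> g e" for e by (simp add: g_def)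
  have "(\<Sum>e\<in>hedges \<H>. g e) \<in> ?S"
  proof (rule CollectI, rule exI[of _ g], rule conjI)
    show "(\<forall>e\<in>hedges \<H>. 0 \<le> g e) \<and> (\<forall>v\<in>X. 1 \<le> (\<Sum>e\<in>{e\<in>hedges \<H>. v \<in> e}. g e))"
      using g0 g1 by blast
  qed (rule refl)
  then have ne: "?S \<noteq> {}" by (rule in_nonempty)
  have "Inf ?S < frac_cover_number \<H> X + 1" by (simp add: frac_cover_number_def)
  from cInf_lessD[OF ne this] obtain x where x: "x \<in> ?S" "x < frac_cover_number \<H> X + 1" ..
  from x(1) obtain \<gamma> where \<gamma>: "x = (\<Sum>e\<in>hedges \<H>. \<gamma> e)" "\<forall>e\<in>hedges \<H>. 0 \<le> \<gamma> e"
    "\<forall>v\<in>X. 1 \<le> (\<Sum>e\<in>{e\<in>hedges \<H>. v \<in> e}. \<gamma> e)" unfolding mem_Collect_eq by (elim exE conjE)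
  show thesis by (rule that[of \<gamma>]) (use \<gamma> x(2) in simp_all)
qed

text \<open>Serves only to show that the infimum defining \<open>fhtw\<close> is taken over a
  nonempty set.\<close>

lemma trivial_tree_decomposition:
  assumes "\<Union>(hedges \<H>) \<subseteq> hverts \<H>"
  shows "tree_decomposition \<H> \<lparr>pverts = {0 :: nat}, parcs = {}\<rparr> (\<lambda>_. hverts \<H>)"
proof -
  let ?T = "\<lparr>pverts = {0 :: nat}, parcs = {}\<rparr>"
  have con: "connected G" if "verts G = {0 :: nat}" for G :: "(nat, nat \<times> nat) pre_digraph"
    unfolding connected_conv that by (auto intro: rtrancl_on_refl)
  have "pair_graph ?T" by unfold_locales (auto simp: symmetric_def sym_def)
  moreover have "\<not> pre_digraph.cycle (with_proj ?T) p" for p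
    by (auto simp: pre_digraph.cycle_def pre_digraph.awalk_def)
  ultimately have "undirected_tree ?T" unfolding undirected_tree_def using con[of "with_proj ?T"] by simp
  then show ?thesis using assms con by (auto simp: tree_decomposition_def)
qed

lemma near_optimal_decomposition:
  assumes "\<Union>(hedges \<H>) \<subseteq> hverts \<H>"
  obtains T :: "nat pair_pre_digraph" and B where "tree_decomposition \<H> T B"
    "\<And>t. t \<in> pverts T \<Longrightarrow> frac_cover_number \<H> (B t) < fhtw \<H> + 1"
proof -
  let ?S = "{Max ((\<lambda>t. frac_cover_number \<H> (B t)) ` pverts T) | (T :: nat pair_pre_digraph) B. tree_decomposition \<H> T B}"
  have "Max ((\<lambda>t. frac_cover_number \<H> (hverts \<H>)) ` pverts \<lparr>pverts = {0 :: nat}, parcs = {}\<rparr>) \<in> ?S"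
    by (rule CollectI, rule exI[of _ "\<lparr>pverts = {0 :: nat}, parcs = {}\<rparr>"], rule exI[of _ "\<lambda>_. hverts \<H>"],
        rule conjI[OF refl trivial_tree_decomposition[OF assms]])
  then have ne: "?S \<noteq> {}" by (rule in_nonempty)
  have "Inf ?S < fhtw \<H> + 1" by (simp add: fhtw_def)
  from cInf_lessD[OF ne this] obtain x where x: "x \<in> ?S" "x < fhtw \<H> + 1" ..
  from x(1) obtain T :: "nat pair_pre_digraph" and B where
    TB: "x = Max ((\<lambda>t. frac_cover_number \<H> (B t)) ` pverts T)" "tree_decomposition \<H> T B"
    unfolding mem_Collect_eq by (elim exE conjE)
  have T: "tree_decomposition \<H> T B" "Max ((\<lambda>t. frac_cover_number \<H> (B t)) ` pverts T) < fhtw \<H> + 1"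
    using TB x(2) by simp_all
  interpret pair_graph T using T(1) by (simp add: tree_decomposition_def undirected_tree_def)
  have "frac_cover_number \<H> (B t) < fhtw \<H> + 1" if "t \<in> pverts T" for t
    by (rule le_less_trans[OF Max_ge[OF finite_imageI[OF pair_finite_verts] imageI[OF that]] T(2)])
  then show thesis by (rule that[OF T(1)])
qed

section \<open>Running time\<close>

text \<open>This dominates all factors that depend on the parameter only, such as \<open>2 ^ h\<close> and
  \<open>(d + 1) ^ h ^ 4\<close>.\<close>

definition param_bound :: "nat \<Rightarrow> nat \<Rightarrow> nat" where
  "param_bound c p = 2 ^ (c * (p + 2) ^ 6)"

definition pow6 :: "exp \<Rightarrow> exp" where
  "pow6 q = q \<otimes> q \<otimes> q \<otimes> q \<otimes> q \<otimes> q"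

lemma eval_pow6: "eval xs A (pow6 q) \<sigma> = eval xs A q \<sigma> ^ 6"
  by (simp add: pow6_def power_numeral_reduce mult.assoc)

text \<open>A loop bound inside an expression must not read memory, so the parameter is first copied
  into a variable, which is then declared small.\<close>

definition param_program :: "nat \<Rightarrow> exp \<Rightarrow> cmd" where
  "param_program c e = seq [Assign 1 e, Assign 0 (Big Mult 2 (N c \<otimes> pow6 (V 1 \<oplus> N 2)) (N 2))]"

lemma param_program:
  assumes "wt_exp {1} e" "\<And>A xs \<sigma>. xs \<in> D \<Longrightarrow> eval xs A e \<sigma> = p xs"
  shows "\<exists>P. \<forall>xs\<in>D. \<exists>t s. exec P (initial_config xs) t s \<and> fst s 0 = param_bound c (p xs)"
proof -
  have wt: "wt {1} (param_program c e)"
    using assms(1) by (simp add: param_program_def pow6_def)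
  from compile_correct[OF wt, where ?c0.0 = 1] obtain K where
    K: "\<And>X xs. 2 \<le> X \<Longrightarrow> safe xs (bounded (X ^ 1) {1} xs) (param_program c e) (init_state xs) \<Longrightarrow>
    \<exists>t s. exec (compile (param_program c e)) (initial_config xs) t s \<and>
      fst s 0 = fst (sem xs (param_program c e) (init_state xs)) 0 \<and>
      t \<le> (steps xs (param_program c e) (init_state xs) + 2 * bits (length xs) + 3) * X ^ K" by blast
  have "\<exists>t s. exec (compile (param_program c e)) (initial_config xs) t s \<and> fst s 0 = param_bound c (p xs)"
    if xs: "xs \<in> D" for xs
  proof -
    have ev: "eval xs A (Big Mult 2 (N c \<otimes> pow6 (V 1 \<oplus> N 2)) (N 2)) (\<sigma>(1 := p xs)) = param_bound c (p xs)" for A \<sigma>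
    proof -
      have f: "fold (\<lambda>k acc. acc * 2) [0..<m] 1 = (2 :: nat) ^ m" for m by (induction m) auto
      have m: "eval xs A (N c \<otimes> pow6 (V 1 \<oplus> N 2)) (\<sigma>(1 := p xs)) = c * (p xs + 2) ^ 6"
        unfolding eval.simps arith.simps eval_pow6 fun_upd_same ..
      show ?thesis unfolding eval.simps(6) m param_bound_def using f[of "c * (p xs + 2) ^ 6"] by simp
    qed
    \<comment> \<open>Computability asks for no time bound, so \<open>X\<close> may simply dominate
      every number that occurs.\<close>
    define X where "X = 2 + length xs + p xs + param_bound c (p xs) + sum_list xs"
    have le: "length xs \<le> X" "p xs \<le> X" "param_bound c (p xs) \<le> X" "2 \<le> X" by (auto simp: X_def)
    have xle: "x \<le> X" if "x \<in> set xs" for x using member_le_sum_list[OF that] by (simp add: X_def)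
    have bl: "bits y \<le> X" if "y \<le> X" for y using bits_le[of y] that by linarith
    let ?s0 = "init_state xs"
    let ?s1 = "((fst ?s0)(1 := p xs), snd ?s0)" let ?s2 = "((fst ?s1)(0 := param_bound c (p xs)), snd ?s0)"
    have b: "bounded (X ^ 1) {1} xs ?s0" "bounded (X ^ 1) {1} xs ?s1" "bounded (X ^ 1) {1} xs ?s2"
      using le xle bl by (auto simp: bounded_def bounded_vars_def bounded_mem_def init_state_def)
    have e0: "eval xs (snd ?s0) e (fst ?s0) = p xs" by (rule assms(2)[OF xs])
    have sem: "sem xs (param_program c e) ?s0 = ?s2"
      unfolding param_program_def seq.simps sem.simps fst_conv snd_conv e0 ev ..
    have "safe xs (bounded (X ^ 1) {1} xs) (param_program c e) ?s0"
      unfolding param_program_def seq.simps safe.simps sem.simps fst_conv snd_conv e0 ev using b by simp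
    from K[OF le(4) this] show ?thesis unfolding sem by auto
  qed
  then show ?thesis by blast
qed

section \<open>Computability of the parameter bound\<close>

lemma computable1_param_bound: "computable1 (param_bound c)"
proof -
  have wt: "wt_exp {1} (In (N 0))" by simp
  have "eval xs A (In (N 0)) \<sigma> = xs ! 0" if "xs \<in> range (\<lambda>x. [x])" for A xs \<sigma>
    using that by (auto simp: inp_def)
  from param_program[where p = "\<lambda>xs. xs ! 0" and c = c, OF wt this] obtain P where
    P: "\<forall>xs\<in>range (\<lambda>x. [x]). \<exists>t s. exec P (initial_config xs) t s \<and> fst s 0 = param_bound c (xs ! 0)" ..
  show ?thesis unfolding computable1_def
  proof (intro exI[of _ P] allI)
    fix x
    show "\<exists>t s. exec P (initial_config [x]) t s \<and> fst s 0 = param_bound c x"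
      using bspec[OF P rangeI[of _ x]] unfolding nth_Cons_0 .
  qed
qed

lemma computable2_param_bound: "computable2 (\<lambda>x y. param_bound c (x + y))"
proof -
  have wt: "wt_exp {1} (In (N 0) \<oplus> In (N 1))" by simp
  have "eval xs A (In (N 0) \<oplus> In (N 1)) \<sigma> = sum_list xs" if "xs \<in> range (\<lambda>(x, y). [x, y])" for A xs \<sigma>
    using that by (auto simp: inp_def)
  from param_program[where p = sum_list and c = c, OF wt this] obtain P where
    P: "\<forall>xs\<in>range (\<lambda>(x, y). [x, y]). \<exists>t s. exec P (initial_config xs) t s \<and> fst s 0 = param_bound c (sum_list xs)" ..
  show ?thesis unfolding computable2_def
  proof (intro exI[of _ P] allI)
    fix x y :: nat
    have "sum_list [x, y] = x + y" by simp
    then show "\<exists>t s. exec P (initial_config [x, y]) t s \<and> fst s 0 = param_bound c (x + y)"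
      using bspec[OF P rangeI[of _ "(x, y)"]] unfolding prod.case by (elim subst)
  qed
qed

text \<open>What matters is linearity in \<open>b\<close>, as \<open>b\<close> carries the exponent
  r. The powers of \<open>Y\<close> are 2 for one attempt, 4 for a pass over all sets and vertices,
  and 6 with the number of rounds; reading and reachability stay below that.\<close>

lemma (in algorithm) total_steps_le:
  assumes Y: "h \<le> Y" "n \<le> Y" "L \<le> Y" "2 ^ h \<le> Y" "1 \<le> Y" and b: "1 \<le> b"
  shows "total_steps b \<le> 256 * (Y ^ 6 * b)"
proof -
  have up: "x \<le> Y ^ 6 * b'" if "x \<le> Y ^ k * b'" "k \<le> 6" for x k b'
  proof -
    have "Y ^ k * b' \<le> Y ^ 6 * b'" using that(2) Y(5) by (intro mult_le_mono power_increasing) auto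
    then show ?thesis using that(1) by linarith
  qed
  have attempt: "attempt_steps b' \<le> 31 * (Y ^ 2 * b')" if b': "1 \<le> b'" for b'
  proof -
    have 1: "1 \<le> Y ^ 2 * b'" using Y(5) b' by simp
    have 2: "h \<le> Y ^ 2 * b'" using mult_le_mono[OF mult_le_mono[OF Y(1) Y(5)] b'] by (simp add: power2_eq_square)
    have 3: "h * b' \<le> Y ^ 2 * b'" using mult_le_mono[OF Y(1) Y(5)] by (simp add: power2_eq_square)
    have 4: "h * b' * n \<le> Y ^ 2 * b'"
    proof -
      have "h * b' * n = (h * n) * b'" by simp
      also have "\<dots> \<le> (Y * Y) * b'" using Y by (intro mult_le_mono) auto
      finally show ?thesis by (simp add: power2_eq_square)
    qed
    have 5: "b' \<le> Y ^ 2 * b'" using Y(5) by simp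
    have "attempt_steps b' = 11 + 8 * h + 2 * (h * b') + 5 * (h * b' * n) + 5 * b'"
      by (simp add: attempt_steps_def algebra_simps)
    then show ?thesis using 1 2 3 4 5 by linarith
  qed
  have pass: "pass_steps b' \<le> 36 * (Y ^ 4 * b')" if b': "1 \<le> b'" for b'
  proof -
    have 1: "1 \<le> Y ^ 4 * b'" using Y(5) b' by simp
    have "h * (1 + attempt_steps b') \<le> Y * (32 * (Y ^ 2 * b'))"
    proof (rule mult_le_mono[OF Y(1)])
      have "1 \<le> Y ^ 2 * b'" using Y(5) b' by simp
      then show "1 + attempt_steps b' \<le> 32 * (Y ^ 2 * b')" using attempt[OF b'] by linarith
    qed
    moreover have "Y ^ 3 * b' \<ge> 1" using Y(5) b' by simp
    moreover have "Y * (32 * (Y ^ 2 * b')) = 32 * (Y ^ 3 * b')"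
      by (simp add: power3_eq_cube power2_eq_square)
    ultimately have 2: "1 + (1 + h * (1 + attempt_steps b')) \<le> 34 * (Y ^ 3 * b')"
      by linarith
    have "2 ^ h * (1 + (1 + h * (1 + attempt_steps b'))) \<le> Y * (34 * (Y ^ 3 * b'))"
      using Y(4) 2 by (intro mult_le_mono)
    also have "\<dots> = 34 * (Y ^ 4 * b')" by (simp add: power_numeral_reduce)
    finally show ?thesis unfolding pass_steps_def using 1 by linarith
  qed
  have search: "search_steps b' \<le> 83 * (Y ^ 6 * b')" if b': "1 \<le> b'" for b'
  proof -
    have 1: "1 \<le> Y ^ 6 * b'" "1 \<le> Y ^ 4 * b'" using Y(5) b' by simp_all
    have "n * h \<le> Y * Y" using Y by (intro mult_le_mono)
    moreover have "1 \<le> Y * Y" using Y(5) by simp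
    ultimately have nh: "n * h + 1 \<le> 2 * Y ^ 2" unfolding power2_eq_square by linarith
    have "1 + (1 + (pass_steps b' + (1 + (1 + 1)))) \<le> 41 * (Y ^ 4 * b')" using pass[OF b'] 1 by linarith
    then have "(n * h + 1) * (1 + (1 + (pass_steps b' + (1 + (1 + 1))))) \<le> 2 * Y ^ 2 * (41 * (Y ^ 4 * b'))"
      using nh by (intro mult_le_mono)
    also have "\<dots> = 82 * (Y ^ 6 * b')" by (simp add: power_numeral_reduce)
    finally show ?thesis unfolding search_steps_def using 1 by linarith
  qed
  have one: "1 \<le> Y ^ 6 * b" using Y(5) b by simp
  have quad: "x * (6 + 2 * x) \<le> 8 * (Y ^ 6 * b)" "x * (2 + 2 * x) \<le> 4 * (Y ^ 6 * b)"
    "L * (2 + x * (2 + 2 * x)) \<le> 6 * (Y ^ 6 * b)" if x: "x \<le> Y" for x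
  proof -
    have xx: "x * x \<le> Y * Y" using x by (intro mult_le_mono)
    have YY: "Y \<le> Y * Y" "1 \<le> Y * Y" using Y(5) by simp_all
    have "Y * Y \<le> Y ^ 2 * b" using b by (simp add: power2_eq_square)
    then have s: "Y * Y \<le> Y ^ 6 * b" by (rule up) simp
    have x6: "x * (6 + 2 * x) = 6 * x + 2 * (x * x)" and x2: "x * (2 + 2 * x) = 2 * x + 2 * (x * x)"
      by (simp_all add: algebra_simps)
    show "x * (6 + 2 * x) \<le> 8 * (Y ^ 6 * b)" unfolding x6 using xx YY x s by linarith
    show "x * (2 + 2 * x) \<le> 4 * (Y ^ 6 * b)" unfolding x2 using xx YY x s by linarith
    have "2 + x * (2 + 2 * x) \<le> 6 * (Y * Y)" unfolding x2 using xx YY x by linarith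
    then have "L * (2 + x * (2 + 2 * x)) \<le> Y * (6 * (Y * Y))" using Y(3) by (intro mult_le_mono)
    also have "\<dots> = 6 * (Y ^ 3)" by (simp add: power3_eq_cube)
    also have "Y ^ 3 \<le> Y ^ 3 * b" using b by simp
    then have "Y ^ 3 \<le> Y ^ 6 * b" by (rule up) simp
    finally show "L * (2 + x * (2 + 2 * x)) \<le> 6 * (Y ^ 6 * b)" by simp
  qed
  have "search_steps (2 * b) \<le> 166 * (Y ^ 6 * b)" using search[of "2 * b"] b by simp
  then show ?thesis unfolding total_steps_def
    using one quad[OF Y(1)] quad[OF Y(2)] by linarith
qed

section \<open>Instances given by two digraphs\<close>

locale instance_pair =
  fixes H G :: "nat pair_pre_digraph"
  assumes H: "numbered_digraph H" and G: "numbered_digraph G"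
begin

abbreviation "hH \<equiv> card (pverts H)"
abbreviation "nG \<equiv> card (pverts G)"
abbreviation "gs \<equiv> dg_size G"
abbreviation "dG \<equiv> max_out_degree G"
abbreviation "RH \<equiv> reachability_hypergraph H"

sublocale homs_instance hH nG "hH * hH" "\<lambda>u v. (u, v) \<in> parcs H" "\<lambda>u v. (u, v) \<in> parcs G"
  using numberedD(3)[OF H] numberedD(3)[OF G] by unfold_locales auto

text \<open>Outside the vertices of \<open>H\<close>, the extensional functions in
  \<open>homs\<close> are \<open>undefined\<close>, whereas assignments are 0. Exchanging the
  default values is a bijection.\<close>

lemma card_homs: "card (homs H G) = card {a \<in> asg nG {..<hH}. hom a}"
proof (rule bij_betw_same_card)
  have v: "pverts H = {..<hH}" "pverts G = {..<nG}" using numberedD(2) H G by blast+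
  have arc: "(u, w) \<in> parcs H \<Longrightarrow> u < hH \<and> w < hH" for u w by (rule numberedD(3)[OF H])
  show "bij_betw (\<lambda>\<phi> u. if u < hH then \<phi> u else 0) (homs H G) {a \<in> asg nG {..<hH}. hom a}"
  proof (rule bij_betw_byWitness[where f' = "\<lambda>a. restrict a {..<hH}"])
    show "\<forall>\<phi>\<in>homs H G. restrict (\<lambda>u. if u < hH then \<phi> u else 0) {..<hH} = \<phi>"
    proof
      fix \<phi> assume "\<phi> \<in> homs H G"
      then have "\<phi> \<in> extensional {..<hH}" using v by (auto simp: homs_def PiE_def)
      then show "restrict (\<lambda>u. if u < hH then \<phi> u else 0) {..<hH} = \<phi>"
        by (auto simp: extensional_def restrict_def)
    qed
    show "\<forall>a\<in>{a \<in> asg nG {..<hH}. hom a}. (\<lambda>u. if u < hH then restrict a {..<hH} u else 0) = a"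
      by (auto simp: asg_def)
    show "(\<lambda>\<phi> u. if u < hH then \<phi> u else 0) ` homs H G \<subseteq> {a \<in> asg nG {..<hH}. hom a}"
    proof (rule image_subsetI)
      fix \<phi> assume "\<phi> \<in> homs H G"
      then have "\<And>u. u < hH \<Longrightarrow> \<phi> u < nG" "\<And>u w. (u, w) \<in> parcs H \<Longrightarrow> (\<phi> u, \<phi> w) \<in> parcs G"
        using v by (auto simp: homs_def PiE_def Pi_def)
      then show "(\<lambda>u. if u < hH then \<phi> u else 0) \<in> {a \<in> asg nG {..<hH}. hom a}"
        using arc by (auto simp: asg_def hom_def)
    qed
    show "(\<lambda>a. restrict a {..<hH}) ` {a \<in> asg nG {..<hH}. hom a} \<subseteq> homs H G"
    proof (rule image_subsetI)
      fix a assume a: "a \<in> {a \<in> asg nG {..<hH}. hom a}"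
      have "restrict a {..<hH} \<in> {..<hH} \<rightarrow>\<^sub>E {..<nG}" using a by (auto simp: hom_def)
      moreover have "(restrict a {..<hH} u, restrict a {..<hH} w) \<in> parcs G" if "(u, w) \<in> parcs H" for u w
        using a that arc[OF that] by (auto simp: hom_def)
      moreover have "pverts H \<rightarrow>\<^sub>E pverts G = {..<hH} \<rightarrow>\<^sub>E {..<nG}"
        by (rule arg_cong2[where f = "\<lambda>X Y. X \<rightarrow>\<^sub>E Y", OF v])
      ultimately show "restrict a {..<hH} \<in> homs H G" unfolding homs_def by blast
    qed
  qed
qed

lemma rH_iff:
  assumes "s < hH"
  shows "rH s w \<longleftrightarrow> s \<rightarrow>\<^sup>*\<^bsub>with_proj H\<^esub> w"
proof -
  interpret pair_fin_digraph H by (rule numberedD(1)[OF H])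
  have s: "s \<in> pverts H" using assms numberedD(2)[OF H] by blast
  have "parcs H \<subseteq> {..<hH} \<times> {..<hH}" using numberedD(3)[OF H] by auto
  from reach_rtrancl[OF this] have "rH s w \<longleftrightarrow> (s, w) \<in> (parcs H)\<^sup>*" .
  also have "\<dots> \<longleftrightarrow> s \<rightarrow>\<^sup>*\<^bsub>with_proj H\<^esub> w"
    using reachable_conv'[of s w] s by (simp add: arcs_ends_def arc_to_ends_def)
  finally show ?thesis .
qed

lemma hedges_rH: "e \<in> hedges RH \<Longrightarrow> \<exists>s<hH. e = {w. rH s w}"
proof -
  assume e: "e \<in> hedges RH"
  interpret pair_fin_digraph H by (rule numberedD(1)[OF H])
  obtain s where s: "s \<in> pverts H" "e = {v. s \<rightarrow>\<^sup>*\<^bsub>with_proj H\<^esub> v}"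
    by (rule hedges_reach[OF e]) unfold_locales
  then have "s < hH" using numberedD(2)[OF H] by blast
  then show ?thesis using s(2) rH_iff by auto
qed

lemma card_hedges: "finite (hedges RH)" "card (hedges RH) \<le> hH"
proof -
  have sub: "hedges RH \<subseteq> (\<lambda>s. {w. rH s w}) ` {..<hH}" using hedges_rH by blast
  then show "finite (hedges RH)" by (rule finite_subset) simp
  have "card (hedges RH) \<le> card ((\<lambda>s. {w. rH s w}) ` {..<hH})" using sub by (rule card_mono[rotated]) simp
  also have "\<dots> \<le> hH" using card_image_le[of "{..<hH}" "\<lambda>s. {w. rH s w}"] by simp
  finally show "card (hedges RH) \<le> hH" .
qed

text \<open>The bridge from the adjacency used by the algorithm to tree decompositions, whose bags
  are only promised to contain hyperedges.\<close>

lemma rH_above: "s < hH \<Longrightarrow> \<exists>e\<in>hedges RH. {w. rH s w} \<subseteq> e"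
  using source_above[OF numberedD(1)[OF H]] numberedD(2)[OF H] rH_iff by auto

lemma vertex_covered:
  assumes "v < hH"
  shows "\<exists>e\<in>hedges RH. v \<in> e"
proof -
  interpret pair_fin_digraph H by (rule numberedD(1)[OF H])
  have "v \<in> pverts H" using assms numberedD(2)[OF H] by blast
  then have "rH v v" using rH_iff[OF assms] by simp
  then show ?thesis using rH_above[OF assms] by blast
qed

lemma hedges_in_hverts: "\<Union>(hedges RH) \<subseteq> hverts RH" "hverts RH = {..<hH}"
proof -
  interpret pair_fin_digraph H by (rule numberedD(1)[OF H])
  show eq: "hverts RH = {..<hH}" using numberedD(2)[OF H] by (simp add: reachability_hypergraph_def)
  show "\<Union>(hedges RH) \<subseteq> hverts RH"
  proof
    fix w assume "w \<in> \<Union>(hedges RH)"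
    then obtain e s where "s < hH" "w \<in> e" "e = {w. rH s w}" using hedges_rH by blast
    then have "s \<rightarrow>\<^sup>*\<^bsub>with_proj H\<^esub> w" using rH_iff by blast
    then have "w \<in> pverts H" using reachable_in_verts(2) by simp
    then show "w \<in> hverts RH" by (simp add: reachability_hypergraph_def)
  qed
qed

text \<open>The summand 1 in the assumption on \<open>r\<close> is the slack of the cover.
  Nonnegativity of \<open>r\<close> comes along, because the weights are nonnegative, and later
  ensures that the limit for the search is at least 1.\<close>

lemma length_lay_bag:
  assumes W: "W \<subseteq> X" "X \<subseteq> {..<hH}" "u \<le> hH" and r: "frac_cover_number RH X + 1 \<le> r"
  shows "real (length (lay W u)) \<le> real gs powr r * real ((dG + 1) ^ (hH * hH * hH)) ^ hH" "0 \<le> r"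
proof -
  have cov: "\<exists>e\<in>hedges RH. v \<in> e" if "v \<in> X" for v using vertex_covered that W(2) by blast
  obtain \<gamma> where \<gamma>: "\<And>e. e \<in> hedges RH \<Longrightarrow> 0 \<le> \<gamma> e"
    "\<And>v. v \<in> X \<Longrightarrow> 1 \<le> (\<Sum>e\<in>{e\<in>hedges RH. v \<in> e}. \<gamma> e)"
    "(\<Sum>e\<in>hedges RH. \<gamma> e) < frac_cover_number RH X + 1"
    using near_optimal_cover[OF card_hedges(1) cov] by blast
  let ?K = "real ((dG + 1) ^ (hH * hH * hH))"
  have gs: "1 \<le> gs" "nG \<le> gs" using dg_size_ge[OF G] by auto
  have "real (length (lay W u)) \<le> real gs powr (\<Sum>e\<in>hedges RH. \<gamma> e) * ?K ^ card (hedges RH)"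
    by (rule length_lay_le) (use card_out_le[OF G] gs W card_hedges(1) \<gamma> hedges_rH in auto)
  also have "\<dots> \<le> real gs powr r * ?K ^ hH"
  proof (rule mult_mono)
    show "real gs powr (\<Sum>e\<in>hedges RH. \<gamma> e) \<le> real gs powr r"
      using \<gamma>(3) r gs(1) by (intro powr_mono) auto
    have "1 \<le> (dG + 1) ^ (hH * hH * hH)" by simp
    then have "1 \<le> ?K" by linarith
    then show "?K ^ card (hedges RH) \<le> ?K ^ hH" using card_hedges(2) by (intro power_increasing)
  qed simp_all
  finally show "real (length (lay W u)) \<le> real gs powr r * ?K ^ hH" .
  have "0 \<le> (\<Sum>e\<in>hedges RH. \<gamma> e)" using \<gamma>(1) by (rule sum_nonneg)
  then show "0 \<le> r" using \<gamma>(3) r by linarith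
qed

text \<open>Holds whatever the width is, and so ensures that the fixed number of rounds in
  \<open>search\<close> suffices.\<close>

lemma length_lay_trivial:
  assumes "W \<subseteq> {..<hH}" "u \<le> hH"
  shows "length (lay W u) \<le> 2 ^ (nG * hH)"
proof -
  have fin: "finite (W \<inter> {..<u})" by simp
  have "card (W \<inter> {..<u}) \<le> hH" using card_mono[of "{..<hH}" "W \<inter> {..<u}"] assms by auto
  then have *: "nG * card (W \<inter> {..<u}) \<le> nG * hH" by (rule mult_le_mono2)
  have "length (lay W u) \<le> card (asg nG (W \<inter> {..<u}))"
    unfolding length_lay[OF assms] using finite_asg[OF fin] by (intro card_mono) auto
  also have "\<dots> \<le> nG ^ card (W \<inter> {..<u})" by (rule card_asg_le[OF fin])
  also have "\<dots> \<le> (2 ^ nG) ^ card (W \<inter> {..<u})" by (rule power_mono) (auto simp: less_imp_le)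
  also have "\<dots> = 2 ^ (nG * card (W \<inter> {..<u}))" by (simp add: power_mult)
  also have "\<dots> \<le> 2 ^ (nG * hH)" using * by (intro power_increasing) auto
  finally show ?thesis .
qed

text \<open>Of the summand 2, one unit is the slack of the tree decomposition and one that of the
  fractional covers of its bags.\<close>

lemma fhtw_elimination:
  shows "\<exists>nice ch. (\<forall>C. nice C \<longrightarrow> C \<subseteq> {..<hH} \<and> ch C \<in> C \<and> (\<forall>C'\<in>comps (C - {ch C}). nice C') \<and>
       (\<forall>u\<le>hH. real (length (lay (insert (ch C) (nbr C)) u)) \<le>
          real gs powr (fhtw RH + 2) * real ((dG + 1) ^ (hH * hH * hH)) ^ hH)) \<and>
     (\<forall>C\<in>comps {..<hH}. nice C)"
    "0 \<le> fhtw RH + 2"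
proof -
  obtain T :: "nat pair_pre_digraph" and B where TB: "tree_decomposition RH T B"
    and fcn: "\<And>t. t \<in> pverts T \<Longrightarrow> frac_cover_number RH (B t) < fhtw RH + 1"
    using near_optimal_decomposition[OF hedges_in_hverts(1)] by blast
  have T: "undirected_tree T" and cover: "(\<Union>t\<in>pverts T. B t) = {..<hH}"
    and edge: "\<And>e. e \<in> hedges RH \<Longrightarrow> \<exists>t\<in>pverts T. e \<subseteq> B t"
    and con: "\<And>v. v < hH \<Longrightarrow> connected (with_proj T \<restriction> {t \<in> pverts T. v \<in> B t})"
    using TB hedges_in_hverts(2) by (auto simp: tree_decomposition_def)
  obtain ts par where ts: "distinct ts" "set ts = pverts T" "ts \<noteq> []"
    and par: "\<And>i. 0 < i \<Longrightarrow> i < length ts \<Longrightarrow> par i < i \<and> (ts ! par i, ts ! i) \<in> parcs T"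
    using tree_order[OF T] by metis
  define bag where "bag i = B (ts ! i)" for i
  have node: "ts ! i \<in> pverts T" if "i < length ts" for i using that ts(2) nth_mem by blast
  have bag: "bag i \<subseteq> {..<hH}" if "i < length ts" for i using cover node[OF that] by (auto simp: bag_def)
  have rip: "v \<in> bag (par i)" if ij: "j < i" "i < length ts" and v: "v \<in> bag i" "v \<in> bag j" for i j v
  proof -
    have "v < hH" using bag[OF ij(2)] v(1) by blast
    from running_intersection[OF T ts(1) par con[OF this] ij]
    have "ts ! par i \<in> {t \<in> pverts T. v \<in> B t}" using v node ij by (auto simp: bag_def)
    then show ?thesis by (simp add: bag_def)
  qed
  have adj: "\<exists>m<length ts. u \<in> bag m \<and> w \<in> bag m" if uw: "adj u w" for u w
  proof -
    obtain s where s: "s < hH" "rH s u" "rH s w" using uw by (auto simp: adj_def)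
    obtain e where e: "e \<in> hedges RH" "{w. rH s w} \<subseteq> e" using rH_above[OF s(1)] by blast
    obtain t where t: "t \<in> pverts T" "e \<subseteq> B t" using edge[OF e(1)] by blast
    obtain m where "m < length ts" "ts ! m = t" using t(1) ts(2) by (metis in_set_conv_nth)
    then show ?thesis using s e(2) t(2) by (auto simp: bag_def)
  qed
  have r: "frac_cover_number RH (bag m) + 1 \<le> fhtw RH + 2" if "m < length ts" for m
    using fcn[OF node[OF that]] by (simp add: bag_def)
  have "0 < length ts" using ts(3) by simp
  then show "0 \<le> fhtw RH + 2"
    by (intro length_lay_bag(2)[OF empty_subsetI bag _ r, of 0 0]) auto
  let ?b = "real gs powr (fhtw RH + 2) * real ((dG + 1) ^ (hH * hH * hH)) ^ hH"
  show "\<exists>nice ch. (\<forall>C. nice C \<longrightarrow> C \<subseteq> {..<hH} \<and> ch C \<in> C \<and> (\<forall>C'\<in>comps (C - {ch C}). nice C') \<and>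
      (\<forall>u\<le>hH. real (length (lay (insert (ch C) (nbr C)) u)) \<le> ?b)) \<and> (\<forall>C\<in>comps {..<hH}. nice C)"
  proof (rule nice_elimination[of "length ts" par bag])
    fix nice ch
    assume nice: "\<And>C. nice C \<Longrightarrow> C \<subseteq> {..<hH} \<and> ch C \<in> C \<and>
        (\<forall>C'\<in>comps (C - {ch C}). nice C') \<and> (\<exists>m<length ts. insert (ch C) (nbr C) \<subseteq> bag m)"
      and root: "\<And>C. C \<in> comps {..<hH} \<Longrightarrow> nice C"
    have short: "\<forall>u\<le>hH. real (length (lay (insert (ch C) (nbr C)) u)) \<le> ?b" if C: "nice C" for C
    proof -
      obtain m where m: "m < length ts" "insert (ch C) (nbr C) \<subseteq> bag m" using nice[OF C] by blast
      show ?thesis using length_lay_bag(1)[OF m(2) bag[OF m(1)] _ r[OF m(1)]] by blast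
    qed
    show ?thesis
    proof (rule exI[of _ nice], rule exI[of _ ch], intro conjI allI impI ballI)
      fix C assume C: "nice C"
      show "C \<subseteq> {..<hH}" "ch C \<in> C" using nice[OF C] by blast+
      show "nice C'" if "C' \<in> comps (C - {ch C})" for C' using nice[OF C] that by blast
      show "real (length (lay (insert (ch C) (nbr C)) u)) \<le> ?b" if "u \<le> hH" for u
        using short[OF C] that by blast
    qed (rule root)
  qed (use par rip adj in \<open>simp_all only:\<close>)
qed

lemma count_homs_in_time:
  assumes K: "\<And>X xs. 2 \<le> X \<Longrightarrow> safe xs (bounded (X ^ 3) small_vars xs) count_homs (init_state xs) \<Longrightarrow>
    \<exists>t s. exec P (initial_config xs) t s \<and> fst s 0 = fst (sem xs count_homs (init_state xs)) 0 \<and>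
      t \<le> (steps xs count_homs (init_state xs) + 2 * bits (length xs) + 3) * X ^ K"
  shows "computes_in_time P (adj_list H @ adj_list G) (card (homs H G))
    (real (param_bound (K + 15) (dg_size H + dG)) * real gs powr (fhtw RH + real (K + 16)))"
proof -
  define p where "p = dg_size H + dG"
  \<comment> \<open>Dominates every quantity depending on the parameter alone. Multiplied by the
    size of \<open>G\<close>, it yields an \<open>X\<close> that dominates everything polynomial in
    the input as well.\<close>
  define A :: nat where "A = 2 ^ ((p + 2) ^ 6)"
  define X where "X = A * gs"
  define xs where "xs = adj_list H @ adj_list G"
  define x where "x = real gs powr (fhtw RH + 2) * real A"
  \<comment> \<open>The search needs a limit of at most \<open>2 ^ (n * h)\<close>. Taking the
    minimum is harmless, as the layers in question respect both bounds.\<close>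
  define b where "b = min (nat \<lfloor>x\<rfloor>) (2 ^ (nG * hH))"
  have hp: "hH + 1 \<le> dg_size H" "dg_size H \<le> p" "dG \<le> p" using dg_size_ge[OF H] by (auto simp: p_def)
  have gs: "1 \<le> gs" "nG \<le> gs" using dg_size_ge[OF G] by auto
  have p6: "(p + 2) ^ k \<le> (p + 2) ^ 6" if "k \<le> 6" for k using that by (intro power_increasing) auto
  have A2: "2 ^ m \<le> A" if "m \<le> (p + 2) ^ k" "k \<le> 6" for m k
    unfolding A_def using order_trans[OF that(1) p6[OF that(2)]] by (intro power_increasing) auto
  have pA: "2 ^ p \<le> A" by (rule A2[of p 1]) simp_all
  have "2 ^ hH \<le> (2 ^ p :: nat)" using hp by (intro power_increasing) auto
  then have hA: "2 ^ hH \<le> A" using pA by linarith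
  have p_less: "p < A" using less_exp[of p] pA by linarith
  have "(2 :: nat) ^ 6 \<le> (p + 2) ^ 6" by (rule power_mono) auto
  then have "2 ^ 6 \<le> A" by (intro A2[of 6 6]) auto
  then have A64: "64 \<le> A" by simp
  have AX: "A \<le> X" using gs(1) by (simp add: X_def)
  have X: "64 \<le> X" "2 \<le> X" "hH \<le> X" "p \<le> X" "2 ^ hH \<le> X" using A64 AX hp p_less hA by linarith+
  have gX: "gs \<le> X" using A64 by (simp add: X_def)
  then have nX: "nG \<le> X" using gs(2) by linarith
  have XX: "64 * X \<le> X ^ 2" "X \<le> X ^ 2" "1 \<le> X ^ 2" using X(1) by (simp_all add: power2_eq_square)
  have X3: "64 * X ^ 2 \<le> X ^ 3" using X(1) by (simp add: power3_eq_cube power2_eq_square)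
  have hh: "hH * hH \<le> X ^ 2" "nG * hH \<le> X ^ 2"
    unfolding power2_eq_square using X(3) nX by (simp_all add: mult_le_mono)
  \<comment> \<open>With \<open>dG + 1\<close> at most \<open>2 ^ dG\<close>, the exponent becomes a
    product of five factors, the degree and four times the order of \<open>H\<close>, each at most
    \<open>p + 2\<close>.\<close>
  have Kh: "((dG + 1) ^ (hH * hH * hH)) ^ hH \<le> A"
  proof -
    have pow5: "q ^ 5 = q * (q * q * q * q)" for q :: nat by (simp add: power_numeral_reduce mult.assoc)
    have "dG + 1 \<le> 2 ^ dG" using less_exp[of dG] by linarith
    then have "(dG + 1) ^ (hH * hH * hH * hH) \<le> (2 ^ dG) ^ (hH * hH * hH * hH)" by (intro power_mono) auto
    also have "\<dots> = 2 ^ (dG * (hH * hH * hH * hH))" by (simp add: power_mult)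
    also have "\<dots> \<le> A"
    proof (rule A2[of _ 5])
      have "dG * (hH * hH * hH * hH) \<le> (p + 2) * ((p + 2) * (p + 2) * (p + 2) * (p + 2))"
        using hp by (intro mult_le_mono) auto
      then show "dG * (hH * hH * hH * hH) \<le> (p + 2) ^ 5" unfolding pow5 .
    qed simp
    finally show ?thesis by (simp only: power_mult[symmetric])
  qed
  have len: "length xs = dg_size H + gs" by (simp add: xs_def dg_size_def)
  have len_le: "length xs \<le> 2 * X" using hp X(4) gX by (simp add: len)
  have entries: "y \<le> X" if "y \<in> set xs" for y
    using that adj_list_le[OF H] adj_list_le[OF G] X(3) nX by (fastforce simp: xs_def)
  \<comment> \<open>The cube leaves room for constant factors: \<open>X\<close> is at least 64, and
    all quantities to be bounded are small multiples of \<open>X\<close> or of its square.\<close>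
  interpret alg: algorithm xs "X ^ 3" hH nG "hH * hH" "\<lambda>u v. (u, v) \<in> parcs H" "\<lambda>u v. (u, v) \<in> parcs G"
  proof unfold_locales
    show "bits y \<le> X ^ 3" if "y \<in> set xs" for y
      using entries[OF that] bits_le[of y] XX X3 by linarith
    show "bits (length xs) \<le> X ^ 3" using len_le bits_le[of "length xs"] XX X3 by linarith
    show "1 \<le> X ^ 3" using XX X3 by linarith
    show "5 \<notin> small_vars" by (simp add: small_vars_iff)
    show "2 * (nG * hH) + 3 \<le> X ^ 3" using hh XX X3 by linarith
    show "2 ^ hH \<le> X ^ 3" "nG \<le> X ^ 3" "hH \<le> X ^ 3" "hH * hH \<le> X ^ 3"
      using X nX hh XX X3 by linarith+
  qed
  from fhtw_elimination(1) obtain nice ch where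
    "\<forall>C. nice C \<longrightarrow> C \<subseteq> {..<hH} \<and> ch C \<in> C \<and> (\<forall>C'\<in>comps (C - {ch C}). nice C') \<and>
       (\<forall>u\<le>hH. real (length (lay (insert (ch C) (nbr C)) u)) \<le>
          real gs powr (fhtw RH + 2) * real ((dG + 1) ^ (hH * hH * hH)) ^ hH)"
    and root: "\<forall>C\<in>comps {..<hH}. nice C" by (elim exE conjE)
  note nice = this(1)[THEN spec, THEN mp]
  have le_x: "real gs powr (fhtw RH + 2) * real ((dG + 1) ^ (hH * hH * hH)) ^ hH \<le> x"
  proof -
    have "real (((dG + 1) ^ (hH * hH * hH)) ^ hH) \<le> real A" using Kh by (rule of_nat_mono)
    then show ?thesis unfolding x_def of_nat_power by (intro mult_left_mono) auto
  qed
  have "1 \<le> x"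
  proof -
    have "1 \<le> real gs powr (fhtw RH + 2)" using gs(1) fhtw_elimination(2) by (intro ge_one_powr_ge_zero) auto
    moreover have "1 \<le> real A" using A64 by simp
    ultimately have "1 * 1 \<le> x" unfolding x_def by (intro mult_mono) auto
    then show ?thesis by simp
  qed
  then have "1 \<le> nat \<lfloor>x\<rfloor>" by linarith
  then have b: "1 \<le> b" "b \<le> 2 ^ (nG * hH)" by (auto simp: b_def)
  have bx: "real b \<le> x"
  proof -
    have "real b \<le> real (nat \<lfloor>x\<rfloor>)" by (simp add: b_def)
    also have "\<dots> \<le> x" using \<open>1 \<le> x\<close> by linarith
    finally show ?thesis .
  qed
  have short: "length (lay (insert (ch C) (nbr C)) u) \<le> b" if C: "nice C" "u \<le> hH" for C u
  proof -
    have sub: "insert (ch C) (nbr C) \<subseteq> {..<hH}" using nice[OF C(1)] by (auto simp: nbr_def)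
    have "real (length (lay (insert (ch C) (nbr C)) u)) \<le> x" using nice[OF C(1)] C(2) le_x order_trans by blast
    then have "length (lay (insert (ch C) (nbr C)) u) \<le> nat \<lfloor>x\<rfloor>" by (rule le_nat_floor)
    then show ?thesis using length_lay_trivial[OF sub C(2)] by (simp add: b_def)
  qed
  have "alg.runs count_homs (init_state xs) (alg.total_steps b)
      (\<lambda>s. vr s 0 = card {a \<in> asg nG {..<hH}. hom a})"
  proof (rule alg.runs_count_homs)
    show "xs = (hH # blocks (nbrs H) hH) @ (nG # blocks (nbrs G) nG)"
      unfolding xs_def adj_list_blocks[OF H] adj_list_blocks[OF G] ..
    show "set (nbrs H u) = {v. (u, v) \<in> parcs H} \<and> length (nbrs H u) \<le> hH" for u
      using nbrs(1,3)[OF H] by blast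
    show "set (nbrs G u) = {v. (u, v) \<in> parcs G} \<and> length (nbrs G u) \<le> nG" for u
      using nbrs(1,3)[OF G] by blast
    show "C \<subseteq> {..<hH} \<and> ch C \<in> C \<and> (\<forall>C'\<in>comps (C - {ch C}). nice C') \<and>
        (\<forall>u\<le>hH. length (lay (insert (ch C) (nbr C)) u) \<le> b)" if "nice C" for C
      using nice[OF that] short[OF that] by blast
  qed (use root b in auto)
  moreover have "alg.ok = bounded (X ^ 3) small_vars xs" by (rule ext) (rule alg.ok_def)
  ultimately have run: "safe xs (bounded (X ^ 3) small_vars xs) count_homs (init_state xs)"
    "steps xs count_homs (init_state xs) \<le> alg.total_steps b"
    "fst (sem xs count_homs (init_state xs)) 0 = card (homs H G)"
    unfolding alg.runs_def vr_def card_homs by simp_all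
  obtain t s where ts: "exec P (initial_config xs) t s" "fst s 0 = card (homs H G)"
    "t \<le> (steps xs count_homs (init_state xs) + 2 * bits (length xs) + 3) * X ^ K"
    using K[OF X(2) run(1)] run(3) by auto
  \<comment> \<open>The estimate is used with \<open>X ^ 2\<close> for \<open>Y\<close>, because the
    length bound \<open>hH * hH\<close> may be that large; its sixth power gives the exponent
    12.\<close>
  have total: "alg.total_steps b \<le> 256 * (X ^ 12 * b)"
  proof -
    have "alg.total_steps b \<le> 256 * ((X ^ 2) ^ 6 * b)"
      by (rule alg.total_steps_le) (use X nX hh XX b in linarith)+
    then show ?thesis by (simp only: power_mult[symmetric]) simp
  qed
  have "X ^ 1 \<le> X ^ 12" using X(1) by (intro power_increasing) auto
  then have "X \<le> X ^ 12 * b" using b(1) mult_le_mono[of X "X ^ 12" 1 b] by simp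
  moreover have "2 * bits (length xs) + 3 \<le> 4 * X + 3" using len_le bits_le[of "length xs"] by linarith
  ultimately have "steps xs count_homs (init_state xs) + 2 * bits (length xs) + 3 \<le> 263 * (X ^ 12 * b)"
    using run(2) total X(1) by linarith
  also have "\<dots> \<le> X ^ 2 * (X ^ 12 * b)" using XX(1) X(1) by (intro mult_le_mono1) linarith
  also have "\<dots> = X ^ 14 * b" by (simp only: mult.assoc[symmetric] power_add[symmetric]) simp
  finally have "t \<le> X ^ 14 * b * X ^ K" using ts(3) by (meson mult_le_mono1 order_trans)
  also have "X ^ 14 * b * X ^ K = X ^ (K + 14) * b" by (simp only: power_add) (simp add: ac_simps)
  finally have "real t \<le> real (X ^ (K + 14) * b)" by (rule of_nat_mono)
  also have "\<dots> = real X ^ (K + 14) * real b" by (simp only: of_nat_mult of_nat_power)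
  also have "\<dots> \<le> real X ^ (K + 14) * x" using bx by (intro mult_left_mono) auto
  \<comment> \<open>Of the exponents \<open>K + 15\<close> and \<open>K + 16\<close>, both factors
    of \<open>X\<close> contribute \<open>K + 14\<close>. The limit \<open>x\<close> adds one more
    factor \<open>A\<close> and the 2 by which its exponent exceeds the width.\<close>
  also have "\<dots> = real A ^ (K + 15) * (real gs powr real (K + 14) * real gs powr (fhtw RH + 2))"
  proof -
    have "real gs powr real (K + 14) = real gs ^ (K + 14)" by (rule powr_realpow) (use gs in simp)
    moreover have "K + 15 = Suc (K + 14)" by simp
    ultimately show ?thesis unfolding X_def x_def of_nat_mult power_mult_distrib
      by (simp only: power_Suc) (simp add: ac_simps)
  qed
  also have "real gs powr real (K + 14) * real gs powr (fhtw RH + 2) = real gs powr (fhtw RH + real (K + 16))"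
    unfolding powr_add[symmetric] by (simp add: algebra_simps)
  also have "real A ^ (K + 15) = real (param_bound (K + 15) p)"
  proof -
    have "A ^ (K + 15) = param_bound (K + 15) p"
      unfolding A_def param_bound_def power_mult[symmetric] by (subst mult.commute) (rule refl)
    then show ?thesis by (metis of_nat_power)
  qed
  finally show ?thesis using ts(1,2) unfolding computes_in_time_def xs_def p_def by blast
qed

end

theorem theorem8:
  shows "(\<exists>(f :: nat \<Rightarrow> nat \<Rightarrow> nat) c (k :: nat). computable2 f \<and>
            (\<forall>H G. numbered_digraph H \<longrightarrow> numbered_digraph G \<longrightarrow>
               computes_in_time c (adj_list H @ adj_list G) (card (homs H G))
                 (real (f (dg_size H) (max_out_degree G)) *
                  real (dg_size G) powr (fhtw (reachability_hypergraph H) + real k))))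
         \<and>
         (\<forall>C. (\<forall>H \<in> C. numbered_digraph H) \<longrightarrow>
              bdd_above ((\<lambda>H. fhtw (reachability_hypergraph H)) ` C) \<longrightarrow>
              fixed_parameter_tractable (DirHom_d C))"
proof -
  \<comment> \<open>The exponent 3 matches the word length \<open>X ^ 3\<close> with which the
    program is verified.\<close>
  from compile_correct[OF wt_count_homs, where ?c0.0 = 3] obtain K where K: "\<And>X xs. 2 \<le> X \<Longrightarrow> safe xs (bounded (X ^ 3) small_vars xs) count_homs (init_state xs) \<Longrightarrow>
    \<exists>t s. exec (compile count_homs) (initial_config xs) t s \<and>
      fst s 0 = fst (sem xs count_homs (init_state xs)) 0 \<and>
      t \<le> (steps xs count_homs (init_state xs) + 2 * bits (length xs) + 3) * X ^ K"
    by blast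
  have main: "computes_in_time (compile count_homs) (adj_list H @ adj_list G) (card (homs H G))
      (real (param_bound (K + 15) (dg_size H + max_out_degree G)) *
       real (dg_size G) powr (fhtw (reachability_hypergraph H) + real (K + 16)))"
    if "numbered_digraph H" "numbered_digraph G" for H G
  proof -
    interpret instance_pair H G using that by unfold_locales
    show ?thesis by (rule count_homs_in_time[OF K])
  qed
  have "fixed_parameter_tractable (DirHom_d C)"
    if C: "\<forall>H\<in>C. numbered_digraph H" and bdd: "bdd_above ((\<lambda>H. fhtw (reachability_hypergraph H)) ` C)" for C
  proof -
    obtain M where "\<forall>y\<in>(\<lambda>H. fhtw (reachability_hypergraph H)) ` C. y \<le> M" using bdd unfolding bdd_above_def by blast
    then have M: "fhtw (reachability_hypergraph H) \<le> M" if "H \<in> C" for H using that by blast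
    \<comment> \<open>Rounding the bound on the width up gives a natural exponent that serves the
      whole class; negative bounds become 0.\<close>
    define k where "k = nat \<lceil>M\<rceil> + (K + 16)"
    have "computes_in_time (compile count_homs) (adj_list H @ adj_list G) (card (homs H G))
      (real (param_bound (K + 15) (dg_size H + max_out_degree G)) * real (bit_size (adj_list H @ adj_list G)) ^ k)"
      if H: "H \<in> C" and G: "numbered_digraph G" for H G
    proof -
      obtain t s where ts: "exec (compile count_homs) (initial_config (adj_list H @ adj_list G)) t s"
        "fst s 0 = card (homs H G)" and t: "real t \<le> real (param_bound (K + 15) (dg_size H + max_out_degree G)) *
          real (dg_size G) powr (fhtw (reachability_hypergraph H) + real (K + 16))"
        using main[OF _ G, of H] C H unfolding computes_in_time_def by blast
      have gs: "1 \<le> dg_size G" using dg_size_ge[OF G] by simp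
      have size: "length ys \<le> bit_size ys" for ys by (induction ys) (auto simp: bit_size_def)
      have gb: "dg_size G \<le> bit_size (adj_list H @ adj_list G)"
        using size[of "adj_list H @ adj_list G"] by (simp add: dg_size_def)
      have "real (dg_size G) powr (fhtw (reachability_hypergraph H) + real (K + 16)) \<le> real (dg_size G) powr real k"
        using M[OF H] gs unfolding k_def of_nat_add by (intro powr_mono) linarith+
      also have "\<dots> = real (dg_size G) ^ k" by (rule powr_realpow) (use gs in simp)
      also have "\<dots> \<le> real (bit_size (adj_list H @ adj_list G)) ^ k" using gb by (intro power_mono) auto
      finally have "real t \<le> real (param_bound (K + 15) (dg_size H + max_out_degree G)) *
          real (bit_size (adj_list H @ adj_list G)) ^ k"
        by (intro order_trans[OF t] mult_left_mono) simp_all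
      then show ?thesis using ts unfolding computes_in_time_def by blast
    qed
    then have "\<forall>x\<in>instances (DirHom_d C). computes_in_time (compile count_homs) (encoding (DirHom_d C) x)
      (solution (DirHom_d C) x) (real (param_bound (K + 15) (parameter (DirHom_d C) x)) *
        real (bit_size (encoding (DirHom_d C) x)) ^ k)"
      by (auto simp: DirHom_d_def)
    then show ?thesis unfolding fixed_parameter_tractable_def using computable1_param_bound by blast
  qed
  moreover have "\<exists>(f :: nat \<Rightarrow> nat \<Rightarrow> nat) c (k :: nat). computable2 f \<and>
      (\<forall>H G. numbered_digraph H \<longrightarrow> numbered_digraph G \<longrightarrow>
         computes_in_time c (adj_list H @ adj_list G) (card (homs H G))
           (real (f (dg_size H) (max_out_degree G)) *
            real (dg_size G) powr (fhtw (reachability_hypergraph H) + real k)))"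
    by (rule exI[of _ "\<lambda>x y. param_bound (K + 15) (x + y)"], rule exI[of _ "compile count_homs"],
        rule exI[of _ "K + 16"]) (intro conjI allI impI computable2_param_bound main)
  ultimately show ?thesis by (intro conjI allI impI)
qed

end
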